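(* Let $\alpha:\mathbb M\to\mathbb R^3$ be an immersion of class $C^r$, $r\ge 6$, of an oriented surface $\mathbb M$ into oriented $\mathbb R^3$, let $p_0\in\mathbb M$ be an umbilic point of $\alpha$, and let $\alpha(u,v)=(u,v,h(u,v))$ be a normalized Monge chart at $p_0$ with coefficients $k,a,b,c,A,B,C,D,E,\dots$ (as defined in the context). Suppose that either $a=b=0$ and $cB\ne0$, or $b=c=0$ and $aD\neq0$. Then the principal configuration of $\alpha$ near $p_0$ is of type $D^2_{2h}$, that is: each of the two principal foliations $\mathcal F_1,\mathcal F_2$ has exactly two umbilic separatrices at $p_0$, these two separatrices divide a neighborhood of $p_0$ into exactly two sectors, both of which are hyperbolic sectors of the foliation, and the two separatrices of $\mathcal F_1$ and the two separatrices of $\mathcal F_2$ alternate in the cyclic order around $p_0$.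
   Context: Setting. $\mathbb M$ is an oriented surface and the orientations of $\mathbb M$ and $\mathbb R^3$ are fixed. An umbilic point of an immersion $\alpha$ is a point at which the two principal curvatures coincide. Away from umbilic points write $k_1<k_2$ for the principal curvatures; the lines of curvature associated with $k_1$ and with $k_2$ form the minimal principal foliation $\mathcal F_1$ and the maximal principal foliation $\mathcal F_2$, both singular at umbilic points. The pair $(\mathcal F_1,\mathcal F_2)$ near an umbilic point is the principal configuration there. Normalized Monge chart. At an umbilic point $p_0$, in a suitable positive orthonormal frame of $\mathbb R^3$ centered at $\alpha(p_0)$, with $(u,v)$-plane the tangent plane, the immersion is locally $\alpha(u,v)=(u,v,h(u,v))$ with $$h(u,v)=\tfrac k2(u^2+v^2)+\tfrac a6u^3+\tfrac b2uv^2+\tfrac c6v^3+\tfrac A{24}u^4+\tfrac B6u^3v+\tfrac C4u^2v^2+\tfrac D6uv^3+\tfrac E{24}v^4$$ $$+\tfrac{a_{50}}{120}u^5+\tfrac{a_{41}}{24}u^4v+\tfrac{a_{32}}{12}u^3v^2+\tfrac{a_{23}}{12}u^2v^3+\tfrac{a_{14}}{24}uv^4+\tfrac{a_{05}}{120}v^5+\text{higher order terms},$$ where the $u^2v$ term has been eliminated by a rotation of the $(u,v)$-frame. Separatrices and sectors. Work in a sufficiently small disk neighborhood of the isolated umbilic point $p_0$. An umbilic separatrix of a principal foliation $\mathcal F_i$ at $p_0$ is a leaf (germ at $p_0$ of a half-leaf) tending to $p_0$ and lying on the boundary of a hyperbolic sector of $\mathcal F_i$. A hyperbolic sector of $\mathcal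 F_i$ at $p_0$ is a sector bounded by two half-leaves of $\mathcal F_i$ tending to $p_0$ (arcs from $p_0$ to the boundary of the neighborhood) such that no leaf in the interior of the sector tends to $p_0$ and the foliation on the sector is topologically that of a sector of a planar saddle: leaves in the interior close to $p_0$ follow one bounding half-leaf inward and leave along the other. *)

theory Defs
  imports "HOL-Analysis.Analysis" "HOL-Library.Landau_Symbols"
begin

section \<open>Maps of class \<open>C\<^sup>r\<close> and oriented surfaces\<close>

text \<open>The set \<open>S\<close> is always open where this is used.\<close>

primrec Cr_on :: "nat \<Rightarrow> ('a::euclidean_space \<Rightarrow> 'b::real_normed_vector) \<Rightarrow> 'a set \<Rightarrow> bool" where
  "Cr_on 0 f S \<longleftrightarrow> continuous_on S f"
| "Cr_on (Suc r) f S \<longleftrightarrow>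
     (\<forall>x\<in>S. f differentiable (at x)) \<and>
     (\<forall>v. Cr_on r (\<lambda>x. frechet_derivative f (at x) v) S)"

text \<open>A chart is a pair \<open>(U, \<phi>)\<close>; only the values of \<open>\<phi>\<close> on its domain \<open>U\<close> matter.\<close>

type_synonym 'm chart = "'m set \<times> ('m \<Rightarrow> real^2)"

definition is_chart :: "'m::topological_space chart \<Rightarrow> bool" where
  "is_chart = (\<lambda>(U, \<phi>). open U \<and> open (\<phi> ` U) \<and> homeomorphism U (\<phi> ` U) \<phi> (inv_into U \<phi>))"

definition transition :: "'m chart \<Rightarrow> 'm chart \<Rightarrow> real^2 \<Rightarrow> real^2" where
  "transition c d = snd d \<circ> inv_into (fst c) (snd c)"

definition Cr_atlas :: "nat \<Rightarrow> 'm::topological_space chart set \<Rightarrow> bool" where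
  "Cr_atlas r \<A> \<longleftrightarrow>
     (\<forall>c\<in>\<A>. is_chart c) \<and> (\<Union>c\<in>\<A>. fst c) = UNIV \<and>
     (\<forall>c\<in>\<A>. \<forall>d\<in>\<A>. Cr_on r (transition c d) (snd c ` (fst c \<inter> fst d)))"

definition oriented_Cr_atlas :: "nat \<Rightarrow> 'm::topological_space chart set \<Rightarrow> bool" where
  "oriented_Cr_atlas r \<A> \<longleftrightarrow>
     Cr_atlas r \<A> \<and>
     (\<forall>c\<in>\<A>. \<forall>d\<in>\<A>. \<forall>z\<in>snd c ` (fst c \<inter> fst d).
        det (matrix (frechet_derivative (transition c d) (at z))) > 0)"

definition local_param :: "'m chart \<Rightarrow> ('m \<Rightarrow> real^3) \<Rightarrow> real^2 \<Rightarrow> real^3" where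
  "local_param c \<alpha> = \<alpha> \<circ> inv_into (fst c) (snd c)"

definition Cr_immersion :: "nat \<Rightarrow> 'm chart set \<Rightarrow> ('m \<Rightarrow> real^3) \<Rightarrow> bool" where
  "Cr_immersion r \<A> \<alpha> \<longleftrightarrow>
     (\<forall>c\<in>\<A>. Cr_on r (local_param c \<alpha>) (snd c ` fst c) \<and>
        (\<forall>z\<in>snd c ` fst c. inj (frechet_derivative (local_param c \<alpha>) (at z))))"


section \<open>Principal curvatures and principal directions\<close>

definition unit_normal :: "(real^2 \<Rightarrow> real^3) \<Rightarrow> real^2 \<Rightarrow> real^3" where
  "unit_normal X z =
     sgn (cross3 (frechet_derivative X (at z) (axis 1 1)) (frechet_derivative X (at z) (axis 2 1)))"

text \<open>Rodrigues' equation: \<open>w\<close> is an eigenvector, with eigenvalue \<open>\<kappa>\<close>, of the shape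
  operator \<open>- dN\<close>. With this sign, a graph over its tangent plane, with normal pointing up, has
  the eigenvalues of the Hessian as principal curvatures.\<close>

definition principal_vector :: "(real^2 \<Rightarrow> real^3) \<Rightarrow> real^2 \<Rightarrow> real \<Rightarrow> real^2 \<Rightarrow> bool" where
  "principal_vector X z \<kappa> w \<longleftrightarrow>
     w \<noteq> 0 \<and> frechet_derivative (unit_normal X) (at z) w = - \<kappa> *\<^sub>R frechet_derivative X (at z) w"

definition principal_curvatures :: "'m chart set \<Rightarrow> ('m \<Rightarrow> real^3) \<Rightarrow> 'm \<Rightarrow> real set" where
  "principal_curvatures \<A> \<alpha> p =
     {\<kappa>. \<exists>c\<in>\<A>. p \<in> fst c \<and> (\<exists>w. principal_vector (local_param c \<alpha>) (snd c p) \<kappa> w)}"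

datatype principal = Minimal | Maximal

fun principal_curvature :: "'m chart set \<Rightarrow> ('m \<Rightarrow> real^3) \<Rightarrow> principal \<Rightarrow> 'm \<Rightarrow> real" where
  "principal_curvature \<A> \<alpha> Minimal p = Min (principal_curvatures \<A> \<alpha> p)"
| "principal_curvature \<A> \<alpha> Maximal p = Max (principal_curvatures \<A> \<alpha> p)"

definition umbilic :: "'m chart set \<Rightarrow> ('m \<Rightarrow> real^3) \<Rightarrow> 'm \<Rightarrow> bool" where
  "umbilic \<A> \<alpha> p \<longleftrightarrow>
     principal_curvature \<A> \<alpha> Minimal p = principal_curvature \<A> \<alpha> Maximal p"


section \<open>Principal foliations near a point\<close>

text \<open>Regular curves, parametrised by the interval \<open>T\<close>, running inside a leaf of the foliation
  of index \<open>i\<close>.\<close>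

definition line_of_curvature ::
  "'m::topological_space chart set \<Rightarrow> ('m \<Rightarrow> real^3) \<Rightarrow> principal \<Rightarrow> (real \<Rightarrow> 'm) \<Rightarrow> real set \<Rightarrow> bool" where
  "line_of_curvature \<A> \<alpha> i \<gamma> T \<longleftrightarrow>
     continuous_on T \<gamma> \<and>
     (\<forall>t\<in>T. \<not> umbilic \<A> \<alpha> (\<gamma> t) \<and>
        (\<forall>c\<in>\<A>. \<gamma> t \<in> fst c \<longrightarrow>
           (\<exists>w. ((snd c \<circ> \<gamma>) has_vector_derivative w) (at t within T) \<and>
                principal_vector (local_param c \<alpha>) (snd c (\<gamma> t))
                  (principal_curvature \<A> \<alpha> i (\<gamma> t)) w)))"

definition leaf_arc ::
  "'m::topological_space chart set \<Rightarrow> ('m \<Rightarrow> real^3) \<Rightarrow> principal \<Rightarrow> 'm set \<Rightarrow> bool" where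
  "leaf_arc \<A> \<alpha> i l \<longleftrightarrow>
     (\<exists>\<gamma>. arc \<gamma> \<and> path_image \<gamma> = l \<and> line_of_curvature \<A> \<alpha> i \<gamma> {0..1})"

text \<open>A half-leaf tending to \<open>p\<close>, as a point set containing \<open>p\<close>.\<close>

definition half_leaf ::
  "'m::topological_space chart set \<Rightarrow> ('m \<Rightarrow> real^3) \<Rightarrow> principal \<Rightarrow> 'm \<Rightarrow> 'm set \<Rightarrow> bool" where
  "half_leaf \<A> \<alpha> i p l \<longleftrightarrow>
     (\<exists>\<gamma>. arc \<gamma> \<and> pathstart \<gamma> = p \<and> path_image \<gamma> = l \<and> line_of_curvature \<A> \<alpha> i \<gamma> {0<..1})"

definition same_germ :: "'m::topological_space \<Rightarrow> 'm set \<Rightarrow> 'm set \<Rightarrow> bool" where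
  "same_germ p l l' \<longleftrightarrow> (\<forall>\<^sub>F x in nhds p. x \<in> l \<longleftrightarrow> x \<in> l')"

text \<open>The model sector of a planar saddle at the origin, foliated by the level sets of \<open>x * y\<close>.\<close>

definition saddle_sector :: "(real \<times> real) set" where
  "saddle_sector = {(x, y). 0 \<le> x \<and> x \<le> 1 \<and> 0 \<le> y \<and> y \<le> 1 \<and> x * y \<le> 1/4}"

definition hyperbolic_sector ::
  "'m::topological_space chart set \<Rightarrow> ('m \<Rightarrow> real^3) \<Rightarrow> principal \<Rightarrow> 'm \<Rightarrow>
   'm set \<Rightarrow> 'm set \<Rightarrow> 'm set \<Rightarrow> bool" where
  "hyperbolic_sector \<A> \<alpha> i p S l l' \<longleftrightarrow>
     half_leaf \<A> \<alpha> i p l \<and> half_leaf \<A> \<alpha> i p l' \<and>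
     (\<forall>m. half_leaf \<A> \<alpha> i p m \<longrightarrow> \<not> m - {p} \<subseteq> interior S) \<and>
     (\<exists>f g. homeomorphism saddle_sector S f g \<and> f (0, 0) = p \<and>
        l = f ` {(x, y) \<in> saddle_sector. y = 0} \<and>
        l' = f ` {(x, y) \<in> saddle_sector. x = 0} \<and>
        (\<forall>c. 0 < c \<and> c \<le> 1/4 \<longrightarrow>
           leaf_arc \<A> \<alpha> i (f ` {(x, y) \<in> saddle_sector. x * y = c})))"

definition umbilic_separatrix ::
  "'m::topological_space chart set \<Rightarrow> ('m \<Rightarrow> real^3) \<Rightarrow> principal \<Rightarrow> 'm \<Rightarrow> 'm set \<Rightarrow> bool" where
  "umbilic_separatrix \<A> \<alpha> i p s \<longleftrightarrow>
     half_leaf \<A> \<alpha> i p s \<and>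
     (\<exists>S l l'. hyperbolic_sector \<A> \<alpha> i p S l l' \<and> (same_germ p s l \<or> same_germ p s l'))"


section \<open>The configuration \<open>D\<^sup>2\<^sub>2\<^sub>h\<close>\<close>

text \<open>As separatrices are germs, their number is counted up to \<open>same_germ\<close>.\<close>

definition exactly_two_separatrices ::
  "'m::topological_space chart set \<Rightarrow> ('m \<Rightarrow> real^3) \<Rightarrow> principal \<Rightarrow> 'm \<Rightarrow> 'm set \<Rightarrow> 'm set \<Rightarrow> bool" where
  "exactly_two_separatrices \<A> \<alpha> i p s s' \<longleftrightarrow>
     umbilic_separatrix \<A> \<alpha> i p s \<and> umbilic_separatrix \<A> \<alpha> i p s' \<and> \<not> same_germ p s s' \<and>
     (\<forall>t. umbilic_separatrix \<A> \<alpha> i p t \<longrightarrow> same_germ p t s \<or> same_germ p t s')"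

definition divides_into_two_hyperbolic_sectors ::
  "'m::topological_space chart set \<Rightarrow> ('m \<Rightarrow> real^3) \<Rightarrow> principal \<Rightarrow> 'm \<Rightarrow> 'm set \<Rightarrow> 'm set \<Rightarrow> bool" where
  "divides_into_two_hyperbolic_sectors \<A> \<alpha> i p s s' \<longleftrightarrow>
     (\<exists>D C C'. D homeomorphic cball (0::complex) 1 \<and> p \<in> interior D \<and>
        C \<noteq> C' \<and> components (D - (s \<union> s')) = {C, C'} \<and>
        hyperbolic_sector \<A> \<alpha> i p (C \<union> s \<union> s') s s' \<and>
        hyperbolic_sector \<A> \<alpha> i p (C' \<union> s \<union> s') s s')"

text \<open>The germs \<open>l 0, l 1, l 2, l 3\<close> of arcs starting at \<open>p\<close> occur in this cyclic order around
  \<open>p\<close>, clockwise or counterclockwise: they are represented by arcs running from \<open>p\<close> to the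
  boundary circle of a closed disk, disjoint except for \<open>p\<close>, which hit that circle in this order.\<close>

definition cyclically_ordered4 :: "'m::topological_space \<Rightarrow> (nat \<Rightarrow> 'm set) \<Rightarrow> bool" where
  "cyclically_ordered4 p l \<longleftrightarrow>
     (\<exists>D f g \<gamma> \<theta>. homeomorphism D (cball (0::complex) 1) f g \<and> p \<in> interior D \<and>
        (\<forall>j<4. arc (\<gamma> j) \<and> pathstart (\<gamma> j) = p \<and> path_image (\<gamma> j) \<subseteq> D \<and>
           {x \<in> path_image (\<gamma> j). f x \<in> sphere 0 1} = {pathfinish (\<gamma> j)} \<and>
           f (pathfinish (\<gamma> j)) = cis (\<theta> j) \<and>
           same_germ p (path_image (\<gamma> j)) (l j)) \<and>
        (\<forall>j<4. \<forall>k<4. j \<noteq> k \<longrightarrow> path_image (\<gamma> j) \<inter> path_image (\<gamma> k) = {p}) \<and>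
        \<theta> 0 < \<theta> 1 \<and> \<theta> 1 < \<theta> 2 \<and> \<theta> 2 < \<theta> 3 \<and> \<theta> 3 < \<theta> (0::nat) + 2 * pi)"

definition type_D22h ::
  "'m::topological_space chart set \<Rightarrow> ('m \<Rightarrow> real^3) \<Rightarrow> 'm \<Rightarrow> bool" where
  "type_D22h \<A> \<alpha> p \<longleftrightarrow>
     (\<exists>s\<^sub>1 s\<^sub>1' s\<^sub>2 s\<^sub>2'.
        exactly_two_separatrices \<A> \<alpha> Minimal p s\<^sub>1 s\<^sub>1' \<and>
        divides_into_two_hyperbolic_sectors \<A> \<alpha> Minimal p s\<^sub>1 s\<^sub>1' \<and>
        exactly_two_separatrices \<A> \<alpha> Maximal p s\<^sub>2 s\<^sub>2' \<and>
        divides_into_two_hyperbolic_sectors \<A> \<alpha> Maximal p s\<^sub>2 s\<^sub>2' \<and>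
        cyclically_ordered4 p ((!) [s\<^sub>1, s\<^sub>2, s\<^sub>1', s\<^sub>2']))"


section \<open>Monge charts\<close>

text \<open>The columns of \<open>R\<close> form a positive orthonormal frame. The chart has to be compatible with
  the atlas, but no compatibility with the orientation is demanded, so that the third frame vector
  may be either of the two unit normals at \<open>p\<close>.\<close>

definition Monge_chart ::
  "nat \<Rightarrow> 'm::topological_space chart set \<Rightarrow> ('m \<Rightarrow> real^3) \<Rightarrow> 'm \<Rightarrow>
   'm chart \<Rightarrow> real^3^3 \<Rightarrow> (real^2 \<Rightarrow> real) \<Rightarrow> bool" where
  "Monge_chart r \<A> \<alpha> p c R h \<longleftrightarrow>
     Cr_atlas r (insert c \<A>) \<and> p \<in> fst c \<and> snd c p = 0 \<and>
     rotation_matrix R \<and>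
     (\<forall>z\<in>snd c ` fst c. local_param c \<alpha> z = \<alpha> p + R *v vector [z$1, z$2, h z])"

end

theory Submission
  imports Defs
begin

text \<open>The lines of curvature of the graph of \<open>h\<close> satisfy a quadratic equation in the direction
  \<open>(u', v')\<close>. In the coordinates \<open>x = u + v\<close>, \<open>y = v - u\<close> it reads
  \<open>(\<nu> - \<mu>) y'\<^sup>2 - 2 l x' y' + (\<nu> + \<mu>) x'\<^sup>2 = 0\<close>, with coefficients formed from the first and second
  derivatives of \<open>h\<close>. Put \<open>R = sqrt (l\<^sup>2 + \<mu>\<^sup>2 - \<nu>\<^sup>2)\<close>. As long as \<open>R > 0\<close> and \<open>l + R > 0\<close>, the two
  solutions are \<open>y' = f x'\<close> and \<open>x' = g y'\<close> with \<open>f = (\<mu> + \<nu>) / (l + R)\<close> and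
  \<open>g = (\<nu> - \<mu>) / (l + R)\<close>, and each of them belongs to a fixed one of the two principal foliations
  (\<open>eigenlines\<close>).

  A permutation and reflection of the axes turns both cases of the hypothesis into \<open>a = b = 0\<close>,
  \<open>c > 0\<close>, \<open>B > 0\<close>. Then \<open>\<mu>\<close> is \<open>c v\<close> up to order two, \<open>\<nu>\<close> has order three, and \<open>l\<close> is
  \<open>B u\<^sup>2\<close> plus a multiple of \<open>v\<close> of order two and terms of higher order. Away from the line \<open>v = 0\<close>
  the slope \<open>f\<close> is close to the sign of \<open>v\<close>. Near that line \<open>l\<close> is positive, so \<open>l + R\<close> does not
  vanish, and \<open>f\<close> increases in \<open>y\<close> from near \<open>- 1\<close> to near \<open>1\<close>. This is the point of the
  condition \<open>c B \<noteq> 0\<close>: although \<open>f\<close> has no limit at the umbilic point, it is bounded by \<open>2\<close> and as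
  smooth as needed everywhere else. Hence the leaves of the foliation are graphs over the
  \<open>x\<close>-axis, solutions of \<open>dy/dx = f x y\<close>.

  What remains is a scalar differential equation with a single singular point. The monotonicity
  of \<open>f\<close> in \<open>y\<close> and the location of the solutions that end at the origin show that exactly one
  solution leaves the origin on each side (locale \<open>one_through_leaf\<close>). Therefore
  the solutions depend continuously on their values at \<open>x = 0\<close>, the singular one included
  (locale \<open>half_singular_ode\<close>), and a neighbourhood of the umbilic point is a product: a rectangle
  foliated by horizontal segments, one of which passes through the umbilic point
  and is cut by it into two separatrices. Each half of such a rectangle is a saddle sector, by an
  explicit homeomorphism (locale \<open>product_chart\<close>).

  After the reflection \<open>v \<mapsto> - v\<close> the second foliation satisfies the same estimates. The separatrices
  of the first one lie in the sectors \<open>v > \<bar>u\<bar>\<close> and \<open>u < v < 0\<close>, hence those of the second one in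
  \<open>- v > \<bar>u\<bar>\<close> and \<open>0 < v < - u\<close>. These four sectors are disjoint and the two foliations alternate in
  them (\<open>cyclically_ordered4_sectors\<close>).\<close>

section \<open>Scalar differential equations with one singular point\<close>

text \<open>Gronwall's argument: while \<open>\<phi>\<close> is positive, \<open>exp (C x) \<phi> x\<close> does not decrease, so \<open>\<phi>\<close> cannot
  come down to zero. The growth condition is local in this way because it will be verified for
  differences of solutions, for which a Lipschitz bound is at hand on one side only.\<close>
lemma derivative_lower_bound_pos:
  fixes \<phi> \<phi>' :: "real \<Rightarrow> real"
  assumes "a \<le> b" and cont: "continuous_on {a..b} \<phi>" and pos: "\<phi> a > 0"
    and der: "\<And>x. \<lbrakk>a < x; x < b\<rbrakk> \<Longrightarrow> (\<phi> has_real_derivative \<phi>' x) (at x)"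
    and growth: "\<And>x. \<lbrakk>a < x; x < b; \<phi> x > 0\<rbrakk> \<Longrightarrow> \<phi>' x \<ge> - C * \<phi> x"
  shows "\<phi> b > 0"
proof (rule ccontr)
  assume neg: "\<not> \<phi> b > 0"
  define Z where "Z = {x \<in> {a..b}. \<phi> x \<le> 0}"
  have "closed Z"
    unfolding Z_def using continuous_closed_preimage[OF cont, of "{..0}"]
    by (simp add: vimage_def Int_def)
  moreover have "b \<in> Z" and bdd: "bdd_below Z"
    using neg \<open>a \<le> b\<close> by (auto simp: Z_def intro: bdd_belowI[of _ a])
  ultimately have "Inf Z \<in> Z"
    by (intro closed_contains_Inf) auto
  define z where "z = Inf Z"
  have z: "a \<le> z" "z \<le> b" "\<phi> z \<le> 0" using \<open>Inf Z \<in> Z\<close> by (auto simp: z_def Z_def)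
  have "a < z" using z pos by (cases "a = z") auto
  have before: "\<phi> x > 0" if "a \<le> x" "x < z" for x
    proof (rule ccontr)
    assume "\<not> \<phi> x > 0"
    hence "x \<in> Z" using that z by (auto simp: Z_def)
    from cInf_lower[OF this bdd] that show False by (simp add: z_def)
  qed
  define w where "w x = exp (C * x) * \<phi> x" for x
  have "w a \<le> w z"
  proof (rule DERIV_nonneg_imp_increasing_open[OF \<open>a \<le> z\<close>])
    fix x assume x: "a < x" "x < z"
    have "(w has_real_derivative exp (C * x) * C * \<phi> x + \<phi>' x * exp (C * x)) (at x)"
      unfolding w_def using x z by (auto intro!: derivative_eq_intros der)
    moreover have "exp (C * x) * C * \<phi> x + \<phi>' x * exp (C * x) = exp (C * x) * (\<phi>' x + C * \<phi> x)"
      by (simp add: algebra_simps)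
    moreover have "\<dots> \<ge> 0"
      using growth[of x] before[of x] x z by simp
    ultimately show "\<exists>y. (w has_real_derivative y) (at x) \<and> 0 \<le> y" by auto
  next
    show "continuous_on {a..z} w" unfolding w_def
      using z by (intro continuous_intros continuous_on_subset[OF cont]) auto
  qed
  moreover have "w a > 0" "w z \<le> 0" using pos z by (auto simp: w_def mult_nonneg_nonpos)
  ultimately show False by simp
qed

lemma derivative_upper_bound_pos:
  fixes \<phi> \<phi>' :: "real \<Rightarrow> real"
  assumes "a \<le> b" and cont: "continuous_on {a..b} \<phi>" and pos: "\<phi> b > 0"
    and der: "\<And>x. \<lbrakk>a < x; x < b\<rbrakk> \<Longrightarrow> (\<phi> has_real_derivative \<phi>' x) (at x)"
    and growth: "\<And>x. \<lbrakk>a < x; x < b; \<phi> x > 0\<rbrakk> \<Longrightarrow> \<phi>' x \<le> C * \<phi> x"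
  shows "\<phi> a > 0"
proof -
  have "(\<phi> \<circ> uminus) (- a) > 0"
  proof (rule derivative_lower_bound_pos[where a = "- b" and b = "- a" and C = C
        and \<phi> = "\<phi> \<circ> uminus" and \<phi>' = "\<lambda>x. - \<phi>' (- x)"])
    show "continuous_on {- b..- a} (\<phi> \<circ> uminus)"
      by (intro continuous_on_compose continuous_intros continuous_on_subset[OF cont]) auto
    fix x assume x: "- b < x" "x < - a"
    have "((\<lambda>x. \<phi> (- x)) has_real_derivative \<phi>' (- x) * (- 1)) (at x)"
      using x by (intro DERIV_chain2[where f = \<phi>] der) (auto intro!: derivative_eq_intros)
    thus "((\<phi> \<circ> uminus) has_real_derivative - \<phi>' (- x)) (at x)"
      by (simp add: o_def)
  qed (use assms in \<open>auto\<close>)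
  thus ?thesis by simp
qed

text \<open>Multiplied by \<open>exp (- K x)\<close> with \<open>K\<close> above \<open>2 L\<close>, the integral operator is a contraction with
  constant \<open>1/2\<close> on the bounded continuous functions, so that no shrinking of the interval is
  necessary.\<close>
lemma picard_global:
  fixes F :: "real \<Rightarrow> real \<Rightarrow> real"
  assumes \<delta>: "\<delta> > 0"
    and cont: "continuous_on ({0..\<delta>} \<times> UNIV) (\<lambda>(x, y). F x y)"
    and lip: "\<And>x y z. \<lbrakk>0 \<le> x; x \<le> \<delta>\<rbrakk> \<Longrightarrow> \<bar>F x y - F x z\<bar> \<le> L * \<bar>y - z\<bar>"
  shows "\<exists>\<phi>. \<phi> 0 = y\<^sub>0 \<and>
    (\<forall>x\<in>{0..\<delta>}. (\<phi> has_real_derivative F x (\<phi> x)) (at x within {0..\<delta>}))"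
proof -
  define K where "K = 2 * (\<bar>L\<bar> + 1)"
  have K: "K > 0" "\<bar>L\<bar> / K \<le> 1/2" by (auto simp: K_def field_simps)
  \<comment> \<open>Functions on the interval are extended by constants, to use the complete space of bounded continuous functions on the line.\<close>
  define c where "c x = max 0 (min \<delta> x)" for x :: real
  have c: "0 \<le> c x" "c x \<le> \<delta>" "0 \<le> x \<Longrightarrow> x \<le> \<delta> \<Longrightarrow> c x = x" for x
    using \<delta> by (auto simp: c_def)
  have contc: "continuous_on UNIV c" unfolding c_def by (intro continuous_intros)
  have contF: "continuous_on {0..\<delta>} (\<lambda>s. F s (g s))" if "continuous_on {0..\<delta>} g" for g
  proof -
    have "continuous_on {0..\<delta>} ((\<lambda>(x, y). F x y) \<circ> (\<lambda>s. (s, g s)))"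
      by (intro continuous_on_compose continuous_on_Pair continuous_on_id that
          continuous_on_subset[OF cont]) auto
    thus ?thesis by (simp add: o_def)
  qed
  define I where "I w x = integral {0..x} (\<lambda>s. F s (exp (K * s) * w s))" for w x
  have contI: "continuous_on {0..\<delta>} (I w)" if "continuous_on {0..\<delta>} w" for w
    unfolding I_def
    by (intro indefinite_integral_continuous_1 integrable_continuous_real contF continuous_intros that)
  have intF: "(\<lambda>s. F s (exp (K * s) * w s)) integrable_on {0..x}"
    if "continuous_on UNIV w" "x \<le> \<delta>" for w x
  proof (rule integrable_continuous_real)
    have "continuous_on {0..\<delta>} (\<lambda>s. F s (exp (K * s) * w s))"
      by (intro contF continuous_intros continuous_on_subset[OF that(1)]) auto
    thus "continuous_on {0..x} (\<lambda>s. F s (exp (K * s) * w s))"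
      by (rule continuous_on_subset) (use that in auto)
  qed
  define T where "T w x = exp (- K * c x) * (y\<^sub>0 + I w (c x))" for w x
  have T_bcont: "T w \<in> bcontfun" if w: "continuous_on UNIV w" for w
  proof -
    have ci: "continuous_on {0..\<delta>} (\<lambda>x. exp (- K * x) * (y\<^sub>0 + I w x))"
      by (intro continuous_intros contI continuous_on_subset[OF w]) auto
    have "T w = (\<lambda>x. exp (- K * x) * (y\<^sub>0 + I w x)) \<circ> c" by (simp add: T_def fun_eq_iff)
    hence "continuous_on UNIV (T w)"

      by (simp only:) (intro continuous_on_compose contc continuous_on_subset[OF ci], use c in auto)
    moreover have "bounded ((\<lambda>x. exp (- K * x) * (y\<^sub>0 + I w x)) ` {0..\<delta>})"
      by (intro compact_imp_bounded compact_continuous_image ci) auto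
    hence "bounded (range (T w))"
      by (rule bounded_subset) (auto simp: T_def intro!: imageI c)
    ultimately show ?thesis by (simp add: bcontfun_def)
  qed
  define TT where "TT w = Bcontfun (T (apply_bcontfun w))" for w
  have TT: "apply_bcontfun (TT w) = T (apply_bcontfun w)" for w
    unfolding TT_def by (rule Bcontfun_inverse) (intro T_bcont continuous_on_apply_bcontfun)
  have "\<exists>!w. TT w = w"
  proof (rule banach_fix_type[of "1/2"])
    show "\<forall>w w'. dist (TT w) (TT w') \<le> 1/2 * dist w w'"
    proof (intro allI dist_bound)
      fix w w' :: "real \<Rightarrow>\<^sub>C real" and x
      have cw: "continuous_on UNIV (apply_bcontfun w)" for w :: "real \<Rightarrow>\<^sub>C real"
        by (rule continuous_on_apply_bcontfun)
      let ?d = "dist w w'"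
      have ib: "((\<lambda>s. \<bar>L\<bar> * (exp (K * s) * ?d)) has_integral
          \<bar>L\<bar> * (exp (K * c x) * ?d) / K - \<bar>L\<bar> * (exp (K * 0) * ?d) / K) {0..c x}"
        using K c
        by (intro fundamental_theorem_of_calculus)
          (auto intro!: derivative_eq_intros simp: has_real_derivative_iff_has_vector_derivative[symmetric])
      have bd: "norm (integral {0..c x} (\<lambda>s. F s (exp (K * s) * w s) - F s (exp (K * s) * w' s)))
          \<le> integral {0..c x} (\<lambda>s. \<bar>L\<bar> * (exp (K * s) * ?d))"
      proof (rule integral_norm_bound_integral)
        fix s assume s: "s \<in> {0..c x}"
        have "\<bar>F s (exp (K * s) * w s) - F s (exp (K * s) * w' s)\<bar>
            \<le> L * \<bar>exp (K * s) * w s - exp (K * s) * w' s\<bar>"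
          using s c(2)[of x] by (intro lip) auto
        also have "\<dots> \<le> \<bar>L\<bar> * \<bar>exp (K * s) * w s - exp (K * s) * w' s\<bar>"
          by (intro mult_right_mono) auto
        also have "\<bar>exp (K * s) * w s - exp (K * s) * w' s\<bar> = exp (K * s) * \<bar>w s - w' s\<bar>"
          by (simp add: right_diff_distrib[symmetric] abs_mult)
        also have "\<dots> \<le> exp (K * s) * ?d"
          using dist_bounded[of w s w'] by (intro mult_left_mono) (auto simp: dist_real_def)
        finally show "norm (F s (exp (K * s) * w s) - F s (exp (K * s) * w' s)) \<le> \<bar>L\<bar> * (exp (K * s) * ?d)"
          by (simp add: mult_left_mono)
      qed (use intF[OF cw c(2)] ib in \<open>auto intro!: integrable_diff\<close>)
      have "\<bar>I w (c x) - I w' (c x)\<bar>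
          = \<bar>integral {0..c x} (\<lambda>s. F s (exp (K * s) * w s) - F s (exp (K * s) * w' s))\<bar>"
        unfolding I_def using intF[OF cw c(2)] by (subst Henstock_Kurzweil_Integration.integral_diff) auto
      also have "\<dots> \<le> integral {0..c x} (\<lambda>s. \<bar>L\<bar> * (exp (K * s) * ?d))"
        using bd by simp
      also have "\<dots> = \<bar>L\<bar> * (exp (K * c x) * ?d) / K - \<bar>L\<bar> * (exp (K * 0) * ?d) / K"
        using ib by (rule integral_unique)
      also have "\<dots> \<le> \<bar>L\<bar> / K * (exp (K * c x) * ?d)"
        using K by simp
      also have "\<dots> \<le> 1/2 * (exp (K * c x) * ?d)"
        using K by (intro mult_right_mono) auto
      finally have "exp (- K * c x) * \<bar>I w (c x) - I w' (c x)\<bar>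
          \<le> exp (- K * c x) * (1/2 * (exp (K * c x) * ?d))"
        by (intro mult_left_mono) auto
      also have "\<dots> = 1/2 * ?d" by (simp add: exp_minus field_simps)
      finally have "exp (- K * c x) * \<bar>I w (c x) - I w' (c x)\<bar> \<le> 1/2 * ?d" .
      moreover have "T w x - T w' x = exp (- K * c x) * (I w (c x) - I w' (c x))"
        by (simp add: T_def algebra_simps)
      ultimately show "dist (TT w x) (TT w' x) \<le> 1/2 * ?d"
        by (simp add: TT dist_real_def abs_mult)
    qed
  qed auto
  then obtain w where w: "TT w = w" by blast
  have wx: "w x = exp (- K * x) * (y\<^sub>0 + I w x)" if "x \<in> {0..\<delta>}" for x
    using fun_cong[OF TT[of w], of x] w that c(3)[of x] by (simp add: T_def)
  define \<phi> where "\<phi> x = y\<^sub>0 + I w x" for x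
  have \<phi>: "exp (K * s) * w s = \<phi> s" if "s \<in> {0..\<delta>}" for s
    using wx[OF that] by (simp add: \<phi>_def exp_minus)
  have cw: "continuous_on {0..\<delta>} (apply_bcontfun w)"
    using continuous_on_apply_bcontfun continuous_on_subset by blast
  have "(\<phi> has_real_derivative F x (\<phi> x)) (at x within {0..\<delta>})" if x: "x \<in> {0..\<delta>}" for x
  proof -
    have "(I w has_real_derivative F x (exp (K * x) * w x)) (at x within {0..\<delta>})"
      unfolding I_def using x
      by (intro integral_has_real_derivative[where g = "\<lambda>s. F s (exp (K * s) * w s)"]
          contF continuous_intros cw)
    thus ?thesis unfolding \<phi>_def[abs_def] using \<phi>[OF x]
      by (auto intro!: derivative_eq_intros simp: \<phi>_def)
  qed
  moreover have "\<phi> 0 = y\<^sub>0" by (simp add: \<phi>_def I_def)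
  ultimately show ?thesis by blast
qed

text \<open>The equation in integral form survives pointwise limits, by dominated convergence.\<close>
lemma limit_of_solutions:
  fixes f :: "real \<Rightarrow> real \<Rightarrow> real" and \<phi> :: "nat \<Rightarrow> real \<Rightarrow> real"
  assumes "a < b"
    and cont: "continuous_on D (\<lambda>(x, y). f x y)"
    and bound: "\<And>x y. (x, y) \<in> D \<Longrightarrow> \<bar>f x y\<bar> \<le> M"
    and sol: "\<And>n x. x \<in> {a..b} \<Longrightarrow> (\<phi> n has_real_derivative f x (\<phi> n x)) (at x within {a..b})"
    and inD: "\<And>n x. x \<in> {a..b} \<Longrightarrow> (x, \<phi> n x) \<in> D"
    and lim: "\<And>x. x \<in> {a..b} \<Longrightarrow> (\<lambda>n. \<phi> n x) \<longlonglongrightarrow> \<psi> x"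
    and inD': "\<And>x. x \<in> {a..b} \<Longrightarrow> (x, \<psi> x) \<in> D"
    and x: "x \<in> {a..b}"
  shows "(\<psi> has_real_derivative f x (\<psi> x)) (at x within {a..b})"
proof -
  have contf: "continuous_on {a..b} (\<lambda>s. f s (g s))"
    if "continuous_on {a..b} g" "\<And>s. s \<in> {a..b} \<Longrightarrow> (s, g s) \<in> D" for g
  proof -
    have "continuous_on {a..b} ((\<lambda>(x, y). f x y) \<circ> (\<lambda>s. (s, g s)))"
      by (intro continuous_on_compose continuous_on_Pair continuous_on_id that
          continuous_on_subset[OF cont]) (use that in auto)
    thus ?thesis by (simp add: o_def)
  qed
  have cont\<phi>: "continuous_on {a..b} (\<phi> n)" for n
    using sol by (rule DERIV_continuous_on)
  have lip: "\<bar>\<phi> n s - \<phi> n t\<bar> \<le> M * \<bar>s - t\<bar>" if "s \<in> {a..b}" "t \<in> {a..b}" for n s t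
    using field_differentiable_bound[of "{a..b}" "\<phi> n" "\<lambda>x. f x (\<phi> n x)" M t s] that sol inD bound
    by (auto simp: abs_minus_commute)
  have "\<bar>\<psi> s - \<psi> t\<bar> \<le> M * \<bar>s - t\<bar>" if "s \<in> {a..b}" "t \<in> {a..b}" for s t
    by (rule LIMSEQ_le_const2[OF tendsto_rabs[OF tendsto_diff[OF lim[OF that(1)] lim[OF that(2)]]]])
      (use lip that in auto)
  hence cont\<psi>: "continuous_on {a..b} \<psi>"
  proof -
    assume *: "\<And>s t. s \<in> {a..b} \<Longrightarrow> t \<in> {a..b} \<Longrightarrow> \<bar>\<psi> s - \<psi> t\<bar> \<le> M * \<bar>s - t\<bar>"
    have "(\<bar>M\<bar>)-lipschitz_on {a..b} \<psi>"
    proof (rule lipschitz_onI)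
      fix s t assume "s \<in> {a..b}" "t \<in> {a..b}"
      from *[OF this] have "\<bar>\<psi> s - \<psi> t\<bar> \<le> \<bar>M\<bar> * \<bar>s - t\<bar>"
        by (meson abs_ge_self abs_ge_zero mult_right_mono order_trans)
      thus "dist (\<psi> s) (\<psi> t) \<le> \<bar>M\<bar> * dist s t" by (simp add: dist_real_def)
    qed auto
    thus ?thesis by (rule lipschitz_on_continuous_on)
  qed
  have eq: "\<psi> t - \<psi> a = integral {a..t} (\<lambda>s. f s (\<psi> s))" if t: "t \<in> {a..b}" for t
  proof (rule LIMSEQ_unique)
    show "(\<lambda>n. \<phi> n t - \<phi> n a) \<longlonglongrightarrow> \<psi> t - \<psi> a"
      using t \<open>a < b\<close> by (intro tendsto_diff lim) auto
    have sub: "{a..t} \<subseteq> {a..b}" using t by auto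
    have "(\<lambda>n. integral {a..t} (\<lambda>s. f s (\<phi> n s))) \<longlonglongrightarrow> integral {a..t} (\<lambda>s. f s (\<psi> s))"
    proof (rule dominated_convergence(2))
      show "(\<lambda>s. f s (\<phi> n s)) integrable_on {a..t}" for n
        by (intro integrable_continuous_real continuous_on_subset[OF contf sub] cont\<phi> inD)
      show "(\<lambda>s. M) integrable_on {a..t}" by (rule integrable_continuous_real) (rule continuous_on_const)
      show "norm (f s (\<phi> n s)) \<le> M" if "s \<in> {a..t}" for n s
        using bound inD that sub by auto
      show "(\<lambda>n. f s (\<phi> n s)) \<longlonglongrightarrow> f s (\<psi> s)" if "s \<in> {a..t}" for s
      proof -
        have s: "s \<in> {a..b}" using that sub by auto
        have "(\<lambda>n. (\<lambda>(x, y). f x y) (s, \<phi> n s)) \<longlonglongrightarrow> (\<lambda>(x, y). f x y) (s, \<psi> s)"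
          using lim[OF s] inD[OF s] inD'[OF s]
          by (intro continuous_on_tendsto_compose[OF cont]) (auto intro!: tendsto_intros)
        thus ?thesis by simp
      qed
    qed
    moreover have "integral {a..t} (\<lambda>s. f s (\<phi> n s)) = \<phi> n t - \<phi> n a" for n
    proof (rule integral_unique, rule fundamental_theorem_of_calculus)
      show "a \<le> t" using t by simp
      fix s assume "s \<in> {a..t}"
      hence "(\<phi> n has_real_derivative f s (\<phi> n s)) (at s within {a..t})"
        using sol[of s n] sub by (auto intro: DERIV_subset)
      thus "(\<phi> n has_vector_derivative f s (\<phi> n s)) (at s within {a..t})"
        by (simp add: has_real_derivative_iff_has_vector_derivative)
    qed
    ultimately show "(\<lambda>n. \<phi> n t - \<phi> n a) \<longlonglongrightarrow> integral {a..t} (\<lambda>s. f s (\<psi> s))"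
      by simp
  qed
  have "((\<lambda>t. integral {a..t} (\<lambda>s. f s (\<psi> s)) + \<psi> a) has_real_derivative f x (\<psi> x) + 0) (at x within {a..b})"
    using x by (intro DERIV_add integral_has_real_derivative[where g = "\<lambda>s. f s (\<psi> s)"] contf cont\<psi> inD')
      auto
  moreover have "integral {a..t} (\<lambda>s. f s (\<psi> s)) + \<psi> a = \<psi> t" if "t \<in> {a..b}" for t
    using eq[OF that] by simp
  ultimately show ?thesis
    using x by (intro has_field_derivative_transform_within[of "\<lambda>t. integral {a..t} (\<lambda>s. f s (\<psi> s)) + \<psi> a"
          "f x (\<psi> x)" x "{a..b}" 1 \<psi>]) auto
qed

text \<open>The equation \<open>dy/dx = f x y\<close> to the right of the \<open>y\<close>-axis, with a right-hand side that may
  have no limit at the origin. At the origin the hypothesis \<open>uniq\<close> takes the place of a Lipschitz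
  condition. Slopes are at most \<open>2\<close>, so the height \<open>\<eta> + 2 \<delta>\<close> of the strip contains all solutions
  which start at height at most \<open>\<eta>\<close>.\<close>
locale half_singular_ode =
  fixes f f' :: "real \<Rightarrow> real \<Rightarrow> real" and \<delta> \<eta> :: real and Q :: "(real \<times> real) set"
  defines "Q \<equiv> {0..\<delta>} \<times> {- (\<eta> + 2 * \<delta>)..\<eta> + 2 * \<delta>} - {(0, 0)}"
  assumes \<delta>: "\<delta> > 0" and \<eta>: "\<eta> > 0"
    and cont: "continuous_on Q (\<lambda>(x, y). f x y)"
    and cont': "continuous_on Q (\<lambda>(x, y). f' x y)"
    and der: "\<And>x y. (x, y) \<in> Q \<Longrightarrow> (f x has_real_derivative f' x y) (at y)"
    and bound: "\<And>x y. (x, y) \<in> Q \<Longrightarrow> \<bar>f x y\<bar> \<le> 2"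
    and uniq: "\<And>\<phi> \<psi> x. \<lbrakk>\<And>x. x \<in> {0<..<\<delta>} \<Longrightarrow> (\<phi> has_real_derivative f x (\<phi> x)) (at x) \<and> \<bar>\<phi> x\<bar> \<le> 2 * x;
        \<And>x. x \<in> {0<..<\<delta>} \<Longrightarrow> (\<psi> has_real_derivative f x (\<psi> x)) (at x) \<and> \<bar>\<psi> x\<bar> \<le> 2 * x;
        x \<in> {0<..<\<delta>}\<rbrakk> \<Longrightarrow> \<phi> x = \<psi> x"
begin

text \<open>There is no equation at \<open>x = 0\<close>, because \<open>f 0 0\<close> carries no information. For \<open>y\<^sub>0 \<noteq> 0\<close> the
  derivative at \<open>0\<close> is recovered afterwards.\<close>
definition sol :: "real \<Rightarrow> (real \<Rightarrow> real) \<Rightarrow> bool" where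
  "sol y\<^sub>0 \<phi> \<longleftrightarrow> \<phi> 0 = y\<^sub>0 \<and> (\<forall>x\<in>{0..\<delta>}. \<bar>\<phi> x - y\<^sub>0\<bar> \<le> 2 * x) \<and>
     (\<forall>x\<in>{0<..\<delta>}. (\<phi> has_real_derivative f x (\<phi> x)) (at x within {0..\<delta>}))"

lemma sol_in_Q:
  assumes "sol y\<^sub>0 \<phi>" "\<bar>y\<^sub>0\<bar> \<le> \<eta>" "x \<in> {0..\<delta>}" "x \<noteq> 0 \<or> y\<^sub>0 \<noteq> 0"
  shows "(x, \<phi> x) \<in> Q"
proof -
  have "\<bar>\<phi> x - y\<^sub>0\<bar> \<le> 2 * x" "\<phi> 0 = y\<^sub>0" using assms by (auto simp: sol_def)
  thus ?thesis using assms by (auto simp: Q_def)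
qed

lemma sol_deriv_at:
  assumes "sol y\<^sub>0 \<phi>" "0 < x" "x < \<delta>"
  shows "(\<phi> has_real_derivative f x (\<phi> x)) (at x)"
proof -
  have "(\<phi> has_real_derivative f x (\<phi> x)) (at x within {0..\<delta>})" using assms by (auto simp: sol_def)
  thus ?thesis using assms at_within_interior[of x "{0..\<delta>}"] by simp
qed

lemma sol_lipschitz:
  assumes s: "sol y\<^sub>0 \<phi>" "\<bar>y\<^sub>0\<bar> \<le> \<eta>" and x: "x \<in> {0..\<delta>}" "x' \<in> {0..\<delta>}"
  shows "\<bar>\<phi> x - \<phi> x'\<bar> \<le> 2 * \<bar>x - x'\<bar>"
proof -
  have main: "\<bar>\<phi> x - \<phi> x'\<bar> \<le> 2 * \<bar>x - x'\<bar>" if "0 \<le> x" "x \<le> x'" "x' \<le> \<delta>" for x x'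
  proof (cases "x = 0")
    case True
    thus ?thesis using s that by (auto simp: sol_def abs_minus_commute)
  next
    case False
    have "norm (\<phi> x - \<phi> x') \<le> 2 * norm (x - x')"
    proof (rule field_differentiable_bound[where S = "{x..x'}"])
      fix z assume z: "z \<in> {x..x'}"
      have "(\<phi> has_real_derivative f z (\<phi> z)) (at z within {0..\<delta>})"
        using s z that False by (auto simp: sol_def)
      thus "(\<phi> has_real_derivative f z (\<phi> z)) (at z within {x..x'})"
        by (rule DERIV_subset) (use that in auto)
      show "norm (f z (\<phi> z)) \<le> 2"
        using bound[OF sol_in_Q[OF s]] z that False by auto
    qed (use that in auto)
    thus ?thesis by simp
  qed
  show ?thesis
    using main[of x x'] main[of x' x] x by (cases "x \<le> x'") (auto simp: abs_minus_commute)
qed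

lemma sol_cont:
  assumes "sol y\<^sub>0 \<phi>" "\<bar>y\<^sub>0\<bar> \<le> \<eta>"
  shows "continuous_on {0..\<delta>} \<phi>"
  by (rule lipschitz_on_continuous_on[of 2], rule lipschitz_onI)
     (use sol_lipschitz[OF assms] in \<open>auto simp: dist_real_def\<close>)

lemma lipschitz_on_compact:
  assumes "compact T" "T \<subseteq> Q"
    and sect: "\<And>x y z w. \<lbrakk>(x, y) \<in> T; (x, z) \<in> T; y \<le> w; w \<le> z\<rbrakk> \<Longrightarrow> (x, w) \<in> T"
  shows "\<exists>L\<ge>0. \<forall>x y z. (x, y) \<in> T \<longrightarrow> (x, z) \<in> T \<longrightarrow> \<bar>f x y - f x z\<bar> \<le> L * \<bar>y - z\<bar>"
proof -
  have "bounded ((\<lambda>(x, y). f' x y) ` T)"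
    by (intro compact_imp_bounded compact_continuous_image continuous_on_subset[OF cont'] assms)
  then obtain L where L: "L > 0" "\<And>p. p \<in> T \<Longrightarrow> norm ((\<lambda>(x, y). f' x y) p) \<le> L"
    by (metis bounded_pos imageI)
  have main: "\<bar>f x y - f x z\<bar> \<le> L * \<bar>y - z\<bar>" if "(x, y) \<in> T" "(x, z) \<in> T" "y \<le> z" for x y z
  proof -
    have inT: "(x, w) \<in> T" if "w \<in> {y..z}" for w
      using sect[OF \<open>(x, y) \<in> T\<close> \<open>(x, z) \<in> T\<close>] that by auto
    have "norm (f x y - f x z) \<le> L * norm (y - z)"
    proof (rule field_differentiable_bound[where S = "{y..z}"])
      fix w assume "w \<in> {y..z}"
      from inT[OF this] show "(f x has_real_derivative f' x w) (at w within {y..z})" "norm (f' x w) \<le> L"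
        using der[of x w] assms(2) L(2)[of "(x, w)"] by (auto intro: has_field_derivative_at_within)
    qed (use that in auto)
    thus ?thesis by simp
  qed
  have "\<bar>f x y - f x z\<bar> \<le> L * \<bar>y - z\<bar>" if "(x, y) \<in> T" "(x, z) \<in> T" for x y z
    using main[of x y z] main[of x z y] that by (cases "y \<le> z") (auto simp: abs_minus_commute)
  thus ?thesis using L(1) by (intro exI[of _ L]) auto
qed

definition wedge :: "real \<Rightarrow> (real \<times> real) set" where
  "wedge y\<^sub>0 = {(x, y). 0 \<le> x \<and> x \<le> \<delta> \<and> y\<^sub>0 - 2 * x \<le> y \<and> y \<le> y\<^sub>0 + 2 * x}"

text \<open>For \<open>y\<^sub>0 \<noteq> 0\<close> the region that slopes of modulus at most \<open>2\<close> can reach from \<open>(0, y\<^sub>0)\<close> is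
  compact and avoids the origin.\<close>
lemma wedge_lipschitz:
  assumes "y\<^sub>0 \<noteq> 0" "\<bar>y\<^sub>0\<bar> \<le> \<eta>"
  shows "\<exists>L\<ge>0. \<forall>x y z. (x, y) \<in> wedge y\<^sub>0 \<longrightarrow> (x, z) \<in> wedge y\<^sub>0 \<longrightarrow> \<bar>f x y - f x z\<bar> \<le> L * \<bar>y - z\<bar>"
proof (rule lipschitz_on_compact)
  have eq: "wedge y\<^sub>0 = {p. 0 \<le> fst p} \<inter> {p. fst p \<le> \<delta>} \<inter> {p. y\<^sub>0 - 2 * fst p \<le> snd p}
      \<inter> {p. snd p \<le> y\<^sub>0 + 2 * fst p}"
    by (auto simp: wedge_def)
  have "closed (wedge y\<^sub>0)"
    unfolding eq by (intro closed_Int closed_Collect_le continuous_intros)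
  moreover have "wedge y\<^sub>0 \<subseteq> {0..\<delta>} \<times> {- (\<eta> + 2 * \<delta>)..\<eta> + 2 * \<delta>}"
    using assms by (auto simp: wedge_def)
  ultimately show "compact (wedge y\<^sub>0)"
    by (metis bounded_subset compact_Icc compact_Times compact_eq_bounded_closed)
  show "wedge y\<^sub>0 \<subseteq> Q" using assms by (auto simp: wedge_def Q_def)
qed (auto simp: wedge_def)

text \<open>Clipping the argument of \<open>f\<close> to the wedge makes the equation globally Lipschitz, and its
  solution stays in the wedge, where the clipping has no effect.\<close>
lemma ex_sol_nonzero:
  assumes y0: "y\<^sub>0 \<noteq> 0" "\<bar>y\<^sub>0\<bar> \<le> \<eta>"
  shows "\<exists>\<phi>. sol y\<^sub>0 \<phi> \<and> (\<phi> has_real_derivative f 0 y\<^sub>0) (at 0 within {0..\<delta>})"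
proof -
  obtain L where L: "L \<ge> 0"
    "\<And>x y z. (x, y) \<in> wedge y\<^sub>0 \<Longrightarrow> (x, z) \<in> wedge y\<^sub>0 \<Longrightarrow> \<bar>f x y - f x z\<bar> \<le> L * \<bar>y - z\<bar>"
    using wedge_lipschitz[OF y0] by blast
  define cl where "cl x y = max (y\<^sub>0 - 2 * x) (min (y\<^sub>0 + 2 * x) y)" for x y
  have cl: "(x, cl x y) \<in> wedge y\<^sub>0" if "0 \<le> x" "x \<le> \<delta>" for x y
    using that by (auto simp: cl_def wedge_def)
  have wQ: "wedge y\<^sub>0 \<subseteq> Q" using y0 by (auto simp: wedge_def Q_def)
  have clip: "\<bar>cl x y - cl x z\<bar> \<le> \<bar>y - z\<bar>" for x y z by (auto simp: cl_def)
  have "\<exists>\<phi>. \<phi> 0 = y\<^sub>0 \<and>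
    (\<forall>x\<in>{0..\<delta>}. (\<phi> has_real_derivative f x (cl x (\<phi> x))) (at x within {0..\<delta>}))"
  proof (rule picard_global[where F = "\<lambda>x y. f x (cl x y)" and L = L])
    have "continuous_on ({0..\<delta>} \<times> UNIV) ((\<lambda>(x, y). f x y) \<circ> (\<lambda>p. (fst p, cl (fst p) (snd p))))"
      unfolding cl_def
      by (intro continuous_on_compose continuous_on_subset[OF cont] continuous_intros)
         (use cl wQ in \<open>auto simp: cl_def\<close>)
    thus "continuous_on ({0..\<delta>} \<times> UNIV) (\<lambda>(x, y). f x (cl x y))"
      by (simp add: o_def case_prod_unfold)
    fix x y z :: real assume "0 \<le> x" "x \<le> \<delta>"
    hence "\<bar>f x (cl x y) - f x (cl x z)\<bar> \<le> L * \<bar>cl x y - cl x z\<bar>" by (intro L cl)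
    also have "\<dots> \<le> L * \<bar>y - z\<bar>" using L(1) clip by (intro mult_left_mono)
    finally show "\<bar>f x (cl x y) - f x (cl x z)\<bar> \<le> L * \<bar>y - z\<bar>" .
  qed (rule \<delta>)
  then obtain \<phi> where \<phi>: "\<phi> 0 = y\<^sub>0"
    "\<And>x. x \<in> {0..\<delta>} \<Longrightarrow> (\<phi> has_real_derivative f x (cl x (\<phi> x))) (at x within {0..\<delta>})" by blast
  have near: "\<bar>\<phi> x - y\<^sub>0\<bar> \<le> 2 * x" if x: "x \<in> {0..\<delta>}" for x
  proof -
    have "norm (\<phi> x - \<phi> 0) \<le> 2 * norm (x - 0)"
    proof (rule field_differentiable_bound[where S = "{0..\<delta>}"])
      fix z assume z: "z \<in> {0..\<delta>}"
      thus "norm (f z (cl z (\<phi> z))) \<le> 2"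
        using bound[of z "cl z (\<phi> z)"] cl[of z "\<phi> z"] wQ by auto
    qed (use x \<phi> in auto)
    thus ?thesis using x \<phi>(1) by simp
  qed
  hence "cl x (\<phi> x) = \<phi> x" if "x \<in> {0..\<delta>}" for x
    using near[OF that] by (auto simp: cl_def)
  hence "(\<phi> has_real_derivative f x (\<phi> x)) (at x within {0..\<delta>})" if "x \<in> {0..\<delta>}" for x
    using \<phi>(2)[OF that] that by simp
  from this[of 0] this show ?thesis
    using \<phi>(1) near \<delta> unfolding sol_def by (intro exI[of _ \<phi>]) auto
qed

lemma sol_unique:
  assumes s: "sol y\<^sub>0 \<phi>" "sol y\<^sub>0 \<psi>" and y0: "\<bar>y\<^sub>0\<bar> \<le> \<eta>" and x: "x \<in> {0..\<delta>}"
  shows "\<phi> x = \<psi> x"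
proof -
  have op: "\<phi> z = \<psi> z" if z: "0 < z" "z < \<delta>" for z
  proof (cases "y\<^sub>0 = 0")
    case True
    show ?thesis
    proof (rule uniq[of \<phi> \<psi>])
      fix x assume "x \<in> {0<..<\<delta>}"
      thus "(\<phi> has_real_derivative f x (\<phi> x)) (at x) \<and> \<bar>\<phi> x\<bar> \<le> 2 * x"
        "(\<psi> has_real_derivative f x (\<psi> x)) (at x) \<and> \<bar>\<psi> x\<bar> \<le> 2 * x"
        using s sol_deriv_at True by (auto simp: sol_def)
    qed (use z in auto)
  next
    case False
    obtain L where L: "L \<ge> 0"
      "\<And>x y z. (x, y) \<in> wedge y\<^sub>0 \<Longrightarrow> (x, z) \<in> wedge y\<^sub>0 \<Longrightarrow> \<bar>f x y - f x z\<bar> \<le> L * \<bar>y - z\<bar>"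
      using wedge_lipschitz[OF False y0] by blast
    have le: "\<not> \<phi> z < \<psi> z" if s: "sol y\<^sub>0 \<phi>" "sol y\<^sub>0 \<psi>" for \<phi> \<psi>
    proof
      assume less: "\<phi> z < \<psi> z"
      have inw: "(x, \<phi> x) \<in> wedge y\<^sub>0" "(x, \<psi> x) \<in> wedge y\<^sub>0" if "x \<in> {0..\<delta>}" for x
      proof -
        have "\<bar>\<phi> x - y\<^sub>0\<bar> \<le> 2 * x" "\<bar>\<psi> x - y\<^sub>0\<bar> \<le> 2 * x" using that s by (auto simp: sol_def)
        thus "(x, \<phi> x) \<in> wedge y\<^sub>0" "(x, \<psi> x) \<in> wedge y\<^sub>0" using that by (auto simp: wedge_def)
      qed
      have "\<psi> 0 - \<phi> 0 > 0"
      proof (rule derivative_upper_bound_pos[where b = z and C = L and \<phi> = "\<lambda>x. \<psi> x - \<phi> x" and \<phi>' = "\<lambda>x. f x (\<psi> x) - f x (\<phi> x)"])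
        show "continuous_on {0..z} (\<lambda>x. \<psi> x - \<phi> x)"
          using z by (intro continuous_intros continuous_on_subset[OF sol_cont[OF s(1) y0]]
              continuous_on_subset[OF sol_cont[OF s(2) y0]]) auto
        fix x assume x: "0 < x" "x < z"
        show "((\<lambda>x. \<psi> x - \<phi> x) has_real_derivative f x (\<psi> x) - f x (\<phi> x)) (at x)"
          using x z by (intro DERIV_diff sol_deriv_at[OF s(1)] sol_deriv_at[OF s(2)]) auto
        assume "0 < \<psi> x - \<phi> x"
        thus "f x (\<psi> x) - f x (\<phi> x) \<le> L * (\<psi> x - \<phi> x)"
          using L(2)[OF inw(2) inw(1), of x] x z by (auto)
      qed (use z less in auto)
      thus False using s by (simp add: sol_def)
    qed
    from le[OF s] le[OF s(2) s(1)] show ?thesis by simp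
  qed
  have c: "continuous_on {0..\<delta>} (\<lambda>x. \<phi> x - \<psi> x)"
    by (intro continuous_intros sol_cont[OF _ y0] s)
  have "\<phi> x - \<psi> x = 0"
    by (rule continuous_constant_on_closure[of "{0<..<\<delta>}" "\<lambda>x. \<phi> x - \<psi> x"])
       (use c op x \<delta> in auto)
  thus ?thesis by simp
qed

text \<open>Solutions from different initial values are still apart at some small \<open>a > 0\<close>, since their
  slopes are bounded. To the right of \<open>a\<close> the equation is Lipschitz.\<close>
lemma sol_less:
  assumes s: "sol y\<^sub>1 \<phi>" "sol y\<^sub>2 \<psi>" and y: "y\<^sub>1 < y\<^sub>2" "\<bar>y\<^sub>1\<bar> \<le> \<eta>" "\<bar>y\<^sub>2\<bar> \<le> \<eta>" and x: "x \<in> {0..\<delta>}"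
  shows "\<phi> x < \<psi> x"
proof (cases "x = 0")
  case True thus ?thesis using s y by (simp add: sol_def)
next
  case False
  \<comment> \<open>Up to this point the two graphs cannot come closer than half of their initial distance.\<close>
  define a where "a = min x ((y\<^sub>2 - y\<^sub>1) / 8)"
  have a: "0 < a" "a \<le> x" "a < (y\<^sub>2 - y\<^sub>1) / 4" "a \<in> {0..\<delta>}" using False x y by (auto simp: a_def min_def)
  have "\<bar>\<phi> a - y\<^sub>1\<bar> \<le> 2 * a" "\<bar>\<psi> a - y\<^sub>2\<bar> \<le> 2 * a" using s a by (auto simp: sol_def)
  hence pos: "\<psi> a - \<phi> a > 0" using a by (auto simp: field_simps)
  define T where "T = {a..\<delta>} \<times> {- (\<eta> + 2 * \<delta>)..\<eta> + 2 * \<delta>}"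
  have "\<exists>L\<ge>0. \<forall>x y z. (x, y) \<in> T \<longrightarrow> (x, z) \<in> T \<longrightarrow> \<bar>f x y - f x z\<bar> \<le> L * \<bar>y - z\<bar>"
    by (rule lipschitz_on_compact) (use a in \<open>auto simp: T_def Q_def intro!: compact_Times\<close>)
  then obtain L where L: "L \<ge> 0"
    "\<And>x y z. (x, y) \<in> T \<Longrightarrow> (x, z) \<in> T \<Longrightarrow> \<bar>f x y - f x z\<bar> \<le> L * \<bar>y - z\<bar>" by blast
  have inT: "(z, \<phi> z) \<in> T" "(z, \<psi> z) \<in> T" if "z \<in> {a..\<delta>}" for z
    using sol_in_Q[OF s(1) y(2), of z] sol_in_Q[OF s(2) y(3), of z] that a by (auto simp: T_def Q_def)
  have "\<psi> x - \<phi> x > 0"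
  proof (rule derivative_lower_bound_pos[where a = a and b = x and C = L and \<phi> = "\<lambda>x. \<psi> x - \<phi> x" and \<phi>' = "\<lambda>x. f x (\<psi> x) - f x (\<phi> x)"])
    show "continuous_on {a..x} (\<lambda>x. \<psi> x - \<phi> x)"
      using x a by (intro continuous_intros continuous_on_subset[OF sol_cont[OF s(1) y(2)]]
          continuous_on_subset[OF sol_cont[OF s(2) y(3)]]) auto
    fix z assume z: "a < z" "z < x"
    show "((\<lambda>x. \<psi> x - \<phi> x) has_real_derivative f z (\<psi> z) - f z (\<phi> z)) (at z)"
      using x a z by (intro DERIV_diff sol_deriv_at[OF s(1)] sol_deriv_at[OF s(2)]) auto
    assume "0 < \<psi> z - \<phi> z"
    thus "f z (\<psi> z) - f z (\<phi> z) \<ge> - L * (\<psi> z - \<phi> z)"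
      using L(2)[OF inT(2) inT(1), of z] x z by (auto)
  qed (use a pos in auto)
  thus ?thesis by simp
qed

text \<open>Limits of solutions are solutions, also when the initial values tend to the singular one.\<close>
lemma sol_limit:
  assumes s: "\<And>n. sol (c n) (\<phi> n)" and c: "\<And>n. \<bar>c n\<bar> \<le> \<eta>" "c \<longlonglongrightarrow> y\<^sub>0"
    and lim: "\<And>x. x \<in> {0..\<delta>} \<Longrightarrow> (\<lambda>n. \<phi> n x) \<longlonglongrightarrow> \<psi> x"
  shows "sol y\<^sub>0 \<psi>"
  unfolding sol_def
proof (intro conjI ballI)
  have "(\<lambda>n. \<phi> n 0) \<longlonglongrightarrow> \<psi> 0" using \<delta> by (intro lim) auto
  thus "\<psi> 0 = y\<^sub>0" using s c(2) by (intro LIMSEQ_unique[of "\<lambda>n. \<phi> n 0"]) (auto simp: sol_def)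
  have near: "\<bar>\<psi> x - y\<^sub>0\<bar> \<le> 2 * x" if "x \<in> {0..\<delta>}" for x
    by (rule LIMSEQ_le_const2[OF tendsto_rabs[OF tendsto_diff[OF lim[OF that] c(2)]]])
       (use s that in \<open>auto simp: sol_def\<close>)
  thus "\<And>x. x \<in> {0..\<delta>} \<Longrightarrow> \<bar>\<psi> x - y\<^sub>0\<bar> \<le> 2 * x" .
  have y0: "\<bar>y\<^sub>0\<bar> \<le> \<eta>"
    by (rule LIMSEQ_le_const2[OF tendsto_rabs[OF c(2)]]) (use c in auto)
  fix x assume x: "x \<in> {0<..\<delta>}"
  define a where "a = x / 2"
  have a: "0 < a" "a < x" "a < \<delta>" using x by (auto simp: a_def)
  have sub: "{a..\<delta>} \<subseteq> {0..\<delta>}" using a by auto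
  have "(\<psi> has_real_derivative f x (\<psi> x)) (at x within {a..\<delta>})"
  proof (rule limit_of_solutions[where D = Q and M = 2 and \<phi> = \<phi>])
    fix n z assume z: "z \<in> {a..\<delta>}"
    have "(\<phi> n has_real_derivative f z (\<phi> n z)) (at z within {0..\<delta>})"
      using s[of n] z a by (auto simp: sol_def)
    thus "(\<phi> n has_real_derivative f z (\<phi> n z)) (at z within {a..\<delta>})"
      by (rule DERIV_subset) (rule sub)
    show "(z, \<phi> n z) \<in> Q" using z a by (intro sol_in_Q[OF s c(1)]) auto
    show "(\<lambda>n. \<phi> n z) \<longlonglongrightarrow> \<psi> z" using z a by (intro lim) auto
    show "(z, \<psi> z) \<in> Q" using near[of z] y0 z a by (auto simp: Q_def)
  qed (use a x cont bound in auto)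
  thus "(\<psi> has_real_derivative f x (\<psi> x)) (at x within {0..\<delta>})"
    using at_within_nhd[of x "{a<..}" "{a..\<delta>}" "{0..\<delta>}"] a x by (fastforce simp: set_eq_iff)
qed

text \<open>The order of solutions turns monotone sequences of initial values into monotone sequences of
  solutions. This replaces a compactness argument for families of functions.\<close>
lemma sol_convergent:
  assumes s: "\<And>n. sol (c n) (\<phi> n)" and c: "\<And>n. \<bar>c n\<bar> \<le> \<eta>" "monoseq c"
    and x: "x \<in> {0..\<delta>}"
  shows "convergent (\<lambda>n. \<phi> n x)"
proof (rule Bseq_monoseq_convergent)
  have "\<bar>\<phi> n x\<bar> \<le> \<eta> + 2 * \<delta>" for n
  proof -
    have "\<bar>\<phi> n x - c n\<bar> \<le> 2 * x" using s[of n] x by (auto simp: sol_def)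
    thus ?thesis using c(1)[of n] x by auto
  qed
  thus "Bseq (\<lambda>n. \<phi> n x)" by (auto intro!: BseqI')
  have le: "\<phi> m x \<le> \<phi> n x" if "c m \<le> c n" for m n
  proof (cases "c m = c n")
    case True
    thus ?thesis using sol_unique[OF s[of m] _ c(1) x, of "\<phi> n"] s[of n] by auto
  next
    case False
    thus ?thesis using sol_less[OF s[of m] s[of n] _ c(1) c(1) x] that by auto
  qed
  show "monoseq (\<lambda>n. \<phi> n x)" using c(2) le unfolding monoseq_def by blast
qed

lemma ex_sol_zero: "\<exists>\<phi>. sol 0 \<phi>"
proof -
  define c where "c n = \<eta> / real (Suc n)" for n
  have c: "\<bar>c n\<bar> \<le> \<eta>" "c n \<noteq> 0" for n using \<eta> by (auto simp: c_def field_simps)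
  have "\<forall>n. \<exists>\<phi>. sol (c n) \<phi>" using ex_sol_nonzero[OF c(2) c(1)] by blast
  then obtain \<phi> where \<phi>: "\<And>n. sol (c n) (\<phi> n)" by metis
  have "monoseq c" using \<eta> by (intro decseq_imp_monoseq) (auto simp: decseq_def c_def field_simps)
  hence "convergent (\<lambda>n. \<phi> n x)" if "x \<in> {0..\<delta>}" for x
    using sol_convergent[of c \<phi>, OF \<phi> c(1) _ that] \<open>monoseq c\<close> by blast
  moreover have "c \<longlonglongrightarrow> 0"
    unfolding c_def by (rule LIMSEQ_Suc[OF lim_const_over_n])
  ultimately have "sol 0 (\<lambda>x. lim (\<lambda>n. \<phi> n x))"
    unfolding convergent_LIMSEQ_iff
    by (intro sol_limit[of c \<phi>, OF \<phi> c(1)]) auto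
  thus ?thesis by blast
qed

definition flow :: "real \<Rightarrow> real \<Rightarrow> real" where
  "flow x y = (SOME \<phi>. sol y \<phi>) x"

lemma flow_sol: "\<bar>y\<bar> \<le> \<eta> \<Longrightarrow> sol y (\<lambda>x. flow x y)"
  unfolding flow_def using ex_sol_nonzero[of y] ex_sol_zero someI_ex[of "sol y"] by (cases "y = 0") auto

lemma flow_0: "\<bar>y\<bar> \<le> \<eta> \<Longrightarrow> flow 0 y = y"
  using flow_sol[of y] by (simp add: sol_def)

lemma flow_deriv:
  assumes y: "\<bar>y\<bar> \<le> \<eta>" and x: "x \<in> {0..\<delta>}" and nz: "x \<noteq> 0 \<or> y \<noteq> 0"
  shows "((\<lambda>x. flow x y) has_real_derivative f x (flow x y)) (at x within {0..\<delta>})"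
proof (cases "x = 0")
  case False
  thus ?thesis using flow_sol[OF y] x by (auto simp: sol_def)
next
  case True
  then obtain \<phi> where \<phi>: "sol y \<phi>" "(\<phi> has_real_derivative f 0 y) (at 0 within {0..\<delta>})"
    using ex_sol_nonzero[of y] nz y by auto
  have "\<phi> z = flow z y" if "z \<in> {0..\<delta>}" for z
    by (rule sol_unique[OF \<phi>(1) flow_sol[OF y] y that])
  thus ?thesis
    using has_field_derivative_transform_within[OF \<phi>(2), of 1 "\<lambda>x. flow x y"] flow_0[OF y] True x
    by simp
qed

lemma flow_strict_mono:
  "\<lbrakk>\<bar>y\<^sub>1\<bar> \<le> \<eta>; \<bar>y\<^sub>2\<bar> \<le> \<eta>; y\<^sub>1 < y\<^sub>2; x \<in> {0..\<delta>}\<rbrakk> \<Longrightarrow> flow x y\<^sub>1 < flow x y\<^sub>2"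
  using sol_less[OF flow_sol flow_sol] by blast

text \<open>Otherwise a monotone sequence of initial values tending to \<open>y\<close> would have solutions whose limit
  is a second solution from \<open>y\<close>, against uniqueness.\<close>
lemma flow_cont_section:
  assumes x: "x \<in> {0..\<delta>}" and y: "\<bar>y\<bar> \<le> \<eta>" and e: "e > 0"
  shows "\<exists>d>0. \<forall>y'. \<bar>y'\<bar> \<le> \<eta> \<longrightarrow> \<bar>y' - y\<bar> < d \<longrightarrow> \<bar>flow x y' - flow x y\<bar> < e"
proof (rule ccontr)
  assume "\<not> ?thesis"
  hence "\<forall>n. \<exists>y'. \<bar>y'\<bar> \<le> \<eta> \<and> \<bar>y' - y\<bar> < 1 / real (Suc n) \<and> \<bar>flow x y' - flow x y\<bar> \<ge> e"
    by (metis not_less of_nat_0_less_iff zero_less_Suc zero_less_divide_1_iff)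
  then obtain c where c: "\<And>n. \<bar>c n\<bar> \<le> \<eta>" "\<And>n. \<bar>c n - y\<bar> < 1 / real (Suc n)"
    "\<And>n. \<bar>flow x (c n) - flow x y\<bar> \<ge> e" by metis
  have "c \<longlonglongrightarrow> y"
  proof (rule LIMSEQ_I)
    fix r :: real assume "r > 0"
    then obtain n\<^sub>0 where "inverse (real (Suc n\<^sub>0)) < r" using reals_Archimedean by blast
    hence "norm (c n - y) < r" if "n \<ge> n\<^sub>0" for n
    proof -
      have "1 / real (Suc n) \<le> inverse (real (Suc n\<^sub>0))" using that by (simp add: field_simps)
      thus ?thesis using c(2)[of n] \<open>inverse _ < r\<close> by simp
    qed
    thus "\<exists>no. \<forall>n\<ge>no. norm (c n - y) < r" by blast
  qed
  obtain g :: "nat \<Rightarrow> nat" where g: "strict_mono g" "monoseq (\<lambda>n. c (g n))"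
    using seq_monosub[of c] by auto
  have cg: "(\<lambda>n. c (g n)) \<longlonglongrightarrow> y"
    using LIMSEQ_subseq_LIMSEQ[OF \<open>c \<longlonglongrightarrow> y\<close> g(1)] by (simp add: o_def)
  have s: "sol (c (g n)) (\<lambda>x. flow x (c (g n)))" for n by (rule flow_sol[OF c(1)])
  have lim: "(\<lambda>n. flow z (c (g n))) \<longlonglongrightarrow> lim (\<lambda>n. flow z (c (g n)))" if "z \<in> {0..\<delta>}" for z
    using sol_convergent[OF s c(1) g(2) that] by (simp add: convergent_LIMSEQ_iff)
  have "sol y (\<lambda>z. lim (\<lambda>n. flow z (c (g n))))"
    by (rule sol_limit[OF s c(1) cg lim])
  hence "lim (\<lambda>n. flow x (c (g n))) = flow x y"
    using sol_unique[OF _ flow_sol[OF y] y x] by blast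
  hence "(\<lambda>n. \<bar>flow x (c (g n)) - flow x y\<bar>) \<longlonglongrightarrow> \<bar>flow x y - flow x y\<bar>"
    using lim[OF x] by (intro tendsto_intros) auto
  hence "e \<le> \<bar>flow x y - flow x y\<bar>" by (rule LIMSEQ_le_const) (use c(3) in auto)
  thus False using e by simp
qed

lemma flow_continuous: "continuous_on ({0..\<delta>} \<times> {-\<eta>..\<eta>}) (\<lambda>(x, y). flow x y)"
  unfolding continuous_on_iff
proof (intro ballI allI impI)
  fix p and e :: real assume p: "p \<in> {0..\<delta>} \<times> {-\<eta>..\<eta>}" and e: "0 < e"
  obtain x y where xy: "p = (x, y)" "x \<in> {0..\<delta>}" "\<bar>y\<bar> \<le> \<eta>" using p by (cases p) auto
  obtain d where d: "d > 0" "\<And>y'. \<lbrakk>\<bar>y'\<bar> \<le> \<eta>; \<bar>y' - y\<bar> < d\<rbrakk> \<Longrightarrow> \<bar>flow x y' - flow x y\<bar> < e / 2"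
    using flow_cont_section[OF xy(2,3), of "e/2"] e by auto
  have "dist (flow x' y') (flow x y) < e"
    if q: "x' \<in> {0..\<delta>}" "\<bar>y'\<bar> \<le> \<eta>" "dist (x', y') (x, y) < min d (e / 4)" for x' y'
  proof -
    have "\<bar>x' - x\<bar> < e / 4" "\<bar>y' - y\<bar> < d"
      using q(3) dist_fst_le[of "(x', y')" "(x, y)"] dist_snd_le[of "(x', y')" "(x, y)"]
      by (auto simp: dist_real_def)
    moreover have "\<bar>flow x' y' - flow x y'\<bar> \<le> 2 * \<bar>x' - x\<bar>"
      by (rule sol_lipschitz[OF flow_sol[OF q(2)] q(2) q(1) xy(2)])
    ultimately show ?thesis using d(2)[OF q(2)] by (auto simp: dist_real_def abs_if split: if_splits)
  qed
  thus "\<exists>d>0. \<forall>q\<in>{0..\<delta>} \<times> {-\<eta>..\<eta>}. dist q p < d \<longrightarrow> dist (case q of (x, y) \<Rightarrow> flow x y) (case p of (x, y) \<Rightarrow> flow x y) < e"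
    using d(1) e xy by (intro exI[of _ "min d (e / 4)"]) auto
qed

end

section \<open>Slopes with exactly one solution through the singular point\<close>

text \<open>Here \<open>f'\<close> is the derivative of \<open>f\<close> in \<open>y\<close>. The conditions describe how the slope field turns
  around the origin: the slope is above \<open>m - 1\<close> on the upper side of the antidiagonal \<open>x + y = 0\<close>,
  not much below \<open>- 1\<close> on its lower side, at least \<open>1/2\<close> in a sector around the positive
  \<open>x\<close>-axis and at most \<open>- 1/2\<close> in the third quadrant. The derivative \<open>f'\<close> may be unbounded above
  near the origin, so the Lipschitz condition holds on one side only, except in the sector
  of \<open>steep\<close>.\<close>
locale one_through_leaf =
  fixes f f' :: "real \<Rightarrow> real \<Rightarrow> real" and \<epsilon> m C :: real and P :: "(real \<times> real) set"
  defines "P \<equiv> {- \<epsilon>..\<epsilon>} \<times> {- \<epsilon>..\<epsilon>} - {(0, 0)}"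
  assumes \<epsilon>: "\<epsilon> > 0" and m: "m > 0"
    and cont: "continuous_on P (\<lambda>(x, y). f x y)"
    and cont': "continuous_on P (\<lambda>(x, y). f' x y)"
    and der: "\<And>x y. (x, y) \<in> P \<Longrightarrow> (f x has_real_derivative f' x y) (at y)"
    and bound: "\<And>x y. (x, y) \<in> P \<Longrightarrow> \<bar>f x y\<bar> \<le> 2"
    and rise: "\<And>x y. \<lbrakk>(x, y) \<in> P; x + y \<ge> 0\<rbrakk> \<Longrightarrow> 1 + f x y \<ge> m"
    and flat: "\<And>x y. \<lbrakk>(x, y) \<in> P; x + y < 0\<rbrakk> \<Longrightarrow> 1 + f x y \<ge> C * (x + y)"
    and spread: "\<And>x y. (x, y) \<in> P \<Longrightarrow> f' x y \<ge> - C"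
    and steep: "\<And>x y. \<lbrakk>(x, y) \<in> P; 0 < x; x + y \<ge> m * x\<rbrakk> \<Longrightarrow> f x y \<ge> 1/2 \<and> f' x y \<le> C"
    and fall: "\<And>x y. \<lbrakk>(x, y) \<in> P; x < 0; y \<le> 0\<rbrakk> \<Longrightarrow> f x y \<le> - 1/2"
begin

text \<open>Germs at the origin of integral curves over the right and over the left half-axis; the left
  ones are reflected, so that both are parametrised by positive numbers.\<close>

definition right_germ :: "real \<Rightarrow> (real \<Rightarrow> real) \<Rightarrow> bool" where
  "right_germ \<xi> \<phi> \<longleftrightarrow> (\<forall>x\<in>{0<..<\<xi>}. (\<phi> has_real_derivative f x (\<phi> x)) (at x) \<and> \<bar>\<phi> x\<bar> \<le> 2 * x)"

definition left_germ :: "real \<Rightarrow> (real \<Rightarrow> real) \<Rightarrow> bool" where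
  "left_germ \<xi> \<phi> \<longleftrightarrow> (\<forall>x\<in>{0<..<\<xi>}. (\<phi> has_real_derivative - f (- x) (\<phi> x)) (at x) \<and> \<bar>\<phi> x\<bar> \<le> 2 * x)"

text \<open>Germs carry no condition at \<open>0\<close> or to the left of it; they are continued there by \<open>0\<close>.\<close>
lemma germ_continuous:
  assumes "\<And>x. x \<in> {0<..<\<xi>} \<Longrightarrow> (\<phi> has_real_derivative D x) (at x) \<and> \<bar>\<phi> x\<bar> \<le> 2 * x" "b < \<xi>"
  shows "continuous_on {0..b} (\<lambda>x. if x \<le> 0 then 0 else \<phi> x :: real)"
  unfolding continuous_on_eq_continuous_within
proof
  fix x assume x: "x \<in> {0..b}"
  show "continuous (at x within {0..b}) (\<lambda>x. if x \<le> 0 then 0 else \<phi> x)"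
  proof (cases "x = 0")
    case True
    have "((\<lambda>x. if x \<le> 0 then 0 else \<phi> x) \<longlongrightarrow> 0) (at 0 within {0..b})"
    proof (rule Lim_null_comparison)
      show "\<forall>\<^sub>F x in at 0 within {0..b}. norm (if x \<le> 0 then 0 else \<phi> x) \<le> 2 * x"
        using assms by (auto simp: eventually_at_filter)
      show "((*) 2 \<longlongrightarrow> 0) (at (0::real) within {0..b})" by (auto intro!: tendsto_eq_intros)
    qed
    thus ?thesis using True by (simp add: continuous_within)
  next
    case False
    have "(\<phi> has_real_derivative D x) (at x)" using assms x False by auto
    hence "isCont \<phi> x" by (rule DERIV_isCont)
    moreover have "isCont (\<lambda>x. if x \<le> 0 then 0 else \<phi> x) x \<longleftrightarrow> isCont \<phi> x"
      by (rule isCont_cong) (use eventually_gt_at_top x False in \<open>auto intro: eventually_mono[OF eventually_nhds_in_open[of "{0<..}"]]\<close>)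
    ultimately show ?thesis by (simp add: continuous_at_imp_continuous_within)
  qed
qed

lemma germ_deriv:
  assumes "\<And>x. x \<in> {0<..<\<xi>} \<Longrightarrow> (\<phi> has_real_derivative D x) (at x) \<and> \<bar>\<phi> x\<bar> \<le> 2 * x" "0 < x" "x < \<xi>"
  shows "((\<lambda>x. if x \<le> 0 then 0 else \<phi> x) has_real_derivative D x) (at x)"
  by (rule has_field_derivative_transform_within_open[where S = "{0<..}" and f = \<phi>]) (use assms in auto)

lemma slope_diff:
  assumes "y < z" and "\<And>w. \<lbrakk>y \<le> w; w \<le> z\<rbrakk> \<Longrightarrow> (x, w) \<in> P"
  shows "\<exists>w\<ge>y. w \<le> z \<and> f x z - f x y = (z - y) * f' x w"
  using MVT2[OF assms(1), of "f x" "f' x"] assms(2) der by (meson less_imp_le)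

text \<open>A solution that leaves the origin to the right cannot go below the antidiagonal, because
  there \<open>x + \<phi> x\<close> satisfies a differential inequality that would carry its negative sign back to
  \<open>x = 0\<close>. Above the antidiagonal, \<open>x + \<phi> x\<close> grows at least with slope \<open>m\<close>.\<close>
lemma right_germ_above:
  assumes g: "right_germ \<xi> \<phi>" and \<xi>: "2 * \<xi> \<le> \<epsilon>" and b: "0 < b" "b < \<xi>"
  shows "b + \<phi> b \<ge> m * b"
proof -
  let ?\<phi> = "\<lambda>x. if x \<le> 0 then 0 else \<phi> x"
  note g' = g[unfolded right_germ_def, THEN bspec]
  have inP: "(x, \<phi> x) \<in> P" if "0 < x" "x \<le> b" for x
    using g'[of x] that b \<xi> by (auto simp: P_def)
  have c: "continuous_on {0..b'} ?\<phi>" if "b' \<le> b" for b'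
    using that b by (intro germ_continuous[OF g']) auto
  have nonneg: "x + \<phi> x \<ge> 0" if x: "0 < x" "x \<le> b" for x
  proof (rule ccontr)
    assume neg: "\<not> x + \<phi> x \<ge> 0"
    have "- (0 + ?\<phi> 0) > 0"
    proof (rule derivative_upper_bound_pos[where \<phi> = "\<lambda>z. - (z + ?\<phi> z)" and b = x and C = C
          and \<phi>' = "\<lambda>z. - (1 + f z (\<phi> z))"])
      show "continuous_on {0..x} (\<lambda>z. - (z + ?\<phi> z))" using x by (intro continuous_intros c) auto
      fix z assume z: "0 < z" "z < x"
      show "((\<lambda>z. - (z + ?\<phi> z)) has_real_derivative - (1 + f z (\<phi> z))) (at z)"
        using z x b by (intro DERIV_minus DERIV_add DERIV_ident germ_deriv[OF g']) auto
      assume "0 < - (z + ?\<phi> z)"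
      thus "- (1 + f z (\<phi> z)) \<le> C * - (z + ?\<phi> z)"
        using flat[OF inP, of z] z x by (auto simp: algebra_simps)
    qed (use x neg in auto)
    thus False by simp
  qed
  have "(0 + ?\<phi> 0) - m * 0 \<le> (b + ?\<phi> b) - m * b"
  proof (rule DERIV_nonneg_imp_increasing_open[where f = "\<lambda>z. (z + ?\<phi> z) - m * z"])
    fix z assume z: "0 < z" "z < b"
    have "((\<lambda>z. (z + ?\<phi> z) - m * z) has_real_derivative (1 + f z (\<phi> z)) - m * 1) (at z)"
      using z b by (intro DERIV_diff DERIV_add DERIV_ident DERIV_cmult germ_deriv[OF g']) auto
    thus "\<exists>y. ((\<lambda>z. (z + ?\<phi> z) - m * z) has_real_derivative y) (at z) \<and> 0 \<le> y"
      using rise[OF inP nonneg, of z] z by force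
  qed (use b c in \<open>auto intro!: continuous_intros\<close>)
  thus ?thesis using b by simp
qed

lemma right_germ_pos:
  assumes g: "right_germ \<xi> \<phi>" and \<xi>: "2 * \<xi> \<le> \<epsilon>" and b: "0 < b" "b < \<xi>"
  shows "\<phi> b > 0"
proof -
  let ?\<phi> = "\<lambda>x. if x \<le> 0 then 0 else \<phi> x"
  note g' = g[unfolded right_germ_def, THEN bspec]
  have "?\<phi> 0 < ?\<phi> b"
  proof (rule DERIV_pos_imp_increasing_open[where f = ?\<phi> and a = 0 and b = b])
    fix z assume z: "0 < z" "z < b"
    have "(z, \<phi> z) \<in> P" using g'[of z] z b \<xi> by (auto simp: P_def)
    moreover have "z + \<phi> z \<ge> m * z" using right_germ_above[OF g \<xi>] z b by auto
    ultimately have "f z (\<phi> z) > 0" using steep[of z "\<phi> z"] z by auto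
    moreover have "(?\<phi> has_real_derivative f z (\<phi> z)) (at z)"
      using z b by (intro germ_deriv[OF g']) auto
    ultimately show "\<exists>y. (?\<phi> has_real_derivative y) (at z) \<and> 0 < y" by blast
  qed (use b in \<open>auto intro: germ_continuous[OF g']\<close>)
  thus ?thesis using b by simp
qed

text \<open>All such solutions lie in the sector where \<open>f'\<close> is bounded above. Two of them therefore differ
  by a function whose positivity would persist backwards to the origin, where it is zero.\<close>
lemma right_germ_unique:
  assumes g: "right_germ \<xi> \<phi>" "right_germ \<xi> \<psi>" and \<xi>: "2 * \<xi> \<le> \<epsilon>" and b: "0 < b" "b < \<xi>"
  shows "\<phi> b = \<psi> b"
proof -
  have "\<not> \<phi> b < \<psi> b" if g: "right_germ \<xi> \<phi>" "right_germ \<xi> \<psi>" for \<phi> \<psi>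
  proof
    assume less: "\<phi> b < \<psi> b"
    let ?\<phi> = "\<lambda>x. if x \<le> 0 then 0 else \<phi> x" and ?\<psi> = "\<lambda>x. if x \<le> 0 then 0 else \<psi> x"
    note g1 = g(1)[unfolded right_germ_def, THEN bspec] and g2 = g(2)[unfolded right_germ_def, THEN bspec]
    have "?\<psi> 0 - ?\<phi> 0 > 0"
    proof (rule derivative_upper_bound_pos[where \<phi> = "\<lambda>z. ?\<psi> z - ?\<phi> z" and b = b and C = C
          and \<phi>' = "\<lambda>z. f z (\<psi> z) - f z (\<phi> z)"])
      show "continuous_on {0..b} (\<lambda>z. ?\<psi> z - ?\<phi> z)"
        using b by (intro continuous_on_diff germ_continuous[OF g1] germ_continuous[OF g2])
      fix z assume z: "0 < z" "z < b"
      show "((\<lambda>z. ?\<psi> z - ?\<phi> z) has_real_derivative f z (\<psi> z) - f z (\<phi> z)) (at z)"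
        using z b by (intro DERIV_diff germ_deriv[OF g1] germ_deriv[OF g2]) auto
      assume pos: "0 < ?\<psi> z - ?\<phi> z"
      have P: "(z, w) \<in> P" "z + w \<ge> m * z" if "\<phi> z \<le> w" "w \<le> \<psi> z" for w
        using g1[of z] g2[of z] z b \<xi> right_germ_above[OF g(1) \<xi>, of z] that by (auto simp: P_def)
      obtain w where w: "\<phi> z \<le> w" "w \<le> \<psi> z" "f z (\<psi> z) - f z (\<phi> z) = (\<psi> z - \<phi> z) * f' z w"
        using slope_diff[of "\<phi> z" "\<psi> z" z] P pos z by auto
      have "f' z w \<le> C" using steep P[OF w(1,2)] z by auto
      thus "f z (\<psi> z) - f z (\<phi> z) \<le> C * (?\<psi> z - ?\<phi> z)"
        unfolding w(3) using pos z by (simp add: mult.commute mult_left_mono)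
    qed (use less b in auto)
    thus False by simp
  qed
  from this[OF g] this[OF g(2) g(1)] show ?thesis by simp
qed

text \<open>On the left the time is reversed, so the lower bound of \<open>f'\<close>, which holds everywhere, is the
  one that matters.\<close>
lemma left_germ_unique:
  assumes g: "left_germ \<xi> \<phi>" "left_germ \<xi> \<psi>" and \<xi>: "2 * \<xi> \<le> \<epsilon>" and b: "0 < b" "b < \<xi>"
  shows "\<phi> b = \<psi> b"
proof -
  have "\<not> \<phi> b < \<psi> b" if g: "left_germ \<xi> \<phi>" "left_germ \<xi> \<psi>" for \<phi> \<psi>
  proof
    assume less: "\<phi> b < \<psi> b"
    let ?\<phi> = "\<lambda>x. if x \<le> 0 then 0 else \<phi> x" and ?\<psi> = "\<lambda>x. if x \<le> 0 then 0 else \<psi> x"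
    note g1 = g(1)[unfolded left_germ_def, THEN bspec] and g2 = g(2)[unfolded left_germ_def, THEN bspec]
    have "?\<psi> 0 - ?\<phi> 0 > 0"
    proof (rule derivative_upper_bound_pos[where \<phi> = "\<lambda>z. ?\<psi> z - ?\<phi> z" and b = b and C = C
          and \<phi>' = "\<lambda>z. - f (- z) (\<psi> z) - - f (- z) (\<phi> z)"])
      show "continuous_on {0..b} (\<lambda>z. ?\<psi> z - ?\<phi> z)"
        using b by (intro continuous_on_diff germ_continuous[OF g1] germ_continuous[OF g2])
      fix z assume z: "0 < z" "z < b"
      show "((\<lambda>z. ?\<psi> z - ?\<phi> z) has_real_derivative - f (- z) (\<psi> z) - - f (- z) (\<phi> z)) (at z)"
        using z b by (intro DERIV_diff germ_deriv[OF g1] germ_deriv[OF g2]) auto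
      assume pos: "0 < ?\<psi> z - ?\<phi> z"
      have P: "(- z, w) \<in> P" if "\<phi> z \<le> w" "w \<le> \<psi> z" for w
        using g1[of z] g2[of z] z b \<xi> that by (auto simp: P_def)
      obtain w where w: "\<phi> z \<le> w" "w \<le> \<psi> z" "f (- z) (\<psi> z) - f (- z) (\<phi> z) = (\<psi> z - \<phi> z) * f' (- z) w"
        using slope_diff[of "\<phi> z" "\<psi> z" "- z"] P pos z by auto
      have "(\<psi> z - \<phi> z) * f' (- z) w \<ge> (\<psi> z - \<phi> z) * (- C)"
        using spread P[OF w(1,2)] pos z by (intro mult_left_mono) auto
      thus "- f (- z) (\<psi> z) - - f (- z) (\<phi> z) \<le> C * (?\<psi> z - ?\<phi> z)"
        using z w(3) by (simp add: mult.commute)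
    qed (use less b in auto)
    thus False by simp
  qed
  from this[OF g] this[OF g(2) g(1)] show ?thesis by simp
qed

text \<open>In the reflected time the slope is at least \<open>1/2\<close> where \<open>\<phi> \<le> 0\<close> and at most \<open>1 - m\<close> where
  \<open>\<phi> x \<ge> x\<close>. So a solution that left the region \<open>0 < \<phi> x < x\<close> could not have come from the
  origin.\<close>
lemma left_germ_location:
  assumes g: "left_germ \<xi> \<phi>" and \<xi>: "2 * \<xi> \<le> \<epsilon>" and b: "0 < b" "b < \<xi>"
  shows "0 < \<phi> b" "\<phi> b < b"
proof -
  let ?\<phi> = "\<lambda>x. if x \<le> 0 then 0 else \<phi> x"
  note g' = g[unfolded left_germ_def, THEN bspec]
  have inP: "(- x, \<phi> x) \<in> P" if "0 < x" "x \<le> b" for x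
    using g'[of x] that b \<xi> by (auto simp: P_def)
  show "0 < \<phi> b"
  proof (rule ccontr)
    assume neg: "\<not> 0 < \<phi> b"
    have "(\<phi> has_real_derivative - f (- b) (\<phi> b)) (at b)" using g' b by auto
    moreover have "- f (- b) (\<phi> b) > 0" using fall[OF inP, of b] neg b by auto
    ultimately obtain d where d: "d > 0" "\<And>h. \<lbrakk>0 < h; h < d\<rbrakk> \<Longrightarrow> \<phi> (b - h) < \<phi> b"
      using DERIV_pos_inc_left by blast
    define a where "a = b - min (d / 2) (b / 2)"
    have a: "0 < a" "a < b" "\<phi> a < \<phi> b" using d(2)[of "min (d / 2) (b / 2)"] d(1) b by (auto simp: a_def)
    have "- ?\<phi> 0 > 0"
    proof (rule derivative_upper_bound_pos[where \<phi> = "\<lambda>z. - ?\<phi> z" and b = a and C = 0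
          and \<phi>' = "\<lambda>z. - (- f (- z) (\<phi> z))"])
      show "continuous_on {0..a} (\<lambda>z. - ?\<phi> z)"
        using a b by (intro continuous_on_minus germ_continuous[OF g']) auto
      fix z assume z: "0 < z" "z < a"
      show "((\<lambda>z. - ?\<phi> z) has_real_derivative - (- f (- z) (\<phi> z))) (at z)"
        using z a b by (intro DERIV_minus germ_deriv[OF g']) auto
      assume "0 < - ?\<phi> z"
      thus "- (- f (- z) (\<phi> z)) \<le> 0 * - ?\<phi> z" using fall[OF inP, of z] z a by auto
    qed (use a neg in auto)
    thus False by simp
  qed
  show "\<phi> b < b"
  proof (rule ccontr)
    assume neg: "\<not> \<phi> b < b"
    have "((\<lambda>z. z - \<phi> z) has_real_derivative 1 - - f (- b) (\<phi> b)) (at b)"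
      using g' b by (intro DERIV_diff DERIV_ident) auto
    moreover have "1 - - f (- b) (\<phi> b) > 0" using rise[OF inP, of b] neg b m by auto
    ultimately obtain d where d: "d > 0" "\<And>h. \<lbrakk>0 < h; h < d\<rbrakk> \<Longrightarrow> (b - h) - \<phi> (b - h) < b - \<phi> b"
      using DERIV_pos_inc_left[of "\<lambda>z. z - \<phi> z"] by blast
    define a where "a = b - min (d / 2) (b / 2)"
    have a: "0 < a" "a < b" "a - \<phi> a < b - \<phi> b"
      using d(2)[of "min (d / 2) (b / 2)"] d(1) b by (auto simp: a_def)
    have "?\<phi> 0 - 0 > 0"
    proof (rule derivative_upper_bound_pos[where \<phi> = "\<lambda>z. ?\<phi> z - z" and b = a and C = 0
          and \<phi>' = "\<lambda>z. - f (- z) (\<phi> z) - 1"])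
      show "continuous_on {0..a} (\<lambda>z. ?\<phi> z - z)"
        using a b by (intro continuous_on_diff continuous_on_id germ_continuous[OF g']) auto
      fix z assume z: "0 < z" "z < a"
      show "((\<lambda>z. ?\<phi> z - z) has_real_derivative - f (- z) (\<phi> z) - 1) (at z)"
        using z a b by (intro DERIV_diff DERIV_ident germ_deriv[OF g']) auto
      assume "0 < ?\<phi> z - z"
      thus "- f (- z) (\<phi> z) - 1 \<le> 0 * (?\<phi> z - z)" using rise[OF inP, of z] z a m by auto
    qed (use a neg in auto)
    thus False by simp
  qed
qed

lemma right_half:
  assumes \<delta>: "0 < \<delta>" "3 * \<delta> \<le> \<epsilon>"
  shows "half_singular_ode f f' \<delta> \<delta>"
proof
  have sub: "{0..\<delta>} \<times> {- (\<delta> + 2 * \<delta>)..\<delta> + 2 * \<delta>} - {(0, 0)} \<subseteq> P" using \<delta> by (auto simp: P_def)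
  show "continuous_on ({0..\<delta>} \<times> {- (\<delta> + 2 * \<delta>)..\<delta> + 2 * \<delta>} - {(0, 0)}) (\<lambda>(x, y). f x y)"
    "continuous_on ({0..\<delta>} \<times> {- (\<delta> + 2 * \<delta>)..\<delta> + 2 * \<delta>} - {(0, 0)}) (\<lambda>(x, y). f' x y)"
    using cont cont' sub by (auto intro: continuous_on_subset)
  show "\<phi> x = \<psi> x" if "\<And>x. x \<in> {0<..<\<delta>} \<Longrightarrow> (\<phi> has_real_derivative f x (\<phi> x)) (at x) \<and> \<bar>\<phi> x\<bar> \<le> 2 * x"
    "\<And>x. x \<in> {0<..<\<delta>} \<Longrightarrow> (\<psi> has_real_derivative f x (\<psi> x)) (at x) \<and> \<bar>\<psi> x\<bar> \<le> 2 * x"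
    "x \<in> {0<..<\<delta>}" for \<phi> \<psi> x
    using right_germ_unique[of \<delta> \<phi> \<psi> x] that \<delta> by (auto simp: right_germ_def)
qed (use \<delta> der bound in \<open>auto simp: P_def\<close>)

lemma left_half:
  assumes \<delta>: "0 < \<delta>" "3 * \<delta> \<le> \<epsilon>"
  shows "half_singular_ode (\<lambda>x y. - f (- x) y) (\<lambda>x y. - f' (- x) y) \<delta> \<delta>"
proof
  let ?Q = "{0..\<delta>} \<times> {- (\<delta> + 2 * \<delta>)..\<delta> + 2 * \<delta>} - {(0, 0)}"
  have sub: "(\<lambda>p. (- fst p, snd p)) ` ?Q \<subseteq> P" using \<delta> by (auto simp: P_def)
  have "continuous_on ?Q (\<lambda>p. - ((\<lambda>(x, y). f x y) \<circ> (\<lambda>p. (- fst p, snd p))) p)"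
    "continuous_on ?Q (\<lambda>p. - ((\<lambda>(x, y). f' x y) \<circ> (\<lambda>p. (- fst p, snd p))) p)"
    by (intro continuous_on_minus continuous_on_compose continuous_intros
        continuous_on_subset[OF cont sub] continuous_on_subset[OF cont' sub])+
  thus "continuous_on ?Q (\<lambda>(x, y). - f (- x) y)" "continuous_on ?Q (\<lambda>(x, y). - f' (- x) y)"
    by (simp_all add: o_def case_prod_unfold)
  show "\<phi> x = \<psi> x" if "\<And>x. x \<in> {0<..<\<delta>} \<Longrightarrow> (\<phi> has_real_derivative - f (- x) (\<phi> x)) (at x) \<and> \<bar>\<phi> x\<bar> \<le> 2 * x"
    "\<And>x. x \<in> {0<..<\<delta>} \<Longrightarrow> (\<psi> has_real_derivative - f (- x) (\<psi> x)) (at x) \<and> \<bar>\<psi> x\<bar> \<le> 2 * x"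
    "x \<in> {0<..<\<delta>}" for \<phi> \<psi> x
    using left_germ_unique[of \<delta> \<phi> \<psi> x] that \<delta> by (auto simp: left_germ_def)
  show "((\<lambda>y. - f (- x) y) has_real_derivative - f' (- x) y) (at y)" if "(x, y) \<in> ?Q" for x y
    using that \<delta> by (intro DERIV_minus der) (auto simp: P_def)
qed (use \<delta> bound in \<open>auto simp: P_def\<close>)

end

section \<open>The slope of a principal foliation in normal form\<close>

text \<open>The regime in which \<open>\<mu>\<close> dominates: the quadratic equation is close to \<open>x'\<^sup>2 = y'\<^sup>2\<close>, and the
  chosen root is near the sign of \<open>\<mu>\<close>.\<close>
lemma discriminant_outer:
  fixes \<mu> l \<nu> :: real
  defines "R \<equiv> sqrt (l\<^sup>2 + \<mu>\<^sup>2 - \<nu>\<^sup>2)"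
  assumes "\<mu> \<noteq> 0" and l: "\<bar>l\<bar> \<le> \<bar>\<mu>\<bar> / 8" and \<nu>: "\<bar>\<nu>\<bar> \<le> \<bar>\<mu>\<bar> / 8"
  shows "R \<ge> \<bar>\<mu>\<bar> / 2" "l + R \<ge> \<bar>\<mu>\<bar> / 2" "l\<^sup>2 + \<mu>\<^sup>2 - \<nu>\<^sup>2 > 0"
    and "\<bar>(\<mu> + \<nu>) / (l + R) - sgn \<mu>\<bar> \<le> 4 * (\<bar>l\<bar> + \<bar>\<nu>\<bar>) / \<bar>\<mu>\<bar>"
proof -
  have \<mu>: "\<bar>\<mu>\<bar> > 0" using assms by auto
  have "\<nu>\<^sup>2 \<le> (\<bar>\<mu>\<bar> / 8)\<^sup>2" using power_mono[OF \<nu>, of 2] by simp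
  hence "\<nu>\<^sup>2 \<le> \<mu>\<^sup>2 / 64" by (simp add: power_divide)
  moreover have "\<mu>\<^sup>2 > 0" using assms by simp
  ultimately show pos: "l\<^sup>2 + \<mu>\<^sup>2 - \<nu>\<^sup>2 > 0" using zero_le_power2[of l] by linarith
  have up: "R \<le> \<bar>\<mu>\<bar> + \<bar>l\<bar>"
    unfolding R_def
  proof (rule real_le_lsqrt)
    have "(\<bar>\<mu>\<bar> + \<bar>l\<bar>)\<^sup>2 = \<mu>\<^sup>2 + l\<^sup>2 + 2 * (\<bar>\<mu>\<bar> * \<bar>l\<bar>)" by (simp add: power2_sum)
    moreover have "\<bar>\<mu>\<bar> * \<bar>l\<bar> \<ge> 0" by simp
    ultimately show "l\<^sup>2 + \<mu>\<^sup>2 - \<nu>\<^sup>2 \<le> (\<bar>\<mu>\<bar> + \<bar>l\<bar>)\<^sup>2" using zero_le_power2[of \<nu>] by linarith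
  qed auto
  have lo: "R \<ge> \<bar>\<mu>\<bar> - \<bar>\<nu>\<bar>"
    unfolding R_def
  proof (rule real_le_rsqrt)
    have "(\<bar>\<mu>\<bar> - \<bar>\<nu>\<bar>)\<^sup>2 = \<mu>\<^sup>2 + \<nu>\<^sup>2 - 2 * (\<bar>\<mu>\<bar> * \<bar>\<nu>\<bar>)" by (simp add: power2_diff)
    moreover have "\<bar>\<mu>\<bar> * \<bar>\<nu>\<bar> \<ge> \<bar>\<nu>\<bar> * \<bar>\<nu>\<bar>" using \<nu> by (intro mult_right_mono) auto
    moreover have "\<bar>\<nu>\<bar> * \<bar>\<nu>\<bar> = \<nu>\<^sup>2" by (simp add: power2_eq_square)
    ultimately show "(\<bar>\<mu>\<bar> - \<bar>\<nu>\<bar>)\<^sup>2 \<le> l\<^sup>2 + \<mu>\<^sup>2 - \<nu>\<^sup>2" using zero_le_power2[of l] by linarith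
  qed
  show "R \<ge> \<bar>\<mu>\<bar> / 2" and w: "l + R \<ge> \<bar>\<mu>\<bar> / 2" using lo l \<nu> \<mu> by linarith+
  hence wp: "l + R > 0" using \<mu> by linarith
  have "\<bar>(\<mu> + \<nu>) - sgn \<mu> * (l + R)\<bar> \<le> 2 * (\<bar>l\<bar> + \<bar>\<nu>\<bar>)"
    using up lo \<mu> by (cases "\<mu> > 0") (auto simp: sgn_if)
  moreover have "(\<mu> + \<nu>) / (l + R) - sgn \<mu> = ((\<mu> + \<nu>) - sgn \<mu> * (l + R)) / (l + R)"
    using wp by (simp add: field_simps)
  ultimately have "\<bar>(\<mu> + \<nu>) / (l + R) - sgn \<mu>\<bar> \<le> 2 * (\<bar>l\<bar> + \<bar>\<nu>\<bar>) / (l + R)"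
    using wp by (simp add: divide_right_mono)
  also have "\<dots> \<le> 2 * (\<bar>l\<bar> + \<bar>\<nu>\<bar>) / (\<bar>\<mu>\<bar> / 2)"
    using w \<mu> by (intro divide_left_mono mult_pos_pos) auto
  finally show "\<bar>(\<mu> + \<nu>) / (l + R) - sgn \<mu>\<bar> \<le> 4 * (\<bar>l\<bar> + \<bar>\<nu>\<bar>) / \<bar>\<mu>\<bar>" by simp
qed

text \<open>The distance of the slope from \<open>\<plusminus> 1\<close> is governed by \<open>l\<close> and not by \<open>\<mu>\<close>.\<close>
lemma slope_gap:
  fixes \<mu> l \<nu> R :: real
  assumes R2: "R\<^sup>2 = l\<^sup>2 + \<mu>\<^sup>2 - \<nu>\<^sup>2" and w: "l + R > 0"
  defines "F \<equiv> (\<mu> + \<nu>) / (l + R)"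
  shows "(l + R) * (1 - F\<^sup>2) = 2 * (l - \<nu> * F)"
proof -
  have Fw: "\<mu> + \<nu> = F * (l + R)" using w by (simp add: F_def)
  have "(l + R) * ((l + R) * (1 - F\<^sup>2)) = (l + R)\<^sup>2 - (F * (l + R))\<^sup>2" by algebra
  also have "\<dots> = (l + R) * (2 * (l - \<nu> * F))"
    unfolding Fw[symmetric] using R2 Fw by algebra
  finally show ?thesis using w by simp
qed

text \<open>The regime in which \<open>l\<close> is positive and dominates \<open>\<nu>\<close>, while \<open>\<mu>\<close> is arbitrary and may vanish.\<close>
lemma discriminant_inner:
  fixes \<mu> l \<nu> :: real
  defines "R \<equiv> sqrt (l\<^sup>2 + \<mu>\<^sup>2 - \<nu>\<^sup>2)"
  assumes \<nu>: "\<bar>\<nu>\<bar> \<le> l / 4" and l: "l > 0"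
  shows "R \<ge> \<bar>\<mu>\<bar>" "R > 0" "R \<le> l + \<bar>\<mu>\<bar>" "l\<^sup>2 + \<mu>\<^sup>2 - \<nu>\<^sup>2 > 0"
    and "\<bar>(\<mu> + \<nu>) / (l + R)\<bar> < 1"
    and "1 - ((\<mu> + \<nu>) / (l + R))\<^sup>2 \<ge> l / (l + R)"
    and "1 + (\<mu> + \<nu>) / (l + R) \<ge> (3/4) * l / (l + R)"
proof -
  have "\<nu>\<^sup>2 \<le> (l / 4)\<^sup>2" using power_mono[OF \<nu>, of 2] by simp
  hence \<nu>2: "\<nu>\<^sup>2 \<le> l\<^sup>2 / 16" by (simp add: power_divide)
  moreover have l2: "l\<^sup>2 > 0" using l by simp
  ultimately show pos: "l\<^sup>2 + \<mu>\<^sup>2 - \<nu>\<^sup>2 > 0" using zero_le_power2[of \<mu>] by linarith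
  show R: "R > 0" using pos by (simp add: R_def)
  have "\<bar>\<mu>\<bar>\<^sup>2 \<le> l\<^sup>2 + \<mu>\<^sup>2 - \<nu>\<^sup>2" unfolding power2_abs using \<nu>2 l2 by linarith
  thus R\<mu>: "R \<ge> \<bar>\<mu>\<bar>" unfolding R_def by (rule real_le_rsqrt)
  show "R \<le> l + \<bar>\<mu>\<bar>"
    unfolding R_def
  proof (rule real_le_lsqrt)
    have "(l + \<bar>\<mu>\<bar>)\<^sup>2 = l\<^sup>2 + \<mu>\<^sup>2 + 2 * (l * \<bar>\<mu>\<bar>)" by (simp add: power2_sum)
    moreover have "l * \<bar>\<mu>\<bar> \<ge> 0" using l by simp
    ultimately show "l\<^sup>2 + \<mu>\<^sup>2 - \<nu>\<^sup>2 \<le> (l + \<bar>\<mu>\<bar>)\<^sup>2" using zero_le_power2[of \<nu>] by linarith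
  qed (use l in auto)
  define w where "w = l + R"
  have w: "w > 0" using l R by (auto simp: w_def)
  define F where "F = (\<mu> + \<nu>) / w"
  have "\<bar>\<mu> + \<nu>\<bar> < w" using R\<mu> \<nu> l by (auto simp: w_def abs_if split: if_splits)
  thus F: "\<bar>(\<mu> + \<nu>) / (l + R)\<bar> < 1" unfolding w_def[symmetric] using w by (simp add: abs_divide)
  have "R\<^sup>2 = l\<^sup>2 + \<mu>\<^sup>2 - \<nu>\<^sup>2" using pos by (simp add: R_def)
  hence eq: "w * (1 - F\<^sup>2) = 2 * (l - \<nu> * F)"
    using slope_gap[of R l \<mu> \<nu>] w by (simp add: F_def w_def)
  have "\<bar>\<nu> * F\<bar> \<le> \<bar>\<nu>\<bar> * 1" unfolding abs_mult using F by (intro mult_left_mono) (auto simp: F_def w_def)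
  hence "\<nu> * F \<le> l / 4" using \<nu> abs_ge_self[of "\<nu> * F"] by linarith
  hence "2 * (l - \<nu> * F) \<ge> l" using l by (simp add: algebra_simps)
  hence "w * (1 - F\<^sup>2) \<ge> l" unfolding eq .
  thus "1 - ((\<mu> + \<nu>) / (l + R))\<^sup>2 \<ge> l / (l + R)"
    unfolding w_def[symmetric] F_def[symmetric] using w by (simp add: pos_divide_le_eq mult.commute)
  have "w + \<mu> + \<nu> \<ge> (3/4) * l" using R\<mu> \<nu> by (auto simp: w_def)
  hence "(w + \<mu> + \<nu>) / w \<ge> (3/4) * l / w" using w by (intro divide_right_mono) auto
  moreover have "(w + \<mu> + \<nu>) / w = 1 + (\<mu> + \<nu>) / w" using w by (simp add: field_simps)
  ultimately show "1 + (\<mu> + \<nu>) / (l + R) \<ge> (3/4) * l / (l + R)" by (simp add: w_def[symmetric])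
qed

text \<open>Differentiation of the quadratic equation for the slope. The derivatives of \<open>\<mu>\<close>, \<open>l\<close> and \<open>\<nu>\<close>
  enter with the factors \<open>1 - F\<^sup>2\<close>, \<open>- 2 F\<close> and \<open>1 + F\<^sup>2\<close>.\<close>
lemma slope_deriv:
  fixes \<mu> l \<nu> :: "real \<Rightarrow> real"
  defines "R \<equiv> \<lambda>y. sqrt ((l y)\<^sup>2 + (\<mu> y)\<^sup>2 - (\<nu> y)\<^sup>2)"
  defines "F \<equiv> \<lambda>y. (\<mu> y + \<nu> y) / (l y + R y)"
  assumes d: "(\<mu> has_real_derivative \<mu>') (at y)" "(l has_real_derivative l') (at y)"
    "(\<nu> has_real_derivative \<nu>') (at y)"
    and pos: "(l y)\<^sup>2 + (\<mu> y)\<^sup>2 - (\<nu> y)\<^sup>2 > 0" "l y + R y > 0"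
  shows "(F has_real_derivative
    (\<mu>' * (1 - (F y)\<^sup>2) - 2 * l' * F y + \<nu>' * (1 + (F y)\<^sup>2)) / (2 * R y)) (at y)"
proof -
  have R: "R y > 0" using pos by (simp add: R_def)
  have R2: "(R y)\<^sup>2 = (l y)\<^sup>2 + (\<mu> y)\<^sup>2 - (\<nu> y)\<^sup>2" using pos by (simp add: R_def)
  define R' where "R' = (l y * l' + \<mu> y * \<mu>' - \<nu> y * \<nu>') / R y"
  have "(R has_real_derivative R') (at y)"
    unfolding R_def R'_def
    by (rule derivative_eq_intros d refl | use pos in \<open>simp add: field_simps\<close>)+
  hence "(F has_real_derivative ((\<mu>' + \<nu>') * (l y + R y) - (\<mu> y + \<nu> y) * (l' + R')) / ((l y + R y) * (l y + R y))) (at y)"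
    unfolding F_def by (intro DERIV_divide DERIV_add d) (use pos in auto)
  moreover have "((\<mu>' + \<nu>') * (l y + R y) - (\<mu> y + \<nu> y) * (l' + R')) / ((l y + R y) * (l y + R y))
      = (\<mu>' * (1 - (F y)\<^sup>2) - 2 * l' * F y + \<nu>' * (1 + (F y)\<^sup>2)) / (2 * R y)"
  proof -
    define w where "w = l y + R y"
    define G where "G = F y"
    have w: "w > 0" using pos by (simp add: w_def)
    have Gw: "\<mu> y + \<nu> y = G * w" using w by (simp add: G_def F_def w_def)
    have R'R: "R' * R y = l y * l' + \<mu> y * \<mu>' - \<nu> y * \<nu>'" using R by (simp add: R'_def)
    have eq: "w * (1 - G\<^sup>2) = 2 * (l y - \<nu> y * G)"
      using slope_gap[OF R2 pos(2)] by (simp add: w_def G_def F_def)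
    have Ry: "R y = w - l y" and \<mu>y: "\<mu> y = G * w - \<nu> y" using Gw by (auto simp: w_def)
    have "2 * R y * ((\<mu>' + \<nu>') * w - (\<mu> y + \<nu> y) * (l' + R'))
        = w * (2 * R y * (\<mu>' + \<nu>') - 2 * G * (R y * l' + R' * R y))"
      unfolding Gw by (simp add: algebra_simps)
    also have "2 * R y * (\<mu>' + \<nu>') - 2 * G * (R y * l' + R' * R y)
        = \<mu>' * (2 * (w - l y) - 2 * G * (G * w - \<nu> y)) - 2 * l' * G * w
          + \<nu>' * (2 * (w - l y) + 2 * G * \<nu> y)"
      unfolding R'R unfolding Ry \<mu>y by (simp add: algebra_simps)
    also have "2 * (w - l y) - 2 * G * (G * w - \<nu> y) = w * (1 - G\<^sup>2)"
      using eq by (simp add: algebra_simps power2_eq_square)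
    also have "2 * (w - l y) + 2 * G * \<nu> y = w * (1 + G\<^sup>2)"
      using eq by (simp add: algebra_simps power2_eq_square)
    finally have "2 * R y * ((\<mu>' + \<nu>') * w - (\<mu> y + \<nu> y) * (l' + R'))
        = w * w * (\<mu>' * (1 - G\<^sup>2) - 2 * l' * G + \<nu>' * (1 + G\<^sup>2))"
      by (simp add: algebra_simps)
    thus ?thesis unfolding w_def[symmetric] G_def[symmetric]
      using w R by (simp add: frac_eq_eq mult.commute mult.left_commute)
  qed
  ultimately show ?thesis by simp
qed

text \<open>The coefficients of the equation of the lines of curvature in the rotated coordinates
  \<open>x = u + v\<close>, \<open>y = v - u\<close>, with their derivatives in \<open>y\<close>, and the estimates which the Taylor
  polynomial of degree four gives for them. On the axis \<open>v = 0\<close> the coefficient \<open>l\<close> is known up to a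
  small multiple of \<open>u\<^sup>2\<close>, which keeps it positive; \<open>B / 8\<close> is one such multiple.\<close>
locale umbilic_normal_form =
  fixes \<mu> l \<nu> \<mu>' l' \<nu>' :: "real \<Rightarrow> real \<Rightarrow> real" and c B K \<rho> :: real
    and u v n :: "real \<Rightarrow> real \<Rightarrow> real" and S :: "(real \<times> real) set"
  defines "u \<equiv> \<lambda>x y. (x - y) / 2" and "v \<equiv> \<lambda>x y. (x + y) / 2"
    and "n \<equiv> \<lambda>x y. \<bar>u x y\<bar> + \<bar>v x y\<bar>"
    and "S \<equiv> {- \<rho>..\<rho>} \<times> {- \<rho>..\<rho>}"
  assumes cBK: "c > 0" "B > 0" "K > 0" and \<rho>: "\<rho> > 0"
    and cont: "continuous_on S (\<lambda>(x, y). \<mu> x y)" "continuous_on S (\<lambda>(x, y). l x y)"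
      "continuous_on S (\<lambda>(x, y). \<nu> x y)" "continuous_on S (\<lambda>(x, y). \<mu>' x y)"
      "continuous_on S (\<lambda>(x, y). l' x y)" "continuous_on S (\<lambda>(x, y). \<nu>' x y)"
    and der: "\<And>x y. (x, y) \<in> S \<Longrightarrow> (\<mu> x has_real_derivative \<mu>' x y) (at y)"
      "\<And>x y. (x, y) \<in> S \<Longrightarrow> (l x has_real_derivative l' x y) (at y)"
      "\<And>x y. (x, y) \<in> S \<Longrightarrow> (\<nu> x has_real_derivative \<nu>' x y) (at y)"
    and \<mu>: "\<And>x y. (x, y) \<in> S \<Longrightarrow> \<bar>\<mu> x y - c * v x y\<bar> \<le> K * (n x y)\<^sup>2"
    and l: "\<And>x y. (x, y) \<in> S \<Longrightarrow> \<bar>l x y - B * (u x y)\<^sup>2\<bar> \<le> K * n x y * \<bar>v x y\<bar> + B / 8 * (n x y)\<^sup>2"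
    and \<nu>: "\<And>x y. (x, y) \<in> S \<Longrightarrow> \<bar>\<nu> x y\<bar> \<le> K * n x y ^ 3"
    and \<mu>': "\<And>x y. (x, y) \<in> S \<Longrightarrow> \<bar>\<mu>' x y - c / 2\<bar> \<le> K * n x y"
    and l': "\<And>x y. (x, y) \<in> S \<Longrightarrow> \<bar>l' x y\<bar> \<le> K * n x y"
    and \<nu>': "\<And>x y. (x, y) \<in> S \<Longrightarrow> \<bar>\<nu>' x y\<bar> \<le> K * (n x y)\<^sup>2"
begin

definition R :: "real \<Rightarrow> real \<Rightarrow> real" where
  "R x y = sqrt ((l x y)\<^sup>2 + (\<mu> x y)\<^sup>2 - (\<nu> x y)\<^sup>2)"

definition F :: "real \<Rightarrow> real \<Rightarrow> real" where
  "F x y = (\<mu> x y + \<nu> x y) / (l x y + R x y)"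

definition F' :: "real \<Rightarrow> real \<Rightarrow> real" where
  "F' x y = (\<mu>' x y * (1 - (F x y)\<^sup>2) - 2 * l' x y * F x y + \<nu>' x y * (1 + (F x y)\<^sup>2)) / (2 * R x y)"

definition regular :: "real \<Rightarrow> real \<Rightarrow> bool" where
  "regular x y \<longleftrightarrow> (l x y)\<^sup>2 + (\<mu> x y)\<^sup>2 - (\<nu> x y)\<^sup>2 > 0 \<and> l x y + R x y > 0"

text \<open>Outside a sector around the \<open>u\<close>-axis, \<open>\<mu>\<close> is comparable with \<open>v\<close> and with the distance
  from the origin, while \<open>l\<close> and \<open>\<nu>\<close> are of second order.\<close>
lemma outer:
  assumes h: "h > 0"
  shows "\<exists>\<epsilon>>0. \<exists>C>0. \<forall>x y. (x, y) \<in> S \<longrightarrow> v x y \<noteq> 0 \<longrightarrow> n x y \<le> \<epsilon> \<longrightarrow> \<bar>v x y\<bar> \<ge> h * \<bar>u x y\<bar> \<longrightarrow>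
    regular x y \<and> \<bar>F x y - sgn (v x y)\<bar> \<le> C * \<bar>v x y\<bar> \<and> \<bar>F x y - sgn (v x y)\<bar> \<le> 1/2 \<and> \<bar>F' x y\<bar> \<le> C"
proof -
  define H where "H = 1 + 1 / h"
  have H: "H > 0" using h by (simp add: H_def add_pos_pos)
  define C1 where "C1 = 16 * H * (B + K) / c"
  have C1: "C1 > 0" using H cBK by (simp add: C1_def)
  define C2 where "C2 = (3 * C1 * (c / 2 + K) + 9 * K) * (2 * H / c)"
  have C2: "C2 > 0" unfolding C2_def using H cBK C1 by (intro mult_pos_pos add_pos_pos divide_pos_pos) auto
  define \<epsilon> where "\<epsilon> = Min {1, c / (2 * K * H), c / (32 * H * (B + K)), 1 / (2 * C1)}"
  have \<epsilon>: "\<epsilon> > 0" "\<epsilon> \<le> 1" "\<epsilon> \<le> c / (2 * K * H)" "\<epsilon> \<le> c / (32 * H * (B + K))" "\<epsilon> \<le> 1 / (2 * C1)"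
    using H cBK C1 by (auto simp: \<epsilon>_def)
  have main: "regular x y \<and> \<bar>F x y - sgn (v x y)\<bar> \<le> C1 * H * \<bar>v x y\<bar> \<and> \<bar>F x y - sgn (v x y)\<bar> \<le> 1/2 \<and> \<bar>F' x y\<bar> \<le> C2"
    if S: "(x, y) \<in> S" and v0: "v x y \<noteq> 0" and n\<epsilon>: "n x y \<le> \<epsilon>" and hv: "\<bar>v x y\<bar> \<ge> h * \<bar>u x y\<bar>" for x y
  proof -
    define N where "N = n x y"
    have N: "N > 0" "N \<le> 1" "N \<le> \<epsilon>" using v0 n\<epsilon> \<epsilon> by (auto simp: N_def n_def)
    have "\<bar>u x y\<bar> \<le> \<bar>v x y\<bar> / h" using hv h by (simp add: field_simps)
    hence NH: "N \<le> H * \<bar>v x y\<bar>" by (simp add: N_def n_def H_def algebra_simps)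
    have Nv: "\<bar>v x y\<bar> \<le> N" "\<bar>u x y\<bar> \<le> N" by (simp_all add: N_def n_def)
    have N3: "N ^ 3 \<le> N\<^sup>2" using N by (intro power_decreasing) auto
    have "K * N\<^sup>2 \<le> c * \<bar>v x y\<bar> / 2"
    proof -
      have "K * N\<^sup>2 = K * N * N" by (simp add: power2_eq_square)
      also have "\<dots> \<le> K * (c / (2 * K * H)) * (H * \<bar>v x y\<bar>)"
        using N \<epsilon> NH cBK H by (intro mult_mono mult_left_mono mult_nonneg_nonneg) auto
      also have "\<dots> = c * \<bar>v x y\<bar> / 2" using cBK H by (simp add: field_simps)
      finally show ?thesis .
    qed
    with \<mu>[OF S] have \<mu>v: "\<bar>\<mu> x y - c * v x y\<bar> \<le> c * \<bar>v x y\<bar> / 2" by (simp add: N_def)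
    have cv: "c * \<bar>v x y\<bar> > 0" using cBK v0 by simp
    have "\<bar>c * v x y\<bar> = c * \<bar>v x y\<bar>" using cBK by (simp add: abs_mult)
    hence abs\<mu>: "\<bar>\<mu> x y\<bar> \<ge> c * \<bar>v x y\<bar> / 2" using \<mu>v by linarith
    have sgn\<mu>: "sgn (\<mu> x y) = sgn (v x y)"
    proof (cases "v x y > 0")
      case True
      hence "c * v x y = c * \<bar>v x y\<bar>" by simp
      hence "\<mu> x y > 0" using \<mu>v cv by linarith
      thus ?thesis using True by simp
    next
      case False
      hence neg: "v x y < 0" using v0 by simp
      have "c * v x y = - (c * \<bar>v x y\<bar>)" using neg by simp
      hence "\<mu> x y < 0" using \<mu>v cv by linarith
      thus ?thesis using neg by simp
    qed
    have \<mu>0: "\<mu> x y \<noteq> 0" using abs\<mu> cv by auto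
    have \<mu>N: "\<bar>\<mu> x y\<bar> \<ge> c * N / (2 * H)"
    proof -
      have "c * N / (2 * H) \<le> c * (H * \<bar>v x y\<bar>) / (2 * H)"
        using NH cBK H by (intro divide_right_mono mult_left_mono) auto
      also have "\<dots> = c * \<bar>v x y\<bar> / 2" using H by simp
      also have "\<dots> \<le> \<bar>\<mu> x y\<bar>" by (rule abs\<mu>)
      finally show ?thesis .
    qed
    have "\<bar>l x y\<bar> \<le> (2 * B + K) * N\<^sup>2"
    proof -
      have "\<bar>B * (u x y)\<^sup>2\<bar> \<le> B * N\<^sup>2"
        using cBK Nv power_mono[of "\<bar>u x y\<bar>" N 2] by (simp add: abs_mult)
      moreover have "K * N * \<bar>v x y\<bar> \<le> K * N * N" using cBK N Nv by (intro mult_left_mono) auto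
      moreover have "B / 8 * N\<^sup>2 \<le> B * N\<^sup>2" using cBK by (intro mult_right_mono) auto
      ultimately show ?thesis using l[OF S, folded N_def] by (simp add: algebra_simps power2_eq_square)
    qed
    moreover have \<nu>N: "\<bar>\<nu> x y\<bar> \<le> K * N\<^sup>2"
      using \<nu>[OF S, folded N_def] mult_left_mono[OF N3, of K] cBK by linarith
    ultimately have l\<nu>: "\<bar>l x y\<bar> + \<bar>\<nu> x y\<bar> \<le> 2 * (B + K) * N\<^sup>2" by (simp add: algebra_simps)
    note l\<nu>
    also have "2 * (B + K) * N\<^sup>2 \<le> 2 * (B + K) * (c / (32 * H * (B + K)) * N)"
    proof (rule mult_left_mono)
      have "N * N \<le> c / (32 * H * (B + K)) * N" using N \<epsilon> by (intro mult_right_mono) auto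
      thus "N\<^sup>2 \<le> c / (32 * H * (B + K)) * N" by (simp add: power2_eq_square)
    qed (use cBK in auto)
    also have "\<dots> = (c * N / (2 * H)) / 8"
    proof -
      define D where "D = B + K"
      have "D \<noteq> 0" using cBK by (simp add: D_def)
      thus ?thesis unfolding D_def[symmetric] using H by (simp add: field_simps)
    qed
    also have "(c * N / (2 * H)) / 8 \<le> \<bar>\<mu> x y\<bar> / 8" using \<mu>N by (intro divide_right_mono) auto
    finally have small: "\<bar>l x y\<bar> + \<bar>\<nu> x y\<bar> \<le> \<bar>\<mu> x y\<bar> / 8" .
    have "\<bar>l x y\<bar> \<le> \<bar>\<mu> x y\<bar> / 8" "\<bar>\<nu> x y\<bar> \<le> \<bar>\<mu> x y\<bar> / 8" using small by linarith+
    note disc = discriminant_outer[OF \<mu>0 this, folded R_def, folded F_def]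
    have reg: "regular x y" unfolding regular_def using disc(2,3) \<mu>0 by linarith
    have F1: "\<bar>F x y - sgn (v x y)\<bar> \<le> C1 * N"
    proof -
      have "\<bar>F x y - sgn (v x y)\<bar> \<le> 4 * (\<bar>l x y\<bar> + \<bar>\<nu> x y\<bar>) / \<bar>\<mu> x y\<bar>" using disc(4) sgn\<mu> by simp
      also have "\<dots> \<le> 4 * (2 * (B + K) * N\<^sup>2) / (c * N / (2 * H))"
        using \<mu>N l\<nu> N cBK H by (intro frac_le) auto
      also have "\<dots> = C1 * N" using N cBK H by (simp add: C1_def field_simps power2_eq_square)
      finally show ?thesis .
    qed
    also have "C1 * N \<le> C1 * (1 / (2 * C1))" using C1 N \<epsilon> by (intro mult_left_mono) auto
    also have "\<dots> = 1/2" using C1 by simp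
    finally have Fh: "\<bar>F x y - sgn (v x y)\<bar> \<le> 1/2" .
    hence F2: "\<bar>F x y\<bar> \<le> 3/2" using v0 by (auto simp: sgn_if abs_if split: if_splits)
    have F1': "\<bar>1 - (F x y)\<^sup>2\<bar> \<le> 3 * (C1 * N)"
    proof -
      have "1 - (F x y)\<^sup>2 = - (F x y - sgn (v x y)) * (F x y + sgn (v x y))"
        using v0 by (auto simp: sgn_if algebra_simps power2_eq_square)
      hence "\<bar>1 - (F x y)\<^sup>2\<bar> = \<bar>F x y - sgn (v x y)\<bar> * \<bar>F x y + sgn (v x y)\<bar>"
        by (simp add: abs_mult abs_minus_commute)
      also have "\<dots> \<le> C1 * N * 3"
        using F1 F2 C1 N by (intro mult_mono) (auto simp: sgn_if)
      finally show ?thesis by simp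
    qed
    have F22: "(F x y)\<^sup>2 \<le> (3/2)\<^sup>2" using F2 by (metis power2_abs abs_ge_zero power_mono)
    have num: "\<bar>\<mu>' x y * (1 - (F x y)\<^sup>2) - 2 * l' x y * F x y + \<nu>' x y * (1 + (F x y)\<^sup>2)\<bar>
        \<le> (3 * C1 * (c / 2 + K) + 9 * K) * N"
    proof -
      have "\<bar>\<mu>' x y\<bar> \<le> c / 2 + K"
      proof -
        have "K * N \<le> K * 1" using N cBK by (intro mult_left_mono) auto
        thus ?thesis using \<mu>'[OF S, folded N_def] cBK by linarith
      qed
      hence 1: "\<bar>\<mu>' x y * (1 - (F x y)\<^sup>2)\<bar> \<le> (c / 2 + K) * (3 * (C1 * N))"
        unfolding abs_mult using F1' cBK by (intro mult_mono) auto
      have 2: "\<bar>2 * l' x y * F x y\<bar> \<le> 2 * (K * N) * (3/2)"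
        unfolding abs_mult using F2 l'[OF S, folded N_def] by (intro mult_mono) auto
      have "N\<^sup>2 \<le> N" using N by (simp add: power2_eq_square mult_left_le)
      hence "K * N\<^sup>2 \<le> K * N" using cBK by simp
      hence "\<bar>\<nu>' x y\<bar> \<le> K * N" using \<nu>'[OF S, folded N_def] by linarith
      hence 3: "\<bar>\<nu>' x y * (1 + (F x y)\<^sup>2)\<bar> \<le> K * N * (13/4)"
        unfolding abs_mult using F22 N cBK by (intro mult_mono) (auto simp: power2_eq_square)
      have "\<bar>\<mu>' x y * (1 - (F x y)\<^sup>2) - 2 * l' x y * F x y + \<nu>' x y * (1 + (F x y)\<^sup>2)\<bar>
          \<le> (c / 2 + K) * (3 * (C1 * N)) + 2 * (K * N) * (3/2) + K * N * (13/4)"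
        using 1 2 3 by linarith
      also have "\<dots> \<le> (3 * C1 * (c / 2 + K) + 9 * K) * N"
        using cBK N mult_nonneg_nonneg[of K N] by (simp add: algebra_simps)
      finally show ?thesis .
    qed
    have R2: "2 * R x y \<ge> c * N / (2 * H)" using disc(1) \<mu>N by linarith
    have Rpos: "c * N / (2 * H) > 0" using N cBK H by simp
    have "\<bar>F' x y\<bar> \<le> ((3 * C1 * (c / 2 + K) + 9 * K) * N) / (c * N / (2 * H))"
    proof -
      have "\<bar>2 * R x y\<bar> = 2 * R x y" using R2 Rpos by linarith
      thus ?thesis unfolding F'_def abs_divide using num R2 Rpos C1 cBK N
        by (intro frac_le) (auto intro!: mult_nonneg_nonneg add_nonneg_nonneg)
    qed
    also have "\<dots> = C2" using N cBK H by (simp add: C2_def field_simps)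
    finally have F'b: "\<bar>F' x y\<bar> \<le> C2" .
    have "C1 * N \<le> C1 * H * \<bar>v x y\<bar>" using NH C1 by (simp add: mult.assoc)
    thus ?thesis using reg F1 Fh F'b by auto
  qed
  define C where "C = max (C1 * H) C2"
  have le: "C1 * H * \<bar>v x y\<bar> \<le> C * \<bar>v x y\<bar>" for x y unfolding C_def by (intro mult_right_mono) auto
  have "C2 \<le> C" "C > 0" using C2 by (auto simp: C_def)
  moreover have "regular x y \<and> \<bar>F x y - sgn (v x y)\<bar> \<le> C * \<bar>v x y\<bar> \<and> \<bar>F x y - sgn (v x y)\<bar> \<le> 1/2 \<and> \<bar>F' x y\<bar> \<le> C"
    if "(x, y) \<in> S" "v x y \<noteq> 0" "n x y \<le> \<epsilon>" "\<bar>v x y\<bar> \<ge> h * \<bar>u x y\<bar>" for x y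
    using main[OF that] le[of x y] \<open>C2 \<le> C\<close> by (meson order_trans)
  ultimately show ?thesis using \<epsilon>(1) by blast
qed

text \<open>In a narrow sector around the \<open>u\<close>-axis the slope increases in \<open>y\<close>. In the derivative, the term
  \<open>\<mu>' (1 - F\<^sup>2)\<close> is at least of order \<open>B u / h\<close>: the gap \<open>1 - F\<^sup>2\<close> is about \<open>l / (l + R)\<close>, with
  \<open>l\<close> of the size \<open>B u\<^sup>2\<close> and \<open>l + R\<close> at most of the size \<open>c h u\<close>. The terms from \<open>l'\<close> and \<open>\<nu>'\<close>
  are of order \<open>K u\<close>, so a small opening \<open>h\<close> of the sector makes the first term win.\<close>
lemma inner:
  "\<exists>h>0. h \<le> 1 \<and> (\<exists>\<epsilon>>0. \<exists>m>0. \<forall>x y. (x, y) \<in> S \<longrightarrow> u x y \<noteq> 0 \<longrightarrow> n x y \<le> \<epsilon> \<longrightarrow> \<bar>v x y\<bar> \<le> h * \<bar>u x y\<bar> \<longrightarrow>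
    regular x y \<and> \<bar>F x y\<bar> < 1 \<and> F' x y \<ge> 0 \<and> (v x y \<ge> 0 \<longrightarrow> 1 + F x y \<ge> m))"
proof -
  define h where "h = Min {1, B / (8 * K), B / (384 * K)}"
  have h: "h > 0" "h \<le> 1" "h \<le> B / (8 * K)" "h \<le> B / (384 * K)" using cBK by (auto simp: h_def)
  define \<epsilon> where "\<epsilon> = Min {1, B / (128 * K), c * h / (4 * B + 8 * K), c / (4 * K)}"
  have \<epsilon>: "\<epsilon> > 0" "\<epsilon> \<le> 1" "\<epsilon> \<le> B / (128 * K)" "\<epsilon> \<le> c * h / (4 * B + 8 * K)" "\<epsilon> \<le> c / (4 * K)"
    using h cBK by (auto simp: \<epsilon>_def)
  define m where "m = (3 * B / 16) / (5 * B + 4 * K)"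
  have m: "m > 0" "m \<le> 1" using cBK by (auto simp: m_def field_simps)
  have main: "regular x y \<and> \<bar>F x y\<bar> < 1 \<and> F' x y \<ge> 0 \<and> (v x y \<ge> 0 \<longrightarrow> 1 + F x y \<ge> m)"
    if S: "(x, y) \<in> S" and u0: "u x y \<noteq> 0" and n\<epsilon>: "n x y \<le> \<epsilon>" and hv: "\<bar>v x y\<bar> \<le> h * \<bar>u x y\<bar>" for x y
  proof -
    define N U where "N = n x y" and "U = \<bar>u x y\<bar>"
    have U: "U > 0" using u0 by (simp add: U_def)
    have "h * U \<le> 1 * U" using h U by (intro mult_right_mono) auto
    hence vU: "\<bar>v x y\<bar> \<le> h * U" "\<bar>v x y\<bar> \<le> U" using hv by (auto simp: U_def)
    have N: "N \<ge> U" "N \<le> 2 * U" "U \<le> \<epsilon>" "N \<le> \<epsilon>" "N > 0"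
      using vU n\<epsilon> U by (auto simp: N_def n_def U_def)
    have N2: "N\<^sup>2 \<le> 4 * U\<^sup>2" using power_mono[OF N(2), of 2] N U by (simp add: power_mult_distrib)
    have uU: "(u x y)\<^sup>2 = U\<^sup>2" by (simp add: U_def)
    have U2: "U\<^sup>2 > 0" using U by simp
    have "K * N * \<bar>v x y\<bar> \<le> K * (2 * U) * (h * U)"
      using cBK N U vU h by (intro mult_mono mult_left_mono mult_nonneg_nonneg) auto
    also have "\<dots> = 2 * K * h * U\<^sup>2" by (simp add: power2_eq_square)
    finally have KNv: "K * N * \<bar>v x y\<bar> \<le> 2 * K * h * U\<^sup>2" .
    have Kh: "2 * K * h \<le> B / 4" using h(3) cBK by (simp add: field_simps)
    have "2 * K * h * U\<^sup>2 \<le> B / 4 * U\<^sup>2" using Kh by (intro mult_right_mono) auto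
    moreover have "B / 8 * N\<^sup>2 \<le> B / 8 * (4 * U\<^sup>2)" using N2 cBK by (intro mult_left_mono) auto
    ultimately have lB: "\<bar>l x y - B * U\<^sup>2\<bar> \<le> 3/4 * (B * U\<^sup>2)"
      using l[OF S, folded N_def] KNv unfolding uU by linarith
    have BU: "B * U\<^sup>2 > 0" using cBK U2 by simp
    have "B / 4 * U\<^sup>2 = (B * U\<^sup>2) / 4" by simp
    hence lo: "l x y \<ge> B / 4 * U\<^sup>2" "l x y > 0" "l x y \<le> 2 * (B * U\<^sup>2)" using lB BU by linarith+
    have \<nu>l: "\<bar>\<nu> x y\<bar> \<le> l x y / 4"
    proof -
      have "N ^ 3 = N\<^sup>2 * N" by (simp add: power2_eq_square power3_eq_cube)
      also have "\<dots> \<le> 4 * U\<^sup>2 * (B / (128 * K))" using N2 N \<epsilon> by (intro mult_mono) auto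
      finally have "K * N ^ 3 \<le> K * (4 * U\<^sup>2 * (B / (128 * K)))"
        using cBK by (intro mult_left_mono) auto
      also have "\<dots> = B / 32 * U\<^sup>2" using cBK by (simp add: field_simps)
      also have "\<dots> \<le> l x y / 4" using lo BU by simp
      finally show ?thesis using \<nu>[OF S, folded N_def] by linarith
    qed
    note disc = discriminant_inner[OF \<nu>l lo(2), of "\<mu> x y", folded R_def, folded F_def]
    have reg: "regular x y" unfolding regular_def using disc lo by linarith
    have w: "l x y + R x y > 0" using disc lo by linarith
    have \<mu>U: "\<bar>\<mu> x y - c * v x y\<bar> \<le> 4 * K * U\<^sup>2"
      using \<mu>[OF S, folded N_def] mult_left_mono[OF N2, of K] cBK by linarith
    have part: "1 + F x y \<ge> m" if v: "v x y \<ge> 0"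
    proof (cases "\<mu> x y + \<nu> x y \<ge> 0")
      case True
      hence "F x y \<ge> 0" using w by (simp add: F_def)
      thus ?thesis using m by linarith
    next
      case False
      have "c * v x y \<ge> 0" using v cBK by simp
      hence "\<mu> x y \<ge> - (4 * K * U\<^sup>2)" using \<mu>U by (simp add: abs_le_iff)
      have KU: "K * U\<^sup>2 \<ge> 0" using cBK by simp
      have \<mu>neg: "\<bar>\<mu> x y\<bar> \<le> 4 * K * U\<^sup>2 + l x y / 4"
        using \<open>\<mu> x y \<ge> _\<close> False \<nu>l lo KU by (auto simp: abs_if split: if_splits)
      have "l x y + R x y \<le> 2 * l x y + \<bar>\<mu> x y\<bar>" using disc(3) by linarith
      also have "\<dots> \<le> 9/4 * (2 * (B * U\<^sup>2)) + 4 * K * U\<^sup>2" using \<mu>neg lo by linarith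
      finally have wU: "l x y + R x y \<le> (5 * B + 4 * K) * U\<^sup>2"
        using BU by (simp add: algebra_simps)
      have "m * (l x y + R x y) \<le> (3/4) * l x y"
      proof -
        have "m * (l x y + R x y) \<le> m * ((5 * B + 4 * K) * U\<^sup>2)"
          using wU m by (intro mult_left_mono) auto
        also have "\<dots> = (3/4) * (B / 4 * U\<^sup>2)"
          using cBK by (simp add: m_def field_simps)
        also have "\<dots> \<le> (3/4) * l x y" using lo by simp
        finally show ?thesis .
      qed
      hence "m \<le> (3/4) * l x y / (l x y + R x y)" using w by (simp add: field_simps)
      thus ?thesis using disc(7) by linarith
    qed
    have F'0: "F' x y \<ge> 0"
    proof -
      have K4: "K * N \<le> c / 4" using N \<epsilon> cBK mult_left_mono[of N "c / (4 * K)" K] by simp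
      have \<mu>'p: "\<mu>' x y \<ge> c / 4" using \<mu>'[OF S, folded N_def] K4 by linarith
      have "c * \<bar>v x y\<bar> \<le> c * (h * U)" using vU cBK by (intro mult_left_mono) auto
      hence "\<bar>\<mu> x y\<bar> \<le> c * h * U + 4 * K * U\<^sup>2"
      proof -
        have "\<bar>\<mu> x y\<bar> \<le> \<bar>\<mu> x y - c * v x y\<bar> + \<bar>c * v x y\<bar>" by simp
        moreover have "\<bar>c * v x y\<bar> = c * \<bar>v x y\<bar>" using cBK by (simp add: abs_mult)
        ultimately show ?thesis using \<mu>U \<open>c * \<bar>v x y\<bar> \<le> _\<close> by simp
      qed
      hence "l x y + R x y \<le> c * h * U + (4 * B + 4 * K) * U\<^sup>2"
        using disc(3) lo by (simp add: algebra_simps)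
      also have "(4 * B + 4 * K) * U\<^sup>2 \<le> c * h * U"
      proof -
        have "(4 * B + 4 * K) * U\<^sup>2 \<le> (4 * B + 8 * K) * U * U"
          using cBK U by (simp add: power2_eq_square algebra_simps)
        also have "\<dots> \<le> (4 * B + 8 * K) * (c * h / (4 * B + 8 * K)) * U"
          using cBK N \<epsilon> U by (intro mult_right_mono mult_left_mono) auto
        also have "\<dots> = c * h * U" using cBK by simp
        finally show ?thesis .
      qed
      finally have wU: "l x y + R x y \<le> 2 * (c * h * U)" by (simp add: mult_ac)
      have "B * U / (8 * c * h) = (B / 4 * U\<^sup>2) / (2 * (c * h * U))"
        using U cBK h by (simp add: field_simps power2_eq_square)
      also have "\<dots> \<le> l x y / (l x y + R x y)"
        using lo w wU by (intro frac_le) auto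
      also have "\<dots> \<le> 1 - (F x y)\<^sup>2" by (rule disc(6))
      finally have gap: "1 - (F x y)\<^sup>2 \<ge> B * U / (8 * c * h)" .
      have gap0: "B * U / (8 * c * h) \<ge> 0" using U cBK h by simp
      have "\<mu>' x y * (1 - (F x y)\<^sup>2) \<ge> c / 4 * (B * U / (8 * c * h))"
        using \<mu>'p gap gap0 cBK by (intro mult_mono) auto
      also have "c / 4 * (B * U / (8 * c * h)) = B / (32 * h) * U" using cBK h by (simp add: field_simps)
      finally have t1: "\<mu>' x y * (1 - (F x y)\<^sup>2) \<ge> B / (32 * h) * U" .
      have "12 * K \<le> B / (32 * h)" using h cBK by (simp add: field_simps)
      hence t1: "\<mu>' x y * (1 - (F x y)\<^sup>2) \<ge> 12 * K * U"
        using t1 U mult_right_mono[of "12 * K" "B / (32 * h)" U] by linarith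
      have "\<bar>l' x y\<bar> * \<bar>F x y\<bar> \<le> (K * (2 * U)) * 1"
      proof (rule mult_mono)
        have "K * N \<le> K * (2 * U)" using N cBK by (intro mult_left_mono) auto
        thus "\<bar>l' x y\<bar> \<le> K * (2 * U)" using l'[OF S, folded N_def] by linarith
      qed (use disc(5) cBK U in auto)
      hence t2: "\<bar>2 * l' x y * F x y\<bar> \<le> 4 * K * U" by (simp add: abs_mult)
      have "(F x y)\<^sup>2 \<le> 1" using disc(5) by (simp add: abs_square_le_1)
      moreover have "\<bar>\<nu>' x y\<bar> \<le> K * (4 * U)"
      proof -
        have "U\<^sup>2 \<le> U" using N \<epsilon> U by (simp add: power2_eq_square mult_left_le)
        hence "K * N\<^sup>2 \<le> K * (4 * U)" using N2 cBK by (intro mult_left_mono) auto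
        thus ?thesis using \<nu>'[OF S, folded N_def] by linarith
      qed
      ultimately have "\<bar>\<nu>' x y\<bar> * (1 + (F x y)\<^sup>2) \<le> K * (4 * U) * 2"
        using cBK U by (intro mult_mono) auto
      hence t3: "\<bar>\<nu>' x y * (1 + (F x y)\<^sup>2)\<bar> \<le> 8 * K * U" by (simp add: abs_mult)
      have "\<mu>' x y * (1 - (F x y)\<^sup>2) - 2 * l' x y * F x y + \<nu>' x y * (1 + (F x y)\<^sup>2) \<ge> 0"
        using t1 t2 t3 by linarith
      thus ?thesis using disc(2) by (simp add: F'_def)
    qed
    show ?thesis using reg disc(5) F'0 part by blast
  qed
  thus ?thesis using h(1,2) \<epsilon>(1) m(1)
    by (intro exI[of _ h] conjI exI[of _ \<epsilon>] exI[of _ m]) auto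
qed

lemma regular_continuous:
  assumes T: "T \<subseteq> S" and reg: "\<And>x y. (x, y) \<in> T \<Longrightarrow> regular x y"
  shows "continuous_on T (\<lambda>(x, y). F x y)" "continuous_on T (\<lambda>(x, y). F' x y)"
proof -
  note c = cont[THEN continuous_on_subset, OF T, unfolded case_prod_unfold]
  have R: "continuous_on T (\<lambda>p. R (fst p) (snd p))"
    unfolding R_def by (intro continuous_intros c)
  have pos: "l (fst p) (snd p) + R (fst p) (snd p) \<noteq> 0" "R (fst p) (snd p) \<noteq> 0" if "p \<in> T" for p
    using reg[of "fst p" "snd p"] that by (auto simp: regular_def R_def)
  have F: "continuous_on T (\<lambda>p. F (fst p) (snd p))"
    unfolding F_def by (intro continuous_intros c R) (use pos in auto)
  thus "continuous_on T (\<lambda>(x, y). F x y)" by (simp add: case_prod_unfold)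
  have "continuous_on T (\<lambda>p. F' (fst p) (snd p))"
    unfolding F'_def by (intro continuous_intros c R F) (use pos in auto)
  thus "continuous_on T (\<lambda>(x, y). F' x y)" by (simp add: case_prod_unfold)
qed

lemma regular_deriv:
  assumes "(x, y) \<in> S" "regular x y"
  shows "(F x has_real_derivative F' x y) (at y)"
  using slope_deriv[OF der(1)[OF assms(1)] der(2)[OF assms(1)] der(3)[OF assms(1)]] assms(2)
  by (simp add: regular_def F_def[abs_def] F'_def R_def)

text \<open>The outer estimate is used twice: outside the sector in which the slope increases, and, with
  opening \<open>m / 2\<close>, in the sector which contains all solutions leaving the origin to the right. The
  second bound may depend on \<open>m\<close>, which comes from the inner estimate.\<close>
theorem ex_one_through_leaf:
  "\<exists>\<epsilon>>0. \<epsilon> \<le> \<rho> \<and> (\<exists>m C. one_through_leaf F F' \<epsilon> m C) \<and>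
     (\<forall>x y. \<bar>x\<bar> \<le> \<epsilon> \<longrightarrow> \<bar>y\<bar> \<le> \<epsilon> \<longrightarrow> (x, y) \<noteq> (0, 0) \<longrightarrow> regular x y)"
proof -
  let ?I = "\<lambda>m x y. regular x y \<and> \<bar>F x y\<bar> < 1 \<and> F' x y \<ge> 0 \<and> (v x y \<ge> 0 \<longrightarrow> 1 + F x y \<ge> m)"
  let ?O = "\<lambda>C x y. regular x y \<and> \<bar>F x y - sgn (v x y)\<bar> \<le> C * \<bar>v x y\<bar> \<and> \<bar>F x y - sgn (v x y)\<bar> \<le> 1/2 \<and> \<bar>F' x y\<bar> \<le> C"
  obtain h \<epsilon>1 m1 where h: "h > 0" "h \<le> 1" and \<epsilon>1: "\<epsilon>1 > 0" and m1: "m1 > 0" and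
    inn: "\<And>x y. \<lbrakk>(x, y) \<in> S; u x y \<noteq> 0; n x y \<le> \<epsilon>1; \<bar>v x y\<bar> \<le> h * \<bar>u x y\<bar>\<rbrakk> \<Longrightarrow>
      ?I m1 x y"
    using inner by blast
  define m where "m = min m1 (1/2)"
  have m: "m > 0" "m \<le> m1" "m \<le> 1/2" using m1 by (auto simp: m_def)
  obtain \<epsilon>2 C2 where \<epsilon>2: "\<epsilon>2 > 0" and C2: "C2 > 0" and
    out: "\<And>x y. \<lbrakk>(x, y) \<in> S; v x y \<noteq> 0; n x y \<le> \<epsilon>2; \<bar>v x y\<bar> \<ge> h * \<bar>u x y\<bar>\<rbrakk> \<Longrightarrow>
      ?O C2 x y"
    using outer[OF h(1)] by blast
  obtain \<epsilon>3 C3 where \<epsilon>3: "\<epsilon>3 > 0" and C3: "C3 > 0" and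
    right: "\<And>x y. \<lbrakk>(x, y) \<in> S; v x y \<noteq> 0; n x y \<le> \<epsilon>3; \<bar>v x y\<bar> \<ge> m / 2 * \<bar>u x y\<bar>\<rbrakk> \<Longrightarrow>
      ?O C3 x y"
    using outer[of "m / 2"] m by fastforce
  define \<epsilon> where "\<epsilon> = Min {\<rho>, \<epsilon>1 / 2, \<epsilon>2 / 2, \<epsilon>3 / 2}"
  have \<epsilon>: "\<epsilon> > 0" "\<epsilon> \<le> \<rho>" "2 * \<epsilon> \<le> \<epsilon>1" "2 * \<epsilon> \<le> \<epsilon>2" "2 * \<epsilon> \<le> \<epsilon>3"
    using \<rho> \<epsilon>1 \<epsilon>2 \<epsilon>3 by (auto simp: \<epsilon>_def)
  define P where "P = {- \<epsilon>..\<epsilon>} \<times> {- \<epsilon>..\<epsilon>} - {(0::real, 0::real)}"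
  have inS: "(x, y) \<in> S" "n x y \<le> 2 * \<epsilon>" "u x y \<noteq> 0 \<or> v x y \<noteq> 0" if "(x, y) \<in> P" for x y
  proof -
    have xy: "- \<epsilon> \<le> x" "x \<le> \<epsilon>" "- \<epsilon> \<le> y" "y \<le> \<epsilon>" "x \<noteq> 0 \<or> y \<noteq> 0" using that by (auto simp: P_def)
    show "(x, y) \<in> S" using xy \<epsilon>(2) by (auto simp: S_def)
    have "\<bar>(x - y) / 2\<bar> + \<bar>(x + y) / 2\<bar> \<le> \<bar>x\<bar> + \<bar>y\<bar>"
      using abs_triangle_ineq4[of x y] abs_triangle_ineq[of x y] by simp
    thus "n x y \<le> 2 * \<epsilon>" unfolding n_def u_def v_def using xy by linarith
    show "u x y \<noteq> 0 \<or> v x y \<noteq> 0" using xy by (auto simp: u_def v_def)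
  qed
  have dich: "?I m1 x y \<or>
      (v x y \<noteq> 0 \<and> ?O C2 x y)"
    if P: "(x, y) \<in> P" for x y
  proof (cases "\<bar>v x y\<bar> \<le> h * \<bar>u x y\<bar>")
    case True
    hence "u x y \<noteq> 0" using inS[OF P] by auto
    thus ?thesis using inn[OF inS(1)[OF P]] inS[OF P] \<epsilon> True by auto
  next
    case False
    moreover have "h * \<bar>u x y\<bar> \<ge> 0" using h by simp
    ultimately have "v x y \<noteq> 0" by auto
    thus ?thesis using out[OF inS(1)[OF P]] inS[OF P] \<epsilon> False by auto
  qed
  have reg: "regular x y" if "(x, y) \<in> P" for x y using dich[OF that] by blast
  have PS: "P \<subseteq> S" using inS by auto
  have "one_through_leaf F F' \<epsilon> m (max C2 C3)"
  proof (unfold_locales, fold P_def)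
    show "0 < \<epsilon>" "0 < m" by fact+
    show "continuous_on P (\<lambda>(x, y). F x y)" "continuous_on P (\<lambda>(x, y). F' x y)"
      using regular_continuous[OF PS reg] by auto
    fix x y assume P: "(x, y) \<in> P"
    show "(F x has_real_derivative F' x y) (at y)"
      by (rule regular_deriv[OF inS(1) reg]) (rule P)+
    show "\<bar>F x y\<bar> \<le> 2" using dich[OF P] by (auto simp: sgn_if abs_if split: if_splits)
    show "- max C2 C3 \<le> F' x y" using dich[OF P] C2 by auto
    show "m \<le> 1 + F x y" if "0 \<le> x + y"
    proof -
      have "v x y \<ge> 0" using that by (simp add: v_def)
      thus ?thesis using dich[OF P] m by (auto simp: sgn_if abs_if split: if_splits)
    qed
    show "max C2 C3 * (x + y) \<le> 1 + F x y" if "x + y < 0"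
    proof -
      have v: "v x y < 0" "v x y = (x + y) / 2" using that by (auto simp: v_def)
      have neg: "max C2 C3 * (x + y) \<le> C2 * v x y" and neg0: "max C2 C3 * (x + y) \<le> 0"
      proof -
        have "max C2 C3 * (x + y) \<le> C2 * (x + y)" using that by (intro mult_right_mono_neg) auto
        also have "\<dots> \<le> C2 * v x y" using C2 that v(2) by (intro mult_left_mono) auto
        finally show "max C2 C3 * (x + y) \<le> C2 * v x y" .
        show "max C2 C3 * (x + y) \<le> 0" using that C2 by (intro mult_nonneg_nonpos) auto
      qed
      from dich[OF P] show ?thesis
      proof
        assume "?I m1 x y"
        thus ?thesis using neg0 by linarith
      next
        assume "v x y \<noteq> 0 \<and> ?O C2 x y"
        hence "\<bar>F x y + 1\<bar> \<le> - (C2 * v x y)" using v(1) by simp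
        thus ?thesis using neg by linarith
      qed
    qed
    \<comment> \<open>This sector lies in the region \<open>v \<ge> (m / 2) \<bar>u\<bar>\<close>.\<close>
    show "1/2 \<le> F x y \<and> F' x y \<le> max C2 C3" if "0 < x" "m * x \<le> x + y"
    proof -
      have mx: "m * x > 0" using that m by simp
      hence v: "v x y > 0" using that by (simp add: v_def)
      have "m / 2 * \<bar>u x y\<bar> \<le> v x y"
      proof (cases "u x y \<ge> 0")
        case True
        have "x = u x y + v x y" by (simp add: u_def v_def field_simps)
        hence "m * x = m * u x y + m * v x y" by (metis distrib_left)
        moreover have "x + y = 2 * v x y" by (simp add: v_def)
        ultimately have "m * u x y \<le> 2 * v x y - m * v x y" using that by linarith
        moreover have "m * v x y \<ge> 0" using m v by simp
        ultimately show ?thesis using True by simp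
      next
        case False
        have "m / 2 * \<bar>u x y\<bar> \<le> 1 * \<bar>u x y\<bar>" using m by (intro mult_right_mono) auto
        also have "\<dots> \<le> v x y" using False that by (simp add: u_def v_def)
        finally show ?thesis .
      qed
      hence "\<bar>F x y - 1\<bar> \<le> 1/2" "\<bar>F' x y\<bar> \<le> C3"
        using right[OF inS(1)[OF P]] inS(2)[OF P] \<epsilon> v by auto
      hence "F x y \<ge> 1/2" "F' x y \<le> C3" by linarith+
      thus ?thesis by auto
    qed
    show "F x y \<le> - 1/2" if "x < 0" "y \<le> 0"
    proof -
      have v: "v x y < 0" using that by (simp add: v_def)
      have "\<bar>x - y\<bar> \<le> \<bar>x + y\<bar>" using that by linarith
      hence "\<bar>u x y\<bar> \<le> \<bar>v x y\<bar>" by (simp add: u_def v_def)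
      moreover have "h * \<bar>u x y\<bar> \<le> 1 * \<bar>u x y\<bar>" using h by (intro mult_right_mono) auto
      ultimately have "\<bar>F x y + 1\<bar> \<le> 1/2"
        using out[OF inS(1)[OF P]] inS(2)[OF P] \<epsilon> v by auto
      thus ?thesis by linarith
    qed
  qed
  moreover have "regular x y" if "\<bar>x\<bar> \<le> \<epsilon>" "\<bar>y\<bar> \<le> \<epsilon>" "(x, y) \<noteq> (0, 0)" for x y
    using that by (intro reg) (auto simp: P_def abs_le_iff)
  ultimately show ?thesis using \<epsilon>(1,2) by blast
qed

end

section \<open>Two hyperbolic sectors from a product chart\<close>

lemma mem_unit_square: "(a, b) \<in> {-1..1} \<times> {-1..1} \<longleftrightarrow> \<bar>a\<bar> \<le> 1 \<and> \<bar>b\<bar> \<le> 1" for a b :: real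
  by auto

lemma homeomorphism_mem_image_iff:
  assumes "homeomorphism A B f g" "X \<subseteq> A" "x \<in> A"
  shows "f x \<in> f ` X \<longleftrightarrow> x \<in> X"
proof
  assume "f x \<in> f ` X"
  then obtain z where z: "z \<in> X" "f x = f z" by blast
  hence "g (f x) = g (f z)" by simp
  moreover have "g (f x) = x" "g (f z) = z"
    using z(1) assms(2,3) by (auto intro: homeomorphism_apply1[OF assms(1)])
  ultimately have "x = z" by simp
  thus "x \<in> X" using z by simp
qed auto

text \<open>The levels of \<open>x y\<close> become horizontal segments and the two half-axes become the two halves of
  the bottom side. The denominator stretches all segments to the same length: on the level \<open>k\<close> of
  the saddle sector, \<open>x - y\<close> runs from \<open>- (1 - k)\<close> to \<open>1 - k\<close>.\<close>
definition saddle_to_strip :: "real \<times> real \<Rightarrow> real \<times> real" where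
  "saddle_to_strip = (\<lambda>(x, y). ((x - y) / (1 - x * y), 4 * (x * y)))"

lemma saddle_denominator: "(x, y) \<in> saddle_sector \<Longrightarrow> 1 - x * y > 0"
  by (auto simp: saddle_sector_def)

lemma saddle_sector_compact: "compact saddle_sector"
proof -
  have eq: "saddle_sector = {p. 0 \<le> fst p} \<inter> {p. fst p \<le> 1} \<inter> {p. 0 \<le> snd p} \<inter> {p. snd p \<le> 1}
      \<inter> {p. fst p * snd p \<le> 1/4}"
    by (auto simp: saddle_sector_def)
  have "closed saddle_sector"
    unfolding eq by (intro closed_Int closed_Collect_le continuous_intros)
  moreover have "saddle_sector \<subseteq> {0..1} \<times> {0..1}" by (auto simp: saddle_sector_def)
  ultimately show ?thesis by (metis bounded_subset compact_Icc compact_Times compact_eq_bounded_closed)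
qed

lemma saddle_to_strip_continuous: "continuous_on saddle_sector saddle_to_strip"
  unfolding saddle_to_strip_def case_prod_unfold
  by (intro continuous_intros) (use saddle_denominator in force)

lemma saddle_to_strip_inj: "inj_on saddle_to_strip saddle_sector"
proof (rule inj_onI, clarify)
  fix x y x' y' assume a: "(x, y) \<in> saddle_sector" "(x', y') \<in> saddle_sector"
    and eq: "saddle_to_strip (x, y) = saddle_to_strip (x', y')"
  have xy: "x * y = x' * y'" using eq by (simp add: saddle_to_strip_def)
  have d: "x - y = x' - y'"
    using eq saddle_denominator[OF a(1)] by (simp add: saddle_to_strip_def xy)
  have "(x + y)\<^sup>2 = (x' + y')\<^sup>2"
    using xy d by algebra
  moreover have "x + y \<ge> 0" "x' + y' \<ge> 0" using a by (auto simp: saddle_sector_def)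
  ultimately have "x + y = x' + y'" by (simp add: power2_eq_iff_nonneg)
  thus "x = x' \<and> y = y'" using d by auto
qed

lemma saddle_to_strip_level:
  assumes k: "0 \<le> k" "k \<le> 1/4"
  shows "saddle_to_strip ` {(x, y) \<in> saddle_sector. x * y = k} = {-1..1} \<times> {4 * k}"
proof (intro equalityI subsetI)
  fix p assume "p \<in> saddle_to_strip ` {(x, y) \<in> saddle_sector. x * y = k}"
  then obtain x y where xy: "(x, y) \<in> saddle_sector" "x * y = k" "p = ((x - y) / (1 - k), 4 * k)"
    by (auto simp: saddle_to_strip_def)
  have "0 \<le> (1 - x) * (1 + y)" "0 \<le> (1 - y) * (1 + x)"
    using xy(1) by (auto simp: saddle_sector_def intro!: mult_nonneg_nonneg)
  hence "x - y \<le> 1 - k" "- (1 - k) \<le> x - y" using xy(2) by (simp_all add: algebra_simps)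
  hence "(x - y) / (1 - k) \<in> {-1..1}" using k by (simp add: pos_divide_le_eq pos_le_divide_eq)
  thus "p \<in> {-1..1} \<times> {4 * k}" using xy(3) by simp
next
  fix p :: "real \<times> real" assume "p \<in> {-1..1} \<times> {4 * k}"
  then obtain e where e: "p = (e, 4 * k)" "-1 \<le> e" "e \<le> 1" by auto
  define d where "d = e * (1 - k)"
  have k1: "1 - k > 0" using k by simp
  have d: "- (1 - k) \<le> d" "d \<le> 1 - k"
    using e mult_right_mono[of e 1 "1 - k"] mult_right_mono[of "-1" e "1 - k"] k1 by (auto simp: d_def)
  \<comment> \<open>The sum \<open>x + y\<close>, if \<open>x - y = d\<close> and \<open>x y = k\<close>.\<close>
  define q where "q = sqrt (d\<^sup>2 + 4 * k)"
  have q2: "q\<^sup>2 = d\<^sup>2 + 4 * k" using k by (simp add: q_def)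
  have q0: "q \<ge> \<bar>d\<bar>" unfolding q_def using k by (intro real_le_rsqrt) simp
  have q1: "q \<le> 2 - \<bar>d\<bar>" unfolding q_def
  proof (rule real_le_lsqrt)
    have "(2 - \<bar>d\<bar>)\<^sup>2 = 4 - 4 * \<bar>d\<bar> + d\<^sup>2" by (simp add: power2_diff)
    moreover have "\<bar>d\<bar> \<le> 1 - k" using d by auto
    ultimately show "d\<^sup>2 + 4 * k \<le> (2 - \<bar>d\<bar>)\<^sup>2" by linarith
  qed (use d k in auto)
  define x y where "x = (q + d) / 2" and "y = (q - d) / 2"
  have xy: "x * y = k" using q2 by (simp add: x_def y_def field_simps power2_eq_square)
  have "0 \<le> x" "x \<le> 1" "0 \<le> y" "y \<le> 1" using q0 q1 by (auto simp: x_def y_def)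
  hence S: "(x, y) \<in> saddle_sector" using xy k by (simp add: saddle_sector_def)
  have "x - y = d" by (simp add: x_def y_def field_simps)
  hence "saddle_to_strip (x, y) = p" using xy k1 by (simp add: saddle_to_strip_def e d_def)
  thus "p \<in> saddle_to_strip ` {(x, y) \<in> saddle_sector. x * y = k}"
    using S xy by (intro image_eqI[of _ _ "(x, y)"]) auto
qed

lemma saddle_to_strip_image: "saddle_to_strip ` saddle_sector = {-1..1} \<times> {0..1}"
proof -
  have "saddle_sector = (\<Union>k\<in>{0..1/4}. {(x, y) \<in> saddle_sector. x * y = k})"
    by (auto simp: saddle_sector_def)
  hence "saddle_to_strip ` saddle_sector = (\<Union>k\<in>{0..1/4}. {-1..1} \<times> {4 * k})"
    using saddle_to_strip_level by (metis (no_types, lifting) SUP_cong atLeastAtMost_iff image_UN)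
  also have "\<dots> = {-1..1} \<times> {0..1}"
  proof -
    have "(x, y) \<in> (\<Union>k\<in>{0..1/4}. {-1..1} \<times> {4 * k})" if "x \<in> {-1..1}" "y \<in> {0..1}" for x y :: real
      using that by (intro UN_I[of "y / 4"]) auto
    thus ?thesis by auto
  qed
  finally show ?thesis .
qed

lemma saddle_to_strip_axes:
  "saddle_to_strip ` {(x, y) \<in> saddle_sector. y = 0} = {0..1} \<times> {0}"
  "saddle_to_strip ` {(x, y) \<in> saddle_sector. x = 0} = {-1..0} \<times> {0}"
proof -
  show "saddle_to_strip ` {(x, y) \<in> saddle_sector. y = 0} = {0..1} \<times> {0}"
  proof (intro equalityI subsetI)
    fix p :: "real \<times> real" assume "p \<in> {0..1} \<times> {0}"
    thus "p \<in> saddle_to_strip ` {(x, y) \<in> saddle_sector. y = 0}"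
      by (intro image_eqI[of _ _ "(fst p, 0)"]) (auto simp: saddle_to_strip_def saddle_sector_def)
  qed (auto simp: saddle_to_strip_def saddle_sector_def)
  show "saddle_to_strip ` {(x, y) \<in> saddle_sector. x = 0} = {-1..0} \<times> {0}"
  proof (intro equalityI subsetI)
    fix p :: "real \<times> real" assume "p \<in> {-1..0} \<times> {0}"
    thus "p \<in> saddle_to_strip ` {(x, y) \<in> saddle_sector. x = 0}"
      by (intro image_eqI[of _ _ "(0, - fst p)"]) (auto simp: saddle_to_strip_def saddle_sector_def)
  qed (auto simp: saddle_to_strip_def saddle_sector_def)
qed

text \<open>A square foliated by horizontal segments, only the middle one of which contains the singular
  point. All half-leaves tending to the singular point are halves of this segment, as germs.\<close>
locale product_chart =
  fixes \<A> :: "'m::t2_space chart set" and \<alpha> :: "'m \<Rightarrow> real^3" and i :: principal and p :: 'm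
    and \<Theta> :: "real \<times> real \<Rightarrow> 'm" and \<Theta>' :: "'m \<Rightarrow> real \<times> real" and D s s' :: "'m set"
  assumes homeo: "homeomorphism ({-1..1} \<times> {-1..1}) D \<Theta> \<Theta>'"
    and p: "\<Theta> (0, 0) = p" "p \<in> interior D"
    and s: "s = \<Theta> ` ({0..1} \<times> {0})" and s': "s' = \<Theta> ` ({-1..0} \<times> {0})"
    and leaf: "\<And>c. \<lbrakk>c \<in> {-1..1}; c \<noteq> 0\<rbrakk> \<Longrightarrow> leaf_arc \<A> \<alpha> i (\<Theta> ` ({-1..1} \<times> {c}))"
    and half: "half_leaf \<A> \<alpha> i p s" "half_leaf \<A> \<alpha> i p s'"
    and germ: "\<And>l. half_leaf \<A> \<alpha> i p l \<Longrightarrow> same_germ p l s \<or> same_germ p l s'"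
begin

lemma \<Theta>_mem: "\<lbrakk>X \<subseteq> {-1..1} \<times> {-1..1}; z \<in> {-1..1} \<times> {-1..1}\<rbrakk> \<Longrightarrow> \<Theta> z \<in> \<Theta> ` X \<longleftrightarrow> z \<in> X"
  using homeomorphism_mem_image_iff[OF homeo] by blast

lemma \<Theta>_cont: "continuous_on ({-1..1} \<times> {-1..1}) \<Theta>"
  using homeo by (simp add: homeomorphism_def)

lemma \<Theta>_inj: "inj_on \<Theta> ({-1..1} \<times> {-1..1})"
  by (rule inj_on_inverseI[of _ \<Theta>']) (rule homeomorphism_apply1[OF homeo])

lemma axis_tendsto:
  assumes "\<bar>e\<bar> = 1"
  shows "(\<lambda>n. \<Theta> (e / real (Suc n), 0)) \<longlonglongrightarrow> p"
proof -
  have "(\<lambda>n. (e / real (Suc n), 0::real)) \<longlonglongrightarrow> (0, 0)"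
    by (intro tendsto_Pair tendsto_const LIMSEQ_Suc[OF lim_const_over_n])
  moreover have "\<bar>e / real (Suc n)\<bar> \<le> 1" for n using assms by (simp add: abs_divide)
  hence "(e / real (Suc n), 0) \<in> {-1..1} \<times> {-1..1::real}" for n
    unfolding mem_unit_square by simp
  ultimately show ?thesis
    unfolding p(1)[symmetric]
    by (intro continuous_on_tendsto_compose[OF \<Theta>_cont] always_eventually allI) auto
qed

lemma eventually_axis:
  assumes "\<forall>\<^sub>F q in nhds p. P q" "\<bar>e\<bar> = 1"
  shows "\<exists>x. x \<noteq> 0 \<and> \<bar>x\<bar> \<le> 1 \<and> sgn x = sgn e \<and> P (\<Theta> (x, 0))"
proof -
  have "\<forall>\<^sub>F n in sequentially. P (\<Theta> (e / real (Suc n), 0))"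
    by (rule eventually_compose_filterlim[OF assms(1) axis_tendsto[OF assms(2)]])
  then obtain n where "P (\<Theta> (e / real (Suc n), 0))" by (auto simp: eventually_sequentially)
  thus ?thesis using assms(2)
    by (intro exI[of _ "e / real (Suc n)"]) (auto simp: abs_divide sgn_if zero_less_divide_iff)
qed

lemma separatrices_distinct: "\<not> same_germ p s s'"
proof
  assume "same_germ p s s'"
  then obtain x where x: "x \<noteq> 0" "\<bar>x\<bar> \<le> 1" "sgn x = sgn 1" "\<Theta> (x, 0) \<in> s \<longleftrightarrow> \<Theta> (x, 0) \<in> s'"
    using eventually_axis[of "\<lambda>x. x \<in> s \<longleftrightarrow> x \<in> s'" 1] by (auto simp: same_germ_def)
  hence "x > 0" by (auto simp: sgn_if split: if_splits)
  moreover have "\<Theta> (x, 0) \<in> s \<longleftrightarrow> (x, 0) \<in> {0..1} \<times> {0::real}" unfolding s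
    using x by (intro \<Theta>_mem) auto
  moreover have "\<Theta> (x, 0) \<in> s' \<longleftrightarrow> (x, 0) \<in> {-1..0} \<times> {0::real}" unfolding s'
    using x by (intro \<Theta>_mem) auto
  ultimately show False using x by auto
qed

text \<open>Points of the bottom side are limits of points beyond it. This excludes half-leaves from the
  interior of the sectors.\<close>
lemma axis_not_interior:
  assumes \<sigma>: "\<bar>\<sigma>\<bar> = 1" and x: "\<bar>x\<bar> \<le> 1"
  shows "\<Theta> (x, 0) \<notin> interior (\<Theta> ` ({-1..1} \<times> {y. 0 \<le> \<sigma> * y \<and> \<sigma> * y \<le> 1}))" (is "_ \<notin> interior ?S")
proof
  assume int: "\<Theta> (x, 0) \<in> interior ?S"
  have "(\<lambda>n. (x, - \<sigma> / real (Suc n))) \<longlonglongrightarrow> (x, 0)"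
    by (intro tendsto_Pair tendsto_const LIMSEQ_Suc[OF lim_const_over_n])
  moreover have "\<bar>- \<sigma> / real (Suc n)\<bar> \<le> 1" for n using \<sigma> by (simp add: abs_divide)
  hence b: "(x, - \<sigma> / real (Suc n)) \<in> {-1..1} \<times> {-1..1}" for n
    unfolding mem_unit_square using x by blast
  ultimately have "(\<lambda>n. \<Theta> (x, - \<sigma> / real (Suc n))) \<longlonglongrightarrow> \<Theta> (x, 0)"
    using x by (intro continuous_on_tendsto_compose[OF \<Theta>_cont] always_eventually allI) auto
  hence "\<forall>\<^sub>F n in sequentially. \<Theta> (x, - \<sigma> / real (Suc n)) \<in> interior ?S"
    using int by (intro topological_tendstoD) auto
  then obtain n where "\<Theta> (x, - \<sigma> / real (Suc n)) \<in> interior ?S" by (auto simp: eventually_sequentially)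
  hence "\<Theta> (x, - \<sigma> / real (Suc n)) \<in> ?S" using interior_subset by blast
  hence "(x, - \<sigma> / real (Suc n)) \<in> {-1..1} \<times> {y. 0 \<le> \<sigma> * y \<and> \<sigma> * y \<le> 1}"
    using \<sigma> b[of n] by (subst (asm) \<Theta>_mem) (auto simp: abs_if split: if_splits)
  moreover have "\<sigma> * \<sigma> = 1" using \<sigma> by (auto simp: abs_if split: if_splits)
  ultimately show False by (auto simp: field_simps)
qed

text \<open>The sign \<open>\<sigma>\<close> selects the upper or the lower half of the square.\<close>
lemma sector:
  assumes \<sigma>: "\<bar>\<sigma>\<bar> = 1"
  shows "hyperbolic_sector \<A> \<alpha> i p (\<Theta> ` ({-1..1} \<times> {y. 0 \<le> \<sigma> * y \<and> \<sigma> * y \<le> 1})) s s'"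
    (is "hyperbolic_sector _ _ _ _ ?S _ _")
proof -
  define h where "h z = (fst (saddle_to_strip z), \<sigma> * snd (saddle_to_strip z))" for z
  have \<sigma>2: "\<sigma> * (\<sigma> * y) = y" for y using \<sigma> by (auto simp: abs_if split: if_splits)
  have h_img: "h ` X = (\<lambda>z. (fst z, \<sigma> * snd z)) ` (saddle_to_strip ` X)" for X
    by (auto simp: h_def image_image)
  have h_strip: "h ` X = U \<times> ((*) \<sigma> ` V)" if "saddle_to_strip ` X = U \<times> V" for X U V
    unfolding h_img that by (auto simp: image_iff)
  have h_all: "h ` saddle_sector = {-1..1} \<times> {y. 0 \<le> \<sigma> * y \<and> \<sigma> * y \<le> 1}"
  proof -
    have "(*) \<sigma> ` {0..1} = {y. 0 \<le> \<sigma> * y \<and> \<sigma> * y \<le> 1}"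
    proof (intro equalityI subsetI)
      fix y assume "y \<in> {y. 0 \<le> \<sigma> * y \<and> \<sigma> * y \<le> 1}"
      thus "y \<in> (*) \<sigma> ` {0..1}" by (intro image_eqI[of _ _ "\<sigma> * y"]) (simp_all only: \<sigma>2, simp)
    next
      fix y assume "y \<in> (*) \<sigma> ` {0..1}"
      then obtain z where "y = \<sigma> * z" "z \<in> {0..1}" by blast
      thus "y \<in> {y. 0 \<le> \<sigma> * y \<and> \<sigma> * y \<le> 1}"
        by (simp only: mem_Collect_eq \<sigma>2 atLeastAtMost_iff simp_thms)
    qed
    thus ?thesis using h_strip[OF saddle_to_strip_image] by simp
  qed
  have sub: "{-1..1} \<times> {y. 0 \<le> \<sigma> * y \<and> \<sigma> * y \<le> 1} \<subseteq> {-1..1} \<times> {-1..1}"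
    using \<sigma> by (auto simp: abs_if split: if_splits)
  have h_cont: "continuous_on saddle_sector h"
    unfolding h_def by (intro continuous_intros saddle_to_strip_continuous)
  have h_inj: "inj_on h saddle_sector"
  proof (rule inj_onI)
    fix a b assume ab: "a \<in> saddle_sector" "b \<in> saddle_sector" "h a = h b"
    have "\<sigma> \<noteq> 0" using \<sigma> by auto
    hence "saddle_to_strip a = saddle_to_strip b" using ab(3) by (simp add: h_def prod_eq_iff)
    thus "a = b" by (rule inj_onD[OF saddle_to_strip_inj _ ab(1,2)])
  qed
  have inj: "inj_on (\<Theta> \<circ> h) saddle_sector"
    unfolding comp_inj_on_iff[OF h_inj, symmetric] h_all by (rule inj_on_subset[OF \<Theta>_inj sub])
  have "continuous_on saddle_sector (\<Theta> \<circ> h)"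
    by (intro continuous_on_compose h_cont continuous_on_subset[OF \<Theta>_cont]) (use h_all sub in auto)
  moreover have "(\<Theta> \<circ> h) ` saddle_sector = ?S" unfolding image_comp[symmetric] h_all ..
  ultimately obtain g where g: "homeomorphism saddle_sector ?S (\<Theta> \<circ> h) g"
    using homeomorphism_compact[OF saddle_sector_compact _ _ inj] by blast
  have leaves: "leaf_arc \<A> \<alpha> i ((\<Theta> \<circ> h) ` {(x, y) \<in> saddle_sector. x * y = c})" if c: "0 < c" "c \<le> 1/4" for c
  proof -
    have "h ` {(x, y) \<in> saddle_sector. x * y = c} = {-1..1} \<times> {\<sigma> * (4 * c)}"
      using h_strip[OF saddle_to_strip_level, of c] c by simp
    moreover have "\<sigma> * (4 * c) \<in> {-1..1}" "\<sigma> * (4 * c) \<noteq> 0"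
      using c \<sigma> by (auto simp: abs_if split: if_splits)
    ultimately show ?thesis using leaf by (simp only: image_comp[symmetric])
  qed
  have nolow: "\<not> l - {p} \<subseteq> interior ?S" if hl: "half_leaf \<A> \<alpha> i p l" for l
  proof
    assume sub: "l - {p} \<subseteq> interior ?S"
    obtain e :: real and t where e: "\<bar>e\<bar> = 1" "same_germ p l t" "t = s \<and> e = 1 \<or> t = s' \<and> e = - 1"
    proof -
      from germ[OF hl] show thesis
      proof
        assume "same_germ p l s" thus thesis by (intro that[of 1 s]) auto
      next
        assume "same_germ p l s'" thus thesis by (intro that[of "- 1" s']) auto
      qed
    qed
    obtain x where x: "x \<noteq> 0" "\<bar>x\<bar> \<le> 1" "sgn x = sgn e" "\<Theta> (x, 0) \<in> l \<longleftrightarrow> \<Theta> (x, 0) \<in> t"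
      using eventually_axis[of "\<lambda>x. x \<in> l \<longleftrightarrow> x \<in> t" e] e by (auto simp: same_germ_def)
    have "\<Theta> (x, 0) \<in> t"
      using e(3) x(1-3) unfolding s s' by (auto simp: sgn_if split: if_splits)
    moreover have "\<Theta> (x, 0) \<noteq> p"
      using \<Theta>_mem[of "{(0, 0)}" "(x, 0)"] x p by (auto simp: abs_le_iff)
    ultimately show False using x(4) sub axis_not_interior[OF \<sigma> x(2)] by auto
  qed
  have "(0, 0) \<in> saddle_sector" by (simp add: saddle_sector_def)
  moreover have "(\<Theta> \<circ> h) (0, 0) = p" using p by (simp add: h_def saddle_to_strip_def)
  moreover have "s = (\<Theta> \<circ> h) ` {(x, y) \<in> saddle_sector. y = 0}"
    unfolding s image_comp[symmetric] using h_strip[OF saddle_to_strip_axes(1)] by simp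
  moreover have "s' = (\<Theta> \<circ> h) ` {(x, y) \<in> saddle_sector. x = 0}"
    unfolding s' image_comp[symmetric] using h_strip[OF saddle_to_strip_axes(2)] by simp
  ultimately show ?thesis unfolding hyperbolic_sector_def using half nolow leaves g by blast
qed

theorem two_separatrices: "exactly_two_separatrices \<A> \<alpha> i p s s'"
proof -
  have refl: "same_germ p l l" for l by (simp add: same_germ_def)
  have sec: "hyperbolic_sector \<A> \<alpha> i p (\<Theta> ` ({-1..1} \<times> {y. 0 \<le> 1 * y \<and> 1 * y \<le> 1})) s s'"
    by (rule sector) simp
  show ?thesis
    unfolding exactly_two_separatrices_def umbilic_separatrix_def
  proof (intro conjI allI impI)
    show "\<exists>S l l'. hyperbolic_sector \<A> \<alpha> i p S l l' \<and> (same_germ p s l \<or> same_germ p s l')"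
      "\<exists>S l l'. hyperbolic_sector \<A> \<alpha> i p S l l' \<and> (same_germ p s' l \<or> same_germ p s' l')"
      using sec refl by blast+
  qed (use half separatrices_distinct germ in blast)+
qed

text \<open>The vertical coordinate has a constant sign on connected sets that avoid the two
  separatrices, so the open halves of the square are the components.\<close>
theorem two_sectors: "divides_into_two_hyperbolic_sectors \<A> \<alpha> i p s s'"
proof -
  define C C' where "C = \<Theta> ` ({-1..1} \<times> {0<..1})" and "C' = \<Theta> ` ({-1..1} \<times> {-1..<0})"
  have D: "D = \<Theta> ` ({-1..1} \<times> {-1..1})" using homeo by (simp add: homeomorphism_def)
  have ss: "s \<union> s' = \<Theta> ` ({-1..1} \<times> {0})" unfolding s s' image_Un[symmetric] by (rule arg_cong[of _ _ "image \<Theta>"]) auto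
  have mem: "\<Theta> z \<in> \<Theta> ` X \<longleftrightarrow> z \<in> X" if "X \<subseteq> {-1..1} \<times> {-1..1}" "z \<in> {-1..1} \<times> {-1..1}" for X z
    using \<Theta>_mem that by blast
  have diff: "D - (s \<union> s') = C \<union> C'"
  proof -
    have "D - (s \<union> s') = \<Theta> ` ({-1..1} \<times> {-1..1} - {-1..1} \<times> {0})"
      unfolding D ss by (rule inj_on_image_set_diff[symmetric, OF \<Theta>_inj]) auto
    also have "{-1..1} \<times> {-1..1} - {-1..1} \<times> {0} = {-1..1} \<times> {0<..1} \<union> {-1..1} \<times> {-1..<(0::real)}"
      by (auto simp: less_le)
    finally show ?thesis by (simp add: C_def C'_def image_Un)
  qed
  have conn: "connected C" "connected C'"
    unfolding C_def C'_def
    by (intro connected_continuous_image continuous_on_subset[OF \<Theta>_cont] convex_connected convex_Times; force)+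
  have lab: "continuous_on D (\<lambda>q. snd (\<Theta>' q))"
    using homeo by (intro continuous_intros) (simp add: homeomorphism_def)
  have inv: "\<Theta>' (\<Theta> z) = z" if "z \<in> {-1..1} \<times> {-1..1}" for z
    by (rule homeomorphism_apply1[OF homeo that])
  have labC: "snd (\<Theta>' q) > 0" if "q \<in> C" for q using that inv by (force simp: C_def)
  have labC': "snd (\<Theta>' q) < 0" if "q \<in> C'" for q using that inv by (force simp: C'_def)
  have one_sided: "K \<subseteq> C \<or> K \<subseteq> C'" if K: "connected K" "K \<subseteq> C \<union> C'" for K
  proof (rule ccontr)
    assume "\<not> ?thesis"
    then obtain q q' where q: "q \<in> K" "q \<in> C" "q' \<in> K" "q' \<in> C'" using K(2) by blast
    have "continuous_on K (\<lambda>q. snd (\<Theta>' q))" using K(2) diff by (intro continuous_on_subset[OF lab]) auto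
    hence "connected ((\<lambda>q. snd (\<Theta>' q)) ` K)" using K(1) by (intro connected_continuous_image)
    hence "0 \<in> (\<lambda>q. snd (\<Theta>' q)) ` K"
      using connectedD_interval[of _ "snd (\<Theta>' q')" "snd (\<Theta>' q)" 0] q labC[of q] labC'[of q'] by force
    thus False using K(2) labC labC' by fastforce
  qed
  have ne: "C \<noteq> {}" "C' \<noteq> {}" by (auto simp: C_def C'_def)
  have disj: "C \<inter> C' = {}" using labC labC' by force
  have "components (C \<union> C') = {C, C'}"
  proof (intro equalityI subsetI)
    fix K assume "K \<in> components (C \<union> C')"
    note K = in_components_nonempty[OF this] in_components_connected[OF this]
      in_components_subset[OF this] components_maximal[OF this]
    have "C \<subseteq> K" if "K \<subseteq> C" using K(4)[OF conn(1)] that K(1) by blast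
    moreover have "C' \<subseteq> K" if "K \<subseteq> C'" using K(4)[OF conn(2)] that K(1) by blast
    ultimately show "K \<in> {C, C'}" using one_sided[OF K(2,3)] by blast
  next
    fix K assume K: "K \<in> {C, C'}"
    have "L = K" if "connected L" "L \<subseteq> C \<union> C'" "K \<subseteq> L" for L
      using one_sided[OF that(1,2)] that(3) K ne disj by blast
    thus "K \<in> components (C \<union> C')" unfolding in_components_maximal using K ne conn by blast
  qed
  hence comps: "components (D - (s \<union> s')) = {C, C'}" by (simp add: diff)
  have up: "C \<union> s \<union> s' = \<Theta> ` ({-1..1} \<times> {y. 0 \<le> 1 * y \<and> 1 * y \<le> 1})"
    unfolding Un_assoc ss C_def image_Un[symmetric] by (rule arg_cong[of _ _ "image \<Theta>"]) (auto simp: less_le)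
  have down: "C' \<union> s \<union> s' = \<Theta> ` ({-1..1} \<times> {y. 0 \<le> -1 * y \<and> -1 * y \<le> 1})"
    unfolding Un_assoc ss C'_def image_Un[symmetric] by (rule arg_cong[of _ _ "image \<Theta>"]) (auto simp: less_le)
  have "({-1..1::real} \<times> {-1..1::real}) homeomorphic cball (0::complex) 1"
  proof -
    have "interior ({-1..1::real} \<times> {-1..1::real}) \<noteq> {}"
      by (simp add: interior_Times)
    hence "aff_dim ({-1..1::real} \<times> {-1..1::real}) = 2"
      by (simp add: aff_dim_nonempty_interior)
    moreover have "aff_dim (cball (0::complex) 1) = 2" by (simp add: aff_dim_cball)
    ultimately show ?thesis
      by (intro homeomorphic_convex_compact_sets convex_Times compact_Times) auto
  qed
  moreover have "({-1..1::real} \<times> {-1..1::real}) homeomorphic D"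
    using homeo unfolding homeomorphic_def by blast
  ultimately have "D homeomorphic cball (0::complex) 1"
    by (metis homeomorphic_sym homeomorphic_trans)
  moreover have "C \<noteq> C'" using ne disj by auto
  moreover have "hyperbolic_sector \<A> \<alpha> i p (C \<union> s \<union> s') s s'" unfolding up by (rule sector) simp
  moreover have "hyperbolic_sector \<A> \<alpha> i p (C' \<union> s \<union> s') s s'" unfolding down by (rule sector) simp
  ultimately show ?thesis
    unfolding divides_into_two_hyperbolic_sectors_def using p(2) comps by blast
qed

end

section \<open>Regular curves as graphs of solutions\<close>

text \<open>A regular curve tangent to a field of finite slopes moves strictly monotonically in the
  direction of \<open>X\<close>, by Rolle's theorem. It can be parametrised by \<open>X\<close>, and the new parametrisation
  solves the differential equation.\<close>
lemma regular_curve_is_graph: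
  fixes X Y a :: "real \<Rightarrow> real" and G :: "real \<Rightarrow> real \<Rightarrow> real"
  assumes t1: "t1 > 0"
    and cont: "continuous_on {0..t1} X" "continuous_on {0..t1} Y"
    and start: "X 0 = 0" "Y 0 = 0"
    and der: "\<And>t. \<lbrakk>0 < t; t < t1\<rbrakk> \<Longrightarrow> (X has_real_derivative a t) (at t)"
      "\<And>t. \<lbrakk>0 < t; t < t1\<rbrakk> \<Longrightarrow> (Y has_real_derivative G (X t) (Y t) * a t) (at t)"
    and reg: "\<And>t. \<lbrakk>0 < t; t < t1\<rbrakk> \<Longrightarrow> a t \<noteq> 0"
    and bound: "\<And>t. \<lbrakk>0 < t; t < t1\<rbrakk> \<Longrightarrow> \<bar>G (X t) (Y t)\<bar> \<le> 2"
    and nonneg: "X t1 \<ge> 0"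
  shows "\<exists>\<phi>. (\<forall>x\<in>{0<..<X t1}. (\<phi> has_real_derivative G x (\<phi> x)) (at x) \<and> \<bar>\<phi> x\<bar> \<le> 2 * x) \<and>
    (\<forall>t\<in>{0..t1}. \<phi> (X t) = Y t) \<and> strict_mono_on {0..t1} X \<and> X ` {0..t1} = {0..X t1}"
proof -
  have neq: "X s \<noteq> X t" if st: "0 \<le> s" "s < t" "t \<le> t1" for s t
  proof
    assume eq: "X s = X t"
    have c: "continuous_on {s..t} X" using cont(1) by (rule continuous_on_subset) (use st in auto)
    have "\<exists>z. s < z \<and> z < t \<and> DERIV X z :> 0"
    proof (rule Rolle[OF st(2) eq c])
      fix x assume "s < x" "x < t"
      hence "(X has_real_derivative a x) (at x)" using der(1) st by auto
      thus "X differentiable (at x)" unfolding real_differentiable_def by blast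
    qed
    then obtain z where z: "s < z" "z < t" "DERIV X z :> 0" by blast
    have "(X has_real_derivative a z) (at z)" "a z \<noteq> 0" using der(1) reg z st by auto
    thus False using z(3) DERIV_unique by blast
  qed
  have pos: "X t1 > 0" using neq[of 0 t1] t1 start nonneg by auto
  have inj: "inj_on X {0..t1}"
    by (rule linorder_inj_onI) (use neq in auto)
  have betw: "X s < X x \<and> X x < X t" if "0 \<le> s" "s < x" "x < t" "t \<le> t1" "X s < X t" for s x t
  proof -
    have "continuous_on {s..t} X" "inj_on X {s..t}"
      using that cont(1) inj by (auto intro: continuous_on_subset inj_on_subset)
    from continuous_inj_imp_mono[OF that(2,3) this] that(5) show ?thesis by auto
  qed
  have less1: "X s < X t1" if "0 \<le> s" "s < t1" for s
    using betw[of 0 s t1] that pos start by (cases "s = 0") auto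
  have mono: "strict_mono_on {0..t1} X"
  proof (rule strict_mono_onI)
    fix s t assume "s \<in> {0..t1}" "t \<in> {0..t1}" "s < t"
    thus "X s < X t" using less1[of s] betw[of s t t1] by (cases "t = t1") auto
  qed
  have le: "X s \<le> X t" if "0 \<le> s" "s \<le> t" "t \<le> t1" for s t
    using strict_mono_onD[OF mono, of s t] that by (cases "s = t") auto
  have img: "X ` {0..t1} = {0..X t1}"
  proof (intro equalityI subsetI)
    fix x assume "x \<in> X ` {0..t1}" thus "x \<in> {0..X t1}" using le[of 0] le[of _ t1] start by force
  next
    fix x assume x: "x \<in> {0..X t1}"
    have "\<exists>t\<ge>0. t \<le> t1 \<and> X t = x" by (rule IVT') (use x start t1 cont in auto)
    thus "x \<in> X ` {0..t1}" by force
  qed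
  obtain g where g: "homeomorphism {0..t1} {0..X t1} X g"
    using homeomorphism_compact[OF _ cont(1) img inj] by auto
  have gX: "g (X t) = t" if "t \<in> {0..t1}" for t using g that by (simp add: homeomorphism_def)
  have Xg: "X (g x) = x" "g x \<in> {0..t1}" if "x \<in> {0..X t1}" for x
    using g that by (auto simp: homeomorphism_def)
  have cg: "continuous_on {0..X t1} g" using g by (simp add: homeomorphism_def)
  define \<phi> where "\<phi> x = Y (g x)" for x
  have g_int: "0 < g x" "g x < t1" if "x \<in> {0<..<X t1}" for x
  proof -
    have x: "x \<in> {0..X t1}" using that by auto
    have "g x \<noteq> 0" "g x \<noteq> t1" using Xg(1)[OF x] that start by auto
    thus "0 < g x" "g x < t1" using Xg(2)[OF x] by auto
  qed
  have d\<phi>: "(\<phi> has_real_derivative G x (\<phi> x)) (at x)" if x: "x \<in> {0<..<X t1}" for x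
  proof -
    have "isCont g x"
      using continuous_on_interior[OF cg, of x] x by simp
    hence "(g has_real_derivative inverse (a (g x))) (at x)"
      by (intro DERIV_inverse_function[where f = X and a = 0 and b = "X t1"])
         (use der(1) reg g_int[OF x] x Xg(1) in auto)
    moreover have "(Y has_real_derivative G (X (g x)) (Y (g x)) * a (g x)) (at (g x))"
      using der(2) g_int[OF x] by auto
    ultimately have "((\<lambda>x. Y (g x)) has_real_derivative G (X (g x)) (Y (g x)) * a (g x) * inverse (a (g x))) (at x)"
      by (rule DERIV_chain2[rotated])
    moreover have "a (g x) \<noteq> 0" using reg g_int[OF x] by simp
    ultimately show ?thesis using Xg(1)[of x] x by (simp add: \<phi>_def[abs_def] mult.assoc)
  qed
  have c\<phi>: "continuous_on {0..X t1} \<phi>"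
    unfolding \<phi>_def by (intro continuous_on_compose2[OF cont(2) cg]) (use Xg in auto)
  have b\<phi>: "\<bar>\<phi> x\<bar> \<le> 2 * x" if x: "x \<in> {0<..<X t1}" for x
  proof -
    have "g 0 = 0" using gX[of 0] start t1 by auto
    hence \<phi>0: "\<phi> 0 = 0" by (simp add: \<phi>_def start)
    have "\<exists>l z. 0 < z \<and> z < x \<and> DERIV \<phi> z :> l \<and> \<phi> x - \<phi> 0 = (x - 0) * l"
    proof (rule MVT)
      show "continuous_on {0..x} \<phi>" by (rule continuous_on_subset[OF c\<phi>]) (use x in auto)
      fix z assume "0 < z" "z < x"
      hence "(\<phi> has_real_derivative G z (\<phi> z)) (at z)" using d\<phi> x by auto
      thus "\<phi> differentiable (at z)" unfolding real_differentiable_def by blast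
    qed (use x in auto)
    then obtain l z where z: "0 < z" "z < x" "DERIV \<phi> z :> l" "\<phi> x = x * l" using \<phi>0 by auto
    have zi: "z \<in> {0<..<X t1}" using z x by auto
    have "l = G z (\<phi> z)" using DERIV_unique[OF z(3) d\<phi>[OF zi]] .
    moreover have "\<bar>G z (\<phi> z)\<bar> \<le> 2"
      using bound[OF g_int[OF zi]] Xg(1)[of z] zi by (simp add: \<phi>_def)
    ultimately have "\<bar>l\<bar> \<le> 2" by simp
    thus ?thesis using z x by (simp add: abs_mult mult.commute)
  qed
  have "\<forall>t\<in>{0..t1}. \<phi> (X t) = Y t" using gX by (simp add: \<phi>_def)
  thus ?thesis using d\<phi> b\<phi> mono img by blast
qed

lemma line_of_curvature_subset:
  "\<lbrakk>line_of_curvature \<A> \<alpha> i \<gamma> T; T' \<subseteq> T\<rbrakk> \<Longrightarrow> line_of_curvature \<A> \<alpha> i \<gamma> T'"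
  unfolding line_of_curvature_def
  by (meson continuous_on_subset has_vector_derivative_within_subset subset_iff)

lemma half_leaf_initial_arc:
  assumes "half_leaf \<A> \<alpha> i p l" "open U" "p \<in> U"
  shows "\<exists>\<gamma> t1. 0 < t1 \<and> t1 \<le> 1 \<and> arc \<gamma> \<and> pathstart \<gamma> = p \<and> path_image \<gamma> = l \<and> \<gamma> ` {0..t1} \<subseteq> U \<and>
    line_of_curvature \<A> \<alpha> i \<gamma> {0<..1}"
proof -
  obtain \<gamma> where \<gamma>: "arc \<gamma>" "pathstart \<gamma> = p" "path_image \<gamma> = l" "line_of_curvature \<A> \<alpha> i \<gamma> {0<..1}"
    using assms(1) by (auto simp: half_leaf_def)
  have c: "continuous_on {0..1} \<gamma>" using \<gamma>(1) by (simp add: arc_def path_def)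
  obtain V where V: "open V" "V \<inter> {0..1} = \<gamma> -` U \<inter> {0..1}"
    using c assms(2) by (metis continuous_on_open_invariant)
  have "0 \<in> \<gamma> -` U \<inter> {0..1}" using \<gamma>(2) assms(3) by (simp add: pathstart_def)
  hence "0 \<in> V" using V(2) by blast
  then obtain e where e: "e > 0" "ball 0 e \<subseteq> V" using openE[OF V(1)] by blast
  have "\<gamma> t \<in> U" if "t \<in> {0..min 1 (e/2)}" for t
  proof -
    have "t \<in> V \<inter> {0..1}" using that e by (auto simp: subset_iff dist_real_def)
    thus ?thesis using V(2) by blast
  qed
  thus ?thesis using \<gamma> e by (intro exI[of _ \<gamma>] exI[of _ "min 1 (e/2)"]) auto
qed

text \<open>The final pieces of the two arcs are compact and do not contain \<open>p\<close>.\<close>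
lemma same_germ_initial_arcs:
  fixes \<gamma> \<sigma> :: "real \<Rightarrow> 'm::t2_space"
  assumes c: "continuous_on {0..1} \<gamma>" "continuous_on {0..1} \<sigma>"
    and inj: "inj_on \<gamma> {0..1}" "inj_on \<sigma> {0..1}"
    and start: "\<gamma> 0 = p" "\<sigma> 0 = p"
    and t: "0 < t" "t \<le> 1" "0 < u" "u \<le> 1"
    and eq: "\<gamma> ` {0..t} = \<sigma> ` {0..u}"
  shows "same_germ p (\<gamma> ` {0..1}) (\<sigma> ` {0..1})"
proof -
  define N where "N = - (\<gamma> ` {t..1} \<union> \<sigma> ` {u..1})"
  have sub: "{t..1} \<subseteq> {0..1}" "{u..1} \<subseteq> {0..1}" using t by auto
  have "compact (\<gamma> ` {t..1})" "compact (\<sigma> ` {u..1})"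
    by (intro compact_continuous_image compact_Icc continuous_on_subset[OF c(1) sub(1)]
        continuous_on_subset[OF c(2) sub(2)])+
  hence "closed (\<gamma> ` {t..1} \<union> \<sigma> ` {u..1})" by (intro closed_Un compact_imp_closed)
  hence "open N" unfolding N_def by (rule open_Compl)
  moreover have "p \<in> N"
  proof -
    have "\<gamma> x \<noteq> p" if "x \<in> {t..1}" for x using inj_onD[OF inj(1), of x 0] that t start by auto
    moreover have "\<sigma> x \<noteq> p" if "x \<in> {u..1}" for x using inj_onD[OF inj(2), of x 0] that t start by auto
    ultimately have "p \<notin> \<gamma> ` {t..1}" "p \<notin> \<sigma> ` {u..1}" by blast+
    thus ?thesis by (simp add: N_def)
  qed
  moreover have "x \<in> \<gamma> ` {0..1} \<longleftrightarrow> x \<in> \<sigma> ` {0..1}" if "x \<in> N" for x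
  proof -
    have "{0..1} = {0..t} \<union> {t..1}" "{0..1} = {0..u} \<union> {u..1}" using t by auto
    hence "\<gamma> ` {0..1} = \<gamma> ` {0..t} \<union> \<gamma> ` {t..1}" "\<sigma> ` {0..1} = \<sigma> ` {0..u} \<union> \<sigma> ` {u..1}"
      by (metis image_Un)+
    thus ?thesis using that eq by (auto simp: N_def)
  qed
  ultimately show ?thesis unfolding same_germ_def eventually_nhds by blast
qed

lemma mem_square: "(a, b) \<in> {-r..r} \<times> {-r..r} \<longleftrightarrow> \<bar>a\<bar> \<le> r \<and> \<bar>b\<bar> \<le> r" for a b r :: real
  by auto

section \<open>A foliation with one singular point on one leaf\<close>

text \<open>A chart in which the lines of curvature of index \<open>i\<close> are the regular curves of slope \<open>f\<close>.
  The factor \<open>a\<close> is the horizontal speed.\<close>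
locale foliation_chart =
  fixes f f' :: "real \<Rightarrow> real \<Rightarrow> real" and \<epsilon> m C :: real
    and \<A> :: "'m::t2_space chart set" and \<alpha> :: "'m \<Rightarrow> real^3" and i :: principal and p :: 'm
    and \<psi> :: "real \<times> real \<Rightarrow> 'm" and \<psi>' :: "'m \<Rightarrow> real \<times> real" and W :: "(real \<times> real) set"
  assumes slope: "one_through_leaf f f' \<epsilon> m C"
    and W: "W = {-\<epsilon><..<\<epsilon>} \<times> {-\<epsilon><..<\<epsilon>}"
    and homeo: "homeomorphism W (\<psi> ` W) \<psi> \<psi>'" and open_image: "open (\<psi> ` W)"
    and origin: "\<psi> (0, 0) = p"
    and lines: "\<And>\<gamma> T. \<gamma> ` T \<subseteq> \<psi> ` W \<Longrightarrow> line_of_curvature \<A> \<alpha> i \<gamma> T \<longleftrightarrow>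
      continuous_on T \<gamma> \<and> (\<forall>t\<in>T. \<gamma> t \<noteq> p \<and> (\<exists>a. a \<noteq> 0 \<and>
        ((\<psi>' \<circ> \<gamma>) has_vector_derivative (a, f (fst (\<psi>' (\<gamma> t))) (snd (\<psi>' (\<gamma> t))) * a)) (at t within T)))"
begin

interpretation leaf: one_through_leaf f f' \<epsilon> m C "{- \<epsilon>..\<epsilon>} \<times> {- \<epsilon>..\<epsilon>} - {(0, 0)}"
  by (rule slope)

text \<open>A quarter leaves room for three times \<open>\<delta>\<close>, the height of the strips that contain the flow.\<close>
definition \<delta> where "\<delta> = \<epsilon> / 4"

lemma \<delta>: "0 < \<delta>" "3 * \<delta> \<le> \<epsilon>" "2 * \<delta> \<le> \<epsilon>" "3 * \<delta> < \<epsilon>"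
  using leaf.\<epsilon> by (auto simp: \<delta>_def)

interpretation R: half_singular_ode f f' \<delta> \<delta> "{0..\<delta>} \<times> {- (\<delta> + 2 * \<delta>)..\<delta> + 2 * \<delta>} - {(0, 0)}"
  by (rule leaf.right_half) (use \<delta> in auto)

interpretation L: half_singular_ode "\<lambda>x y. - f (- x) y" "\<lambda>x y. - f' (- x) y" \<delta> \<delta>
    "{0..\<delta>} \<times> {- (\<delta> + 2 * \<delta>)..\<delta> + 2 * \<delta>} - {(0, 0)}"
  by (rule leaf.left_half) (use \<delta> in auto)

text \<open>The height over \<open>x\<close> of the leaf that crosses the vertical axis at height \<open>y\<close>.\<close>
definition \<Phi> :: "real \<Rightarrow> real \<Rightarrow> real" where
  "\<Phi> x y = (if x \<le> 0 then L.flow (- x) y else R.flow x y)"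

lemma \<Phi>_right: "\<lbrakk>0 \<le> x; \<bar>y\<bar> \<le> \<delta>\<rbrakk> \<Longrightarrow> \<Phi> x y = R.flow x y"
  using L.flow_0 R.flow_0 by (cases "x = 0") (auto simp: \<Phi>_def)

lemma \<Phi>_left: "x \<le> 0 \<Longrightarrow> \<Phi> x y = L.flow (- x) y"
  by (simp add: \<Phi>_def)

lemma \<Phi>_near:
  assumes "\<bar>x\<bar> \<le> \<delta>" "\<bar>y\<bar> \<le> \<delta>"
  shows "\<bar>\<Phi> x y - y\<bar> \<le> 2 * \<bar>x\<bar>"
proof -
  have "\<bar>R.flow z y - y\<bar> \<le> 2 * z" "\<bar>L.flow z y - y\<bar> \<le> 2 * z" if "z \<in> {0..\<delta>}" for z
    using R.flow_sol[OF assms(2)] L.flow_sol[OF assms(2)] that unfolding R.sol_def L.sol_def by blast+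
  from this[of x] this[of "- x"] show ?thesis using assms by (cases "x \<le> 0") (auto simp: \<Phi>_def)
qed

lemma \<Phi>_strict_mono: "\<lbrakk>\<bar>x\<bar> \<le> \<delta>; \<bar>y\<bar> \<le> \<delta>; \<bar>y'\<bar> \<le> \<delta>; y < y'\<rbrakk> \<Longrightarrow> \<Phi> x y < \<Phi> x y'"
  using R.flow_strict_mono[of y y' x] L.flow_strict_mono[of y y' "- x"] by (auto simp: \<Phi>_def)

lemma \<Phi>_continuous: "continuous_on ({-\<delta>..\<delta>} \<times> {-\<delta>..\<delta>}) (\<lambda>z. \<Phi> (fst z) (snd z))"
  unfolding \<Phi>_def
proof (rule continuous_on_cases_le[where h = fst and a = 0])
  have "continuous_on {t \<in> {-\<delta>..\<delta>} \<times> {-\<delta>..\<delta>}. fst t \<le> 0} ((\<lambda>(x, y). L.flow x y) \<circ> (\<lambda>z. (- fst z, snd z)))"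
    by (intro continuous_on_compose continuous_intros continuous_on_subset[OF L.flow_continuous]) auto
  thus "continuous_on {t \<in> {-\<delta>..\<delta>} \<times> {-\<delta>..\<delta>}. fst t \<le> 0} (\<lambda>t. L.flow (- fst t) (snd t))"
    by (simp add: o_def)
  show "continuous_on {t \<in> {-\<delta>..\<delta>} \<times> {-\<delta>..\<delta>}. 0 \<le> fst t} (\<lambda>t. R.flow (fst t) (snd t))"
    unfolding case_prod_unfold[symmetric]
    by (rule continuous_on_subset[OF R.flow_continuous[unfolded case_prod_unfold]]) auto
qed (use L.flow_0 R.flow_0 in \<open>auto intro!: continuous_intros\<close>)

lemma \<Phi>_deriv:
  assumes x: "\<bar>x\<bar> \<le> \<delta>" and y: "\<bar>y\<bar> \<le> \<delta>" and nz: "x \<noteq> 0 \<or> y \<noteq> 0"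
  shows "((\<lambda>x. \<Phi> x y) has_real_derivative f x (\<Phi> x y)) (at x within {-\<delta>..\<delta>})"
proof -
  have right: "((\<lambda>x. \<Phi> x y) has_real_derivative f x (\<Phi> x y)) (at x within {0..\<delta>})" if "0 \<le> x"
  proof -
    have "((\<lambda>x. R.flow x y) has_real_derivative f x (R.flow x y)) (at x within {0..\<delta>})"
      using that x nz by (intro R.flow_deriv[OF y]) auto
    hence "((\<lambda>x. \<Phi> x y) has_real_derivative f x (R.flow x y)) (at x within {0..\<delta>})"
      by (rule has_field_derivative_transform_within[where d = 1]) (use that x y \<Phi>_right in auto)
    thus ?thesis using \<Phi>_right[OF that y] by simp
  qed
  have left: "((\<lambda>x. \<Phi> x y) has_real_derivative f x (\<Phi> x y)) (at x within {-\<delta>..0})" if "x \<le> 0"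
  proof -
    have "((\<lambda>x. L.flow x y) has_real_derivative - f (- (- x)) (L.flow (- x) y)) (at (- x) within {0..\<delta>})"
      using that x nz by (intro L.flow_deriv[OF y]) auto
    hence "((\<lambda>x. L.flow x y) has_real_derivative - f x (\<Phi> x y)) (at (- x) within uminus ` {-\<delta>..0})"
      using \<Phi>_left[OF that] by simp
    hence "(((\<lambda>x. L.flow x y) \<circ> uminus) has_real_derivative - f x (\<Phi> x y) * - 1) (at x within {-\<delta>..0})"
      by (rule DERIV_image_chain) (auto intro!: derivative_eq_intros)
    hence "((\<lambda>x. L.flow (- x) y) has_real_derivative f x (\<Phi> x y)) (at x within {-\<delta>..0})"
      by (simp add: o_def)
    thus ?thesis
      by (rule has_field_derivative_transform_within[where d = 1]) (use that x \<Phi>_left in auto)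
  qed
  consider "x > 0" | "x < 0" | "x = 0" by linarith
  thus ?thesis
  proof cases
    case 1
    have "at x within {0..\<delta>} = at x within {-\<delta>..\<delta>}"
      by (rule at_within_nhd[of x "{0<..}"]) (use 1 in auto)
    thus ?thesis using right 1 by simp
  next
    case 2
    have "at x within {-\<delta>..0} = at x within {-\<delta>..\<delta>}"
      by (rule at_within_nhd[of x "{..<0}"]) (use 2 in auto)
    thus ?thesis using left 2 by simp
  next
    case 3
    have "{-\<delta>..\<delta>} = {-\<delta>..0} \<union> {0..\<delta>}" using \<delta>(1) by auto
    thus ?thesis using left right 3 by (simp add: has_field_derivative_iff Lim_within_Un)
  qed
qed

definition \<Theta> :: "real \<times> real \<Rightarrow> 'm" where
  "\<Theta> z = \<psi> (\<delta> * fst z, \<Phi> (\<delta> * fst z) (\<delta> * snd z))"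

lemma scale: "\<bar>x\<bar> \<le> 1 \<Longrightarrow> \<bar>\<delta> * x\<bar> \<le> \<delta>"
  using \<delta>(1) by (simp add: abs_mult mult_left_le)

lemma scale_image:
  "(\<lambda>z. (\<delta> * fst z, \<delta> * snd z)) ` ({-1..1} \<times> {-1..1}) \<subseteq> {-\<delta>..\<delta>} \<times> {-\<delta>..\<delta>}"
proof (rule image_subsetI)
  fix z :: "real \<times> real" assume "z \<in> {-1..1} \<times> {-1..1}"
  hence "\<bar>fst z\<bar> \<le> 1" "\<bar>snd z\<bar> \<le> 1" by auto
  thus "(\<delta> * fst z, \<delta> * snd z) \<in> {-\<delta>..\<delta>} \<times> {-\<delta>..\<delta>}"
    unfolding mem_square using scale by blast
qed

lemma \<Theta>_in_W: "\<lbrakk>\<bar>x\<bar> \<le> 1; \<bar>y\<bar> \<le> 1\<rbrakk> \<Longrightarrow> (\<delta> * x, \<Phi> (\<delta> * x) (\<delta> * y)) \<in> W"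
  using \<Phi>_near[of "\<delta> * x" "\<delta> * y"] scale[of x] scale[of y] \<delta> by (auto simp: W)

lemma inv: "z \<in> W \<Longrightarrow> \<psi>' (\<psi> z) = z"
  using homeo by (simp add: homeomorphism_def)

lemma zero_W: "(0, 0) \<in> W" using \<delta> by (auto simp: W)

lemma \<Theta>_continuous: "continuous_on ({-1..1} \<times> {-1..1}) \<Theta>"
proof -
  have "continuous_on ({-1..1} \<times> {-1..1}) ((\<lambda>z. \<Phi> (fst z) (snd z)) \<circ> (\<lambda>z. (\<delta> * fst z, \<delta> * snd z)))"
    by (intro continuous_on_compose continuous_intros continuous_on_subset[OF \<Phi>_continuous] scale_image)
  hence "continuous_on ({-1..1} \<times> {-1..1}) (\<lambda>z. (\<delta> * fst z, \<Phi> (\<delta> * fst z) (\<delta> * snd z)))"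
    by (intro continuous_intros) (simp add: o_def)
  moreover have "(\<lambda>z. (\<delta> * fst z, \<Phi> (\<delta> * fst z) (\<delta> * snd z))) ` ({-1..1} \<times> {-1..1}) \<subseteq> W"
  proof (rule image_subsetI)
    fix z :: "real \<times> real" assume "z \<in> {-1..1} \<times> {-1..1}"
    hence "\<bar>fst z\<bar> \<le> 1" "\<bar>snd z\<bar> \<le> 1" by auto
    thus "(\<delta> * fst z, \<Phi> (\<delta> * fst z) (\<delta> * snd z)) \<in> W" by (rule \<Theta>_in_W)
  qed
  ultimately have "continuous_on ({-1..1} \<times> {-1..1}) (\<psi> \<circ> (\<lambda>z. (\<delta> * fst z, \<Phi> (\<delta> * fst z) (\<delta> * snd z))))"
    by (rule continuous_on_compose[OF _ continuous_on_subset[OF homeomorphism_cont1[OF homeo]]])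
  thus ?thesis by (simp add: \<Theta>_def[abs_def] o_def)
qed

lemma \<Theta>_inj: "inj_on \<Theta> ({-1..1} \<times> {-1..1})"
proof (rule inj_onI)
  fix z z' assume z: "z \<in> {-1..1} \<times> {-1..1}" "z' \<in> {-1..1} \<times> {-1..1}" and eq: "\<Theta> z = \<Theta> z'"
  obtain x y x' y' where xy: "z = (x, y)" "z' = (x', y')" by (cases z, cases z')
  have b: "\<bar>x\<bar> \<le> 1" "\<bar>y\<bar> \<le> 1" "\<bar>x'\<bar> \<le> 1" "\<bar>y'\<bar> \<le> 1" using z xy by auto
  have "(\<delta> * x, \<Phi> (\<delta> * x) (\<delta> * y)) = (\<delta> * x', \<Phi> (\<delta> * x') (\<delta> * y'))"
  proof -
    have "\<psi>' (\<Theta> z) = (\<delta> * x, \<Phi> (\<delta> * x) (\<delta> * y))" "\<psi>' (\<Theta> z') = (\<delta> * x', \<Phi> (\<delta> * x') (\<delta> * y'))"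
      unfolding \<Theta>_def xy fst_conv snd_conv by (rule inv[OF \<Theta>_in_W[OF b(1,2)]], rule inv[OF \<Theta>_in_W[OF b(3,4)]])
    thus ?thesis using eq by metis
  qed
  hence x: "x = x'" and \<Phi>: "\<Phi> (\<delta> * x) (\<delta> * y) = \<Phi> (\<delta> * x) (\<delta> * y')" using \<delta>(1) by auto
  have "\<not> y < y'" "\<not> y' < y"
    using \<Phi>_strict_mono[of "\<delta> * x" "\<delta> * y" "\<delta> * y'"] \<Phi>_strict_mono[of "\<delta> * x" "\<delta> * y'" "\<delta> * y"]
      \<Phi> scale b \<delta>(1) by auto
  thus "z = z'" using x xy by auto
qed

text \<open>The leaves through the top and the bottom of the axis stay above and below a small box, and
  by the intermediate value theorem the leaves between them fill it.\<close>
lemma p_interior: "p \<in> interior (\<Theta> ` ({-1..1} \<times> {-1..1}))"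
proof (rule interiorI)
  define V where "V = {-\<delta>/4<..<\<delta>/4} \<times> {-\<delta>/2<..<\<delta>/2}"
  have VW: "V \<subseteq> W" using \<delta> by (auto simp: V_def W)
  have "openin (top_of_set (\<psi> ` W)) (\<psi> ` V)"
    by (rule homeomorphism_imp_open_map[OF homeo])
      (use VW in \<open>auto simp: V_def intro!: open_subset open_Times\<close>)
  thus "open (\<psi> ` V)" using open_image by (simp add: openin_open_eq)
  show "p \<in> \<psi> ` V" using \<delta>(1) by (intro image_eqI[of _ _ "(0, 0)"]) (auto simp: V_def origin)
  show "\<psi> ` V \<subseteq> \<Theta> ` ({-1..1} \<times> {-1..1})"
  proof clarify
    fix x y assume "(x, y) \<in> V"
    hence xy: "\<bar>x\<bar> \<le> \<delta> / 4" "\<bar>y\<bar> \<le> \<delta> / 2" by (auto simp: V_def)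
    have "\<bar>\<Phi> x \<delta> - \<delta>\<bar> \<le> 2 * \<bar>x\<bar>" "\<bar>\<Phi> x (- \<delta>) - - \<delta>\<bar> \<le> 2 * \<bar>x\<bar>"
      using xy \<delta> by (intro \<Phi>_near; simp)+
    hence "\<Phi> x (- \<delta>) \<le> y" "y \<le> \<Phi> x \<delta>" using xy by auto
    moreover have "continuous_on {-\<delta>..\<delta>} (\<lambda>y. \<Phi> (fst (x, y)) (snd (x, y)))"
      by (rule continuous_on_compose2[OF \<Phi>_continuous, of _ "\<lambda>y. (x, y)"])
        (use xy \<delta> in \<open>auto intro!: continuous_intros\<close>)
    ultimately have "\<exists>y0. - \<delta> \<le> y0 \<and> y0 \<le> \<delta> \<and> \<Phi> x y0 = y"
      using \<delta>(1) by (intro IVT'[of "\<Phi> x"]) auto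
    then obtain y0 where y0: "- \<delta> \<le> y0" "y0 \<le> \<delta>" "\<Phi> x y0 = y" by blast
    have "\<psi> (x, y) = \<Theta> (x / \<delta>, y0 / \<delta>)" using y0 \<delta>(1) by (simp add: \<Theta>_def)
    moreover have "(x / \<delta>, y0 / \<delta>) \<in> {-1..1} \<times> {-1..1}"
      using y0 xy \<delta>(1) by (auto simp: field_simps abs_le_iff)
    ultimately show "\<psi> (x, y) \<in> \<Theta> ` ({-1..1} \<times> {-1..1})" by blast
  qed
qed

text \<open>The affine reparametrisation covers whole leaves as well as both half-leaves on the axis, which
  are parametrised from the singular point outwards.\<close>
lemma \<Theta>_leaf:
  assumes c: "\<bar>c\<bar> \<le> 1" and A: "A \<noteq> 0" and T: "\<And>t. t \<in> T \<Longrightarrow> \<bar>A * t + B\<bar> \<le> 1"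
    and nz: "\<And>t. t \<in> T \<Longrightarrow> A * t + B \<noteq> 0 \<or> c \<noteq> 0"
  shows "line_of_curvature \<A> \<alpha> i (\<lambda>t. \<Theta> (A * t + B, c)) T"
proof -
  have sub: "(\<lambda>t. \<Theta> (A * t + B, c)) ` T \<subseteq> \<psi> ` W"
    using \<Theta>_in_W T c by (auto simp: \<Theta>_def)
  show ?thesis unfolding lines[OF sub]
  proof (intro conjI ballI)
    have mem: "(A * t + B, c) \<in> {-1..1} \<times> {-1..1}" if "t \<in> T" for t
      unfolding mem_square using T[OF that] c by simp
    show "continuous_on T (\<lambda>t. \<Theta> (A * t + B, c))"
      by (rule continuous_on_compose2[OF \<Theta>_continuous]) (use mem in \<open>auto intro!: continuous_intros\<close>)
    fix t assume t: "t \<in> T"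
    define x where "x = \<delta> * (A * t + B)"
    have x: "\<bar>x\<bar> \<le> \<delta>" unfolding x_def by (rule scale[OF T[OF t]])
    have inv': "\<psi>' (\<Theta> (A * t + B, c)) = (\<delta> * (A * t + B), \<Phi> (\<delta> * (A * t + B)) (\<delta> * c))" if "t \<in> T" for t
      using inv[OF \<Theta>_in_W[OF T[OF that] c]] by (simp add: \<Theta>_def)
    show "\<Theta> (A * t + B, c) \<noteq> p"
    proof
      assume eq: "\<Theta> (A * t + B, c) = p"
      have "\<psi>' p = (0, 0)" using inv[OF zero_W] origin by simp
      hence 0: "A * t + B = 0" "\<Phi> (\<delta> * (A * t + B)) (\<delta> * c) = 0" using inv'[OF t] eq \<delta>(1) by auto
      have "\<Phi> 0 (\<delta> * c) = \<delta> * c" using \<Phi>_near[of 0 "\<delta> * c"] scale[OF c] \<delta>(1) by simp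
      thus False using 0 nz[OF t] \<delta>(1) by simp
    qed
    have aff: "((\<lambda>t. \<delta> * (A * t + B)) has_real_derivative \<delta> * A) (at t within T)"
      by (auto intro!: derivative_eq_intros)
    have "((\<lambda>x. \<Phi> x (\<delta> * c)) has_real_derivative f x (\<Phi> x (\<delta> * c))) (at x within {-\<delta>..\<delta>})"
      using nz[OF t] \<delta>(1) by (intro \<Phi>_deriv x scale c) (auto simp: x_def)
    hence "((\<lambda>x. \<Phi> x (\<delta> * c)) has_real_derivative f x (\<Phi> x (\<delta> * c)))
        (at (\<delta> * (A * t + B)) within (\<lambda>t. \<delta> * (A * t + B)) ` T)"
    proof (unfold x_def[symmetric], rule DERIV_subset, clarify)
      fix t assume "t \<in> T"
      from scale[OF T[OF this]] show "\<delta> * (A * t + B) \<in> {-\<delta>..\<delta>}" by auto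
    qed
    from DERIV_image_chain[OF this aff]
    have "((\<lambda>t. \<Phi> (\<delta> * (A * t + B)) (\<delta> * c)) has_real_derivative f x (\<Phi> x (\<delta> * c)) * (\<delta> * A)) (at t within T)"
      by (simp add: o_def)
    with aff have "((\<lambda>t. (\<delta> * (A * t + B), \<Phi> (\<delta> * (A * t + B)) (\<delta> * c))) has_vector_derivative
        (\<delta> * A, f x (\<Phi> x (\<delta> * c)) * (\<delta> * A))) (at t within T)"
      by (intro has_vector_derivative_Pair) (simp_all add: has_real_derivative_iff_has_vector_derivative)
    hence "((\<psi>' \<circ> (\<lambda>t. \<Theta> (A * t + B, c))) has_vector_derivative
        (\<delta> * A, f x (\<Phi> x (\<delta> * c)) * (\<delta> * A))) (at t within T)"
      by (rule has_vector_derivative_transform[OF t, rotated]) (simp add: inv')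
    moreover have "\<psi>' (\<Theta> (A * t + B, c)) = (x, \<Phi> x (\<delta> * c))" using inv'[OF t] by (simp add: x_def)
    ultimately show "\<exists>a. a \<noteq> 0 \<and> ((\<psi>' \<circ> (\<lambda>t. \<Theta> (A * t + B, c))) has_vector_derivative
        (a, f (fst (\<psi>' (\<Theta> (A * t + B, c)))) (snd (\<psi>' (\<Theta> (A * t + B, c)))) * a)) (at t within T)"
      using A \<delta>(1) by (intro exI[of _ "\<delta> * A"]) simp
  qed
qed

lemma \<Theta>_arc:
  assumes c: "\<bar>c\<bar> \<le> 1" and A: "A \<noteq> 0" and T: "\<And>t. t \<in> {0..1} \<Longrightarrow> \<bar>A * t + B\<bar> \<le> 1"
  shows "arc (\<lambda>t. \<Theta> (A * t + B, c))"
  unfolding arc_def path_def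
proof
  have mem: "(A * t + B, c) \<in> {-1..1} \<times> {-1..1}" if "t \<in> {0..1}" for t
    unfolding mem_unit_square using T[OF that] c by simp
  show "continuous_on {0..1} (\<lambda>t. \<Theta> (A * t + B, c))"
    by (rule continuous_on_compose2[OF \<Theta>_continuous]) (use mem in \<open>auto intro!: continuous_intros\<close>)
  show "inj_on (\<lambda>t. \<Theta> (A * t + B, c)) {0..1}"
  proof (rule inj_onI)
    fix s t assume "s \<in> {0..1}" "t \<in> {0..1}" "\<Theta> (A * s + B, c) = \<Theta> (A * t + B, c)"
    hence "(A * s + B, c) = (A * t + B, c)" using mem by (intro inj_onD[OF \<Theta>_inj]) auto
    thus "s = t" using A by simp
  qed
qed

definition sR :: "'m set" where "sR = \<Theta> ` ({0..1} \<times> {0})"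
definition sL :: "'m set" where "sL = \<Theta> ` ({-1..0} \<times> {0})"

lemma \<Theta>_0: "\<Theta> (0, 0) = p"
  using \<Phi>_near[of 0 0] \<delta>(1) by (simp add: \<Theta>_def origin)

lemma half_leaf_axis:
  assumes e: "\<bar>e\<bar> = 1"
  shows "half_leaf \<A> \<alpha> i p ((\<lambda>t. \<Theta> (e * t, 0)) ` {0..1})"
  unfolding half_leaf_def
proof (intro exI conjI)
  have b: "\<bar>e * t\<bar> \<le> 1" if "t \<in> {0..1}" for t using that e by (simp add: abs_mult)
  show "arc (\<lambda>t. \<Theta> (e * t + 0, 0))" using e b by (intro \<Theta>_arc) auto
  show "pathstart (\<lambda>t. \<Theta> (e * t + 0, 0)) = p" by (simp add: pathstart_def \<Theta>_0)
  show "path_image (\<lambda>t. \<Theta> (e * t + 0, 0)) = (\<lambda>t. \<Theta> (e * t, 0)) ` {0..1}" by (simp add: path_image_def)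
  show "line_of_curvature \<A> \<alpha> i (\<lambda>t. \<Theta> (e * t + 0, 0)) {0<..1}"
    using e b by (intro \<Theta>_leaf) auto
qed

lemma s_axis: "sR = (\<lambda>t. \<Theta> (1 * t, 0)) ` {0..1}" "sL = (\<lambda>t. \<Theta> (- 1 * t, 0)) ` {0..1}"
proof -
  show "sR = (\<lambda>t. \<Theta> (1 * t, 0)) ` {0..1}" by (force simp: sR_def)
  show "sL = (\<lambda>t. \<Theta> (- 1 * t, 0)) ` {0..1}"
  proof -
    have "{-1..0} \<times> {0} = (\<lambda>t. (- 1 * t, 0)) ` {0..1::real}"
      by (auto simp: image_iff intro!: bexI[of _ "- _"])
    hence "\<Theta> ` ({-1..0} \<times> {0}) = \<Theta> ` (\<lambda>t. (- 1 * t, 0)) ` {0..1}" by (rule arg_cong)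
    thus ?thesis by (simp only: sL_def image_image)
  qed
qed

text \<open>The sign \<open>e\<close> distinguishes the two sides of the singular point.\<close>
lemma germ_on_axis:
  assumes e: "\<bar>e\<bar> = 1" and \<gamma>: "arc \<gamma>" "pathstart \<gamma> = p" and t1: "0 < t1" "t1 \<le> 1"
    and W': "\<And>t. t \<in> {0..t1} \<Longrightarrow> \<gamma> t = \<psi> (X t, Y t)"
    and small: "\<And>t. t \<in> {0..t1} \<Longrightarrow> \<bar>X t\<bar> \<le> \<delta>"
    and mono: "strict_mono_on {0..t1} (\<lambda>t. e * X t)" and img: "(\<lambda>t. e * X t) ` {0..t1} = {0..e * X t1}"
    and X0: "X 0 = 0"
    and Y: "\<And>t. \<lbrakk>0 \<le> t; t < t1\<rbrakk> \<Longrightarrow> Y t = \<Phi> (X t) 0"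
  shows "same_germ p (path_image \<gamma>) ((\<lambda>t. \<Theta> (e * t, 0)) ` {0..1})"
  unfolding path_image_def
proof (rule same_germ_initial_arcs[where t = "t1 / 2" and u = "e * X (t1 / 2) / \<delta>"])
  have arc: "arc (\<lambda>t. \<Theta> (e * t + 0, 0))" using e by (intro \<Theta>_arc) (auto simp: abs_mult)
  show "continuous_on {0..1} \<gamma>" "inj_on \<gamma> {0..1}" using \<gamma> by (auto simp: arc_def path_def)
  show "continuous_on {0..1} (\<lambda>t. \<Theta> (e * t, 0))" "inj_on (\<lambda>t. \<Theta> (e * t, 0)) {0..1}"
    using arc by (auto simp: arc_def path_def)
  show "\<gamma> 0 = p" using \<gamma> by (simp add: pathstart_def)
  show "\<Theta> (e * 0, 0) = p" by (simp add: \<Theta>_0)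
  let ?h = "t1 / 2"
  have ee: "e * (e * x) = x" for x using e by (auto simp: abs_if split: if_splits)
  have pos: "0 < e * X ?h" using strict_mono_onD[OF mono, of 0 ?h] t1 X0 by simp
  have "\<bar>e * X ?h\<bar> \<le> \<delta>" using small[of ?h] t1 e by (simp add: abs_mult)
  thus "0 < e * X ?h / \<delta>" "e * X ?h / \<delta> \<le> 1" using pos \<delta>(1) by auto
  have \<gamma>\<Theta>: "\<gamma> t = \<Theta> (e * (e * X t / \<delta>), 0)" if "t \<in> {0..?h}" for t
  proof -
    have "\<gamma> t = \<psi> (X t, \<Phi> (X t) 0)" using W'[of t] Y[of t] that t1 by auto
    also have "\<dots> = \<Theta> (X t / \<delta>, 0)" using \<delta>(1) by (simp add: \<Theta>_def)
    also have "X t / \<delta> = e * (e * X t / \<delta>)" by (simp add: ee)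
    finally show ?thesis .
  qed
  have le: "e * X s \<le> e * X t" if "0 \<le> s" "s \<le> t" "t \<le> t1" for s t
    using strict_mono_onD[OF mono, of s t] that by (cases "s = t") auto
  have Ximg: "(\<lambda>t. e * X t) ` {0..?h} = {0..e * X ?h}"
  proof (intro equalityI subsetI)
    fix x assume "x \<in> (\<lambda>t. e * X t) ` {0..?h}"
    then obtain t where t: "t \<in> {0..?h}" "x = e * X t" by blast
    thus "x \<in> {0..e * X ?h}" using le[of 0 t] le[of t ?h] t1 X0 by simp
  next
    fix x assume x: "x \<in> {0..e * X ?h}"
    have "x \<in> {0..e * X t1}" using x le[of ?h t1] t1 by simp
    then obtain t where t: "t \<in> {0..t1}" "x = e * X t" unfolding img[symmetric] by blast
    have "t \<le> ?h"
    proof (rule ccontr)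
      assume "\<not> t \<le> ?h"
      hence "e * X ?h < e * X t" using t t1 by (intro strict_mono_onD[OF mono]) auto
      thus False using x t by simp
    qed
    thus "x \<in> (\<lambda>t. e * X t) ` {0..?h}" using t by auto
  qed
  have "\<gamma> ` {0..?h} = (\<lambda>x. \<Theta> (e * (x / \<delta>), 0)) ` ((\<lambda>t. e * X t) ` {0..?h})"
    unfolding image_image by (rule image_cong) (use \<gamma>\<Theta> in auto)
  also have "\<dots> = (\<lambda>x. \<Theta> (e * (x / \<delta>), 0)) ` {0..e * X ?h}" by (simp only: Ximg)
  also have "{0..e * X ?h} = (*) \<delta> ` {0..e * X ?h / \<delta>}"
    using \<delta>(1) pos by (simp add: image_mult_atLeastAtMost)
  also have "(\<lambda>x. \<Theta> (e * (x / \<delta>), 0)) ` ((*) \<delta> ` {0..e * X ?h / \<delta>}) = (\<lambda>t. \<Theta> (e * t, 0)) ` {0..e * X ?h / \<delta>}"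
    using \<delta>(1) by (simp only: image_image) simp
  finally show "\<gamma> ` {0..?h} = (\<lambda>t. \<Theta> (e * t, 0)) ` {0..e * X ?h / \<delta>}" .
qed (use t1 in auto)

lemma flow_right_germ: "\<xi> \<le> \<delta> \<Longrightarrow> leaf.right_germ \<xi> (\<lambda>x. R.flow x 0)"
  using R.flow_sol[of 0] R.sol_deriv_at[of 0 "\<lambda>x. R.flow x 0"] \<delta>(1)
  by (auto simp: leaf.right_germ_def R.sol_def)

lemma flow_left_germ: "\<xi> \<le> \<delta> \<Longrightarrow> leaf.left_germ \<xi> (\<lambda>x. L.flow x 0)"
  using L.flow_sol[of 0] L.sol_deriv_at[of 0 "\<lambda>x. L.flow x 0"] \<delta>(1)
  by (auto simp: leaf.left_germ_def L.sol_def)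

text \<open>A half-leaf is a graph over the right or over the left half of the axis near \<open>p\<close>; as a solution
  through the origin it agrees with the flow, by the uniqueness on that side.\<close>
lemma half_leaf_germ:
  assumes "half_leaf \<A> \<alpha> i p l"
  shows "same_germ p l sR \<or> same_germ p l sL"
proof -
  define V where "V = {-\<delta><..<\<delta>} \<times> {-\<delta><..<\<delta>}"
  have VW: "V \<subseteq> W" using \<delta> by (auto simp: V_def W)
  have "openin (top_of_set (\<psi> ` W)) (\<psi> ` V)"
    by (rule homeomorphism_imp_open_map[OF homeo])
      (use VW in \<open>auto simp: V_def intro!: open_subset open_Times\<close>)
  hence "open (\<psi> ` V)" using open_image by (simp add: openin_open_eq)
  moreover have "p \<in> \<psi> ` V" using \<delta>(1) by (intro image_eqI[of _ _ "(0, 0)"]) (auto simp: V_def origin)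
  ultimately obtain \<gamma> t1 where \<gamma>: "0 < t1" "t1 \<le> 1" "arc \<gamma>" "pathstart \<gamma> = p" "path_image \<gamma> = l"
    "\<gamma> ` {0..t1} \<subseteq> \<psi> ` V" "line_of_curvature \<A> \<alpha> i \<gamma> {0<..1}"
    using half_leaf_initial_arc[OF assms] by blast
  define X Y where "X t = fst (\<psi>' (\<gamma> t))" and "Y t = snd (\<psi>' (\<gamma> t))" for t
  have XY: "\<gamma> t = \<psi> (X t, Y t)" "(X t, Y t) \<in> V" if t: "t \<in> {0..t1}" for t
  proof -
    obtain z where z: "z \<in> V" "\<gamma> t = \<psi> z" using \<gamma>(6) t by blast
    hence "(X t, Y t) = z" using inv[of z] VW by (auto simp: X_def Y_def)
    thus "\<gamma> t = \<psi> (X t, Y t)" "(X t, Y t) \<in> V" using z by auto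
  qed
  have c\<gamma>: "continuous_on {0..t1} (\<lambda>t. \<psi>' (\<gamma> t))"
  proof (rule continuous_on_compose2[of "\<psi> ` W" \<psi>'])
    show "continuous_on (\<psi> ` W) \<psi>'" using homeo by (simp add: homeomorphism_def)
    have "continuous_on {0..1} \<gamma>" using \<gamma>(3) by (simp add: arc_def path_def)
    thus "continuous_on {0..t1} \<gamma>" by (rule continuous_on_subset) (use \<gamma> in auto)
  qed (use \<gamma>(6) VW in auto)
  have cXY: "continuous_on {0..t1} X" "continuous_on {0..t1} Y"
    unfolding X_def Y_def by (intro continuous_on_fst continuous_on_snd c\<gamma>)+
  have start: "X 0 = 0" "Y 0 = 0"
  proof -
    have "\<psi>' (\<gamma> 0) = (0, 0)" using \<gamma>(4) inv[OF zero_W] origin by (simp add: pathstart_def)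
    thus "X 0 = 0" "Y 0 = 0" by (auto simp: X_def Y_def)
  qed
  have "line_of_curvature \<A> \<alpha> i \<gamma> {0<..<t1}"
    by (rule line_of_curvature_subset[OF \<gamma>(7)]) (use \<gamma> in auto)
  moreover have "\<gamma> ` {0<..<t1} \<subseteq> \<psi> ` W" using \<gamma>(6) VW by (force simp: image_subset_iff)
  ultimately have "\<forall>t\<in>{0<..<t1}. \<gamma> t \<noteq> p \<and> (\<exists>a. a \<noteq> 0 \<and>
      ((\<psi>' \<circ> \<gamma>) has_vector_derivative (a, f (X t) (Y t) * a)) (at t within {0<..<t1}))"
    using lines by (simp add: X_def Y_def)
  hence "\<forall>t. \<exists>a. t \<in> {0<..<t1} \<longrightarrow> \<gamma> t \<noteq> p \<and> a \<noteq> 0 \<and>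
      ((\<psi>' \<circ> \<gamma>) has_vector_derivative (a, f (X t) (Y t) * a)) (at t)"
    by (metis at_within_open open_greaterThanLessThan)
  then obtain a where a: "\<And>t. t \<in> {0<..<t1} \<Longrightarrow> \<gamma> t \<noteq> p" "\<And>t. t \<in> {0<..<t1} \<Longrightarrow> a t \<noteq> 0"
    "\<And>t. t \<in> {0<..<t1} \<Longrightarrow> ((\<psi>' \<circ> \<gamma>) has_vector_derivative (a t, f (X t) (Y t) * a t)) (at t)"
    by metis
  have dX: "(X has_real_derivative a t) (at t)" and dY: "(Y has_real_derivative f (X t) (Y t) * a t) (at t)"
    if t: "0 < t" "t < t1" for t
  proof -
    have d: "((\<psi>' \<circ> \<gamma>) has_vector_derivative (a t, f (X t) (Y t) * a t)) (at t)" using a(3) t by simp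
    from bounded_linear.has_vector_derivative[OF bounded_linear_fst d]
    show "(X has_real_derivative a t) (at t)"
      by (simp add: has_real_derivative_iff_has_vector_derivative X_def[abs_def])
    from bounded_linear.has_vector_derivative[OF bounded_linear_snd d]
    show "(Y has_real_derivative f (X t) (Y t) * a t) (at t)"
      by (simp add: has_real_derivative_iff_has_vector_derivative Y_def[abs_def])
  qed
  have small: "\<bar>X t\<bar> \<le> \<delta>" "\<bar>X t\<bar> < \<delta>" if "t \<in> {0..t1}" for t using XY(2)[OF that] by (auto simp: V_def)
  have bnd: "\<bar>f (X t) (Y t)\<bar> \<le> 2" if "0 < t" "t < t1" for t
  proof (rule leaf.bound)
    have "(X t, Y t) \<noteq> (0, 0)" using a(1)[of t] XY(1)[of t] that origin by auto
    moreover have "(X t, Y t) \<in> W" using XY(2)[of t] that VW by auto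
    ultimately show "(X t, Y t) \<in> {- \<epsilon>..\<epsilon>} \<times> {- \<epsilon>..\<epsilon>} - {(0, 0)}" by (auto simp: W)
  qed
  show ?thesis
  proof (cases "X t1 \<ge> 0")
    case True
    obtain \<phi> where \<phi>: "\<forall>x\<in>{0<..<X t1}. (\<phi> has_real_derivative f x (\<phi> x)) (at x) \<and> \<bar>\<phi> x\<bar> \<le> 2 * x"
      "\<forall>t\<in>{0..t1}. \<phi> (X t) = Y t" "strict_mono_on {0..t1} X" "X ` {0..t1} = {0..X t1}"
      using regular_curve_is_graph[OF \<gamma>(1) cXY start dX dY _ bnd True] a(2) by auto
    have g: "leaf.right_germ (X t1) \<phi>" using \<phi>(1) by (simp add: leaf.right_germ_def)
    have "same_germ p (path_image \<gamma>) ((\<lambda>t. \<Theta> (1 * t, 0)) ` {0..1})"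
    proof (rule germ_on_axis[OF _ \<gamma>(3,4,1,2) XY(1) small(1)])
      fix t assume t: "0 \<le> t" "t < t1"
      show "Y t = \<Phi> (X t) 0"
      proof (cases "t = 0")
        case True
        thus ?thesis using start \<Phi>_near[of 0 0] \<delta>(1) by simp
      next
        case False
        have X: "0 < X t" "X t < X t1"
          using strict_mono_onD[OF \<phi>(3), of 0 t] strict_mono_onD[OF \<phi>(3), of t t1] t False start by auto
        have "\<phi> (X t) = R.flow (X t) 0"
          using small[of t1] \<gamma>(1) \<delta> X
          by (intro leaf.right_germ_unique[OF g flow_right_germ]) auto
        thus ?thesis using \<phi>(2) t X \<Phi>_right[of "X t" 0] \<delta>(1) by auto
      qed
    qed (use \<phi>(3,4) start in simp_all)
    thus ?thesis using \<gamma>(5) by (simp add: s_axis)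
  next
    case False
    have "\<exists>\<phi>. (\<forall>x\<in>{0<..<- X t1}. (\<phi> has_real_derivative - f (- x) (\<phi> x)) (at x) \<and> \<bar>\<phi> x\<bar> \<le> 2 * x) \<and>
      (\<forall>t\<in>{0..t1}. \<phi> (- X t) = Y t) \<and> strict_mono_on {0..t1} (\<lambda>t. - X t) \<and> (\<lambda>t. - X t) ` {0..t1} = {0..- X t1}"
      by (rule regular_curve_is_graph[where a = "\<lambda>t. - a t"])
        (use \<gamma>(1) cXY start dX dY bnd a(2) False in \<open>auto intro!: continuous_intros derivative_intros\<close>)
    then obtain \<phi> where \<phi>: "\<forall>x\<in>{0<..<- X t1}. (\<phi> has_real_derivative - f (- x) (\<phi> x)) (at x) \<and> \<bar>\<phi> x\<bar> \<le> 2 * x"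
      "\<forall>t\<in>{0..t1}. \<phi> (- X t) = Y t" "strict_mono_on {0..t1} (\<lambda>t. - X t)" "(\<lambda>t. - X t) ` {0..t1} = {0..- X t1}"
      by blast
    have g: "leaf.left_germ (- X t1) \<phi>" using \<phi>(1) by (simp add: leaf.left_germ_def)
    have "same_germ p (path_image \<gamma>) ((\<lambda>t. \<Theta> (- 1 * t, 0)) ` {0..1})"
    proof (rule germ_on_axis[OF _ \<gamma>(3,4,1,2) XY(1) small(1)])
      fix t assume t: "0 \<le> t" "t < t1"
      show "Y t = \<Phi> (X t) 0"
      proof (cases "t = 0")
        case True
        thus ?thesis using start \<Phi>_near[of 0 0] \<delta>(1) by simp
      next
        case False
        have X: "0 < - X t" "- X t < - X t1"
          using strict_mono_onD[OF \<phi>(3), of 0 t] strict_mono_onD[OF \<phi>(3), of t t1] t False start by auto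
        have "\<phi> (- X t) = L.flow (- X t) 0"
          using small[of t1] \<gamma>(1) \<delta> X
          by (intro leaf.left_germ_unique[OF g flow_left_germ]) auto
        thus ?thesis using \<phi>(2) t X \<Phi>_left[of "X t" 0] by auto
      qed
    qed (use \<phi>(3,4) start in simp_all)
    thus ?thesis using \<gamma>(5) by (simp add: s_axis)
  qed
qed

lemma \<Theta>_product_chart: "\<exists>\<Theta>'. product_chart \<A> \<alpha> i p \<Theta> \<Theta>' (\<Theta> ` ({-1..1} \<times> {-1..1})) sR sL"
proof -
  obtain \<Theta>' where \<Theta>': "homeomorphism ({-1..1} \<times> {-1..1}) (\<Theta> ` ({-1..1} \<times> {-1..1})) \<Theta> \<Theta>'"
    using homeomorphism_compact[OF compact_Times[OF compact_Icc compact_Icc] \<Theta>_continuous refl \<Theta>_inj] by blast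
  have "product_chart \<A> \<alpha> i p \<Theta> \<Theta>' (\<Theta> ` ({-1..1} \<times> {-1..1})) sR sL"
  proof
    show "homeomorphism ({-1..1} \<times> {-1..1}) (\<Theta> ` ({-1..1} \<times> {-1..1})) \<Theta> \<Theta>'" by (rule \<Theta>')
    show "leaf_arc \<A> \<alpha> i (\<Theta> ` ({-1..1} \<times> {c}))" if c: "c \<in> {-1..1}" "c \<noteq> 0" for c
      unfolding leaf_arc_def
    proof (intro exI conjI)
      have b: "\<bar>2 * t + - 1\<bar> \<le> 1" if "t \<in> {0..1}" for t :: real using that by auto
      show "arc (\<lambda>t. \<Theta> (2 * t + - 1, c))" using c b by (intro \<Theta>_arc) auto
      have "{-1..1::real} \<times> {c} = (\<lambda>t. (2 * t + - 1, c)) ` {0..1}"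
      proof (intro equalityI subsetI)
        fix z assume "z \<in> {-1..1::real} \<times> {c}"
        thus "z \<in> (\<lambda>t. (2 * t + - 1, c)) ` {0..1}"
          by (intro image_eqI[of _ _ "(fst z + 1) / 2"]) (auto simp: field_simps)
      qed auto
      thus "path_image (\<lambda>t. \<Theta> (2 * t + - 1, c)) = \<Theta> ` ({-1..1} \<times> {c})"
        by (simp add: path_image_def image_image)
      show "line_of_curvature \<A> \<alpha> i (\<lambda>t. \<Theta> (2 * t + - 1, c)) {0..1}"
        using c b by (intro \<Theta>_leaf) auto
    qed
    show "half_leaf \<A> \<alpha> i p sR" "half_leaf \<A> \<alpha> i p sL"
      using half_leaf_axis[of 1] half_leaf_axis[of "-1"] by (simp_all add: s_axis)
  qed (use \<Theta>_0 p_interior half_leaf_germ in \<open>auto simp: sR_def sL_def\<close>)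
  thus ?thesis by blast
qed

text \<open>Arcs inside the separatrices: the germ is the same, and the arc stays strictly inside the square.\<close>
lemma axis_subarc:
  assumes e: "\<bar>e\<bar> = 1"
  shows "arc (\<lambda>t. \<Theta> (e * (t / 2), 0))" "pathstart (\<lambda>t. \<Theta> (e * (t / 2), 0)) = p"
    "same_germ p (path_image (\<lambda>t. \<Theta> (e * (t / 2), 0))) ((\<lambda>t. \<Theta> (e * t, 0)) ` {0..1})"
proof -
  have arc1: "arc (\<lambda>t. \<Theta> ((e / 2) * t + 0, 0))" using e by (intro \<Theta>_arc) (auto simp: abs_mult)
  thus arc2: "arc (\<lambda>t. \<Theta> (e * (t / 2), 0))" by (simp add: mult.commute)
  show start: "pathstart (\<lambda>t. \<Theta> (e * (t / 2), 0)) = p" by (simp add: pathstart_def \<Theta>_0)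
  have arc3: "arc (\<lambda>t. \<Theta> (e * t + 0, 0))" using e by (intro \<Theta>_arc) (auto simp: abs_mult)
  show "same_germ p (path_image (\<lambda>t. \<Theta> (e * (t / 2), 0))) ((\<lambda>t. \<Theta> (e * t, 0)) ` {0..1})"
    unfolding path_image_def
  proof (rule same_germ_initial_arcs[where t = 1 and u = "1/2"])
    have "{0..1/2} = (\<lambda>t. t / 2) ` {0..1::real}"
      by (simp add: image_divide_atLeastAtMost)
    thus "(\<lambda>t. \<Theta> (e * (t / 2), 0)) ` {0..1} = (\<lambda>t. \<Theta> (e * t, 0)) ` {0..1/2}"
      by (simp only: image_image)
  qed (use arc2 arc3 \<Theta>_0 in \<open>auto simp: arc_def path_def\<close>)
qed

text \<open>The position of the separatrices in the coordinates, needed for the cyclic order, is the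
  position of the solutions through the origin: above the positive \<open>x\<close>-axis, and between
  the negative \<open>x\<close>-axis and the antidiagonal.\<close>
theorem two_hyperbolic_sectors:
  "\<exists>s s' \<sigma> \<sigma>'. exactly_two_separatrices \<A> \<alpha> i p s s' \<and> divides_into_two_hyperbolic_sectors \<A> \<alpha> i p s s' \<and>
    arc \<sigma> \<and> pathstart \<sigma> = p \<and> same_germ p (path_image \<sigma>) s \<and>
    arc \<sigma>' \<and> pathstart \<sigma>' = p \<and> same_germ p (path_image \<sigma>') s' \<and>
    (\<forall>t\<in>{0<..1}. \<exists>x y. (x, y) \<in> W \<and> \<sigma> t = \<psi> (x, y) \<and> 0 < x \<and> 0 < y) \<and>
    (\<forall>t\<in>{0<..1}. \<exists>x y. (x, y) \<in> W \<and> \<sigma>' t = \<psi> (x, y) \<and> x < 0 \<and> 0 < y \<and> y < - x)"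
proof -
  obtain \<Theta>' where "product_chart \<A> \<alpha> i p \<Theta> \<Theta>' (\<Theta> ` ({-1..1} \<times> {-1..1})) sR sL"
    using \<Theta>_product_chart by blast
  then interpret product_chart \<A> \<alpha> i p \<Theta> \<Theta>' "\<Theta> ` ({-1..1} \<times> {-1..1})" sR sL .
  have right: "\<exists>x y. (x, y) \<in> W \<and> \<Theta> (1 * (t / 2), 0) = \<psi> (x, y) \<and> 0 < x \<and> 0 < y" if t: "t \<in> {0<..1}" for t
  proof -
    let ?x = "\<delta> * (1 * (t / 2))"
    have x: "0 < ?x" "?x < \<delta>" using t \<delta>(1) by auto
    hence "0 < R.flow ?x 0" by (rule leaf.right_germ_pos[OF flow_right_germ[OF order_refl] \<delta>(3)])
    hence pos: "0 < \<Phi> ?x (\<delta> * 0)" using x \<Phi>_right[of ?x 0] \<delta>(1) by simp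
    have "(?x, \<Phi> ?x (\<delta> * 0)) \<in> W" by (rule \<Theta>_in_W) (use t in auto)
    moreover have "\<Theta> (1 * (t / 2), 0) = \<psi> (?x, \<Phi> ?x (\<delta> * 0))" unfolding \<Theta>_def fst_conv snd_conv ..
    ultimately show ?thesis using x(1) pos by blast
  qed
  have left: "\<exists>x y. (x, y) \<in> W \<and> \<Theta> (- 1 * (t / 2), 0) = \<psi> (x, y) \<and> x < 0 \<and> 0 < y \<and> y < - x" if t: "t \<in> {0<..1}" for t
  proof -
    let ?x = "\<delta> * (- 1 * (t / 2))"
    have x: "0 < - ?x" "- ?x < \<delta>" using t \<delta>(1) by auto
    note loc = leaf.left_germ_location[OF flow_left_germ[OF order_refl] \<delta>(3) x]
    have "\<Phi> ?x (\<delta> * 0) = L.flow (- ?x) 0" using x(1) \<Phi>_left[of ?x 0] by simp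
    hence loc': "0 < \<Phi> ?x (\<delta> * 0)" "\<Phi> ?x (\<delta> * 0) < - ?x" using loc by simp_all
    have "(?x, \<Phi> ?x (\<delta> * 0)) \<in> W" by (rule \<Theta>_in_W) (use t in auto)
    moreover have "\<Theta> (- 1 * (t / 2), 0) = \<psi> (?x, \<Phi> ?x (\<delta> * 0))" unfolding \<Theta>_def fst_conv snd_conv ..
    moreover have "?x < 0" using x(1) by simp
    ultimately show ?thesis using loc' by blast
  qed
  have one: "\<bar>1 :: real\<bar> = 1" "\<bar>- 1 :: real\<bar> = 1" by simp_all
  show ?thesis
    by (rule exI[of _ sR], rule exI[of _ sL], rule exI[of _ "\<lambda>t. \<Theta> (1 * (t / 2), 0)"],
        rule exI[of _ "\<lambda>t. \<Theta> (- 1 * (t / 2), 0)"], intro conjI ballI two_separatrices two_sectors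
        axis_subarc(1,2)[OF one(1)] axis_subarc(1,2)[OF one(2)]
        axis_subarc(3)[OF one(1), folded s_axis] axis_subarc(3)[OF one(2), folded s_axis] right left)
qed

end

section \<open>Cyclic order of arcs\<close>

lemma first_exit:
  fixes g :: "real \<Rightarrow> real"
  assumes c: "continuous_on {0..1} g" and r: "g 0 < r" "r < g 1"
  obtains u where "0 < u" "u < 1" "g u = r" "\<And>t. \<lbrakk>0 \<le> t; t < u\<rbrakk> \<Longrightarrow> g t < r"
proof -
  define E where "E = {t \<in> {0..1}. g t = r}"
  have "\<exists>t\<ge>0. t \<le> 1 \<and> g t = r" using IVT'[of g 0 r 1] c r by auto
  hence "E \<noteq> {}" by (auto simp: E_def)
  moreover have "compact E"
  proof -
    have "E = {0..1} \<inter> g -` {r}" by (auto simp: E_def)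
    hence "closed E" using continuous_closed_preimage[OF c, of "{r}"] by simp
    moreover have "bounded E" by (rule bounded_subset[of "{0..1}"]) (auto simp: E_def)
    ultimately show ?thesis by (simp add: compact_eq_bounded_closed)
  qed
  ultimately obtain u where u: "u \<in> E" "\<And>t. t \<in> E \<Longrightarrow> u \<le> t" using compact_attains_inf[of E] by blast
  have u': "0 \<le> u" "u \<le> 1" "g u = r" using u(1) by (auto simp: E_def)
  hence "u \<noteq> 0" "u \<noteq> 1" using r by auto
  hence u01: "0 < u" "u < 1" using u' by auto
  have "g t < r" if t: "0 \<le> t" "t < u" for t
  proof (rule ccontr)
    assume "\<not> g t < r"
    moreover have "continuous_on {0..t} g" by (rule continuous_on_subset[OF c]) (use t u01 in auto)
    ultimately have "\<exists>s\<ge>0. s \<le> t \<and> g s = r" using IVT'[of g 0 r t] t r by auto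
    then obtain s where "0 \<le> s" "s \<le> t" "g s = r" by blast
    thus False using u(2)[of s] t u01 by (simp add: E_def)
  qed
  thus ?thesis using that[OF u01 u'(3)] by blast
qed

text \<open>Arcs in disjoint angular sectors of a chart are ordered as these sectors. The disk is a small
  round one, and the arcs are cut off where they first leave it; neither their germs nor their
  sectors change.\<close>
lemma cyclically_ordered4_sectors:
  fixes p :: "'m::t2_space" and \<Phi> :: "'m \<Rightarrow> complex" and lo hi :: "nat \<Rightarrow> real" and \<sigma> :: "nat \<Rightarrow> real \<Rightarrow> 'm"
  assumes h: "homeomorphism U V \<Phi> \<Psi>" and O: "open U" "open V" and p: "p \<in> U" "\<Phi> p = 0"
    and \<sigma>: "\<And>k. k < 4 \<Longrightarrow> arc (\<sigma> k)" "\<And>k. k < 4 \<Longrightarrow> pathstart (\<sigma> k) = p"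
      "\<And>k. k < 4 \<Longrightarrow> path_image (\<sigma> k) \<subseteq> U" "\<And>k. k < 4 \<Longrightarrow> same_germ p (path_image (\<sigma> k)) (l k)"
    and angle: "\<And>k t. \<lbrakk>k < 4; t \<in> {0<..1}\<rbrakk> \<Longrightarrow>
      \<exists>\<theta>. lo k < \<theta> \<and> \<theta> < hi k \<and> \<Phi> (\<sigma> k t) = of_real (cmod (\<Phi> (\<sigma> k t))) * cis \<theta>"
    and order: "hi 0 \<le> lo 1" "hi 1 \<le> lo 2" "hi 2 \<le> lo 3" "hi 3 \<le> lo 0 + 2 * pi"
  shows "cyclically_ordered4 p l"
proof -
  have less4: "k = 0 \<or> k = 1 \<or> k = 2 \<or> k = 3" if "k < 4" for k :: nat using that by arith
  have \<Phi>\<Psi>: "\<Phi> x \<in> V" "\<Psi> (\<Phi> x) = x" if "x \<in> U" for x using h that by (auto simp: homeomorphism_def)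
  have \<Psi>\<Phi>: "\<Psi> z \<in> U" "\<Phi> (\<Psi> z) = z" if "z \<in> V" for z using h that by (auto simp: homeomorphism_def)
  have U: "\<sigma> k t \<in> U" if "k < 4" "t \<in> {0..1}" for k t
    using \<sigma>(3)[OF that(1)] that(2) by (auto simp: path_image_def)
  have start: "\<sigma> k 0 = p" if "k < 4" for k using \<sigma>(2)[OF that] by (simp add: pathstart_def)
  have path: "continuous_on {0..1} (\<sigma> k)" "inj_on (\<sigma> k) {0..1}" if "k < 4" for k
    using \<sigma>(1)[OF that] by (auto simp: arc_def path_def)
  have nz: "\<Phi> (\<sigma> k t) \<noteq> 0" if k: "k < 4" and t: "t \<in> {0<..1}" for k t
  proof
    assume "\<Phi> (\<sigma> k t) = 0"
    hence "\<sigma> k t = p" using \<Phi>\<Psi>(2)[OF U[OF k, of t]] \<Phi>\<Psi>(2)[OF p(1)] p(2) t by auto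
    hence "t = 0" using inj_onD[OF path(2)[OF k], of t 0] start[OF k] t by auto
    thus False using t by simp
  qed
  have "0 \<in> V" using \<Phi>\<Psi>(1)[OF p(1)] p(2) by simp
  then obtain e where e: "e > 0" "cball 0 e \<subseteq> V" using O(2) open_contains_cball by blast
  define N where "N = Min ((\<lambda>k. cmod (\<Phi> (\<sigma> k 1))) ` {..<4})"
  have "{..<4::nat} \<noteq> {}" by (metis empty_iff lessThan_iff zero_less_numeral)
  hence "N > 0" unfolding N_def using nz by (subst Min_gr_iff) auto
  have N: "N \<le> cmod (\<Phi> (\<sigma> k 1))" if "k < 4" for k unfolding N_def using that by (intro Min_le) auto
  \<comment> \<open>The circle of this radius lies in the chart and separates \<open>p\<close> from the ends of the arcs.\<close>
  define \<rho> where "\<rho> = min e (N / 2)"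
  have \<rho>: "\<rho> > 0" "\<rho> \<le> e" "\<rho> < N" using e(1) \<open>N > 0\<close> by (auto simp: \<rho>_def)
  have \<rho>V: "cball 0 \<rho> \<subseteq> V" using e(2) \<rho>(2) by (meson order_trans subset_cball)
  have "\<forall>k. \<exists>u. k < 4 \<longrightarrow> 0 < u \<and> u < 1 \<and> cmod (\<Phi> (\<sigma> k u)) = \<rho> \<and> (\<forall>t. 0 \<le> t \<longrightarrow> t < u \<longrightarrow> cmod (\<Phi> (\<sigma> k t)) < \<rho>)"
  proof (rule allI)
    fix k
    show "\<exists>u. k < 4 \<longrightarrow> 0 < u \<and> u < 1 \<and> cmod (\<Phi> (\<sigma> k u)) = \<rho> \<and> (\<forall>t. 0 \<le> t \<longrightarrow> t < u \<longrightarrow> cmod (\<Phi> (\<sigma> k t)) < \<rho>)"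
    proof (cases "k < 4")
      case True
      have "continuous_on {0..1} (\<lambda>t. \<Phi> (\<sigma> k t))"
        using U[OF True] by (intro continuous_on_compose2[OF homeomorphism_cont1[OF h] path(1)[OF True]]) blast
      hence "continuous_on {0..1} (\<lambda>t. cmod (\<Phi> (\<sigma> k t)))" by (rule continuous_on_norm)
      moreover have "cmod (\<Phi> (\<sigma> k 0)) < \<rho>" using start[OF True] p(2) \<rho> by simp
      moreover have "\<rho> < cmod (\<Phi> (\<sigma> k 1))" using N[OF True] \<rho> by simp
      ultimately show ?thesis by (rule first_exit) blast
    qed simp
  qed
  then obtain u where u: "\<And>k. k < 4 \<Longrightarrow> 0 < u k \<and> u k < 1 \<and> cmod (\<Phi> (\<sigma> k (u k))) = \<rho> \<and>
      (\<forall>t. 0 \<le> t \<longrightarrow> t < u k \<longrightarrow> cmod (\<Phi> (\<sigma> k t)) < \<rho>)" by metis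
  define \<gamma> where "\<gamma> k t = \<sigma> k (u k * t)" for k t
  have ut: "u k * t \<in> {0..1}" "t > 0 \<Longrightarrow> u k * t \<in> {0<..1}" if "k < 4" "t \<in> {0..1}" for k t
    using u[OF that(1)] that(2) mult_le_one[of "u k" t] by auto
  have \<gamma>: "arc (\<gamma> k)" "pathstart (\<gamma> k) = p" "path_image (\<gamma> k) = \<sigma> k ` {0..u k}" if k: "k < 4" for k
  proof -
    have "continuous_on {0..1} (\<lambda>t. u k * t)" by (intro continuous_intros)
    hence "continuous_on {0..1} (\<lambda>t. \<sigma> k (u k * t))"
      by (rule continuous_on_compose2[OF path(1)[OF k]]) (use ut(1)[OF k] in blast)
    moreover have "inj_on (\<gamma> k) {0..1}"
    proof (rule inj_onI)
      fix s t assume s: "s \<in> {0..1}" and t: "t \<in> {0..1}" and eq: "\<gamma> k s = \<gamma> k t"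
      have "u k * s = u k * t"
        by (rule inj_onD[OF path(2)[OF k] eq[unfolded \<gamma>_def] ut(1)[OF k s] ut(1)[OF k t]])
      thus "s = t" using u[OF k] by auto
    qed
    ultimately show "arc (\<gamma> k)" by (simp add: arc_def path_def \<gamma>_def[abs_def])
    show "pathstart (\<gamma> k) = p" using start[OF k] by (simp add: pathstart_def \<gamma>_def)
    have "(\<lambda>t. u k * t) ` {0..1} = {0..u k}" using u[OF k] image_mult_atLeastAtMost[of "u k" 0 1] by simp
    moreover have "path_image (\<gamma> k) = \<sigma> k ` (\<lambda>t. u k * t) ` {0..1}"
      unfolding path_image_def image_image \<gamma>_def ..
    ultimately show "path_image (\<gamma> k) = \<sigma> k ` {0..u k}" by (simp only:)
  qed
  define D where "D = \<Psi> ` cball 0 \<rho>"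
  define f where "f q = \<Phi> q / of_real \<rho>" for q
  have D: "q \<in> D \<longleftrightarrow> q \<in> U \<and> cmod (\<Phi> q) \<le> \<rho>" for q
  proof
    assume "q \<in> D"
    then obtain z where "z \<in> cball 0 \<rho>" "q = \<Psi> z" by (auto simp: D_def)
    thus "q \<in> U \<and> cmod (\<Phi> q) \<le> \<rho>" using \<Psi>\<Phi>[of z] \<rho>V by auto
  next
    assume "q \<in> U \<and> cmod (\<Phi> q) \<le> \<rho>"
    hence "q = \<Psi> (\<Phi> q)" "\<Phi> q \<in> cball 0 \<rho>" using \<Phi>\<Psi>(2) by auto
    thus "q \<in> D" unfolding D_def by blast
  qed
  have hD: "homeomorphism D (cball 0 1) f (\<lambda>z. \<Psi> (of_real \<rho> * z))"
  proof (rule homeomorphismI)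
    have "continuous_on D \<Phi>" using homeomorphism_cont1[OF h] by (rule continuous_on_subset) (auto simp: D)
    thus "continuous_on D f" unfolding f_def using \<rho> by (intro continuous_intros) auto
    have in_V: "of_real \<rho> * z \<in> cball 0 \<rho>" if "z \<in> cball 0 1" for z :: complex
      using that \<rho> by (simp add: norm_mult)
    have "continuous_on (cball 0 1) (\<lambda>z :: complex. of_real \<rho> * z)" by (intro continuous_intros)
    thus "continuous_on (cball 0 1) (\<lambda>z. \<Psi> (of_real \<rho> * z))"
      by (rule continuous_on_compose2[OF homeomorphism_cont2[OF h]]) (use in_V \<rho>V in blast)
    show "f ` D \<subseteq> cball 0 1" using \<rho> by (auto simp: f_def D norm_divide)
    show "(\<lambda>z. \<Psi> (of_real \<rho> * z)) ` cball 0 1 \<subseteq> D" unfolding D_def using in_V by blast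
    show "\<Psi> (of_real \<rho> * f q) = q" if "q \<in> D" for q using that D \<rho> \<Phi>\<Psi>(2) by (simp add: f_def)
    show "f (\<Psi> (of_real \<rho> * z)) = z" if "z \<in> cball 0 1" for z
      using \<Psi>\<Phi>(2)[of "of_real \<rho> * z"] in_V[OF that] \<rho>V \<rho> by (auto simp: f_def)
  qed
  have int: "p \<in> interior D"
  proof -
    have "open (\<Phi> -` ball 0 \<rho> \<inter> U)"
      using continuous_on_open_vimage[OF O(1)] homeomorphism_cont1[OF h] open_ball by blast
    moreover have "p \<in> \<Phi> -` ball 0 \<rho> \<inter> U" using p \<rho> by simp
    moreover have "\<Phi> -` ball 0 \<rho> \<inter> U \<subseteq> D" by (intro subsetI) (simp add: D)
    ultimately show ?thesis by (rule interiorI)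
  qed
  have "\<forall>k. \<exists>\<theta>. k < 4 \<longrightarrow> lo k < \<theta> \<and> \<theta> < hi k \<and> \<Phi> (\<sigma> k (u k)) = of_real \<rho> * cis \<theta>"
  proof (rule allI)
    fix k
    show "\<exists>\<theta>. k < 4 \<longrightarrow> lo k < \<theta> \<and> \<theta> < hi k \<and> \<Phi> (\<sigma> k (u k)) = of_real \<rho> * cis \<theta>"
    proof (cases "k < 4")
      case True
      thus ?thesis using angle[OF True, of "u k"] u[OF True] by auto
    qed simp
  qed
  then obtain \<theta> where \<theta>: "\<And>k. k < 4 \<Longrightarrow> lo k < \<theta> k \<and> \<theta> k < hi k \<and> \<Phi> (\<sigma> k (u k)) = of_real \<rho> * cis (\<theta> k)" by metis
  have fin: "pathfinish (\<gamma> k) = \<sigma> k (u k)" for k by (simp add: pathfinish_def \<gamma>_def)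
  have arcs: "arc (\<gamma> k) \<and> pathstart (\<gamma> k) = p \<and> path_image (\<gamma> k) \<subseteq> D \<and>
           {x \<in> path_image (\<gamma> k). f x \<in> sphere 0 1} = {pathfinish (\<gamma> k)} \<and>
           f (pathfinish (\<gamma> k)) = cis (\<theta> k) \<and> same_germ p (path_image (\<gamma> k)) (l k)" if k: "k < 4" for k
  proof (intro conjI)
    note uk = u[OF k]
    show "arc (\<gamma> k)" "pathstart (\<gamma> k) = p" by (rule \<gamma>[OF k])+
    have le: "cmod (\<Phi> (\<sigma> k t)) \<le> \<rho>" if "t \<in> {0..u k}" for t
      using uk that by (cases "t = u k") (auto intro: less_imp_le)
    show "path_image (\<gamma> k) \<subseteq> D" unfolding \<gamma>(3)[OF k] using le D U[OF k] uk by auto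
    have s: "f x \<in> sphere 0 1 \<longleftrightarrow> cmod (\<Phi> x) = \<rho>" for x using \<rho> by (auto simp: f_def norm_divide field_simps)
    show "{x \<in> path_image (\<gamma> k). f x \<in> sphere 0 1} = {pathfinish (\<gamma> k)}"
    proof (intro equalityI subsetI)
      fix x assume "x \<in> {x \<in> path_image (\<gamma> k). f x \<in> sphere 0 1}"
      then obtain t where t: "t \<in> {0..u k}" "x = \<sigma> k t" "cmod (\<Phi> (\<sigma> k t)) = \<rho>" unfolding \<gamma>(3)[OF k] s by auto
      hence "\<not> t < u k" using uk by auto
      thus "x \<in> {pathfinish (\<gamma> k)}" using t by (simp add: fin)
    next
      fix x assume "x \<in> {pathfinish (\<gamma> k)}"
      thus "x \<in> {x \<in> path_image (\<gamma> k). f x \<in> sphere 0 1}" unfolding \<gamma>(3)[OF k] s using uk by (auto simp: fin)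
    qed
    show "f (pathfinish (\<gamma> k)) = cis (\<theta> k)" using \<theta>[OF k] \<rho> by (simp add: f_def fin)
    have "same_germ p (\<gamma> k ` {0..1}) (\<sigma> k ` {0..1})"
    proof (rule same_germ_initial_arcs[where t = 1 and u = "u k"])
      show "continuous_on {0..1} (\<gamma> k)" "inj_on (\<gamma> k) {0..1}" using \<gamma>(1)[OF k] by (auto simp: arc_def path_def)
      show "\<gamma> k ` {0..1} = \<sigma> k ` {0..u k}" using \<gamma>(3)[OF k] by (simp add: path_image_def)
      show "\<gamma> k 0 = p" using start[OF k] by (simp add: \<gamma>_def)
    qed (use path[OF k] start[OF k] uk in auto)
    thus "same_germ p (path_image (\<gamma> k)) (l k)" using \<sigma>(4)[OF k]
      unfolding same_germ_def path_image_def by eventually_elim blast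
  qed
  have inter: "path_image (\<gamma> k) \<inter> path_image (\<gamma> k') = {p}" if k: "k < k'" "k' < 4" for k k'
  proof (intro equalityI subsetI)
    have k4: "k < 4" using k by simp
    fix x assume "x \<in> path_image (\<gamma> k) \<inter> path_image (\<gamma> k')"
    then obtain s t where s: "s \<in> {0..u k}" "x = \<sigma> k s" and t: "t \<in> {0..u k'}" "x = \<sigma> k' t"
      unfolding \<gamma>(3)[OF k4] \<gamma>(3)[OF k(2)] by auto
    show "x \<in> {p}"
    proof (rule ccontr)
      assume x: "x \<notin> {p}"
      have s': "s \<in> {0<..1}" using s x start[OF k4] u[OF k4] by (cases "s = 0") auto
      have t': "t \<in> {0<..1}" using t x start[OF k(2)] u[OF k(2)] by (cases "t = 0") auto
      obtain a where a: "lo k < a" "a < hi k" "\<Phi> x = of_real (cmod (\<Phi> x)) * cis a" using angle[OF k4 s'] s(2) by auto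
      obtain b where b: "lo k' < b" "b < hi k'" "\<Phi> x = of_real (cmod (\<Phi> x)) * cis b" using angle[OF k(2) t'] t(2) by auto
      have "\<Phi> x \<noteq> 0" using nz[OF k4 s'] s(2) by simp
      hence "cis a = cis b" using a(3) b(3) by (metis mult_cancel_left mult_zero_left)
      moreover have "a < b" "b < a + 2 * pi"
      proof -
        have lh: "lo i < hi i" if "i < 4" for i
          using \<theta>[OF that] by linarith
        show "a < b" "b < a + 2 * pi"
          using less4[OF k4] less4[OF k(2)] k(1) a b order lh[of 0] lh[of 1] lh[of 2] lh[of 3] by auto
      qed
      moreover have "cis a = cis b \<longleftrightarrow> cis (b - a) = 1" by (metis cis_divide cis_neq_zero divide_self_if right_inverse_eq)
      ultimately have "cos (b - a) = 1" by (metis cis.sel(1) one_complex.sel(1))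
      then obtain n :: int where "b - a = n * 2 * pi" using cos_one_2pi_int by auto
      moreover have "0 < b - a" "b - a < 2 * pi" using \<open>a < b\<close> \<open>b < a + 2 * pi\<close> by auto
      ultimately have "0 < n" "n < 1" by (auto simp: zero_less_mult_iff)
      thus False by simp
    qed
  next
    fix x assume "x \<in> {p}"
    moreover have "p \<in> \<sigma> i ` {0..u i}" if "i < 4" for i
      using start[OF that] u[OF that] by (intro image_eqI[of _ _ 0]) auto
    ultimately show "x \<in> path_image (\<gamma> k) \<inter> path_image (\<gamma> k')"
      using k \<gamma>(3)[of k] \<gamma>(3)[of k'] by auto
  qed
  have "path_image (\<gamma> k) \<inter> path_image (\<gamma> k') = {p}" if "k < 4" "k' < 4" "k \<noteq> k'" for k k'
    using inter[of k k'] inter[of k' k] that by (cases "k < k'") auto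
  moreover have "\<theta> 0 < \<theta> 1 \<and> \<theta> 1 < \<theta> 2 \<and> \<theta> 2 < \<theta> 3 \<and> \<theta> 3 < \<theta> 0 + 2 * pi"
    using \<theta>[of 0] \<theta>[of 1] \<theta>[of 2] \<theta>[of 3] order by auto
  ultimately show ?thesis unfolding cyclically_ordered4_def using hD int arcs
    by (intro exI[of _ D] exI[of _ f] exI[of _ "\<lambda>z. \<Psi> (of_real \<rho> * z)"] exI[of _ \<gamma>] exI[of _ \<theta>]) blast
qed

text \<open>The bounds on the slope \<open>b / a\<close> are strict, so that the angle stays in an open sector around
  \<open>\<beta>\<close>.\<close>
lemma angle_of_slope:
  assumes a: "a > 0" and z: "z = cis \<beta> * Complex a b" and b: "s * a < b" "b < t * a"
  shows "\<exists>\<theta>. \<beta> + arctan s < \<theta> \<and> \<theta> < \<beta> + arctan t \<and> z = of_real (cmod z) * cis \<theta>"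
proof (intro exI conjI)
  show "\<beta> + arctan s < \<beta> + arctan (b / a)" "\<beta> + arctan (b / a) < \<beta> + arctan t"
    using a b by (auto intro!: arctan_monotone simp: field_simps)
  have "cmod z = sqrt (a\<^sup>2 + b\<^sup>2)" unfolding z norm_mult norm_cis complex_norm by simp
  moreover have "sqrt (a\<^sup>2 + b\<^sup>2) = a * sqrt (1 + (b / a)\<^sup>2)"
  proof -
    have "a\<^sup>2 + b\<^sup>2 = a\<^sup>2 * (1 + (b / a)\<^sup>2)" using a by (simp add: field_simps)
    thus ?thesis using a by (simp add: real_sqrt_mult)
  qed
  moreover have "sqrt (1 + (b / a)\<^sup>2) \<noteq> 0" by (simp add: add_nonneg_eq_0_iff)
  ultimately have "of_real (cmod z) * cis (arctan (b / a)) = Complex a b"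
    using a by (simp add: complex_eq_iff cos_arctan sin_arctan)
  thus "z = of_real (cmod z) * cis (\<beta> + arctan (b / a))" using z by (simp add: cis_mult[symmetric] mult_ac)
qed

section \<open>Calculus of maps of class \<open>C\<^sup>r\<close>\<close>

lemma Cr_on_subset: "Cr_on r f S \<Longrightarrow> T \<subseteq> S \<Longrightarrow> Cr_on r f T"
  by (induction r arbitrary: f) (auto intro: continuous_on_subset)

lemma Cr_on_Suc_imp: "Cr_on (Suc r) f S \<Longrightarrow> Cr_on r f S"
proof (induction r arbitrary: f)
  case 0
  thus ?case by (auto intro!: differentiable_imp_continuous_on simp: differentiable_on_def
        differentiable_at_withinI)
next
  case (Suc r)
  hence "Cr_on (Suc r) (\<lambda>x. frechet_derivative f (at x) v) S" for v by simp
  hence "Cr_on r (\<lambda>x. frechet_derivative f (at x) v) S" for v by (rule Suc.IH)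
  thus ?case using Suc.prems by simp
qed

lemma Cr_on_mono: "Cr_on r f S \<Longrightarrow> k \<le> r \<Longrightarrow> Cr_on k f S"
  by (induction r) (auto simp: le_Suc_eq simp del: Cr_on.simps dest: Cr_on_Suc_imp)

lemma Cr_on_imp_continuous: "Cr_on r f S \<Longrightarrow> continuous_on S f"
  using Cr_on_mono[of r f S 0] by simp

lemma Cr_on_has_derivative:
  "Cr_on (Suc r) f S \<Longrightarrow> x \<in> S \<Longrightarrow> (f has_derivative frechet_derivative f (at x)) (at x)"
  by (simp add: frechet_derivative_works)

text \<open>The recursive definition speaks of the canonical derivative at every point, hence a
  derivative given by other means can be used only up to equality on \<open>S\<close>. The congruence enters
  as an assumption since its own proof, by induction on \<open>r\<close>, uses this lemma.\<close>
lemma Cr_on_SucI: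
  fixes f :: "'a::euclidean_space \<Rightarrow> 'b::real_normed_vector"
  assumes S: "open S" and d: "\<And>x. x \<in> S \<Longrightarrow> (f has_derivative f' x) (at x)"
    and c: "\<And>v. Cr_on r (\<lambda>x. f' x v) S"
    and cong: "\<And>g h :: 'a \<Rightarrow> 'b. \<lbrakk>Cr_on r g S; \<And>x. x \<in> S \<Longrightarrow> g x = h x\<rbrakk> \<Longrightarrow> Cr_on r h S"
  shows "Cr_on (Suc r) f S"
proof -
  have "f' x = frechet_derivative f (at x)" if "x \<in> S" for x using d[OF that] by (rule frechet_derivative_at)
  hence "Cr_on r (\<lambda>x. frechet_derivative f (at x) v) S" for v by (intro cong[OF c[of v]]) simp
  thus ?thesis using d by (auto simp: differentiable_def)
qed

lemma Cr_on_cong: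
  assumes "open S"
  shows "\<lbrakk>Cr_on r f S; \<And>x. x \<in> S \<Longrightarrow> f x = g x\<rbrakk> \<Longrightarrow> Cr_on r g S"
proof (induction r arbitrary: f g)
  case 0
  thus ?case by (auto cong: continuous_on_cong)
next
  case (Suc r)
  have "(g has_derivative frechet_derivative f (at x)) (at x)" if "x \<in> S" for x
    by (rule has_derivative_transform_within_open[OF Cr_on_has_derivative[OF Suc.prems(1) that] assms that])
      (rule Suc.prems(2))
  moreover have "Cr_on r (\<lambda>x. frechet_derivative f (at x) v) S" for v using Suc.prems(1) by simp
  ultimately show ?case using Suc.IH by (rule Cr_on_SucI[OF assms])
qed

lemma Cr_on_derivI:
  assumes S: "open S" and d: "\<And>x. x \<in> S \<Longrightarrow> (f has_derivative f' x) (at x)"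
    and c: "\<And>v. Cr_on r (\<lambda>x. f' x v) S"
  shows "Cr_on (Suc r) f S"
  using d c Cr_on_cong[OF S] by (rule Cr_on_SucI[OF S])

lemma Cr_on_local:
  assumes "\<And>x. x \<in> S \<Longrightarrow> \<exists>T. open T \<and> x \<in> T \<and> Cr_on r f (T \<inter> S)" "open S"
  shows "Cr_on r f S"
  using assms(1)
proof (induction r arbitrary: f)
  case 0
  show ?case unfolding Cr_on.simps
  proof (rule continuous_at_imp_continuous_on, rule ballI)
    fix x assume "x \<in> S"
    then obtain T where "open T" "x \<in> T" "continuous_on (T \<inter> S) f" using 0 by auto
    thus "isCont f x" using \<open>x \<in> S\<close> assms(2) by (metis IntI continuous_on_eq_continuous_at open_Int)
  qed
next
  case (Suc r)
  have "f differentiable (at x)" if "x \<in> S" for x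
    using Suc.prems[OF that] that by auto
  moreover have "Cr_on r (\<lambda>x. frechet_derivative f (at x) v) S" for v
    using Suc.prems by (intro Suc.IH) fastforce
  ultimately show ?case by simp
qed

lemma Cr_on_linear:
  assumes S: "open S" and L: "bounded_linear L"
  shows "Cr_on r f S \<Longrightarrow> Cr_on r (\<lambda>x. L (f x)) S"
proof (induction r arbitrary: f)
  case 0
  thus ?case using bounded_linear.continuous_on[OF L] by simp
next
  case (Suc r)
  have "((\<lambda>x. L (f x)) has_derivative (\<lambda>v. L (frechet_derivative f (at x) v))) (at x)" if "x \<in> S" for x
    by (rule bounded_linear.has_derivative[OF L Cr_on_has_derivative[OF Suc.prems that]])
  moreover have "Cr_on r (\<lambda>x. L (frechet_derivative f (at x) v)) S" for v using Suc by simp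
  ultimately show ?case by (rule Cr_on_derivI[OF S])
qed

lemma Cr_on_const: "open S \<Longrightarrow> Cr_on r (\<lambda>x. c) S"
proof (induction r arbitrary: c)
  case (Suc r)
  show ?case
    by (rule Cr_on_derivI[OF Suc.prems, of _ "\<lambda>x v. 0"]) (use Suc in auto)
qed auto

lemma Cr_on_bounded_linear: "open S \<Longrightarrow> bounded_linear L \<Longrightarrow> Cr_on r L S"
proof (cases r)
  case (Suc k)
  assume S: "open S" and L: "bounded_linear L"
  have "(L has_derivative L) (at x)" for x by (rule bounded_linear_imp_has_derivative[OF L])
  thus ?thesis unfolding Suc
    by (intro Cr_on_derivI[OF S, of _ "\<lambda>x. L"] Cr_on_const[OF S])
qed (simp add: linear_continuous_on)

lemma Cr_on_add:
  assumes S: "open S"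
  shows "\<lbrakk>Cr_on r f S; Cr_on r g S\<rbrakk> \<Longrightarrow> Cr_on r (\<lambda>x. f x + g x) S"
proof (induction r arbitrary: f g)
  case 0
  thus ?case by (auto intro: continuous_on_add)
next
  case (Suc r)
  have "((\<lambda>x. f x + g x) has_derivative (\<lambda>v. frechet_derivative f (at x) v + frechet_derivative g (at x) v)) (at x)"
    if "x \<in> S" for x
    by (intro has_derivative_add Cr_on_has_derivative[OF Suc.prems(1) that] Cr_on_has_derivative[OF Suc.prems(2) that])
  moreover have "Cr_on r (\<lambda>x. frechet_derivative f (at x) v + frechet_derivative g (at x) v) S" for v
    using Suc by simp
  ultimately show ?case by (rule Cr_on_derivI[OF S])
qed

lemma Cr_on_scaleR:
  assumes S: "open S"
  shows "\<lbrakk>Cr_on r f S; Cr_on r g S\<rbrakk> \<Longrightarrow> Cr_on r (\<lambda>x. f x *\<^sub>R g x) S"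
proof (induction r arbitrary: f g)
  case 0
  thus ?case by (auto intro: continuous_on_scaleR)
next
  case (Suc r)
  have "((\<lambda>x. f x *\<^sub>R g x) has_derivative
      (\<lambda>v. f x *\<^sub>R frechet_derivative g (at x) v + frechet_derivative f (at x) v *\<^sub>R g x)) (at x)"
    if "x \<in> S" for x
    by (intro has_derivative_scaleR Cr_on_has_derivative[OF Suc.prems(1) that] Cr_on_has_derivative[OF Suc.prems(2) that])
  moreover have "Cr_on r (\<lambda>x. f x *\<^sub>R frechet_derivative g (at x) v + frechet_derivative f (at x) v *\<^sub>R g x) S" for v
    using Suc.prems Suc.prems[THEN Cr_on_Suc_imp] by (intro Cr_on_add[OF S] Suc.IH) auto
  ultimately show ?case by (rule Cr_on_derivI[OF S])
qed

lemma Cr_on_mult: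
  fixes f g :: "'a::euclidean_space \<Rightarrow> real"
  shows "\<lbrakk>open S; Cr_on r f S; Cr_on r g S\<rbrakk> \<Longrightarrow> Cr_on r (\<lambda>x. f x * g x) S"
  using Cr_on_scaleR[of S r f g] by simp

lemma Cr_on_sum:
  "\<lbrakk>open S; \<And>i. i \<in> I \<Longrightarrow> Cr_on r (f i) S\<rbrakk> \<Longrightarrow> Cr_on r (\<lambda>x. \<Sum>i\<in>I. f i x) S"
  by (induction I rule: infinite_finite_induct) (auto intro: Cr_on_const Cr_on_add)

lemma Cr_on_compose:
  fixes f :: "'a::euclidean_space \<Rightarrow> 'b::euclidean_space" and g :: "'b \<Rightarrow> 'c::real_normed_vector"
  assumes S: "open S" and T: "open T" and im: "f ` S \<subseteq> T"
  shows "\<lbrakk>Cr_on r g T; Cr_on r f S\<rbrakk> \<Longrightarrow> Cr_on r (\<lambda>x. g (f x)) S"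
proof (induction r arbitrary: g)
  case 0
  thus ?case using im by (auto intro: continuous_on_compose2)
next
  case (Suc r)
  let ?Df = "\<lambda>x v. frechet_derivative f (at x) v" and ?Dg = "\<lambda>y w. frechet_derivative g (at y) w"
  have "((\<lambda>x. g (f x)) has_derivative (\<lambda>v. ?Dg (f x) (?Df x v))) (at x)" if "x \<in> S" for x
  proof (rule has_derivative_compose[OF Cr_on_has_derivative[OF Suc.prems(2) that]])
    show "(g has_derivative ?Dg (f x)) (at (f x))"
      by (rule Cr_on_has_derivative[OF Suc.prems(1)]) (use im that in auto)
  qed
  moreover have "Cr_on r (\<lambda>x. ?Dg (f x) (?Df x v)) S" for v
  proof -
    have eq: "?Dg (f x) (?Df x v) = (\<Sum>b\<in>Basis. (?Df x v \<bullet> b) *\<^sub>R ?Dg (f x) b)" if "x \<in> S" for x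
    proof -
      have "linear (?Dg (f x))"
        using Cr_on_has_derivative[OF Suc.prems(1), of "f x"] im that by (auto intro: has_derivative_linear)
      thus ?thesis
        by (subst euclidean_representation[of "?Df x v", symmetric]) (simp add: linear_sum linear_scale)
    qed
    have "Cr_on r (\<lambda>x. \<Sum>b\<in>Basis. (?Df x v \<bullet> b) *\<^sub>R ?Dg (f x) b) S"
    proof (intro Cr_on_sum[OF S] Cr_on_scaleR[OF S])
      fix b :: 'b
      show "Cr_on r (\<lambda>x. ?Df x v \<bullet> b) S"
        by (rule Cr_on_linear[OF S bounded_linear_inner_left]) (use Suc.prems in simp)
      show "Cr_on r (\<lambda>x. ?Dg (f x) b) S"
        using Suc.prems by (intro Suc.IH Cr_on_Suc_imp[OF Suc.prems(2)]) simp
    qed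
    thus ?thesis by (rule Cr_on_cong[OF S]) (use eq in simp)
  qed
  ultimately show ?case by (rule Cr_on_derivI[OF S])
qed

section \<open>Iterated directional derivatives and finite differences\<close>

primrec iter_deriv :: "'a list \<Rightarrow> ('a::euclidean_space \<Rightarrow> real) \<Rightarrow> 'a \<Rightarrow> real" where
  "iter_deriv [] g = g"
| "iter_deriv (v # vs) g = iter_deriv vs (\<lambda>x. frechet_derivative g (at x) v)"

primrec iter_diff :: "real \<Rightarrow> 'a list \<Rightarrow> ('a::euclidean_space \<Rightarrow> real) \<Rightarrow> 'a \<Rightarrow> real" where
  "iter_diff t [] g x = g x"
| "iter_diff t (v # vs) g x = iter_diff t vs g (x + t *\<^sub>R v) - iter_diff t vs g x"

lemma iter_deriv_Cr: "Cr_on (length vs + r) g S \<Longrightarrow> Cr_on r (iter_deriv vs g) S"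
  by (induction vs arbitrary: g) auto

lemma iter_diff_has_derivative:
  assumes "t \<ge> 0"
    and "\<And>y. dist x y \<le> t * sum_list (map norm vs) \<Longrightarrow> g differentiable (at y)"
  shows "(iter_diff t vs g has_derivative (\<lambda>v. iter_diff t vs (\<lambda>y. frechet_derivative g (at y) v) x)) (at x)"
  using assms(2)
proof (induction vs arbitrary: x)
  case Nil
  have "iter_diff t [] f = f" for f :: "'a \<Rightarrow> real" by (rule ext) simp
  thus ?case using Nil[of x] by (simp add: frechet_derivative_works)
next
  case (Cons w ws)
  have "(iter_diff t ws g has_derivative (\<lambda>v. iter_diff t ws (\<lambda>y. frechet_derivative g (at y) v) x)) (at x)"
    using assms(1) by (intro Cons.IH Cons.prems) (simp add: distrib_left add_increasing)
  moreover have "(iter_diff t ws g has_derivative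
      (\<lambda>v. iter_diff t ws (\<lambda>y. frechet_derivative g (at y) v) (x + t *\<^sub>R w))) (at (x + t *\<^sub>R w))"
  proof (intro Cons.IH Cons.prems)
    fix y assume "dist (x + t *\<^sub>R w) y \<le> t * sum_list (map norm ws)"
    moreover have "dist x y \<le> dist x (x + t *\<^sub>R w) + dist (x + t *\<^sub>R w) y" by (rule dist_triangle)
    moreover have "dist x (x + t *\<^sub>R w) = t * norm w" using assms(1) by (simp add: dist_norm)
    ultimately show "dist x y \<le> t * sum_list (map norm (w # ws))" by (simp add: distrib_left)
  qed
  hence "((\<lambda>x. iter_diff t ws g (x + t *\<^sub>R w)) has_derivative
      (\<lambda>v. iter_diff t ws (\<lambda>y. frechet_derivative g (at y) v) (x + t *\<^sub>R w))) (at x)"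
    by (rule has_derivative_compose[rotated]) (auto intro!: derivative_eq_intros)
  ultimately have "((\<lambda>x. iter_diff t ws g (x + t *\<^sub>R w) - iter_diff t ws g x) has_derivative
      (\<lambda>v. iter_diff t ws (\<lambda>y. frechet_derivative g (at y) v) (x + t *\<^sub>R w)
        - iter_diff t ws (\<lambda>y. frechet_derivative g (at y) v) x)) (at x)"
    by (rule has_derivative_diff[rotated])
  moreover have "iter_diff t (w # ws) g = (\<lambda>x. iter_diff t ws g (x + t *\<^sub>R w) - iter_diff t ws g x)"
    by (rule ext) simp
  ultimately show ?case by simp
qed

text \<open>One mean value theorem for each difference. Finite differences need values of \<open>g\<close> only and
  are symmetric in the directions, which is why they control iterated derivatives.\<close>
lemma iter_diff_mean_value:
  assumes "Cr_on (length vs) g (ball a e)" "t > 0" "dist a x + t * sum_list (map norm vs) < e"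
  shows "\<exists>y. dist x y \<le> t * sum_list (map norm vs) \<and> iter_diff t vs g x = t ^ length vs * iter_deriv vs g y"
  using assms(1,3)
proof (induction vs arbitrary: g x)
  case Nil
  show ?case by (intro exI[of _ x]) simp
next
  case (Cons w ws)
  define \<Sigma> where "\<Sigma> = t * sum_list (map norm ws)"
  have \<Sigma>: "\<Sigma> \<ge> 0" using assms(2) by (auto simp: \<Sigma>_def intro!: mult_nonneg_nonneg sum_list_nonneg)
  have small: "dist a x + t * norm w + \<Sigma> < e" using Cons.prems(2) by (simp add: \<Sigma>_def distrib_left)
  let ?Dg = "\<lambda>v y. frechet_derivative g (at y) v"
  have d: "((\<lambda>s. iter_diff t ws g (x + s *\<^sub>R w)) has_real_derivative iter_diff t ws (?Dg w) (x + s *\<^sub>R w)) (at s)"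
    if s: "0 \<le> s" "s \<le> t" for s
  proof -
    have D: "(iter_diff t ws g has_derivative (\<lambda>v. iter_diff t ws (?Dg v) (x + s *\<^sub>R w))) (at (x + s *\<^sub>R w))"
    proof (rule iter_diff_has_derivative)
      fix y assume y: "dist (x + s *\<^sub>R w) y \<le> t * sum_list (map norm ws)"
      have "dist a y \<le> dist a x + dist x (x + s *\<^sub>R w) + dist (x + s *\<^sub>R w) y"
        by (metis add.assoc add_left_mono dist_triangle order_trans)
      moreover have "dist x (x + s *\<^sub>R w) \<le> t * norm w" using s by (simp add: dist_norm mult_right_mono)
      ultimately have "y \<in> ball a e" using y small by (simp add: \<Sigma>_def)
      thus "g differentiable (at y)" using Cons.prems(1) by simp
    qed (use assms in simp)
    have "((\<lambda>s. x + s *\<^sub>R w) has_derivative (\<lambda>h. h *\<^sub>R w)) (at s)" by (auto intro!: derivative_eq_intros)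
    from has_derivative_compose[OF this D]
    have "((\<lambda>s. iter_diff t ws g (x + s *\<^sub>R w)) has_derivative
        (\<lambda>h. iter_diff t ws (?Dg (h *\<^sub>R w)) (x + s *\<^sub>R w))) (at s)" .
    moreover have "(\<lambda>h. iter_diff t ws (?Dg (h *\<^sub>R w)) (x + s *\<^sub>R w)) = (*) (iter_diff t ws (?Dg w) (x + s *\<^sub>R w))"
      using linear_scale[OF has_derivative_linear[OF D]] by (intro ext) (simp add: mult.commute)
    ultimately show ?thesis by (simp add: has_field_derivative_def)
  qed
  have "\<exists>s>0. s < t \<and> iter_diff t ws g (x + t *\<^sub>R w) - iter_diff t ws g (x + 0 *\<^sub>R w)
      = (t - 0) * iter_diff t ws (?Dg w) (x + s *\<^sub>R w)"
    by (rule MVT2[OF assms(2)]) (use d in auto)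
  then obtain s where s: "0 < s" "s < t"
    "iter_diff t (w # ws) g x = t * iter_diff t ws (?Dg w) (x + s *\<^sub>R w)" by auto
  have step: "dist x (x + s *\<^sub>R w) \<le> t * norm w" using s by (simp add: dist_norm mult_right_mono)
  have "dist a (x + s *\<^sub>R w) \<le> dist a x + dist x (x + s *\<^sub>R w)" by (rule dist_triangle)
  hence "dist a (x + s *\<^sub>R w) + t * sum_list (map norm ws) < e" using step small by (simp add: \<Sigma>_def)
  with Cons.IH[of "?Dg w" "x + s *\<^sub>R w"] Cons.prems(1)
  obtain y where y: "dist (x + s *\<^sub>R w) y \<le> \<Sigma>"
    "iter_diff t ws (?Dg w) (x + s *\<^sub>R w) = t ^ length ws * iter_deriv ws (?Dg w) y" by (auto simp: \<Sigma>_def)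
  have "dist x y \<le> dist x (x + s *\<^sub>R w) + dist (x + s *\<^sub>R w) y" by (rule dist_triangle)
  hence "dist x y \<le> t * sum_list (map norm (w # ws))"
    using step y(1) by (simp add: \<Sigma>_def distrib_left)
  thus ?case using s(3) y(2) by (intro exI[of _ y]) simp
qed

lemma iter_diff_bound:
  assumes "t \<ge> 0" "\<And>y. dist x y \<le> t * sum_list (map norm vs) \<Longrightarrow> \<bar>g y\<bar> \<le> M"
  shows "\<bar>iter_diff t vs g x\<bar> \<le> 2 ^ length vs * M"
  using assms(2)
proof (induction vs arbitrary: x)
  case (Cons w ws)
  have "\<bar>iter_diff t ws g x\<bar> \<le> 2 ^ length ws * M"
    using assms(1) by (intro Cons.IH Cons.prems) (simp add: distrib_left add_increasing)
  moreover have "\<bar>iter_diff t ws g (x + t *\<^sub>R w)\<bar> \<le> 2 ^ length ws * M"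
  proof (intro Cons.IH Cons.prems)
    fix y assume "dist (x + t *\<^sub>R w) y \<le> t * sum_list (map norm ws)"
    moreover have "dist x y \<le> dist x (x + t *\<^sub>R w) + dist (x + t *\<^sub>R w) y" by (rule dist_triangle)
    moreover have "dist x (x + t *\<^sub>R w) = t * norm w" using assms(1) by (simp add: dist_norm)
    ultimately show "dist x y \<le> t * sum_list (map norm (w # ws))" by (simp add: distrib_left)
  qed
  ultimately show ?case by simp
qed simp

text \<open>Both iterated derivatives, divided by the squared step, are limits of the same second
  difference.\<close>
lemma second_derivative_symmetric:
  assumes "Cr_on 2 g (ball x e)" "e > 0"
  shows "iter_deriv [v, w] g x = iter_deriv [w, v] g x"
proof (rule ccontr)
  assume ne: "iter_deriv [v, w] g x \<noteq> iter_deriv [w, v] g x"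
  define d where "d = \<bar>iter_deriv [v, w] g x - iter_deriv [w, v] g x\<bar> / 2"
  have d: "d > 0" using ne by (simp add: d_def)
  have c: "isCont (iter_deriv [a, b] g) x" for a b
  proof -
    have "Cr_on 0 (iter_deriv [a, b] g) (ball x e)"
      by (rule iter_deriv_Cr) (use assms in \<open>simp add: numeral_2_eq_2\<close>)
    thus ?thesis using assms(2) by (simp add: continuous_on_eq_continuous_at)
  qed
  have "\<exists>r>0. \<forall>y. dist y x < r \<longrightarrow> dist (iter_deriv [a, b] g y) (iter_deriv [a, b] g x) < d" for a b
    using c[of a b] d unfolding continuous_at_eps_delta by blast
  then obtain r1 r2 where r: "r1 > 0" "r2 > 0"
    "\<And>y. dist y x < r1 \<Longrightarrow> dist (iter_deriv [v, w] g y) (iter_deriv [v, w] g x) < d"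
    "\<And>y. dist y x < r2 \<Longrightarrow> dist (iter_deriv [w, v] g y) (iter_deriv [w, v] g x) < d" by metis
  define \<sigma> where "\<sigma> = norm v + norm w + 1"
  have \<sigma>: "\<sigma> > 0" by (simp add: \<sigma>_def add_nonneg_pos)
  define t where "t = min e (min r1 r2) / (2 * \<sigma>)"
  have t: "t > 0" using r assms \<sigma> by (simp add: t_def)
  have "min e (min r1 r2) > 0" "t * \<sigma> = min e (min r1 r2) / 2" using \<sigma> r assms by (simp_all add: t_def)
  hence "t * \<sigma> < min e (min r1 r2)" by linarith
  moreover have "t * (norm v + norm w) \<le> t * \<sigma>" using t by (simp add: \<sigma>_def)
  ultimately have small: "t * (norm v + norm w) < e" "t * (norm v + norm w) < r1" "t * (norm v + norm w) < r2"
    by auto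
  obtain y where y: "dist x y \<le> t * (norm v + norm w)" "iter_diff t [v, w] g x = t ^ 2 * iter_deriv [v, w] g y"
    using iter_diff_mean_value[of "[v, w]" g x e t x] assms t small(1) by (auto simp: numeral_2_eq_2)
  obtain y' where y': "dist x y' \<le> t * (norm v + norm w)" "iter_diff t [w, v] g x = t ^ 2 * iter_deriv [w, v] g y'"
    using iter_diff_mean_value[of "[w, v]" g x e t x] assms t small(1) by (auto simp: numeral_2_eq_2 add.commute)
  have "iter_diff t [v, w] g x = iter_diff t [w, v] g x" by (simp add: add_ac)
  hence "t\<^sup>2 * iter_deriv [v, w] g y = t\<^sup>2 * iter_deriv [w, v] g y'"
    unfolding y(2) y'(2) .
  hence "iter_deriv [v, w] g y = iter_deriv [w, v] g y'" using t by simp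
  moreover have "dist (iter_deriv [v, w] g y) (iter_deriv [v, w] g x) < d"
    using y(1) small by (intro r(3)) (simp add: dist_commute)
  moreover have "dist (iter_deriv [w, v] g y') (iter_deriv [w, v] g x) < d"
    using y'(1) small by (intro r(4)) (simp add: dist_commute)
  ultimately show False unfolding d_def dist_real_def by argo
qed

section \<open>Order of vanishing\<close>

text \<open>The Landau condition \<open>o(\<bar>z\<bar>\<^sup>n)\<close> at the origin, with the value at the origin included.\<close>
definition flat :: "nat \<Rightarrow> ('a::euclidean_space \<Rightarrow> real) \<Rightarrow> bool" where
  "flat n g \<longleftrightarrow> (\<forall>c>0. \<exists>d>0. \<forall>z. norm z < d \<longrightarrow> \<bar>g z\<bar> \<le> c * norm z ^ n)"

lemma flat_mono:
  assumes "flat n g" "m \<le> n" shows "flat m g"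
  unfolding flat_def
proof (intro allI impI)
  fix c :: real assume "c > 0"
  then obtain d where d: "d > 0" "\<And>z. norm z < d \<Longrightarrow> \<bar>g z\<bar> \<le> c * norm z ^ n"
    using assms(1) unfolding flat_def by blast
  have "\<bar>g z\<bar> \<le> c * norm z ^ m" if z: "norm z < min d 1" for z
  proof -
    have "norm z ^ n \<le> norm z ^ m" using z assms(2) by (intro power_decreasing) auto
    hence "c * norm z ^ n \<le> c * norm z ^ m" using \<open>c > 0\<close> by simp
    thus ?thesis using d(2)[of z] z by simp
  qed
  thus "\<exists>d>0. \<forall>z. norm z < d \<longrightarrow> \<bar>g z\<bar> \<le> c * norm z ^ m"
    using d(1) by (intro exI[of _ "min d 1"]) auto
qed

text \<open>A nonzero iterated derivative makes the corresponding finite differences with step \<open>t\<close> of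
  order \<open>t\<^sup>n\<close> exactly, while flatness makes them smaller.\<close>
lemma flat_imp_iter_deriv_zero:
  assumes C: "Cr_on (length vs) g (ball 0 e)" "e > 0" and fl: "flat (length vs) g"
  shows "iter_deriv vs g 0 = 0"
proof (rule ccontr)
  assume ne: "iter_deriv vs g 0 \<noteq> 0"
  define D where "D = \<bar>iter_deriv vs g 0\<bar>"
  define n where "n = length vs"
  have D: "D > 0" using ne by (simp add: D_def)
  have "Cr_on 0 (iter_deriv vs g) (ball 0 e)" by (rule iter_deriv_Cr) (use C in simp)
  hence "isCont (iter_deriv vs g) 0" using C(2) by (simp add: continuous_on_eq_continuous_at)
  then obtain r where r: "r > 0" "\<And>y. dist y 0 < r \<Longrightarrow> dist (iter_deriv vs g y) (iter_deriv vs g 0) < D / 2"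
    unfolding continuous_at_eps_delta using D half_gt_zero by blast
  define \<sigma> where "\<sigma> = sum_list (map norm vs) + 1"
  have s0: "sum_list (map norm vs) \<ge> 0" by (intro sum_list_nonneg) auto
  have \<sigma>: "\<sigma> > 0" "sum_list (map norm vs) \<le> \<sigma>" using s0 by (auto simp: \<sigma>_def)
  define c where "c = D / (4 * (2 * \<sigma>) ^ n)"
  have c: "c > 0" using D \<sigma> by (simp add: c_def)
  then obtain d where d: "d > 0" "\<And>z. norm z < d \<Longrightarrow> \<bar>g z\<bar> \<le> c * norm z ^ n"
    using fl unfolding flat_def n_def by blast
  define t where "t = min e (min r d) / (2 * \<sigma>)"
  have t: "t > 0" using r d C \<sigma> by (simp add: t_def)
  have "min e (min r d) > 0" "t * \<sigma> = min e (min r d) / 2" using \<sigma> r d C by (simp_all add: t_def)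
  hence "t * \<sigma> < min e (min r d)" by linarith
  moreover have ts: "t * sum_list (map norm vs) \<le> t * \<sigma>" using t \<sigma> by simp
  ultimately have small: "t * sum_list (map norm vs) < e" "t * sum_list (map norm vs) < r" "t * \<sigma> < d" by auto
  obtain y where y: "dist 0 y \<le> t * sum_list (map norm vs)" "iter_diff t vs g 0 = t ^ n * iter_deriv vs g y"
    using iter_diff_mean_value[OF C(1) t, of 0] small unfolding n_def by auto
  have "dist (iter_deriv vs g y) (iter_deriv vs g 0) < D / 2"
    using y(1) small by (intro r(2)) (simp add: dist_commute)
  hence "\<bar>iter_deriv vs g y\<bar> > D / 2" unfolding D_def dist_real_def by argo
  hence "t ^ n * (D / 2) < t ^ n * \<bar>iter_deriv vs g y\<bar>" using t by (intro mult_strict_left_mono) auto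
  also have "\<dots> = \<bar>iter_diff t vs g 0\<bar>" using y(2) t by (simp add: abs_mult)
  also have "\<dots> \<le> 2 ^ n * (c * (t * \<sigma>) ^ n)"
    unfolding n_def
  proof (rule iter_diff_bound)
    fix z :: 'a assume "dist 0 z \<le> t * sum_list (map norm vs)"
    hence z: "norm z \<le> t * \<sigma>" using ts by simp
    hence "\<bar>g z\<bar> \<le> c * norm z ^ n" using small by (intro d) auto
    also have "\<dots> \<le> c * (t * \<sigma>) ^ n" using c z by (intro mult_left_mono power_mono) auto
    finally show "\<bar>g z\<bar> \<le> c * (t * \<sigma>) ^ length vs" by (simp add: n_def)
  qed (use t in simp)
  also have "\<dots> = t ^ n * (D / 4)" using \<sigma> by (simp add: c_def power_mult_distrib field_simps)
  finally show False using t D by simp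
qed

lemma iter_deriv_zero_imp_flat:
  assumes e: "e > 0"
  shows "\<lbrakk>Cr_on n g (ball 0 e); \<And>vs. length vs \<le> n \<Longrightarrow> iter_deriv vs g 0 = 0\<rbrakk> \<Longrightarrow> flat n g"
proof (induction n arbitrary: g)
  case 0
  have "isCont g 0" using 0(1) e by (simp add: continuous_on_eq_continuous_at)
  moreover have "g 0 = 0" using 0(2)[of "[]"] by simp
  ultimately show ?case unfolding flat_def continuous_at_eps_delta
    by (metis diff_zero dist_0_norm dist_commute less_imp_le mult_1_right norm_minus_commute power_0 real_norm_def dist_norm)
next
  case (Suc n)
  let ?D = "\<lambda>v z. frechet_derivative g (at z) v"
  have fl: "flat n (?D v)" for v
  proof (rule Suc.IH)
    show "Cr_on n (?D v) (ball 0 e)" using Suc.prems(1) by simp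
    show "iter_deriv vs (?D v) 0 = 0" if "length vs \<le> n" for vs
      using Suc.prems(2)[of "v # vs"] that by simp
  qed
  show ?case unfolding flat_def
  proof (intro allI impI)
    fix c :: real assume c: "c > 0"
    define c' where "c' = c / real DIM('a)"
    have c': "c' > 0" using c by (simp add: c'_def)
    have "\<forall>b. \<exists>d>0. \<forall>z. norm z < d \<longrightarrow> \<bar>?D b z\<bar> \<le> c' * norm z ^ n" using fl c' unfolding flat_def by blast
    then obtain d where d: "\<And>b. d b > 0" "\<And>b z. norm z < d b \<Longrightarrow> \<bar>?D b z\<bar> \<le> c' * norm z ^ n" by metis
    define d' where "d' = Min (insert e (d ` Basis))"
    have d': "d' > 0" "d' \<le> e" using d(1) e by (auto simp: d'_def)
    have d'b: "d' \<le> d b" if "b \<in> Basis" for b unfolding d'_def by (rule Min_le) (use that in auto)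
    have "\<bar>g z\<bar> \<le> c * norm z ^ Suc n" if z: "norm z < d'" for z
    proof -
      have D: "(g has_derivative frechet_derivative g (at y)) (at y)" if "y \<in> cball 0 (norm z)" for y
        using Cr_on_has_derivative[OF Suc.prems(1), of y] that z d' by auto
      have "norm (g z - g 0) \<le> (c * norm z ^ n) * norm (z - 0)"
      proof (rule differentiable_bound[of "cball 0 (norm z)"])
        fix y :: 'a assume y: "y \<in> cball 0 (norm z)"
        show "(g has_derivative frechet_derivative g (at y)) (at y within cball 0 (norm z))"
          by (rule has_derivative_at_withinI[OF D[OF y]])
        have lin: "linear (frechet_derivative g (at y))" by (rule has_derivative_linear[OF D[OF y]])
        show "onorm (frechet_derivative g (at y)) \<le> c * norm z ^ n"
        proof (rule onorm_bound)
          fix w :: 'a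
          have "frechet_derivative g (at y) w = (\<Sum>b\<in>Basis. (w \<bullet> b) * ?D b y)"
            by (subst euclidean_representation[of w, symmetric]) (simp add: linear_sum[OF lin] linear_scale[OF lin])
          hence "norm (frechet_derivative g (at y) w) \<le> (\<Sum>b\<in>Basis. \<bar>(w \<bullet> b) * ?D b y\<bar>)" by (simp add: sum_abs)
          also have "\<dots> \<le> (\<Sum>b\<in>(Basis::'a set). norm w * (c' * norm z ^ n))"
          proof (rule sum_mono)
            fix b :: 'a assume b: "b \<in> Basis"
            have "\<bar>?D b y\<bar> \<le> c' * norm y ^ n" using y z d'b[OF b] by (intro d(2)) auto
            also have "\<dots> \<le> c' * norm z ^ n" using y c' by (intro mult_left_mono power_mono) auto
            finally show "\<bar>(w \<bullet> b) * ?D b y\<bar> \<le> norm w * (c' * norm z ^ n)"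
              unfolding abs_mult using Basis_le_norm[OF b, of w] by (intro mult_mono) auto
          qed
          also have "\<dots> = c * norm z ^ n * norm w" by (simp add: c'_def)
          finally show "norm (frechet_derivative g (at y) w) \<le> c * norm z ^ n * norm w" .
        qed (use c in simp)
      qed auto
      moreover have "g 0 = 0" using Suc.prems(2)[of "[]"] by simp
      ultimately show ?thesis by (simp add: mult_ac)
    qed
    thus "\<exists>d>0. \<forall>z. norm z < d \<longrightarrow> \<bar>g z\<bar> \<le> c * norm z ^ Suc n" using d'(1) by blast
  qed
qed

text \<open>The Taylor expansion of a \<open>C\<^sup>n\<close> function may be differentiated. By the preceding lemmas,
  flatness is the vanishing of the derivatives up to order \<open>n\<close>, a property which passes to derivatives.\<close>
theorem flat_iter_deriv:
  assumes e: "e > 0" and C: "Cr_on n g (ball 0 e)" and fl: "flat n g" and vs: "length vs \<le> n"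
  shows "flat (n - length vs) (iter_deriv vs g)"
proof (rule iter_deriv_zero_imp_flat[OF e])
  show "Cr_on (n - length vs) (iter_deriv vs g) (ball 0 e)" by (rule iter_deriv_Cr) (use C vs in simp)
  have app: "iter_deriv ws (iter_deriv vs g) = iter_deriv (vs @ ws) g" for ws
    by (induction vs arbitrary: g) auto
  fix ws :: "'a list" assume "length ws \<le> n - length vs"
  hence len: "length (vs @ ws) \<le> n" using vs by simp
  show "iter_deriv ws (iter_deriv vs g) 0 = 0"
    unfolding app by (rule flat_imp_iter_deriv_zero[OF Cr_on_mono[OF C len] e flat_mono[OF fl len]])
qed

section \<open>Principal directions of a graph\<close>

text \<open>An eigenvector of the second fundamental form with respect to the first one is a vector that
  the two forms send to parallel covectors; the eigenvalue is the quotient of the quadratic forms.\<close>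
lemma parallel_imp_eigenvector:
  fixes u v E F G r s t :: real
  assumes par: "(E * u + F * v) * (s * u + t * v) = (F * u + G * v) * (r * u + s * v)"
    and pos: "(E * u + F * v) * u + (F * u + G * v) * v > 0"
  defines "k \<equiv> ((r * u + s * v) * u + (s * u + t * v) * v) / ((E * u + F * v) * u + (F * u + G * v) * v)"
  shows "r * u + s * v = k * (E * u + F * v)" "s * u + t * v = k * (F * u + G * v)"
proof -
  define a b c d where "a = E * u + F * v" and "b = F * u + G * v" and "c = r * u + s * v" and "d = s * u + t * v"
  have ad: "a * d = b * c" and p: "a * u + b * v > 0" and k: "k = (c * u + d * v) / (a * u + b * v)"
    using par pos by (auto simp: a_def b_def c_def d_def k_def)
  have "(c * u + d * v) * a = c * (a * u + b * v)" "(c * u + d * v) * b = d * (a * u + b * v)"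
    using ad by algebra+
  hence "c = k * a" "d = k * b" using p by (auto simp: k field_simps)
  thus "r * u + s * v = k * (E * u + F * v)" "s * u + t * v = k * (F * u + G * v)"
    by (simp_all add: a_def b_def c_def d_def)
qed

text \<open>The parallelism condition is a quadratic form \<open>Q\<close> in \<open>(u, v)\<close>. In terms of \<open>u + v\<close> and \<open>v - u\<close> it
  splits as \<open>- (l + R) ((v - u) - f (u + v)) ((u + v) - g (v - u)) / 4\<close>. Evaluating \<open>Q\<close> on the sum of
  the two eigenvectors in two ways, by this formula and by the eigenvalue equations, shows which of the
  eigenvalues is larger.\<close>
lemma eigenlines:
  fixes p q r s t :: real
  defines "E \<equiv> 1 + p\<^sup>2" and "F \<equiv> p * q" and "G \<equiv> 1 + q\<^sup>2"
  defines "\<mu> \<equiv> E * t - G * r" and "l \<equiv> (E + G) * s - F * (r + t)" and "\<nu> \<equiv> (E - G) * s + F * (t - r)"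
  defines "R \<equiv> sqrt (l\<^sup>2 + \<mu>\<^sup>2 - \<nu>\<^sup>2)"
  defines "f \<equiv> (\<mu> + \<nu>) / (l + R)" and "g \<equiv> (\<nu> - \<mu>) / (l + R)"
  assumes pos: "l\<^sup>2 + \<mu>\<^sup>2 - \<nu>\<^sup>2 > 0" "l + R > 0"
  shows "\<exists>k1 k2. k1 < k2 \<and> (\<forall>k u v. (u, v) \<noteq> (0, 0) \<longrightarrow>
    (r * u + s * v = k * (E * u + F * v) \<and> s * u + t * v = k * (F * u + G * v)) =
    (k = k2 \<and> v - u = f * (u + v) \<or> k = k1 \<and> u + v = g * (v - u)))"
proof -
  define w where "w = l + R"
  have w: "w > 0" using pos by (simp add: w_def)
  have R: "R > 0" using pos by (simp add: R_def)
  have R2: "R\<^sup>2 = l\<^sup>2 + \<mu>\<^sup>2 - \<nu>\<^sup>2" using pos by (simp add: R_def)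
  have fw: "f * w = \<mu> + \<nu>" and gw: "g * w = \<nu> - \<mu>" using w by (auto simp: f_def g_def w_def)
  have fg: "w * (1 - f * g) = 2 * R" and fg': "w * (1 + f * g) = 2 * l"
  proof -
    have e: "w * (w * (f * g)) = (\<mu> + \<nu>) * (\<nu> - \<mu>)" unfolding fw[symmetric] gw[symmetric] by algebra
    have "w * (w * (1 - f * g)) = w * (2 * R)" "w * (w * (1 + f * g)) = w * (2 * l)"
      using e R2 unfolding w_def by algebra+
    thus "w * (1 - f * g) = 2 * R" "w * (1 + f * g) = 2 * l" using w by auto
  qed
  have fg1: "1 - f * g > 0"
  proof -
    have "w * (1 - f * g) > 0" using fg R by simp
    thus ?thesis using w by (simp add: zero_less_mult_iff)
  qed
  define Q where "Q u v = (E * u + F * v) * (s * u + t * v) - (F * u + G * v) * (r * u + s * v)" for u v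
  have Q: "4 * Q u v = - w * (((v - u) - f * (u + v)) * ((u + v) - g * (v - u)))" for u v
  proof -
    have "4 * Q u v = (\<nu> - \<mu>) * (v - u)\<^sup>2 - 2 * l * ((u + v) * (v - u)) + (\<nu> + \<mu>) * (u + v)\<^sup>2"
      unfolding Q_def \<mu>_def l_def \<nu>_def by algebra
    also have "\<dots> = - w * (((v - u) - f * (u + v)) * ((u + v) - g * (v - u)))"
      using fw gw fg' by algebra
    finally show ?thesis .
  qed
  have I: "(E * u + F * v) * u + (F * u + G * v) * v > 0" if "(u, v) \<noteq> (0, 0)" for u v
  proof -
    have "(E * u + F * v) * u + (F * u + G * v) * v = u\<^sup>2 + v\<^sup>2 + (p * u + q * v)\<^sup>2"
      unfolding E_def F_def G_def by algebra
    moreover have "u\<^sup>2 + v\<^sup>2 > 0" using that by (auto simp: sum_power2_gt_zero_iff)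
    ultimately show ?thesis by (simp add: add_pos_nonneg)
  qed
  have Inz: "E * u + F * v \<noteq> 0 \<or> F * u + G * v \<noteq> 0" if "(u, v) \<noteq> (0, 0)" for u v
    using I[OF that] by auto
  define K where "K u v = ((r * u + s * v) * u + (s * u + t * v) * v) / ((E * u + F * v) * u + (F * u + G * v) * v)" for u v
  have eig: "r * u + s * v = K u v * (E * u + F * v)" "s * u + t * v = K u v * (F * u + G * v)"
    if "(u, v) \<noteq> (0, 0)" "Q u v = 0" for u v
    unfolding K_def using that I by (intro parallel_imp_eigenvector; simp add: Q_def)+
  define k2 where "k2 = K (1 - f) (1 + f)"
  define k1 where "k1 = K (g - 1) (g + 1)"
  have nz: "(1 - f, 1 + f) \<noteq> (0, 0)" "(g - 1, g + 1) \<noteq> (0, 0)" by auto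
  have Q0: "Q (1 - f) (1 + f) = 0" "Q (g - 1) (g + 1) = 0"
    using Q[of "1 - f" "1 + f"] Q[of "g - 1" "g + 1"] by (simp_all add: algebra_simps)
  note e2 = eig[OF nz(1) Q0(1), folded k2_def] and e1 = eig[OF nz(2) Q0(2), folded k1_def]
  have lt: "k1 < k2"
  proof -
    have x1: "Q ((1 - f) + (g - 1)) ((1 + f) + (g + 1))
        = (k1 - k2) * ((E * G - F\<^sup>2) * ((1 - f) * (g + 1) - (1 + f) * (g - 1)))"
      unfolding Q_def using e1 e2 by algebra
    have x2: "(1 - f) * (g + 1) - (1 + f) * (g - 1) = 2 * (1 - f * g)" by algebra
    have x3: "4 * Q ((1 - f) + (g - 1)) ((1 + f) + (g + 1)) = - w * ((2 - 2 * f * g) * (2 - 2 * f * g))"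
      unfolding Q by algebra
    have "2 - 2 * f * g > 0" using fg1 by simp
    hence "- w * ((2 - 2 * f * g) * (2 - 2 * f * g)) < 0" using w by (simp add: mult_pos_pos)
    hence "4 * Q ((1 - f) + (g - 1)) ((1 + f) + (g + 1)) < 0" unfolding x3 .
    hence "(k1 - k2) * ((E * G - F\<^sup>2) * (2 * (1 - f * g))) < 0" unfolding x1 x2 by simp
    moreover have "E * G - F\<^sup>2 = 1 + p\<^sup>2 + q\<^sup>2" unfolding E_def F_def G_def by algebra
    hence "E * G - F\<^sup>2 > 0" by (simp add: add_pos_nonneg)
    hence "(E * G - F\<^sup>2) * (2 * (1 - f * g)) > 0" using fg1 by simp
    ultimately show ?thesis
      using mult_nonneg_nonneg[of "k1 - k2" "(E * G - F\<^sup>2) * (2 * (1 - f * g))"] by (meson diff_ge_0_iff_ge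
          less_imp_le not_less)
  qed
  have "(r * u + s * v = k * (E * u + F * v) \<and> s * u + t * v = k * (F * u + G * v)) =
    (k = k2 \<and> v - u = f * (u + v) \<or> k = k1 \<and> u + v = g * (v - u))" if nz': "(u, v) \<noteq> (0, 0)" for k u v
  proof
    assume *: "r * u + s * v = k * (E * u + F * v) \<and> s * u + t * v = k * (F * u + G * v)"
    hence "Q u v = 0" unfolding Q_def by algebra
    hence "((v - u) - f * (u + v)) * ((u + v) - g * (v - u)) = 0" using Q[of u v] w by simp
    hence "v - u = f * (u + v) \<or> u + v = g * (v - u)" by auto
    thus "k = k2 \<and> v - u = f * (u + v) \<or> k = k1 \<and> u + v = g * (v - u)"
    proof
      assume f: "v - u = f * (u + v)"
      define x where "x = (u + v) / 2"
      have uv: "u = x * (1 - f)" "v = x * (1 + f)" using f by (auto simp: x_def field_simps)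
      have "r * u + s * v = k2 * (E * u + F * v)" "s * u + t * v = k2 * (F * u + G * v)"
        unfolding uv using e2 by algebra+
      hence "k = k2" using * Inz[OF nz'] by auto
      thus ?thesis using f by simp
    next
      assume g: "u + v = g * (v - u)"
      define y where "y = (v - u) / 2"
      have uv: "u = y * (g - 1)" "v = y * (g + 1)" using g by (auto simp: y_def field_simps)
      have "r * u + s * v = k1 * (E * u + F * v)" "s * u + t * v = k1 * (F * u + G * v)"
        unfolding uv using e1 by algebra+
      hence "k = k1" using * Inz[OF nz'] by auto
      thus ?thesis using g by simp
    qed
  next
    assume "k = k2 \<and> v - u = f * (u + v) \<or> k = k1 \<and> u + v = g * (v - u)"
    thus "r * u + s * v = k * (E * u + F * v) \<and> s * u + t * v = k * (F * u + G * v)"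
    proof
      assume *: "k = k2 \<and> v - u = f * (u + v)"
      define x where "x = (u + v) / 2"
      have uv: "u = x * (1 - f)" "v = x * (1 + f)" using * by (auto simp: x_def field_simps)
      show ?thesis unfolding uv using e2 * by algebra
    next
      assume *: "k = k1 \<and> u + v = g * (v - u)"
      define y where "y = (v - u) / 2"
      have uv: "u = y * (g - 1)" "v = y * (g + 1)" using * by (auto simp: y_def field_simps)
      show ?thesis unfolding uv using e1 * by algebra
    qed
  qed
  thus ?thesis using lt by blast
qed

lemma has_derivative_vector_3:
  assumes "(a has_derivative a') F" "(b has_derivative b') F" "(c has_derivative c') F"
  shows "((\<lambda>z. vector [a z, b z, c z] :: real^3) has_derivative (\<lambda>w. vector [a' w, b' w, c' w])) F"
proof -
  have eq: "vector [x, y, z] = x *\<^sub>R axis 1 1 + y *\<^sub>R axis 2 1 + z *\<^sub>R (axis 3 1 :: real^3)" for x y z :: real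
    by (simp add: vec_eq_iff forall_3 vector_3 axis_def)
  show ?thesis unfolding eq using assms by (intro derivative_intros)
qed

text \<open>The letters \<open>p, q, r, s, t\<close> are Monge's notation for the partial derivatives of \<open>h\<close>. The
  orthogonal matrix \<open>M\<close> may reverse the orientation.\<close>
locale graph_immersion =
  fixes h p q r s t :: "real^2 \<Rightarrow> real" and V :: "(real^2) set"
    and a\<^sub>0 :: "real^3" and M :: "real^3^3" and X :: "real^2 \<Rightarrow> real^3"
  assumes V: "open V" and M: "orthogonal_matrix M"
    and X: "\<And>z. z \<in> V \<Longrightarrow> X z = a\<^sub>0 + M *v vector [z$1, z$2, h z]"
    and dh: "\<And>z. z \<in> V \<Longrightarrow> (h has_derivative (\<lambda>w. p z * w$1 + q z * w$2)) (at z)"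
    and dp: "\<And>z. z \<in> V \<Longrightarrow> (p has_derivative (\<lambda>w. r z * w$1 + s z * w$2)) (at z)"
    and dq: "\<And>z. z \<in> V \<Longrightarrow> (q has_derivative (\<lambda>w. s z * w$1 + t z * w$2)) (at z)"
begin

definition L :: "real^2 \<Rightarrow> real" where "L z = sqrt (1 + (p z)\<^sup>2 + (q z)\<^sup>2)"

lemma L_pos: "L z > 0" "(L z)\<^sup>2 = 1 + (p z)\<^sup>2 + (q z)\<^sup>2"
proof -
  have "1 + (p z)\<^sup>2 + (q z)\<^sup>2 > 0" by (intro add_pos_nonneg) auto
  thus "L z > 0" "(L z)\<^sup>2 = 1 + (p z)\<^sup>2 + (q z)\<^sup>2" by (auto simp: L_def)
qed

lemma det_M: "det M * det M = 1"
  using det_orthogonal_matrix[OF M] by auto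

lemma X_has_derivative:
  assumes z: "z \<in> V"
  shows "(X has_derivative (\<lambda>w. M *v vector [w$1, w$2, p z * w$1 + q z * w$2])) (at z)"
proof -
  have "((\<lambda>z. vector [z$1, z$2, h z] :: real^3) has_derivative (\<lambda>w. vector [w$1, w$2, p z * w$1 + q z * w$2])) (at z)"
    by (intro has_derivative_vector_3 dh[OF z] bounded_linear_imp_has_derivative bounded_linear_vec_nth)
  hence "((\<lambda>z. M *v vector [z$1, z$2, h z]) has_derivative
      (\<lambda>w. M *v vector [w$1, w$2, p z * w$1 + q z * w$2])) (at z)"
    by (rule bounded_linear.has_derivative[OF matrix_vector_mul_bounded_linear])
  hence "((\<lambda>z. a\<^sub>0 + M *v vector [z$1, z$2, h z]) has_derivative
      (\<lambda>w. M *v vector [w$1, w$2, p z * w$1 + q z * w$2])) (at z)"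
    using has_derivative_add[OF has_derivative_const] by fastforce
  thus ?thesis by (rule has_derivative_transform_within_open[OF _ V z]) (simp add: X)
qed

lemma X_frechet: "z \<in> V \<Longrightarrow> frechet_derivative X (at z) w = M *v vector [w$1, w$2, p z * w$1 + q z * w$2]"
  by (simp add: frechet_derivative_at[OF X_has_derivative, symmetric])

lemma unit_normal_graph:
  assumes z: "z \<in> V"
  shows "unit_normal X z = det M *\<^sub>R (M *v vector [- p z / L z, - q z / L z, 1 / L z])"
proof -
  let ?n = "vector [- p z, - q z, 1] :: real^3"
  have c: "cross3 (vector [1, 0, p z]) (vector [0, 1, q z]) = ?n"
    by (simp add: cross3_def vec_eq_iff forall_3 vector_3)
  have "cross3 (frechet_derivative X (at z) (axis 1 1)) (frechet_derivative X (at z) (axis 2 1))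
      = det M *\<^sub>R (M *v ?n)"
    unfolding X_frechet[OF z] by (simp add: axis_def cross_orthogonal_matrix[OF M] c)
  moreover have "norm (det M *\<^sub>R (M *v ?n)) = L z"
  proof -
    have "norm (M *v ?n) = norm ?n"
      using M by (intro orthogonal_transformation_norm)
        (simp add: orthogonal_transformation_matrix matrix_of_matrix_vector_mul)
    moreover have "\<bar>det M\<bar> = 1" using det_orthogonal_matrix[OF M] by auto
    moreover have "norm ?n = L z"
      by (simp add: L_def norm_vec_def L2_set_def sum_3 vector_3 add_ac)
    ultimately show ?thesis by simp
  qed
  ultimately have "unit_normal X z = (1 / L z) *\<^sub>R (det M *\<^sub>R (M *v ?n))"
    by (simp add: unit_normal_def sgn_div_norm divide_inverse)
  also have "\<dots> = det M *\<^sub>R (M *v ((1 / L z) *\<^sub>R ?n))"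
    by (simp add: matrix_vector_mult_scaleR)
  also have "(1 / L z) *\<^sub>R ?n = vector [- p z / L z, - q z / L z, 1 / L z]"
    by (simp add: vec_eq_iff forall_3 vector_3)
  finally show ?thesis .
qed

lemma unit_normal_has_derivative:
  assumes z: "z \<in> V"
  defines "j \<equiv> \<lambda>w. - (p z * (r z * w$1 + s z * w$2) + q z * (s z * w$1 + t z * w$2)) / L z ^ 3"
  shows "(unit_normal X has_derivative (\<lambda>w. det M *\<^sub>R (M *v vector
      [- (r z * w$1 + s z * w$2) / L z - p z * j w, - (s z * w$1 + t z * w$2) / L z - q z * j w, j w]))) (at z)"
proof -
  have dL: "((\<lambda>z. 1 / L z) has_derivative j) (at z)"
  proof -
    let ?N = "\<lambda>z. 1 + (p z)\<^sup>2 + (q z)\<^sup>2"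
    let ?P = "\<lambda>w::real^2. r z * w$1 + s z * w$2" and ?Q = "\<lambda>w::real^2. s z * w$1 + t z * w$2"
    have "((\<lambda>z. 1 + p z * p z + q z * q z) has_derivative
        (\<lambda>w. 0 + (p z * ?P w + ?P w * p z) + (q z * ?Q w + ?Q w * q z))) (at z)"
      by (intro has_derivative_add has_derivative_const has_derivative_mult dp[OF z] dq[OF z])
    moreover have "(\<lambda>w. 0 + (p z * ?P w + ?P w * p z) + (q z * ?Q w + ?Q w * q z))
        = (\<lambda>w. 2 * (p z * ?P w + q z * ?Q w))" by (simp add: fun_eq_iff algebra_simps)
    ultimately have dN: "(?N has_derivative (\<lambda>w. 2 * (p z * ?P w + q z * ?Q w))) (at z)"
      by (simp only: power2_eq_square)
    have "?N z > 0" by (intro add_pos_nonneg) auto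
    note has_derivative_real_sqrt[OF this dN]
    moreover have "(\<lambda>w. 2 * (p z * ?P w + q z * ?Q w) * (inverse (sqrt (?N z)) / 2))
        = (\<lambda>w. (p z * ?P w + q z * ?Q w) / L z)" by (simp only: L_def divide_inverse) (simp add: fun_eq_iff)
    ultimately have "(L has_derivative (\<lambda>w. (p z * ?P w + q z * ?Q w) / L z)) (at z)"
      by (simp only: L_def[abs_def])
    moreover have "L z \<noteq> 0" using L_pos[of z] by auto
    ultimately have "((\<lambda>z. inverse (L z)) has_derivative (\<lambda>w. - (inverse (L z) *
        ((p z * (r z * w$1 + s z * w$2) + q z * (s z * w$1 + t z * w$2)) / L z) * inverse (L z)))) (at z)"
      by (intro Deriv.has_derivative_inverse)
    moreover have "(\<lambda>w. - (inverse (L z) *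
        ((p z * (r z * w$1 + s z * w$2) + q z * (s z * w$1 + t z * w$2)) / L z) * inverse (L z))) = j"
    proof -
      have "- (inverse y * (x / y) * inverse y) = - x / y ^ 3" for x y :: real
        by (simp add: power3_eq_cube divide_inverse mult_ac)
      thus ?thesis by (intro ext) (simp only: j_def)
    qed
    ultimately show ?thesis by (simp add: inverse_eq_divide)
  qed
  have "((\<lambda>z. vector [- p z * (1 / L z), - q z * (1 / L z), 1 / L z] :: real^3) has_derivative
      (\<lambda>w. vector [- (r z * w$1 + s z * w$2) / L z - p z * j w, - (s z * w$1 + t z * w$2) / L z - q z * j w, j w])) (at z)"
  proof (intro has_derivative_vector_3 dL)
    have *: "((\<lambda>z. - g z * (1 / L z)) has_derivative (\<lambda>w. - g' w / L z - g z * j w)) (at z)"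
      if "(g has_derivative g') (at z)" for g g'
    proof -
      have "(\<lambda>w. - g z * j w + - g' w * (1 / L z)) = (\<lambda>w. - g' w / L z - g z * j w)"
        by (simp add: fun_eq_iff)
      with has_derivative_mult[OF has_derivative_minus[OF that] dL] show ?thesis by simp
    qed
    show "((\<lambda>z. - p z * (1 / L z)) has_derivative (\<lambda>w. - (r z * w$1 + s z * w$2) / L z - p z * j w)) (at z)"
      "((\<lambda>z. - q z * (1 / L z)) has_derivative (\<lambda>w. - (s z * w$1 + t z * w$2) / L z - q z * j w)) (at z)"
      by (rule *[OF dp[OF z]], rule *[OF dq[OF z]])
  qed
  hence "((\<lambda>z. det M *\<^sub>R (M *v vector [- p z * (1 / L z), - q z * (1 / L z), 1 / L z])) has_derivative
      (\<lambda>w. det M *\<^sub>R (M *v vector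
      [- (r z * w$1 + s z * w$2) / L z - p z * j w, - (s z * w$1 + t z * w$2) / L z - q z * j w, j w]))) (at z)"
    by (intro has_derivative_scaleR_right bounded_linear.has_derivative[OF matrix_vector_mul_bounded_linear])
  thus ?thesis
    by (rule has_derivative_transform_within_open[OF _ V z]) (simp add: unit_normal_graph)
qed

lemma principal_vector_graph:
  assumes z: "z \<in> V"
  shows "principal_vector X z \<kappa> w \<longleftrightarrow> w \<noteq> 0 \<and>
    r z * w$1 + s z * w$2 = det M * \<kappa> * L z * ((1 + (p z)\<^sup>2) * w$1 + p z * q z * w$2) \<and>
    s z * w$1 + t z * w$2 = det M * \<kappa> * L z * (p z * q z * w$1 + (1 + (q z)\<^sup>2) * w$2)"
proof -
  define a b k j where "a = r z * w$1 + s z * w$2" and "b = s z * w$1 + t z * w$2"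
    and "k = det M * \<kappa>" and "j = - (p z * a + q z * b) / L z ^ 3"
  have M1: "M *v x = M *v y \<longleftrightarrow> x = y" for x y
    using M by (metis matrix_vector_mul_assoc matrix_vector_mul_lid orthogonal_matrix_def)
  have "principal_vector X z \<kappa> w \<longleftrightarrow> w \<noteq> 0 \<and>
      det M *\<^sub>R (M *v vector [- a / L z - p z * j, - b / L z - q z * j, j])
      = - \<kappa> *\<^sub>R (M *v vector [w$1, w$2, p z * w$1 + q z * w$2])"
    unfolding principal_vector_def X_frechet[OF z]
      frechet_derivative_at[OF unit_normal_has_derivative[OF z], symmetric]
    by (simp add: a_def b_def j_def)
  also have "det M *\<^sub>R (M *v vector [- a / L z - p z * j, - b / L z - q z * j, j])
      = - \<kappa> *\<^sub>R (M *v vector [w$1, w$2, p z * w$1 + q z * w$2]) \<longleftrightarrow>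
      M *v vector [- a / L z - p z * j, - b / L z - q z * j, j]
      = M *v (- k *\<^sub>R vector [w$1, w$2, p z * w$1 + q z * w$2])" (is "det M *\<^sub>R ?x = - \<kappa> *\<^sub>R ?y \<longleftrightarrow> _")
  proof -
    have "det M *\<^sub>R ?x = - \<kappa> *\<^sub>R ?y \<longleftrightarrow> det M *\<^sub>R (det M *\<^sub>R ?x) = det M *\<^sub>R (- \<kappa> *\<^sub>R ?y)"
      using det_M by (metis mult_zero_left scaleR_cancel_left zero_neq_one)
    also have "\<dots> \<longleftrightarrow> ?x = - k *\<^sub>R ?y" using det_M by (simp add: k_def)
    finally show ?thesis unfolding matrix_vector_mult_scaleR .
  qed
  also have "\<dots> \<longleftrightarrow> - a / L z - p z * j = - k * w$1 \<and> - b / L z - q z * j = - k * w$2 \<and>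
      j = - k * (p z * w$1 + q z * w$2)"
    unfolding M1 by (simp add: vec_eq_iff forall_3 vector_3)
  also have "\<dots> \<longleftrightarrow> a = k * L z * ((1 + (p z)\<^sup>2) * w$1 + p z * q z * w$2) \<and>
      b = k * L z * (p z * q z * w$1 + (1 + (q z)\<^sup>2) * w$2)" (is "?A \<longleftrightarrow> ?B")
  proof
    have L: "L z \<noteq> 0" using L_pos[of z] by simp
    {
      assume A: ?A
      hence j: "j = - k * (p z * w$1 + q z * w$2)" by blast
      have ab: "a / L z = k * w$1 - p z * j" "b / L z = k * w$2 - q z * j" using A by linarith+
      have "a / L z = k * ((1 + (p z)\<^sup>2) * w$1 + p z * q z * w$2)"
        "b / L z = k * (p z * q z * w$1 + (1 + (q z)\<^sup>2) * w$2)"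
        unfolding ab j by (simp_all add: algebra_simps power2_eq_square)
      thus ?B using L by (simp add: field_simps)
    next
      assume ?B
      hence 1: "a / L z = k * ((1 + (p z)\<^sup>2) * w$1 + p z * q z * w$2)"
        "b / L z = k * (p z * q z * w$1 + (1 + (q z)\<^sup>2) * w$2)"
        using L by simp_all
      have "(p z * a + q z * b) / L z = p z * (a / L z) + q z * (b / L z)" by (simp add: add_divide_distrib)
      also have "\<dots> = k * (p z * w$1 + q z * w$2) * (L z)\<^sup>2"
        unfolding 1 L_pos(2) by (simp add: algebra_simps power2_eq_square)
      finally have "(p z * a + q z * b) / L z = k * (p z * w$1 + q z * w$2) * (L z)\<^sup>2" .
      moreover have "j = - ((p z * a + q z * b) / L z) / (L z)\<^sup>2"
      proof -
        have "- x / y ^ 3 = - (x / y) / y\<^sup>2" for x y :: real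
          by (simp add: power3_eq_cube power2_eq_square mult.assoc)
        thus ?thesis unfolding j_def .
      qed
      ultimately have j: "j = - k * (p z * w$1 + q z * w$2)" using L by simp
      have "- a / L z - p z * j = - k * w$1" "- b / L z - q z * j = - k * w$2"
        unfolding minus_divide_left[symmetric] 1 j by (simp_all add: algebra_simps power2_eq_square)
      thus ?A using j by blast
    }
  qed
  finally show ?thesis by (simp add: a_def b_def k_def)
qed

end

section \<open>Principal directions in charts\<close>

lemma linear_real2: "linear f \<Longrightarrow> f (w :: real^2) = w$1 *\<^sub>R f (axis 1 1) + w$2 *\<^sub>R f (axis 2 1)"
proof -
  assume f: "linear f"
  have "w = w$1 *\<^sub>R axis 1 1 + w$2 *\<^sub>R axis 2 1" by (simp add: vec_eq_iff forall_2 axis_def)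
  thus ?thesis using linear_add[OF f] linear_scale[OF f] by metis
qed

text \<open>A change of parameters multiplies the cross product of the tangent vectors by its Jacobian
  determinant, so only the sign of the determinant affects the unit normal.\<close>
lemma unit_normal_compose:
  assumes O: "open S" "z \<in> S" and X': "\<And>y. y \<in> S \<Longrightarrow> X' y = X (\<sigma> y)"
    and d\<sigma>: "(\<sigma> has_derivative D) (at z)" and dX: "X differentiable (at (\<sigma> z))"
  shows "unit_normal X' z = sgn (det (matrix D)) *\<^sub>R unit_normal X (\<sigma> z)"
    and "frechet_derivative X' (at z) w = frechet_derivative X (at (\<sigma> z)) (D w)"
proof -
  let ?A = "frechet_derivative X (at (\<sigma> z))"
  have dX': "(X has_derivative ?A) (at (\<sigma> z))" using dX frechet_derivative_works by blast
  have "((\<lambda>y. X (\<sigma> y)) has_derivative (\<lambda>w. ?A (D w))) (at z)" by (rule has_derivative_compose[OF d\<sigma> dX'])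
  hence "(X' has_derivative (\<lambda>w. ?A (D w))) (at z)"
    by (rule has_derivative_transform_within_open[OF _ O]) (simp add: X')
  hence fr: "frechet_derivative X' (at z) = (\<lambda>w. ?A (D w))" by (rule frechet_derivative_at[symmetric])
  thus "frechet_derivative X' (at z) w = ?A (D w)" by simp
  have lin: "linear ?A" by (rule has_derivative_linear[OF dX'])
  define a b where "a = ?A (axis 1 1)" and "b = ?A (axis 2 1)"
  have A: "?A w = w$1 *\<^sub>R a + w$2 *\<^sub>R b" for w unfolding a_def b_def by (rule linear_real2[OF lin])
  have "cross3 (?A (D (axis 1 1))) (?A (D (axis 2 1))) = det (matrix D) *\<^sub>R cross3 a b"
    unfolding A by (simp add: det_2 matrix_def cross3_def vec_eq_iff forall_3 vector_3 algebra_simps)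
  thus "unit_normal X' z = sgn (det (matrix D)) *\<^sub>R unit_normal X (\<sigma> z)"
    unfolding unit_normal_def fr by (simp add: sgn_scaleR a_def b_def)
qed

lemma principal_vector_compose:
  assumes O: "open S" "z \<in> S" and X': "\<And>y. y \<in> S \<Longrightarrow> X' y = X (\<sigma> y)"
    and d\<sigma>: "\<And>y. y \<in> S \<Longrightarrow> (\<sigma> has_derivative D y) (at y)"
    and dX: "\<And>y. y \<in> S \<Longrightarrow> X differentiable (at (\<sigma> y))"
    and dN: "unit_normal X differentiable (at (\<sigma> z))"
    and sgn: "\<And>y. y \<in> S \<Longrightarrow> sgn (det (matrix (D y))) = e" and e: "\<bar>e\<bar> = (1::real)"
    and inj: "w \<noteq> 0 \<Longrightarrow> D z w \<noteq> 0"
  shows "principal_vector X' z \<kappa> w \<longleftrightarrow> principal_vector X (\<sigma> z) (e * \<kappa>) (D z w)"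
proof -
  let ?B = "frechet_derivative (unit_normal X) (at (\<sigma> z))"
  have "(unit_normal X has_derivative ?B) (at (\<sigma> z))" using dN frechet_derivative_works by blast
  from has_derivative_compose[OF d\<sigma>[OF O(2)] this]
  have "((\<lambda>y. e *\<^sub>R unit_normal X (\<sigma> y)) has_derivative (\<lambda>w. e *\<^sub>R ?B (D z w))) (at z)"
    by (rule has_derivative_scaleR_right)
  hence "(unit_normal X' has_derivative (\<lambda>w. e *\<^sub>R ?B (D z w))) (at z)"
  proof (rule has_derivative_transform_within_open[OF _ O])
    fix y assume y: "y \<in> S"
    show "e *\<^sub>R unit_normal X (\<sigma> y) = unit_normal X' y"
      using unit_normal_compose(1)[OF O(1) y X' d\<sigma>[OF y] dX[OF y]] sgn[OF y] by simp
  qed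
  hence fr: "frechet_derivative (unit_normal X') (at z) = (\<lambda>w. e *\<^sub>R ?B (D z w))"
    by (rule frechet_derivative_at[symmetric])
  have ee: "e * e = 1" using e by (auto simp: abs_if split: if_splits)
  have flip: "e *\<^sub>R a = - \<kappa> *\<^sub>R b \<longleftrightarrow> a = - (e * \<kappa>) *\<^sub>R b" for a b :: "real^3"
  proof
    assume "e *\<^sub>R a = - \<kappa> *\<^sub>R b"
    hence "e *\<^sub>R (e *\<^sub>R a) = e *\<^sub>R (- \<kappa> *\<^sub>R b)" by simp
    thus "a = - (e * \<kappa>) *\<^sub>R b" using ee by simp
  next
    assume "a = - (e * \<kappa>) *\<^sub>R b"
    hence "e *\<^sub>R a = - (e * e * \<kappa>) *\<^sub>R b" by simp
    thus "e *\<^sub>R a = - \<kappa> *\<^sub>R b" using ee by simp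
  qed
  have "D z w = 0" if "w = 0" using that d\<sigma>[OF O(2)] linear_0 has_derivative_linear by blast
  hence nz: "w \<noteq> 0 \<longleftrightarrow> D z w \<noteq> 0" using inj by blast
  have fX: "frechet_derivative X' (at z) w = frechet_derivative X (at (\<sigma> z)) (D z w)"
    by (rule unit_normal_compose(2)[OF O X' d\<sigma>[OF O(2)] dX[OF O(2)]])
  show ?thesis by (simp only: principal_vector_def fr fX flip nz)
qed

lemma is_chart_open_image:
  assumes "is_chart (U, \<phi>)" "open W" "W \<subseteq> U"
  shows "open (\<phi> ` W)"
proof -
  have h: "homeomorphism U (\<phi> ` U) \<phi> (inv_into U \<phi>)" "open (\<phi> ` U)" using assms(1) by (auto simp: is_chart_def)
  have "openin (top_of_set (\<phi> ` U)) (\<phi> ` W)"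
    by (rule homeomorphism_imp_open_map[OF h(1)]) (use assms in \<open>auto intro: open_subset\<close>)
  thus ?thesis using h(2) by (simp add: openin_open_eq)
qed

lemma is_chart_open_preimage:
  assumes "is_chart (U, \<phi>)" "open N"
  shows "open {x \<in> U. \<phi> x \<in> N}"
proof -
  have "continuous_on U \<phi>" "open U" using assms(1) by (auto simp: is_chart_def homeomorphism_def)
  hence "open (\<phi> -` N \<inter> U)" using assms(2) by (simp add: continuous_on_open_vimage)
  moreover have "\<phi> -` N \<inter> U = {x \<in> U. \<phi> x \<in> N}" by auto
  ultimately show ?thesis by simp
qed

lemma is_chart_inv: "is_chart (U, \<phi>) \<Longrightarrow> x \<in> U \<Longrightarrow> inv_into U \<phi> (\<phi> x) = x"
  by (auto simp: is_chart_def homeomorphism_def)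

lemma transition_apply: "is_chart c \<Longrightarrow> x \<in> fst c \<Longrightarrow> transition c d (snd c x) = snd d x"
  using is_chart_inv[of "fst c" "snd c" x] by (simp add: transition_def)

text \<open>A surface which is a graph in an additional chart \<open>(U, \<phi>)\<close>. This chart is compatible with the
  atlas \<open>\<A>\<close> but may reverse the orientation, and it is not a member of \<open>\<A>\<close> in general; principal
  curvatures are defined by the charts of \<open>\<A>\<close>. Transitions of class \<open>C\<^sup>1\<close> suffice, for the smoothness
  of the immersion is that of \<open>h\<close>.\<close>
locale graph_chart =
  fixes \<A> :: "'m::t2_space chart set" and \<alpha> :: "'m \<Rightarrow> real^3" and x\<^sub>0 :: 'm
    and U :: "'m set" and \<phi> :: "'m \<Rightarrow> real^2" and M :: "real^3^3" and h :: "real^2 \<Rightarrow> real"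
  assumes charts: "\<And>c. c \<in> \<A> \<Longrightarrow> is_chart c" "(\<Union>c\<in>\<A>. fst c) = UNIV"
    and C1: "\<And>c d. \<lbrakk>c \<in> insert (U, \<phi>) \<A>; d \<in> insert (U, \<phi>) \<A>\<rbrakk> \<Longrightarrow>
      Cr_on 1 (transition c d) (snd c ` (fst c \<inter> fst d))"
    and oriented: "\<And>c d z. \<lbrakk>c \<in> \<A>; d \<in> \<A>; z \<in> snd c ` (fst c \<inter> fst d)\<rbrakk> \<Longrightarrow>
      det (matrix (frechet_derivative (transition c d) (at z))) > 0"
    and chart: "is_chart (U, \<phi>)" and x\<^sub>0: "x\<^sub>0 \<in> U" "\<phi> x\<^sub>0 = 0"
    and M: "orthogonal_matrix M"
    and graph: "\<And>z. z \<in> \<phi> ` U \<Longrightarrow> local_param (U, \<phi>) \<alpha> z = \<alpha> x\<^sub>0 + M *v vector [z$1, z$2, h z]"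
    and h: "Cr_on 4 h (\<phi> ` U)"
begin

definition hu :: "real^2 \<Rightarrow> real" where "hu = iter_deriv [axis 1 1] h"
definition hv :: "real^2 \<Rightarrow> real" where "hv = iter_deriv [axis 2 1] h"
definition huu :: "real^2 \<Rightarrow> real" where "huu = iter_deriv [axis 1 1, axis 1 1] h"
definition huv :: "real^2 \<Rightarrow> real" where "huv = iter_deriv [axis 1 1, axis 2 1] h"
definition hvv :: "real^2 \<Rightarrow> real" where "hvv = iter_deriv [axis 2 1, axis 2 1] h"

lemma openU: "open U" "open (\<phi> ` U)"
  using chart by (auto simp: is_chart_def)

lemma ball_in_chart: obtains e where "e > 0" "ball 0 e \<subseteq> \<phi> ` U"
proof -
  have "0 \<in> \<phi> ` U" using x\<^sub>0 by (metis imageI)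
  thus ?thesis using openE[OF openU(2)] that by blast
qed

lemma partial_derivative:
  assumes "Cr_on (Suc r) g (\<phi> ` U)" "z \<in> \<phi> ` U"
  shows "(g has_derivative (\<lambda>w. frechet_derivative g (at z) (axis 1 1) * w$1
      + frechet_derivative g (at z) (axis 2 1) * w$2)) (at z)"
proof -
  have d: "(g has_derivative frechet_derivative g (at z)) (at z)" by (rule Cr_on_has_derivative[OF assms])
  have "frechet_derivative g (at z) = (\<lambda>w. frechet_derivative g (at z) (axis 1 1) * w$1
      + frechet_derivative g (at z) (axis 2 1) * w$2)"
  proof
    fix w
    have "frechet_derivative g (at z) w = w$1 * frechet_derivative g (at z) (axis 1 1)
        + w$2 * frechet_derivative g (at z) (axis 2 1)"
      using linear_real2[OF has_derivative_linear[OF d], of w] unfolding real_scaleR_def .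
    thus "frechet_derivative g (at z) w = frechet_derivative g (at z) (axis 1 1) * w$1
        + frechet_derivative g (at z) (axis 2 1) * w$2" by (simp only: mult.commute)
  qed
  with d show ?thesis by (simp only:)
qed

lemma huv_symmetric:
  assumes "z \<in> \<phi> ` U"
  shows "iter_deriv [axis 2 1, axis 1 1] h z = huv z"
proof -
  obtain e where e: "e > 0" "ball z e \<subseteq> \<phi> ` U" using openE[OF openU(2) assms] by blast
  have "Cr_on 2 h (ball z e)" by (rule Cr_on_subset[OF Cr_on_mono[OF h] e(2)]) simp
  thus ?thesis unfolding huv_def by (rule second_derivative_symmetric[OF _ e(1)])
qed

sublocale graph_immersion h hu hv huu huv hvv "\<phi> ` U" "\<alpha> x\<^sub>0" M "local_param (U, \<phi>) \<alpha>"
proof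
  have h': "Cr_on (Suc 3) h (\<phi> ` U)" using h by (simp add: numeral_eq_Suc)
  fix z assume z: "z \<in> \<phi> ` U"
  show "(h has_derivative (\<lambda>w. hu z * w $ 1 + hv z * w $ 2)) (at z)"
    using partial_derivative[OF h' z] by (simp add: hu_def hv_def)
  have Cu: "Cr_on (Suc 2) hu (\<phi> ` U)" "Cr_on (Suc 2) hv (\<phi> ` U)"
    using h by (simp_all add: hu_def hv_def numeral_eq_Suc)
  show "(hu has_derivative (\<lambda>w. huu z * w $ 1 + huv z * w $ 2)) (at z)"
    using partial_derivative[OF Cu(1) z] by (simp add: huu_def huv_def hu_def)
  show "(hv has_derivative (\<lambda>w. huv z * w $ 1 + hvv z * w $ 2)) (at z)"
    using partial_derivative[OF Cu(2) z] huv_symmetric[OF z] by (simp add: hvv_def hv_def)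
qed (use openU M graph in auto)

text \<open>Passage from a chart of the atlas to the graph chart, and its derivative.\<close>
abbreviation \<sigma> :: "'m chart \<Rightarrow> real^2 \<Rightarrow> real^2" where "\<sigma> c \<equiv> transition c (U, \<phi>)"
abbreviation D\<sigma> :: "'m chart \<Rightarrow> 'm \<Rightarrow> real^2 \<Rightarrow> real^2" where
  "D\<sigma> c x \<equiv> frechet_derivative (\<sigma> c) (at (snd c x))"

lemma all_charts: "c \<in> insert (U, \<phi>) \<A> \<Longrightarrow> is_chart c"
  using charts(1) chart by blast

lemma chart_open: "c \<in> insert (U, \<phi>) \<A> \<Longrightarrow> open (fst c)"
  using all_charts[of c] by (simp add: is_chart_def case_prod_unfold)

lemma transition_derivative:
  assumes "c \<in> insert (U, \<phi>) \<A>" "d \<in> insert (U, \<phi>) \<A>" "x \<in> fst c" "x \<in> fst d"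
  shows "(transition c d has_derivative frechet_derivative (transition c d) (at (snd c x))) (at (snd c x))"
proof (rule Cr_on_has_derivative)
  show "Cr_on (Suc 0) (transition c d) (snd c ` (fst c \<inter> fst d))" using C1[OF assms(1,2)] by simp
  show "snd c x \<in> snd c ` (fst c \<inter> fst d)" using assms(3,4) by blast
qed

lemma overlap_open:
  assumes "c \<in> insert (U, \<phi>) \<A>" "open W" "W \<subseteq> fst c"
  shows "open (snd c ` W)"
  using is_chart_open_image[of "fst c" "snd c" W] assms(2,3) all_charts[OF assms(1)] by simp

lemma transition_chain:
  assumes c: "c \<in> insert (U, \<phi>) \<A>" "d \<in> insert (U, \<phi>) \<A>" "b \<in> insert (U, \<phi>) \<A>"
    and x: "x \<in> fst c" "x \<in> fst d" "x \<in> fst b"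
  shows "frechet_derivative (transition c b) (at (snd c x)) =
    frechet_derivative (transition d b) (at (snd d x)) \<circ> frechet_derivative (transition c d) (at (snd c x))"
proof -
  note ic = c[THEN all_charts] and o = c[THEN chart_open]
  have "(transition d b has_derivative frechet_derivative (transition d b) (at (snd d x)))
      (at (transition c d (snd c x)))"
    using transition_derivative[OF c(2,3) x(2,3)] transition_apply[OF ic(1) x(1), of d] by simp
  from has_derivative_compose[OF transition_derivative[OF c(1,2) x(1,2)] this]
  have "((\<lambda>y. transition d b (transition c d y)) has_derivative
      (\<lambda>w. frechet_derivative (transition d b) (at (snd d x)) (frechet_derivative (transition c d) (at (snd c x)) w)))
      (at (snd c x))" .
  hence "(transition c b has_derivative
      (\<lambda>w. frechet_derivative (transition d b) (at (snd d x)) (frechet_derivative (transition c d) (at (snd c x)) w)))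
      (at (snd c x))"
  proof (rule has_derivative_transform_within_open)
    show "open (snd c ` (fst c \<inter> fst d \<inter> fst b))" using o by (intro overlap_open[OF c(1)]) auto
    show "snd c x \<in> snd c ` (fst c \<inter> fst d \<inter> fst b)" using x by auto
    fix y assume "y \<in> snd c ` (fst c \<inter> fst d \<inter> fst b)"
    thus "transition d b (transition c d y) = transition c b y"
      by (auto simp: transition_apply[OF ic(1)] transition_apply[OF ic(2)])
  qed
  from frechet_derivative_at[OF this] show ?thesis by (simp add: o_def)
qed

lemma transition_self:
  assumes c: "c \<in> insert (U, \<phi>) \<A>" and x: "x \<in> fst c"
  shows "frechet_derivative (transition c c) (at (snd c x)) = id"
proof -
  have ic: "is_chart c" by (rule all_charts[OF c])
  have "(transition c c has_derivative id) (at (snd c x))"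
  proof (rule has_derivative_transform_within_open[of "\<lambda>y. y"])
    show "((\<lambda>y. y) has_derivative id) (at (snd c x))" by (simp add: id_def)
    show "open (snd c ` fst c)" using ic by (auto simp: is_chart_def)
    show "snd c x \<in> snd c ` fst c" using x by auto
    show "\<And>y. y \<in> snd c ` fst c \<Longrightarrow> y = transition c c y" by (auto simp: transition_apply[OF ic])
  qed
  thus ?thesis by (rule frechet_derivative_at[symmetric])
qed

lemma D\<sigma>_inverse:
  assumes c: "c \<in> \<A>" and x: "x \<in> fst c" "x \<in> U"
  defines "E \<equiv> frechet_derivative (transition (U, \<phi>) c) (at (\<phi> x))"
  shows "D\<sigma> c x (E w) = w" "E (D\<sigma> c x w) = w"
  using transition_chain[of "(U, \<phi>)" c "(U, \<phi>)" x] transition_chain[of c "(U, \<phi>)" c x]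
    transition_self[of "(U, \<phi>)" x] transition_self[of c x] assms
  by (auto simp: fun_eq_iff)

lemma D\<sigma>_linear:
  assumes c: "c \<in> \<A>" and x: "x \<in> fst c" "x \<in> U"
  shows "linear (D\<sigma> c x)" "D\<sigma> c x w = 0 \<longleftrightarrow> w = 0" "det (matrix (D\<sigma> c x)) \<noteq> 0"
proof -
  show lin: "linear (D\<sigma> c x)"
    by (rule has_derivative_linear[OF transition_derivative]) (use c x in auto)
  show "D\<sigma> c x w = 0 \<longleftrightarrow> w = 0" using D\<sigma>_inverse(2)[OF c x] linear_0[OF lin] by metis
  have "inj (D\<sigma> c x)"
    by (rule inj_on_inverseI[of _ "frechet_derivative (transition (U, \<phi>) c) (at (\<phi> x))"])
      (rule D\<sigma>_inverse(2)[OF c x])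
  thus "det (matrix (D\<sigma> c x)) \<noteq> 0" using lin by (simp add: det_nz_iff_inj)
qed

text \<open>The Jacobian determinant of one transition has a constant sign near \<open>x\<^sub>0\<close>, and the
  orientation of the atlas transfers the sign to all other charts.\<close>
lemma orientation_sign:
  "\<exists>e W. \<bar>e\<bar> = 1 \<and> open W \<and> x\<^sub>0 \<in> W \<and> W \<subseteq> U \<and>
    (\<forall>x\<in>W. \<forall>c\<in>\<A>. x \<in> fst c \<longrightarrow> sgn (det (matrix (D\<sigma> c x))) = e)"
proof -
  obtain c1 where c1: "c1 \<in> \<A>" "x\<^sub>0 \<in> fst c1" using charts(2) by blast
  have ic: "is_chart c1" by (rule charts(1)[OF c1(1)])
  have o1: "open (fst c1)" using ic by (auto simp: is_chart_def case_prod_unfold)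
  define O1 where "O1 = snd c1 ` (fst c1 \<inter> U)"
  have O1: "open O1" unfolding O1_def using c1 o1 openU by (intro overlap_open) auto
  define J where "J y = det (matrix (frechet_derivative (\<sigma> c1) (at y)))" for y
  have "Cr_on 1 (\<sigma> c1) O1" using C1[of c1 "(U, \<phi>)"] c1 by (simp add: O1_def)
  hence "continuous_on O1 (\<lambda>y. frechet_derivative (\<sigma> c1) (at y) w)" for w by simp
  hence contJ: "continuous_on O1 J"
    unfolding J_def det_2 matrix_def by (auto intro!: continuous_intros)
  define y0 where "y0 = snd c1 x\<^sub>0"
  have y0: "y0 \<in> O1" using c1 x\<^sub>0 by (auto simp: y0_def O1_def)
  have J0: "J y0 \<noteq> 0" unfolding J_def y0_def using D\<sigma>_linear(3)[OF c1 x\<^sub>0(1)] by simp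
  define e where "e = sgn (J y0)"
  define N where "N = {y \<in> O1. 0 < e * J y}"
  have "open N"
  proof -
    have "continuous_on O1 (\<lambda>y. e * J y)" by (intro continuous_intros contJ)
    hence "open ((\<lambda>y. e * J y) -` {0<..} \<inter> O1)" using O1 by (simp add: continuous_on_open_vimage)
    moreover have "(\<lambda>y. e * J y) -` {0<..} \<inter> O1 = N" by (auto simp: N_def)
    ultimately show ?thesis by simp
  qed
  have Ns: "sgn (J y) = e" if "y \<in> N" for y
    using that J0 by (auto simp: N_def e_def sgn_if zero_less_mult_iff split: if_splits)
  define W where "W = {x \<in> fst c1. snd c1 x \<in> N} \<inter> U"
  have "open W" unfolding W_def
    using is_chart_open_preimage[of "fst c1" "snd c1" N] ic \<open>open N\<close> openU by auto
  moreover have "x\<^sub>0 \<in> W" using c1 x\<^sub>0 y0 J0 by (auto simp: W_def N_def y0_def[symmetric] e_def sgn_mult_self_eq abs_sgn[symmetric] mult.commute[of "sgn _"])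
  moreover have "sgn (det (matrix (D\<sigma> c x))) = e" if x: "x \<in> W" and c: "c \<in> \<A>" "x \<in> fst c" for x c
  proof -
    have x1: "x \<in> fst c1" "x \<in> U" "snd c1 x \<in> N" using x by (auto simp: W_def)
    have "D\<sigma> c x = D\<sigma> c1 x \<circ> frechet_derivative (transition c c1) (at (snd c x))"
      by (rule transition_chain) (use c c1 x1 in auto)
    moreover have "linear (D\<sigma> c1 x)" by (rule D\<sigma>_linear(1)[OF c1(1) x1(1,2)])
    moreover have "linear (frechet_derivative (transition c c1) (at (snd c x)))"
      by (rule has_derivative_linear[OF transition_derivative]) (use c c1 x1 in auto)
    ultimately have "det (matrix (D\<sigma> c x)) = det (matrix (D\<sigma> c1 x)) *
        det (matrix (frechet_derivative (transition c c1) (at (snd c x))))"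
      by (simp add: matrix_compose det_mul)
    moreover have "det (matrix (frechet_derivative (transition c c1) (at (snd c x)))) > 0"
      by (rule oriented) (use c c1 x1 in auto)
    ultimately show ?thesis using Ns[OF x1(3)] by (simp add: sgn_mult J_def)
  qed
  moreover have "\<bar>e\<bar> = 1" using J0 by (simp add: e_def abs_sgn_eq)
  ultimately show ?thesis unfolding W_def by blast
qed

lemma principal_vector_chart:
  assumes W: "open W" "W \<subseteq> U" and sgn: "\<And>x c. \<lbrakk>x \<in> W; c \<in> \<A>; x \<in> fst c\<rbrakk> \<Longrightarrow> sgn (det (matrix (D\<sigma> c x))) = e"
    and e: "\<bar>e\<bar> = 1" and c: "c \<in> \<A>" and x: "x \<in> W" "x \<in> fst c"
  shows "principal_vector (local_param c \<alpha>) (snd c x) \<kappa> w \<longleftrightarrow>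
    principal_vector (local_param (U, \<phi>) \<alpha>) (\<phi> x) (e * \<kappa>) (D\<sigma> c x w)"
proof -
  have ic: "is_chart c" by (rule charts(1)[OF c])
  have oc: "open (fst c)" using ic by (auto simp: is_chart_def case_prod_unfold)
  define S where "S = snd c ` (fst c \<inter> W)"
  have S: "open S" unfolding S_def using c oc W by (intro overlap_open) auto
  have xU: "x \<in> U" using x W by auto
  have \<sigma>: "\<sigma> c (snd c y) = \<phi> y" if "y \<in> fst c" for y using transition_apply[OF ic that] by simp
  have "principal_vector (local_param c \<alpha>) (snd c x) \<kappa> w \<longleftrightarrow>
      principal_vector (local_param (U, \<phi>) \<alpha>) (\<sigma> c (snd c x)) (e * \<kappa>) (D\<sigma> c x w)"
  proof (rule principal_vector_compose[OF S _ _ _ _ _ _ e])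
    show "snd c x \<in> S" using x by (auto simp: S_def)
    show "local_param c \<alpha> y = local_param (U, \<phi>) \<alpha> (\<sigma> c y)" if "y \<in> S" for y
    proof -
      obtain x' where x': "y = snd c x'" "x' \<in> fst c" "x' \<in> W" using \<open>y \<in> S\<close> by (auto simp: S_def)
      have "inv_into (fst c) (snd c) (snd c x') = x'" using is_chart_inv[of "fst c" "snd c" x'] ic x' by simp
      moreover have "inv_into U \<phi> (\<phi> x') = x'" using is_chart_inv[OF chart] x' W by blast
      ultimately show ?thesis using x' \<sigma>[OF x'(2)] by (simp add: local_param_def)
    qed
    show "(\<sigma> c has_derivative frechet_derivative (\<sigma> c) (at y)) (at y)" if "y \<in> S" for y
      using that transition_derivative[of c "(U, \<phi>)"] c W by (auto simp: S_def)
    have img: "\<sigma> c y \<in> \<phi> ` U" if "y \<in> S" for y using that \<sigma> W by (auto simp: S_def)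
    show "local_param (U, \<phi>) \<alpha> differentiable at (\<sigma> c y)" if "y \<in> S" for y
      using X_has_derivative[OF img[OF that]] by (auto simp: differentiable_def)
    show "unit_normal (local_param (U, \<phi>) \<alpha>) differentiable at (\<sigma> c (snd c x))"
      using unit_normal_has_derivative[of "\<phi> x"] xU \<sigma>[OF x(2)] by (auto simp: differentiable_def)
    show "sgn (det (matrix (frechet_derivative (\<sigma> c) (at y)))) = e" if "y \<in> S" for y
    proof -
      obtain x' where "y = snd c x'" "x' \<in> fst c" "x' \<in> W" using \<open>y \<in> S\<close> by (auto simp: S_def)
      thus ?thesis using sgn[OF _ c] by blast
    qed
    show "w \<noteq> 0 \<Longrightarrow> D\<sigma> c x w \<noteq> 0" using D\<sigma>_linear(2)[OF c x(2) xU] by simp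
  qed
  thus ?thesis using \<sigma>[OF x(2)] by simp
qed

text \<open>The coefficients of the equation \<open>(nu - mu) y'\<^sup>2 - 2 la x' y' + (nu + mu) x'\<^sup>2 = 0\<close> of the
  lines of curvature in the coordinates \<open>x = u + v\<close>, \<open>y = v - u\<close>.\<close>
definition mu :: "real^2 \<Rightarrow> real" where
  "mu z = (1 + (hu z)\<^sup>2) * hvv z - (1 + (hv z)\<^sup>2) * huu z"

definition la :: "real^2 \<Rightarrow> real" where
  "la z = ((1 + (hu z)\<^sup>2) + (1 + (hv z)\<^sup>2)) * huv z - hu z * hv z * (huu z + hvv z)"

definition nu :: "real^2 \<Rightarrow> real" where
  "nu z = ((1 + (hu z)\<^sup>2) - (1 + (hv z)\<^sup>2)) * huv z + hu z * hv z * (hvv z - huu z)"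

definition disc :: "real^2 \<Rightarrow> real" where "disc z = (la z)\<^sup>2 + (mu z)\<^sup>2 - (nu z)\<^sup>2"

definition nondeg :: "real^2 \<Rightarrow> bool" where "nondeg z \<longleftrightarrow> disc z > 0 \<and> la z + sqrt (disc z) > 0"

text \<open>The slope of the principal line which, for \<open>j = 1\<close>, belongs to the larger eigenvalue and, for
  \<open>j = - 1\<close>, to the smaller one, in the coordinates \<open>x = u + j v\<close>, \<open>y = j v - u\<close>.\<close>

definition slope :: "real \<Rightarrow> real^2 \<Rightarrow> real" where
  "slope j z = (j * mu z + nu z) / (la z + sqrt (disc z))"

definition on_line :: "real \<Rightarrow> real^2 \<Rightarrow> real^2 \<Rightarrow> bool" where
  "on_line j z w \<longleftrightarrow> j * w$2 - w$1 = slope j z * (w$1 + j * w$2)"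

lemma principal_vector_eigenlines:
  assumes z: "z \<in> \<phi> ` U" and nd: "nondeg z"
  shows "\<exists>k1 k2. k1 < k2 \<and> (\<forall>\<kappa> w. principal_vector (local_param (U, \<phi>) \<alpha>) z \<kappa> w \<longleftrightarrow>
    w \<noteq> 0 \<and> (det M * \<kappa> = k2 \<and> on_line 1 z w \<or> det M * \<kappa> = k1 \<and> on_line (- 1) z w))"
proof -
  have "\<exists>k1 k2. k1 < k2 \<and> (\<forall>k u v. (u, v) \<noteq> (0, 0) \<longrightarrow>
    (huu z * u + huv z * v = k * ((1 + (hu z)\<^sup>2) * u + hu z * hv z * v) \<and>
     huv z * u + hvv z * v = k * (hu z * hv z * u + (1 + (hv z)\<^sup>2) * v)) =
    (k = k2 \<and> v - u = slope 1 z * (u + v) \<or> k = k1 \<and> u + v = slope (- 1) z * (v - u)))"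
  proof -
    have nd': "(la z)\<^sup>2 + (mu z)\<^sup>2 - (nu z)\<^sup>2 > 0" "la z + sqrt ((la z)\<^sup>2 + (mu z)\<^sup>2 - (nu z)\<^sup>2) > 0"
      using nd by (auto simp: nondeg_def disc_def)
    have sl: "slope 1 z = (mu z + nu z) / (la z + sqrt ((la z)\<^sup>2 + (mu z)\<^sup>2 - (nu z)\<^sup>2))"
      "slope (- 1) z = (nu z - mu z) / (la z + sqrt ((la z)\<^sup>2 + (mu z)\<^sup>2 - (nu z)\<^sup>2))"
      by (simp_all add: slope_def disc_def)
    show ?thesis unfolding sl
      using eigenlines[where p = "hu z" and q = "hv z" and r = "huu z" and s = "huv z" and t = "hvv z",
          folded mu_def la_def nu_def, OF nd'] .
  qed
  then obtain k1 k2 where k: "k1 < k2" and eig: "\<And>k u v. (u, v) \<noteq> (0, 0) \<Longrightarrow>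
    (huu z * u + huv z * v = k * ((1 + (hu z)\<^sup>2) * u + hu z * hv z * v) \<and>
     huv z * u + hvv z * v = k * (hu z * hv z * u + (1 + (hv z)\<^sup>2) * v)) =
    (k = k2 \<and> v - u = slope 1 z * (u + v) \<or> k = k1 \<and> u + v = slope (- 1) z * (v - u))" by blast
  have L: "L z > 0" by (rule L_pos)
  have "principal_vector (local_param (U, \<phi>) \<alpha>) z \<kappa> w \<longleftrightarrow>
    w \<noteq> 0 \<and> (det M * \<kappa> = k2 / L z \<and> on_line 1 z w \<or> det M * \<kappa> = k1 / L z \<and> on_line (- 1) z w)" for \<kappa> w
  proof (cases "w = 0")
    case False
    hence nz: "(w$1, w$2) \<noteq> (0, 0)" by (auto simp: vec_eq_iff forall_2)
    have q: "det M * \<kappa> * L z = k' \<longleftrightarrow> det M * \<kappa> = k' / L z" for k' using L by (auto simp: field_simps)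
    have ol: "w$2 - w$1 = slope 1 z * (w$1 + w$2) \<longleftrightarrow> on_line 1 z w"
      "w$1 + w$2 = slope (- 1) z * (w$2 - w$1) \<longleftrightarrow> on_line (- 1) z w"
      unfolding on_line_def by (auto simp: algebra_simps)
    show ?thesis
      unfolding principal_vector_graph[OF z] eig[OF nz, of "det M * \<kappa> * L z"] q ol using False by blast
  qed (simp add: principal_vector_def)
  moreover have "k1 / L z < k2 / L z" using k L by (rule divide_strict_right_mono)
  ultimately show ?thesis by blast
qed

lemma on_line_nonzero: "\<exists>w. w \<noteq> 0 \<and> on_line 1 z w" "\<exists>w. w \<noteq> 0 \<and> on_line (- 1) z w"
proof -
  have nz: "vector [a, b] \<noteq> (0 :: real^2) \<longleftrightarrow> a \<noteq> 0 \<or> b \<noteq> 0" for a b :: real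
    by (auto simp: vec_eq_iff forall_2 vector_2)
  show "\<exists>w. w \<noteq> 0 \<and> on_line 1 z w"
    by (rule exI[of _ "vector [1 - slope 1 z, 1 + slope 1 z]"]) (auto simp: nz on_line_def vector_2)
  show "\<exists>w. w \<noteq> 0 \<and> on_line (- 1) z w"
    by (rule exI[of _ "vector [1 - slope (- 1) z, - 1 - slope (- 1) z]"]) (auto simp: nz on_line_def vector_2)
qed

text \<open>Reversing the unit normal exchanges the two principal curvatures, and the normal of the graph
  may be opposite to the normal given by the orientation of the surface. The sign \<open>J i\<close> selects the
  eigenline for the foliation of index \<open>i\<close>.\<close>
theorem ex_principal_lines:
  "\<exists>W J. open W \<and> x\<^sub>0 \<in> W \<and> W \<subseteq> U \<and> \<bar>J Maximal :: real\<bar> = 1 \<and> J Minimal = - J Maximal \<and>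
    (\<forall>x\<in>W. nondeg (\<phi> x) \<longrightarrow> \<not> umbilic \<A> \<alpha> x \<and>
      (\<forall>i. \<forall>c\<in>\<A>. x \<in> fst c \<longrightarrow> (\<forall>w. principal_vector (local_param c \<alpha>) (snd c x) (principal_curvature \<A> \<alpha> i x) w
        \<longleftrightarrow> w \<noteq> 0 \<and> on_line (J i) (\<phi> x) (D\<sigma> c x w))))"
proof -
  obtain e W where e: "\<bar>e\<bar> = 1" and W: "open W" "x\<^sub>0 \<in> W" "W \<subseteq> U"
    and sgn: "\<And>x c. \<lbrakk>x \<in> W; c \<in> \<A>; x \<in> fst c\<rbrakk> \<Longrightarrow> sgn (det (matrix (D\<sigma> c x))) = e"
    using orientation_sign by blast
  define J where "J i = (case i of Maximal \<Rightarrow> det M * e | Minimal \<Rightarrow> - (det M * e))" for i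
  define d where "d = det M * e"
  have "\<bar>det M\<bar> = 1" using det_orthogonal_matrix[OF M] by auto
  hence d1: "\<bar>d\<bar> = 1" using e by (simp add: d_def abs_mult)
  hence dd: "d * (d * a) = a" for a by (auto simp: abs_if split: if_splits)
  have "\<not> umbilic \<A> \<alpha> x \<and>
      (\<forall>i. \<forall>c\<in>\<A>. x \<in> fst c \<longrightarrow> (\<forall>w. principal_vector (local_param c \<alpha>) (snd c x) (principal_curvature \<A> \<alpha> i x) w
        \<longleftrightarrow> w \<noteq> 0 \<and> on_line (J i) (\<phi> x) (D\<sigma> c x w)))" if x: "x \<in> W" and nd: "nondeg (\<phi> x)" for x
  proof -
    have xU: "x \<in> U" using x W by blast
    then obtain k1 k2 where k: "k1 < k2" and eig: "\<And>\<kappa> w. principal_vector (local_param (U, \<phi>) \<alpha>) (\<phi> x) \<kappa> w \<longleftrightarrow>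
      w \<noteq> 0 \<and> (det M * \<kappa> = k2 \<and> on_line 1 (\<phi> x) w \<or> det M * \<kappa> = k1 \<and> on_line (- 1) (\<phi> x) w)"
      using principal_vector_eigenlines[OF _ nd] by blast
    have pv: "principal_vector (local_param c \<alpha>) (snd c x) \<kappa> w \<longleftrightarrow>
      w \<noteq> 0 \<and> (\<kappa> = d * k2 \<and> on_line 1 (\<phi> x) (D\<sigma> c x w) \<or> \<kappa> = d * k1 \<and> on_line (- 1) (\<phi> x) (D\<sigma> c x w))"
      if c: "c \<in> \<A>" "x \<in> fst c" for c \<kappa> w
    proof -
      have sc: "det M * (e * \<kappa>) = k \<longleftrightarrow> \<kappa> = d * k" for k
        using dd[of \<kappa>] dd[of k] by (auto simp: d_def mult.assoc)
      have "principal_vector (local_param c \<alpha>) (snd c x) \<kappa> w \<longleftrightarrow>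
          principal_vector (local_param (U, \<phi>) \<alpha>) (\<phi> x) (e * \<kappa>) (D\<sigma> c x w)"
        by (rule principal_vector_chart[OF W(1,3) sgn e c(1) x c(2)])
      also have "\<dots> \<longleftrightarrow> D\<sigma> c x w \<noteq> 0 \<and> (\<kappa> = d * k2 \<and> on_line 1 (\<phi> x) (D\<sigma> c x w) \<or>
          \<kappa> = d * k1 \<and> on_line (- 1) (\<phi> x) (D\<sigma> c x w))"
        by (subst eig) (simp only: sc)
      finally show ?thesis by (simp only: D\<sigma>_linear(2)[OF c xU])
    qed
    obtain c0 where c0: "c0 \<in> \<A>" "x \<in> fst c0" using charts(2) by blast
    have surj: "\<exists>w. w \<noteq> 0 \<and> D\<sigma> c0 x w = w'" if "w' \<noteq> 0" for w'
      using D\<sigma>_inverse(1)[OF c0 xU] D\<sigma>_linear(2)[OF c0 xU] that by metis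
    have ex: "\<exists>w. w \<noteq> 0 \<and> on_line 1 (\<phi> x) (D\<sigma> c0 x w)" "\<exists>w. w \<noteq> 0 \<and> on_line (- 1) (\<phi> x) (D\<sigma> c0 x w)"
      using on_line_nonzero[of "\<phi> x"] surj by metis+
    have pc: "principal_curvatures \<A> \<alpha> x = {d * k1, d * k2}"
    proof (intro equalityI subsetI)
      fix \<kappa> assume "\<kappa> \<in> principal_curvatures \<A> \<alpha> x"
      thus "\<kappa> \<in> {d * k1, d * k2}" unfolding principal_curvatures_def using pv by auto
    next
      fix \<kappa> assume "\<kappa> \<in> {d * k1, d * k2}"
      thus "\<kappa> \<in> principal_curvatures \<A> \<alpha> x"
        unfolding principal_curvatures_def using c0 pv[OF c0] ex by blast
    qed
    have lt: "d = 1 \<and> d * k1 < d * k2 \<or> d = - 1 \<and> d * k2 < d * k1"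
      using d1 k by (auto simp: abs_if split: if_splits)
    have cur: "principal_curvature \<A> \<alpha> i x = (if J i = 1 then d * k2 else d * k1)" for i
      using lt by (cases i) (auto simp: pc J_def d_def[symmetric])
    have Ji: "J i = 1 \<or> J i = - 1" for i
      using lt by (cases i) (auto simp: J_def d_def[symmetric])
    have "\<not> umbilic \<A> \<alpha> x" using lt by (auto simp: umbilic_def pc)
    moreover have "principal_vector (local_param c \<alpha>) (snd c x) (principal_curvature \<A> \<alpha> i x) w
        \<longleftrightarrow> w \<noteq> 0 \<and> on_line (J i) (\<phi> x) (D\<sigma> c x w)" if c: "c \<in> \<A>" "x \<in> fst c" for i c w
      using Ji[of i]
    proof
      assume J: "J i = 1"
      show ?thesis unfolding pv[OF c] cur J using lt by auto
    next
      assume J: "J i = - 1"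
      show ?thesis unfolding pv[OF c] cur J using lt by auto
    qed
    ultimately show ?thesis by blast
  qed
  moreover have "\<bar>J Maximal\<bar> = 1" "J Minimal = - J Maximal" using d1 by (auto simp: J_def d_def)
  ultimately show ?thesis using W by (intro exI[of _ W] exI[of _ J]) blast
qed

text \<open>The domain \<open>T\<close> is an arbitrary set of times. Continuity of \<open>\<gamma>\<close> keeps the curve in both charts
  near \<open>t\<close>, so that the transition map relates the two coordinate curves there.\<close>
lemma chart_derivative_change:
  assumes c: "c \<in> insert (U, \<phi>) \<A>" "d \<in> insert (U, \<phi>) \<A>" and t: "t \<in> T" "\<gamma> t \<in> fst c" "\<gamma> t \<in> fst d"
    and cont: "continuous_on T \<gamma>"
    and der: "((snd c \<circ> \<gamma>) has_vector_derivative w) (at t within T)"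
  shows "((snd d \<circ> \<gamma>) has_vector_derivative frechet_derivative (transition c d) (at (snd c (\<gamma> t))) w) (at t within T)"
proof -
  let ?D = "frechet_derivative (transition c d) (at (snd c (\<gamma> t)))"
  have D: "(transition c d has_derivative ?D) (at ((snd c \<circ> \<gamma>) t))"
    using transition_derivative[OF c t(2,3)] by simp
  have "((\<lambda>s. transition c d ((snd c \<circ> \<gamma>) s)) has_derivative (\<lambda>h. ?D (h *\<^sub>R w))) (at t within T)"
    using has_derivative_compose[OF der[unfolded has_vector_derivative_def] D] .
  moreover have "(\<lambda>h. ?D (h *\<^sub>R w)) = (\<lambda>h. h *\<^sub>R ?D w)"
    using linear_scale[OF has_derivative_linear[OF D]] by (intro ext) blast
  ultimately have "((\<lambda>s. transition c d ((snd c \<circ> \<gamma>) s)) has_derivative (\<lambda>h. h *\<^sub>R ?D w)) (at t within T)"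
    by (simp only:)
  hence "((snd d \<circ> \<gamma>) has_derivative (\<lambda>h. h *\<^sub>R ?D w)) (at t within T)"
  proof (rule has_derivative_transform_eventually)
    have "open (fst c \<inter> fst d)" using c[THEN chart_open] by blast
    hence "\<forall>\<^sub>F s in at t within T. \<gamma> s \<in> fst c \<inter> fst d"
      using cont t unfolding continuous_on_def by (blast dest: topological_tendstoD)
    thus "\<forall>\<^sub>F s in at t within T. transition c d ((snd c \<circ> \<gamma>) s) = (snd d \<circ> \<gamma>) s"
      by eventually_elim (simp add: transition_apply[OF all_charts[OF c(1)]])
    show "transition c d ((snd c \<circ> \<gamma>) t) = (snd d \<circ> \<gamma>) t"
      using t by (simp add: transition_apply[OF all_charts[OF c(1)]])
  qed (rule t(1))
  thus ?thesis by (simp add: has_vector_derivative_def)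
qed

text \<open>Lines of curvature can be recognised in the graph chart alone.\<close>
lemma line_of_curvature_chart:
  assumes W: "W \<subseteq> U" and \<gamma>: "\<gamma> ` T \<subseteq> W" and um: "umbilic \<A> \<alpha> x\<^sub>0"
    and nd: "\<And>x. \<lbrakk>x \<in> W; x \<noteq> x\<^sub>0\<rbrakk> \<Longrightarrow> \<not> umbilic \<A> \<alpha> x"
    and pv: "\<And>x c w. \<lbrakk>x \<in> W; x \<noteq> x\<^sub>0; c \<in> \<A>; x \<in> fst c\<rbrakk> \<Longrightarrow>
      principal_vector (local_param c \<alpha>) (snd c x) (principal_curvature \<A> \<alpha> i x) w
        \<longleftrightarrow> w \<noteq> 0 \<and> on_line j (\<phi> x) (D\<sigma> c x w)"
  shows "line_of_curvature \<A> \<alpha> i \<gamma> T \<longleftrightarrow> continuous_on T \<gamma> \<and> (\<forall>t\<in>T. \<gamma> t \<noteq> x\<^sub>0 \<and>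
    (\<exists>w. w \<noteq> 0 \<and> ((\<phi> \<circ> \<gamma>) has_vector_derivative w) (at t within T) \<and> on_line j (\<phi> (\<gamma> t)) w))"
proof -
  have "(\<not> umbilic \<A> \<alpha> (\<gamma> t) \<and> (\<forall>c\<in>\<A>. \<gamma> t \<in> fst c \<longrightarrow>
        (\<exists>w. ((snd c \<circ> \<gamma>) has_vector_derivative w) (at t within T) \<and>
          principal_vector (local_param c \<alpha>) (snd c (\<gamma> t)) (principal_curvature \<A> \<alpha> i (\<gamma> t)) w))) \<longleftrightarrow>
      (\<gamma> t \<noteq> x\<^sub>0 \<and> (\<exists>w. w \<noteq> 0 \<and> ((\<phi> \<circ> \<gamma>) has_vector_derivative w) (at t within T) \<and> on_line j (\<phi> (\<gamma> t)) w))"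
    (is "?A \<longleftrightarrow> ?B") if cont: "continuous_on T \<gamma>" and t: "t \<in> T" for t
  proof
    have x: "\<gamma> t \<in> W" "\<gamma> t \<in> U" using \<gamma> t W by auto
    obtain c where c: "c \<in> \<A>" "\<gamma> t \<in> fst c" using charts(2) by blast
    have c': "c \<in> insert (U, \<phi>) \<A>" "(U, \<phi>) \<in> insert (U, \<phi>) \<A>" using c by auto
    { assume A: ?A
      hence ne: "\<gamma> t \<noteq> x\<^sub>0" using um by auto
      obtain w where w: "((snd c \<circ> \<gamma>) has_vector_derivative w) (at t within T)"
        "principal_vector (local_param c \<alpha>) (snd c (\<gamma> t)) (principal_curvature \<A> \<alpha> i (\<gamma> t)) w"
        using A c by blast
      have "((\<phi> \<circ> \<gamma>) has_vector_derivative D\<sigma> c (\<gamma> t) w) (at t within T)"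
        using chart_derivative_change[OF c' t c(2) _ cont w(1)] x by simp
      moreover have "D\<sigma> c (\<gamma> t) w \<noteq> 0" "on_line j (\<phi> (\<gamma> t)) (D\<sigma> c (\<gamma> t) w)"
        using w(2) pv[OF x(1) ne c] D\<sigma>_linear(2)[OF c x(2)] by auto
      ultimately show ?B using ne by blast
    next
      assume B: ?B
      then obtain w where ne: "\<gamma> t \<noteq> x\<^sub>0" and w: "w \<noteq> 0" "((\<phi> \<circ> \<gamma>) has_vector_derivative w) (at t within T)"
        "on_line j (\<phi> (\<gamma> t)) w" by blast
      have "\<exists>w. ((snd c \<circ> \<gamma>) has_vector_derivative w) (at t within T) \<and>
          principal_vector (local_param c \<alpha>) (snd c (\<gamma> t)) (principal_curvature \<A> \<alpha> i (\<gamma> t)) w"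
        if c: "c \<in> \<A>" "\<gamma> t \<in> fst c" for c
      proof -
        have c': "c \<in> insert (U, \<phi>) \<A>" "(U, \<phi>) \<in> insert (U, \<phi>) \<A>" using c by auto
        let ?w = "frechet_derivative (transition (U, \<phi>) c) (at (\<phi> (\<gamma> t))) w"
        have "((snd c \<circ> \<gamma>) has_vector_derivative ?w) (at t within T)"
          using chart_derivative_change[OF c'(2,1) t _ c(2) cont] w(2) x by simp
        moreover have Dw: "D\<sigma> c (\<gamma> t) ?w = w" by (rule D\<sigma>_inverse(1)[OF c x(2)])
        hence "?w \<noteq> 0" using w(1) D\<sigma>_linear(2)[OF c x(2)] by metis
        hence "principal_vector (local_param c \<alpha>) (snd c (\<gamma> t)) (principal_curvature \<A> \<alpha> i (\<gamma> t)) ?w"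
          using pv[OF x(1) ne c] Dw w(3) by simp
        ultimately show ?thesis by blast
      qed
      thus ?A using nd[OF x(1) ne] by blast
    }
  qed
  thus ?thesis unfolding line_of_curvature_def by blast
qed

end

section \<open>The jets of a graph at an umbilic point\<close>

text \<open>The Landau condition \<open>O(\<bar>z\<bar>\<^sup>n)\<close> at the origin. Orders add under multiplication, which reduces
  the estimates below to counting.\<close>
definition order_at_least :: "nat \<Rightarrow> ('a::euclidean_space \<Rightarrow> real) \<Rightarrow> bool" where
  "order_at_least n f \<longleftrightarrow> (\<exists>K. \<exists>d>0. \<forall>z. norm z < d \<longrightarrow> \<bar>f z\<bar> \<le> K * norm z ^ n)"

lemma order_at_leastE:
  assumes "order_at_least n f"
  obtains K d where "K > 0" "d > 0" "d \<le> 1" "\<And>z. norm z < d \<Longrightarrow> \<bar>f z\<bar> \<le> K * norm z ^ n"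
proof -
  obtain K d where d: "d > 0" "\<And>z. norm z < d \<Longrightarrow> \<bar>f z\<bar> \<le> K * norm z ^ n"
    using assms by (auto simp: order_at_least_def)
  have "\<bar>f z\<bar> \<le> (\<bar>K\<bar> + 1) * norm z ^ n" if "norm z < min d 1" for z
  proof -
    have "K * norm z ^ n \<le> (\<bar>K\<bar> + 1) * norm z ^ n" by (intro mult_right_mono) auto
    thus ?thesis using d(2)[of z] that by simp
  qed
  thus ?thesis using d(1) by (intro that[of "\<bar>K\<bar> + 1" "min d 1"]) auto
qed

lemma order_mono: "order_at_least n f \<Longrightarrow> m \<le> n \<Longrightarrow> order_at_least m f"
proof (elim order_at_leastE)
  fix K d assume "m \<le> n" and K: "K > 0" "d > 0" "d \<le> 1" "\<And>z. norm z < d \<Longrightarrow> \<bar>f z\<bar> \<le> K * norm z ^ n"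
  have "\<bar>f z\<bar> \<le> K * norm z ^ m" if z: "norm z < d" for z
  proof -
    have "norm z ^ n \<le> norm z ^ m" using z K \<open>m \<le> n\<close> by (intro power_decreasing) auto
    thus ?thesis using K(4)[OF z] K(1) by (meson mult_left_mono less_imp_le order_trans)
  qed
  thus "order_at_least m f" unfolding order_at_least_def using K by blast
qed

lemma order_add:
  assumes "order_at_least n f" "order_at_least n g"
  shows "order_at_least n (\<lambda>z. f z + g z)"
proof -
  obtain K d where 1: "d > 0" "\<And>z. norm z < d \<Longrightarrow> \<bar>f z\<bar> \<le> K * norm z ^ n"
    using assms(1) order_at_leastE by metis
  obtain K' d' where 2: "d' > 0" "\<And>z. norm z < d' \<Longrightarrow> \<bar>g z\<bar> \<le> K' * norm z ^ n"
    using assms(2) order_at_leastE by metis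
  have "\<bar>f z + g z\<bar> \<le> (K + K') * norm z ^ n" if "norm z < min d d'" for z
    using 1(2)[of z] 2(2)[of z] that abs_triangle_ineq[of "f z" "g z"] by (simp add: distrib_right)
  thus ?thesis unfolding order_at_least_def using 1(1) 2(1) by (intro exI[of _ "K + K'"] exI[of _ "min d d'"]) auto
qed

lemma order_mult:
  assumes "order_at_least n f" "order_at_least m g"
  shows "order_at_least (n + m) (\<lambda>z. f z * g z)"
proof -
  obtain K d where 1: "K > 0" "d > 0" "\<And>z. norm z < d \<Longrightarrow> \<bar>f z\<bar> \<le> K * norm z ^ n"
    using assms(1) order_at_leastE by metis
  obtain K' d' where 2: "K' > 0" "d' > 0" "\<And>z. norm z < d' \<Longrightarrow> \<bar>g z\<bar> \<le> K' * norm z ^ m"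
    using assms(2) order_at_leastE by metis
  have "\<bar>f z * g z\<bar> \<le> (K * K') * norm z ^ (n + m)" if "norm z < min d d'" for z
  proof -
    have "\<bar>f z\<bar> * \<bar>g z\<bar> \<le> (K * norm z ^ n) * (K' * norm z ^ m)"
      using 1 2 that by (intro mult_mono) auto
    thus ?thesis by (simp add: abs_mult power_add mult_ac)
  qed
  thus ?thesis unfolding order_at_least_def using 1(2) 2(2) by (intro exI[of _ "K * K'"] exI[of _ "min d d'"]) auto
qed

lemma order_mult': "\<lbrakk>order_at_least n f; order_at_least m g; k \<le> n + m\<rbrakk> \<Longrightarrow> order_at_least k (\<lambda>z. f z * g z)"
  by (blast intro: order_mono order_mult)

lemma order_minus: "order_at_least n f \<Longrightarrow> order_at_least n (\<lambda>z. - f z)"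
  by (simp add: order_at_least_def)

lemma order_diff: "\<lbrakk>order_at_least n f; order_at_least n g\<rbrakk> \<Longrightarrow> order_at_least n (\<lambda>z. f z - g z)"
  using order_add[of n f "\<lambda>z. - g z"] order_minus[of n g] by simp

lemma order_const: "order_at_least 0 (\<lambda>z. c)"
  unfolding order_at_least_def by (intro exI[of _ "\<bar>c\<bar>"] exI[of _ 1]) auto

lemma order_cmult: "order_at_least n f \<Longrightarrow> order_at_least n (\<lambda>z. c * f z)"
  using order_mult'[OF order_const, of n f n c] by simp

lemma order_coordinate: "order_at_least (Suc 0) (\<lambda>z :: real^'n. z $ i)"
  unfolding order_at_least_def using component_le_norm_cart
  by (intro exI[of _ 1] exI[of _ 1]) auto

lemma flat_imp_order: "flat n f \<Longrightarrow> order_at_least n f"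
  unfolding flat_def order_at_least_def by (metis zero_less_one)

lemma order_imp_flat:
  assumes "order_at_least n f" "m < n"
  shows "flat m f"
  unfolding flat_def
proof (intro allI impI)
  fix c :: real assume c: "c > 0"
  obtain K d where K: "K > 0" "d > 0" "d \<le> 1" "\<And>z. norm z < d \<Longrightarrow> \<bar>f z\<bar> \<le> K * norm z ^ n"
    using assms(1) by (auto elim: order_at_leastE)
  have "\<bar>f z\<bar> \<le> c * norm z ^ m" if z: "norm z < min d (c / K)" for z
  proof -
    have "norm z ^ n \<le> norm z ^ Suc m" using z K assms(2) by (intro power_decreasing) auto
    hence "\<bar>f z\<bar> \<le> K * norm z ^ Suc m" using K(4)[of z] K(1) z by (meson min_less_iff_conj mult_left_mono less_imp_le order_trans)
    also have "\<dots> = (K * norm z) * norm z ^ m" by simp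
    also have "\<dots> \<le> c * norm z ^ m" using z K(1) by (intro mult_right_mono) (auto simp: field_simps)
    finally show ?thesis .
  qed
  thus "\<exists>d>0. \<forall>z. norm z < d \<longrightarrow> \<bar>f z\<bar> \<le> c * norm z ^ m" using K c by (intro exI[of _ "min d (c / K)"]) auto
qed

lemma flat_add:
  assumes "flat n f" "flat n g" shows "flat n (\<lambda>z. f z + g z)"
  unfolding flat_def
proof (intro allI impI)
  fix c :: real assume "c > 0"
  hence c: "c / 2 > 0" by simp
  obtain d d' where d: "d > 0" "\<And>z. norm z < d \<Longrightarrow> \<bar>f z\<bar> \<le> c / 2 * norm z ^ n"
    "d' > 0" "\<And>z. norm z < d' \<Longrightarrow> \<bar>g z\<bar> \<le> c / 2 * norm z ^ n"
    using assms c unfolding flat_def by metis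
  have "\<bar>f z + g z\<bar> \<le> c * norm z ^ n" if "norm z < min d d'" for z
    using d(2)[of z] d(4)[of z] that abs_triangle_ineq[of "f z" "g z"] by simp
  thus "\<exists>d>0. \<forall>z. norm z < d \<longrightarrow> \<bar>f z + g z\<bar> \<le> c * norm z ^ n" using d(1,3) by (intro exI[of _ "min d d'"]) auto
qed

lemma flat_cmult:
  assumes "flat n f" shows "flat n (\<lambda>z. k * f z)"
proof (cases "k = 0")
  case True
  thus ?thesis by (auto simp: flat_def intro!: exI[of _ 1])
next
  case False
  show ?thesis unfolding flat_def
  proof (intro allI impI)
    fix c :: real assume "c > 0"
    hence "c / \<bar>k\<bar> > 0" using False by simp
    then obtain d where d: "d > 0" "\<And>z. norm z < d \<Longrightarrow> \<bar>f z\<bar> \<le> c / \<bar>k\<bar> * norm z ^ n"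
      using assms unfolding flat_def by metis
    have "\<bar>k * f z\<bar> \<le> c * norm z ^ n" if "norm z < d" for z
      using mult_left_mono[OF d(2)[OF that], of "\<bar>k\<bar>"] False by (simp add: abs_mult)
    thus "\<exists>d>0. \<forall>z. norm z < d \<longrightarrow> \<bar>k * f z\<bar> \<le> c * norm z ^ n" using d(1) by blast
  qed
qed

lemma flat_derivative:
  fixes g :: "'a::euclidean_space \<Rightarrow> real"
  assumes e: "e > 0" and C: "Cr_on (Suc n) g (ball 0 e)" and fl: "flat (Suc n) g"
    and d: "\<And>z. z \<in> ball 0 e \<Longrightarrow> (g has_derivative g' z) (at z)" and G: "\<And>z. G z = g' z w"
  shows "Cr_on n G (ball 0 e)" "flat n G"
proof -
  have eq: "frechet_derivative g (at z) w = G z" if "z \<in> ball 0 e" for z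
    using frechet_derivative_at[OF d[OF that]] G by simp
  show "Cr_on n G (ball 0 e)"
    by (rule Cr_on_cong[of _ _ "\<lambda>z. frechet_derivative g (at z) w"]) (use C eq in auto)
  have fl': "flat n (\<lambda>z. frechet_derivative g (at z) w)"
    using flat_iter_deriv[OF e C fl, of "[w]"] by simp
  show "flat n G" unfolding flat_def
  proof (intro allI impI)
    fix c :: real assume "c > 0"
    then obtain d where d: "d > 0" "\<And>z. norm z < d \<Longrightarrow> \<bar>frechet_derivative g (at z) w\<bar> \<le> c * norm z ^ n"
      using fl' unfolding flat_def by blast
    have "\<bar>G z\<bar> \<le> c * norm z ^ n" if "norm z < min d e" for z
      using d(2)[of z] eq[of z] that by simp
    thus "\<exists>d>0. \<forall>z. norm z < d \<longrightarrow> \<bar>G z\<bar> \<le> c * norm z ^ n"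
      using d(1) e by (intro exI[of _ "min d e"]) auto
  qed
qed

lemma Cr_on_power:
  fixes f :: "'a::euclidean_space \<Rightarrow> real"
  shows "open S \<Longrightarrow> Cr_on r f S \<Longrightarrow> Cr_on r (\<lambda>x. f x ^ n) S"
  by (induction n) (auto intro: Cr_on_const Cr_on_mult)

lemma Cr_on_diff:
  fixes f g :: "'a::euclidean_space \<Rightarrow> real"
  assumes "open S" "Cr_on r f S" "Cr_on r g S"
  shows "Cr_on r (\<lambda>x. f x - g x) S"
proof -
  have "Cr_on r (\<lambda>x. f x + (- 1) * g x) S" using assms by (intro Cr_on_add Cr_on_mult Cr_on_const)
  thus ?thesis by simp
qed

lemmas Cr_on_intros = Cr_on_add Cr_on_diff Cr_on_mult Cr_on_power Cr_on_const

text \<open>The normal form of the fourth Taylor polynomial: the coefficients of \<open>u\<^sup>3\<close>, \<open>u\<^sup>2 v\<close> and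
  \<open>u v\<^sup>2\<close> vanish.\<close>
locale quartic_jet = graph_chart +
  fixes k c A B C D E :: real
  assumes jet: "flat 4 (\<lambda>z. h z - (k/2 * ((z$1)^2 + (z$2)^2) + c/6 * (z$2)^3
      + A/24 * (z$1)^4 + B/6 * (z$1)^3 * z$2 + C/4 * (z$1)^2 * (z$2)^2 + D/6 * z$1 * (z$2)^3 + E/24 * (z$2)^4))"
begin

text \<open>The Taylor polynomial and its partial derivatives; \<open>dPuu w\<close>, \<open>dPuv w\<close> and \<open>dPvv w\<close> are the
  derivatives of the second ones in the direction \<open>w\<close>.\<close>
definition P :: "real^2 \<Rightarrow> real" where
  "P z = k/2 * ((z$1)^2 + (z$2)^2) + c/6 * (z$2)^3
      + A/24 * (z$1)^4 + B/6 * (z$1)^3 * z$2 + C/4 * (z$1)^2 * (z$2)^2 + D/6 * z$1 * (z$2)^3 + E/24 * (z$2)^4"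

definition Pu where "Pu z = k * z$1 + A/6 * (z$1)^3 + B/2 * (z$1)^2 * z$2 + C/2 * z$1 * (z$2)^2 + D/6 * (z$2)^3" for z :: "real^2"
definition Pv where "Pv z = k * z$2 + c/2 * (z$2)^2 + B/6 * (z$1)^3 + C/2 * (z$1)^2 * z$2 + D/2 * z$1 * (z$2)^2 + E/6 * (z$2)^3" for z :: "real^2"
definition Puu where "Puu z = k + A/2 * (z$1)^2 + B * z$1 * z$2 + C/2 * (z$2)^2" for z :: "real^2"
definition Puv where "Puv z = B/2 * (z$1)^2 + C * z$1 * z$2 + D/2 * (z$2)^2" for z :: "real^2"
definition Pvv where "Pvv z = k + c * z$2 + C/2 * (z$1)^2 + D * z$1 * z$2 + E/2 * (z$2)^2" for z :: "real^2"
definition dPuu where "dPuu w z = A * z$1 * w$1 + B * (w$1 * z$2 + z$1 * w$2) + C * z$2 * w$2" for w z :: "real^2"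
definition dPuv where "dPuv w z = B * z$1 * w$1 + C * (w$1 * z$2 + z$1 * w$2) + D * z$2 * w$2" for w z :: "real^2"
definition dPvv where "dPvv w z = c * w$2 + C * z$1 * w$1 + D * (w$1 * z$2 + z$1 * w$2) + E * z$2 * w$2" for w z :: "real^2"

lemma P_derivatives:
  "(P has_derivative (\<lambda>w. Pu z * w$1 + Pv z * w$2)) (at z)"
  "(Pu has_derivative (\<lambda>w. Puu z * w$1 + Puv z * w$2)) (at z)"
  "(Pv has_derivative (\<lambda>w. Puv z * w$1 + Pvv z * w$2)) (at z)"
  "(Puu has_derivative (\<lambda>w. dPuu w z)) (at z)"
  "(Puv has_derivative (\<lambda>w. dPuv w z)) (at z)"
  "(Pvv has_derivative (\<lambda>w. dPvv w z)) (at z)"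
proof -
  note c = bounded_linear_imp_has_derivative[OF bounded_linear_vec_nth]
  show "(P has_derivative (\<lambda>w. Pu z * w$1 + Pv z * w$2)) (at z)"
    unfolding P_def by (auto intro!: derivative_eq_intros c simp: fun_eq_iff Pu_def Pv_def field_simps power2_eq_square power3_eq_cube)
  show "(Pu has_derivative (\<lambda>w. Puu z * w$1 + Puv z * w$2)) (at z)"
    unfolding Pu_def by (auto intro!: derivative_eq_intros c simp: fun_eq_iff Puu_def Puv_def field_simps power2_eq_square)
  show "(Pv has_derivative (\<lambda>w. Puv z * w$1 + Pvv z * w$2)) (at z)"
    unfolding Pv_def by (auto intro!: derivative_eq_intros c simp: fun_eq_iff Puv_def Pvv_def field_simps power2_eq_square)
  show "(Puu has_derivative (\<lambda>w. dPuu w z)) (at z)"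
    unfolding Puu_def by (auto intro!: derivative_eq_intros c simp: fun_eq_iff dPuu_def field_simps)
  show "(Puv has_derivative (\<lambda>w. dPuv w z)) (at z)"
    unfolding Puv_def by (auto intro!: derivative_eq_intros c simp: fun_eq_iff dPuv_def field_simps)
  show "(Pvv has_derivative (\<lambda>w. dPvv w z)) (at z)"
    unfolding Pvv_def by (auto intro!: derivative_eq_intros c simp: fun_eq_iff dPvv_def field_simps)
qed

text \<open>The remainder \<open>h - P\<close> loses one order of flatness with each derivative. Three derivatives are
  needed: the slope involves second derivatives of \<open>h\<close>, and its monotonicity a further one.\<close>
lemma second_jet:
  "flat 3 (\<lambda>z. hu z - Pu z)" "flat 3 (\<lambda>z. hv z - Pv z)"
  "flat 2 (\<lambda>z. huu z - Puu z)" "flat 2 (\<lambda>z. huv z - Puv z)" "flat 2 (\<lambda>z. hvv z - Pvv z)"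
  "flat 1 (\<lambda>z. frechet_derivative huu (at z) w - dPuu w z)"
  "flat 1 (\<lambda>z. frechet_derivative huv (at z) w - dPuv w z)"
  "flat 1 (\<lambda>z. frechet_derivative hvv (at z) w - dPvv w z)"
proof -
  obtain e where e: "e > 0" "ball 0 e \<subseteq> \<phi> ` U" using ball_in_chart by blast
  have C2: "Cr_on 2 huu (\<phi> ` U)" "Cr_on 2 huv (\<phi> ` U)" "Cr_on 2 hvv (\<phi> ` U)"
    using h by (simp_all add: huu_def huv_def hvv_def numeral_eq_Suc)
  have dd: "(huu has_derivative frechet_derivative huu (at z)) (at z)"
    "(huv has_derivative frechet_derivative huv (at z)) (at z)"
    "(hvv has_derivative frechet_derivative hvv (at z)) (at z)" if "z \<in> ball 0 e" for z
    using C2 that e(2) by (auto simp: numeral_2_eq_2 frechet_derivative_works)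
  have CP: "Cr_on 4 P (ball 0 e)"
    unfolding P_def by (intro Cr_on_intros Cr_on_bounded_linear bounded_linear_vec_nth open_ball)
  have Ch: "Cr_on 4 h (ball 0 e)" by (rule Cr_on_subset[OF h e(2)])
  have C4: "Cr_on (Suc 3) (\<lambda>z. h z - P z) (ball 0 e)" using Cr_on_diff[OF _ Ch CP] by (simp add: numeral_eq_Suc)
  have f4: "flat (Suc 3) (\<lambda>z. h z - P z)" using jet by (simp add: P_def numeral_eq_Suc)
  note d = has_derivative_diff[OF _ P_derivatives(1)] has_derivative_diff[OF _ P_derivatives(2)]
    has_derivative_diff[OF _ P_derivatives(3)] has_derivative_diff[OF _ P_derivatives(4)]
    has_derivative_diff[OF _ P_derivatives(5)] has_derivative_diff[OF _ P_derivatives(6)]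
  have in_U: "z \<in> ball 0 e \<Longrightarrow> z \<in> \<phi> ` U" for z using e by blast
  note D0 = flat_derivative[OF e(1) C4 f4 d(1)[OF dh[OF in_U]]]
  have 1: "Cr_on 3 (\<lambda>z. hu z - Pu z) (ball 0 e)" "flat 3 (\<lambda>z. hu z - Pu z)"
    by (rule D0[where w = "axis 1 1"]; simp add: axis_def)+
  have 2: "Cr_on 3 (\<lambda>z. hv z - Pv z) (ball 0 e)" "flat 3 (\<lambda>z. hv z - Pv z)"
    by (rule D0[where w = "axis 2 1"]; simp add: axis_def)+
  have 1: "Cr_on (Suc 2) (\<lambda>z. hu z - Pu z) (ball 0 e)" "flat (Suc 2) (\<lambda>z. hu z - Pu z)"
    and 2: "Cr_on (Suc 2) (\<lambda>z. hv z - Pv z) (ball 0 e)" "flat (Suc 2) (\<lambda>z. hv z - Pv z)"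
    using 1 2 by (simp_all only: numeral_3_eq_3 numeral_2_eq_2)
  note D1 = flat_derivative[OF e(1) 1 d(2)[OF dp[OF in_U]]] and D2 = flat_derivative[OF e(1) 2 d(3)[OF dq[OF in_U]]]
  have 3: "Cr_on 2 (\<lambda>z. huu z - Puu z) (ball 0 e)" "flat 2 (\<lambda>z. huu z - Puu z)"
    by (rule D1[where w = "axis 1 1"]; simp add: axis_def)+
  have 4: "Cr_on 2 (\<lambda>z. huv z - Puv z) (ball 0 e)" "flat 2 (\<lambda>z. huv z - Puv z)"
    by (rule D1[where w = "axis 2 1"]; simp add: axis_def)+
  have 5: "Cr_on 2 (\<lambda>z. hvv z - Pvv z) (ball 0 e)" "flat 2 (\<lambda>z. hvv z - Pvv z)"
    by (rule D2[where w = "axis 2 1"]; simp add: axis_def)+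
  show "flat 3 (\<lambda>z. hu z - Pu z)" "flat 3 (\<lambda>z. hv z - Pv z)" using 1 2 by (simp_all add: numeral_eq_Suc)
  show "flat 2 (\<lambda>z. huu z - Puu z)" "flat 2 (\<lambda>z. huv z - Puv z)" "flat 2 (\<lambda>z. hvv z - Pvv z)"
    by (rule 3 4 5)+
  have two: "2 = Suc 1" by simp
  show "flat 1 (\<lambda>z. frechet_derivative huu (at z) w - dPuu w z)"
    by (rule flat_derivative(2)[OF e(1) 3[unfolded two] d(4)[OF dd(1)]]) auto
  show "flat 1 (\<lambda>z. frechet_derivative huv (at z) w - dPuv w z)"
    by (rule flat_derivative(2)[OF e(1) 4[unfolded two] d(5)[OF dd(2)]]) auto
  show "flat 1 (\<lambda>z. frechet_derivative hvv (at z) w - dPvv w z)"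
    by (rule flat_derivative(2)[OF e(1) 5[unfolded two] d(6)[OF dd(3)]]) auto
qed

lemma order_of_monomials:
  "order_at_least 1 (\<lambda>z :: real^2. a * z$i)"
  "order_at_least 2 (\<lambda>z :: real^2. a * (z$i * z$j))"
  "order_at_least 3 (\<lambda>z :: real^2. a * (z$i * (z$j * z$l)))"
proof -
  show 1: "order_at_least 1 (\<lambda>z :: real^2. a * z$i)" for a i
    using order_cmult[OF order_coordinate] by simp
  have 2: "order_at_least 2 (\<lambda>z :: real^2. z$i * z$j)" for i j
    by (rule order_mult'[OF 1[of 1, simplified] 1[of 1, simplified]]) simp
  show "order_at_least 2 (\<lambda>z :: real^2. a * (z$i * z$j))" by (rule order_cmult[OF 2])
  show "order_at_least 3 (\<lambda>z :: real^2. a * (z$i * (z$j * z$l)))"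
    by (rule order_cmult[OF order_mult'[OF 1[of 1, simplified] 2]]) simp
qed

lemma order_of_derivatives:
  "order_at_least 1 hu" "order_at_least 1 hv" "order_at_least 2 (\<lambda>z. hv z - k * z$2)"
  "order_at_least 0 huu" "order_at_least 2 huv" "order_at_least 0 hvv"
  "order_at_least 2 (\<lambda>z. hvv z - huu z - c * z$2)"
  "order_at_least 1 (\<lambda>z. hvv z - huu z)"
  "flat 2 (\<lambda>z. huv z - Puv z)"
  "order_at_least 1 (\<lambda>z. frechet_derivative huu (at z) w)"
  "order_at_least 1 (\<lambda>z. frechet_derivative huv (at z) w)"
  "order_at_least 0 (\<lambda>z. frechet_derivative hvv (at z) w)"
  "order_at_least 1 (\<lambda>z. frechet_derivative hvv (at z) w - c * w$2)"
proof -
  have split: "order_at_least n f" if "flat m (\<lambda>z. f z - g z)" "n \<le> m" "order_at_least n g" for n m f and g :: "real^2 \<Rightarrow> real"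
    using order_add[OF order_mono[OF flat_imp_order[OF that(1)] that(2)] that(3)] by simp
  note mono = order_of_monomials[THEN order_mono]
  note m = mono(1) mono(2) mono(3)
  have e: "x^2 = x * x" "x^3 = x * (x * x)" for x :: real by (simp_all add: power2_eq_square power3_eq_cube mult.assoc)
  have Pu: "order_at_least 1 Pu"
  proof -
    have "order_at_least 1 (\<lambda>z :: real^2. k * z$1 + A/6 * (z$1 * (z$1 * z$1)) + B/2 * (z$1 * (z$1 * z$2))
        + C/2 * (z$1 * (z$2 * z$2)) + D/6 * (z$2 * (z$2 * z$2)))"
      by (intro order_add m) auto
    thus ?thesis by (simp add: Pu_def[abs_def] e mult.assoc)
  qed
  have Pv: "order_at_least 2 (\<lambda>z. Pv z - k * z$2)"
  proof -
    have "order_at_least 2 (\<lambda>z :: real^2. c/2 * (z$2 * z$2) + B/6 * (z$1 * (z$1 * z$1)) + C/2 * (z$1 * (z$1 * z$2))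
        + D/2 * (z$1 * (z$2 * z$2)) + E/6 * (z$2 * (z$2 * z$2)))"
      by (intro order_add m) auto
    thus ?thesis by (simp add: Pv_def[abs_def] e mult.assoc add.assoc)
  qed
  have Puu: "order_at_least 2 (\<lambda>z. Puu z - k)"
  proof -
    have "order_at_least 2 (\<lambda>z :: real^2. A/2 * (z$1 * z$1) + B * (z$1 * z$2) + C/2 * (z$2 * z$2))"
      by (intro order_add m) auto
    thus ?thesis by (simp add: Puu_def[abs_def] e mult.assoc add.assoc)
  qed
  have Puv: "order_at_least 2 Puv"
  proof -
    have "order_at_least 2 (\<lambda>z :: real^2. B/2 * (z$1 * z$1) + C * (z$1 * z$2) + D/2 * (z$2 * z$2))"
      by (intro order_add m) auto
    thus ?thesis by (simp add: Puv_def[abs_def] e mult.assoc)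
  qed
  have Pvv: "order_at_least 2 (\<lambda>z. Pvv z - k - c * z$2)"
  proof -
    have "order_at_least 2 (\<lambda>z :: real^2. C/2 * (z$1 * z$1) + D * (z$1 * z$2) + E/2 * (z$2 * z$2))"
      by (intro order_add m) auto
    thus ?thesis by (simp add: Pvv_def[abs_def] e mult.assoc add.assoc)
  qed
  show "order_at_least 1 hu" by (rule split[OF second_jet(1) _ Pu]) simp
  have hv: "order_at_least 2 (\<lambda>z. hv z - k * z$2)"
    using order_add[OF order_mono[OF flat_imp_order[OF second_jet(2)]] Pv] by simp
  thus "order_at_least 2 (\<lambda>z. hv z - k * z$2)" .
  from order_add[OF order_mono[OF this, of 1] order_of_monomials(1)[of k 2]]
  show "order_at_least 1 hv" by simp
  have huu: "order_at_least 2 (\<lambda>z. huu z - k)"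
    using order_add[OF flat_imp_order[OF second_jet(3)] Puu] by simp
  have hvv: "order_at_least 2 (\<lambda>z. hvv z - k - c * z$2)"
    using order_add[OF flat_imp_order[OF second_jet(5)] Pvv] by (simp add: algebra_simps)
  show "order_at_least 2 huv" by (rule split[OF second_jet(4) _ Puv]) simp
  show "order_at_least 0 huu" using order_add[OF order_mono[OF huu, of 0] order_const[of k]] by simp
  have "order_at_least 0 (\<lambda>z. hvv z - k - c * z$2 + (k + c * z$2))"
    by (intro order_add order_mono[OF hvv] order_const order_mono[OF order_of_monomials(1)]) auto
  thus "order_at_least 0 hvv" by simp
  show 2: "order_at_least 2 (\<lambda>z. hvv z - huu z - c * z$2)"
    using order_diff[OF hvv huu] by (simp add: algebra_simps)
  from order_add[OF order_mono[OF this, of 1] order_of_monomials(1)[of c 2]]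
  show "order_at_least 1 (\<lambda>z. hvv z - huu z)" by simp
  show "flat 2 (\<lambda>z. huv z - Puv z)" by (rule second_jet(4))
  have "order_at_least 1 (\<lambda>z :: real^2. (A * w$1 + B * w$2) * z$1 + (B * w$1 + C * w$2) * z$2)"
    by (intro order_add m) auto
  hence "order_at_least 1 (dPuu w)" by (simp add: dPuu_def[abs_def] algebra_simps)
  thus "order_at_least 1 (\<lambda>z. frechet_derivative huu (at z) w)" by (rule split[OF second_jet(6) order_refl])
  have "order_at_least 1 (\<lambda>z :: real^2. (B * w$1 + C * w$2) * z$1 + (C * w$1 + D * w$2) * z$2)"
    by (intro order_add m) auto
  hence "order_at_least 1 (dPuv w)" by (simp add: dPuv_def[abs_def] algebra_simps)
  thus "order_at_least 1 (\<lambda>z. frechet_derivative huv (at z) w)" by (rule split[OF second_jet(7) order_refl])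
  have "order_at_least 1 (\<lambda>z :: real^2. (C * w$1 + D * w$2) * z$1 + (D * w$1 + E * w$2) * z$2)"
    by (intro order_add m) auto
  hence "order_at_least 1 (\<lambda>z. dPvv w z - c * w$2)" by (simp add: dPvv_def[abs_def] algebra_simps)
  from order_add[OF flat_imp_order[OF second_jet(8)[of w]] this]
  show t1: "order_at_least 1 (\<lambda>z. frechet_derivative hvv (at z) w - c * w$2)" by simp
  from order_add[OF order_mono[OF t1, of 0] order_const[of "c * w$2"]]
  show "order_at_least 0 (\<lambda>z. frechet_derivative hvv (at z) w)" by simp
qed

lemma coefficients_Cr:
  "Cr_on 1 mu (\<phi> ` U)" "Cr_on 1 la (\<phi> ` U)" "Cr_on 1 nu (\<phi> ` U)"
proof -
  have "Cr_on 3 hu (\<phi> ` U)" "Cr_on 3 hv (\<phi> ` U)" "Cr_on 2 huu (\<phi> ` U)" "Cr_on 2 huv (\<phi> ` U)" "Cr_on 2 hvv (\<phi> ` U)"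
    using h by (simp_all add: hu_def hv_def huu_def huv_def hvv_def numeral_eq_Suc)
  note C = this[THEN Cr_on_mono, of 1]
  show "Cr_on 1 mu (\<phi> ` U)" unfolding mu_def[abs_def] by (intro Cr_on_intros openU(2) C) auto
  show "Cr_on 1 la (\<phi> ` U)" unfolding la_def[abs_def] by (intro Cr_on_intros openU(2) C) auto
  show "Cr_on 1 nu (\<phi> ` U)" unfolding nu_def[abs_def] by (intro Cr_on_intros openU(2) C) auto
qed

text \<open>In each of the following estimates, the coefficient is written as a sum of products whose
  orders can be read off.\<close>
lemma order_mu: "order_at_least 2 (\<lambda>z. mu z - c * z$2)"
proof -
  note o = order_of_derivatives
  have "order_at_least 2 (\<lambda>z. (hvv z - huu z - c * z$2) + (hu z * hu z) * hvv z - (hv z * hv z) * huu z)"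
    by (rule order_diff[OF order_add[OF o(7) order_mult'[OF order_mult[OF o(1) o(1)] o(6)]]
          order_mult'[OF order_mult[OF o(2) o(2)] o(4)]]) auto
  thus ?thesis by (simp add: mu_def[abs_def] power2_eq_square algebra_simps)
qed

text \<open>An estimate of order two for \<open>la - B u\<^sup>2\<close> would be of the size of \<open>B u\<^sup>2\<close> itself. But the
  second-order terms besides \<open>B u\<^sup>2\<close> all contain the factor \<open>v\<close>, including those of the product
  \<open>hu hv\<close>, as \<open>hv\<close> is \<open>k v\<close> up to order two. The rest is \<open>o(\<bar>z\<bar>\<^sup>2)\<close>.\<close>
lemma order_la:
  "\<exists>A1 A2. order_at_least 1 A1 \<and> flat 2 A2 \<and> (\<forall>z. la z - B * (z$1)\<^sup>2 = z$2 * A1 z + A2 z)"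
proof (intro exI conjI allI)
  note o = order_of_derivatives
  \<comment> \<open>The product \<open>hu hv\<close> is split at \<open>hv = k v + (hv - k v)\<close>.\<close>
  define A1 where "A1 z = 2 * C * z$1 + D * z$2 - (k * hu z) * (huu z + hvv z)" for z
  define A2 where "A2 z = 2 * (huv z - Puv z) + ((hu z * hu z + hv z * hv z) * huv z
      - (hu z * (hv z - k * z$2)) * (huu z + hvv z))" for z
  have o0: "order_at_least 0 (\<lambda>z. huu z + hvv z)" by (rule order_add[OF o(4) o(6)])
  show "order_at_least 1 A1" unfolding A1_def
    by (rule order_diff[OF order_add[OF order_of_monomials(1) order_of_monomials(1)]
          order_mult'[OF order_cmult[OF o(1)] o0]]) auto
  have "order_at_least 3 (\<lambda>z. (hu z * hu z + hv z * hv z) * huv z - (hu z * (hv z - k * z$2)) * (huu z + hvv z))"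
    by (rule order_diff[OF order_mult'[OF order_add[OF order_mult[OF o(1) o(1)] order_mult[OF o(2) o(2)]] o(5)]
          order_mult'[OF order_mult[OF o(1) o(3)] o0]]) auto
  thus "flat 2 A2" unfolding A2_def by (intro flat_add flat_cmult o(9) order_imp_flat[where n = 3]) auto
  show "la z - B * (z$1)\<^sup>2 = z$2 * A1 z + A2 z" for z
    unfolding la_def A1_def A2_def Puv_def by (simp add: power2_eq_square algebra_simps)
qed

lemma order_nu: "order_at_least 3 nu"
proof -
  note o = order_of_derivatives
  have "order_at_least 3 (\<lambda>z. (hu z * hu z - hv z * hv z) * huv z + (hu z * hv z) * (hvv z - huu z))"
    by (rule order_add[OF order_mult'[OF order_diff[OF order_mult[OF o(1) o(1)] order_mult[OF o(2) o(2)]] o(5)]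
          order_mult'[OF order_mult[OF o(1) o(2)] o(8)]]) auto
  thus ?thesis by (simp add: nu_def[abs_def] power2_eq_square)
qed

lemma order_coefficient_derivatives:
  "order_at_least 1 (\<lambda>z. frechet_derivative mu (at z) w - c * w$2)"
  "order_at_least 1 (\<lambda>z. frechet_derivative la (at z) w)"
  "order_at_least 2 (\<lambda>z. frechet_derivative nu (at z) w)"
proof -
  note o = order_of_derivatives
  obtain e where e: "e > 0" "ball 0 e \<subseteq> \<phi> ` U" using ball_in_chart by blast
  have near: "order_at_least n f" if eq: "\<And>z. norm z < e \<Longrightarrow> f z = g z" and g: "order_at_least n g" for n f g
  proof -
    obtain K d where "d > 0" "\<And>z. norm z < d \<Longrightarrow> \<bar>g z\<bar> \<le> K * norm z ^ n"
      using g by (auto simp: order_at_least_def)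
    thus ?thesis unfolding order_at_least_def using e(1) eq by (intro exI[of _ K] exI[of _ "min d e"]) auto
  qed
  have C2: "Cr_on 2 huu (\<phi> ` U)" "Cr_on 2 huv (\<phi> ` U)" "Cr_on 2 hvv (\<phi> ` U)"
    using h by (simp_all add: huu_def huv_def hvv_def numeral_eq_Suc)
  define r s t where "r z = frechet_derivative huu (at z)" and "s z = frechet_derivative huv (at z)"
    and "t z = frechet_derivative hvv (at z)" for z
  define p q where "p z w = huu z * w$1 + huv z * w$2" and "q z w = huv z * w$1 + hvv z * w$2" for z and w :: "real^2"
  have d: "(huu has_derivative r z) (at z)" "(huv has_derivative s z) (at z)" "(hvv has_derivative t z) (at z)"
    "(hu has_derivative p z) (at z)" "(hv has_derivative q z) (at z)"
    if "norm z < e" for z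
  proof -
    have "z \<in> \<phi> ` U" using that e by auto
    thus "(huu has_derivative r z) (at z)" "(huv has_derivative s z) (at z)" "(hvv has_derivative t z) (at z)"
      "(hu has_derivative p z) (at z)" "(hv has_derivative q z) (at z)"
      using C2 dp dq by (auto simp: numeral_2_eq_2 frechet_derivative_works r_def s_def t_def p_def[abs_def] q_def[abs_def])
  qed
  have op: "order_at_least 0 (\<lambda>z. p z w)" "order_at_least 0 (\<lambda>z. q z w)"
    using order_add[OF order_cmult[OF o(4), of "w$1"] order_cmult[OF order_mono[OF o(5), of 0], of "w$2"]]
      order_add[OF order_cmult[OF order_mono[OF o(5), of 0], of "w$1"] order_cmult[OF o(6), of "w$2"]]
    by (simp_all add: p_def q_def mult.commute)
  note o' = o(10-13)[of w, folded r_def s_def t_def]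
  have m: "frechet_derivative mu (at z) w - c * w$2 = (t z w - c * w$2) + 2 * ((hu z * p z w) * hvv z) + (hu z * hu z) * t z w
      - 2 * ((hv z * q z w) * huu z) - (1 + hv z * hv z) * r z w" if z: "norm z < e" for z
  proof -
    have "(mu has_derivative (\<lambda>w. t z w + 2 * ((hu z * p z w) * hvv z) + (hu z * hu z) * t z w
      - 2 * ((hv z * q z w) * huu z) - (1 + hv z * hv z) * r z w)) (at z)"
      unfolding mu_def[abs_def] power2_eq_square
      by (auto intro!: derivative_eq_intros d[OF z] simp: fun_eq_iff algebra_simps)
    from frechet_derivative_at[OF this, symmetric] show ?thesis by simp
  qed
  show "order_at_least 1 (\<lambda>z. frechet_derivative mu (at z) w - c * w$2)"
  proof -
    have o1: "order_at_least 0 (\<lambda>z. 1 + hv z * hv z)"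
      by (rule order_add[OF order_const order_mult'[OF o(2) o(2)]]) simp
    show ?thesis
      by (rule near[OF m order_diff[OF order_diff[OF order_add[OF order_add[OF o'(4)
            order_cmult[OF order_mult'[OF order_mult[OF o(1) op(1)] o(6)]]]
            order_mult'[OF order_mult[OF o(1) o(1)] o'(3)]]
            order_cmult[OF order_mult'[OF order_mult[OF o(2) op(2)] o(4)]]]
            order_mult'[OF o1 o'(1)]]]) simp_all
  qed
  have l: "frechet_derivative la (at z) w = 2 * ((hu z * p z w + hv z * q z w) * huv z) + (2 + hu z * hu z + hv z * hv z) * s z w
      - (p z w * hv z + hu z * q z w) * (huu z + hvv z) - (hu z * hv z) * (r z w + t z w)" if z: "norm z < e" for z
  proof -
    have "(la has_derivative (\<lambda>w. 2 * ((hu z * p z w + hv z * q z w) * huv z) + (2 + hu z * hu z + hv z * hv z) * s z w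
      - (p z w * hv z + hu z * q z w) * (huu z + hvv z) - (hu z * hv z) * (r z w + t z w))) (at z)"
      unfolding la_def[abs_def] power2_eq_square
      by (auto intro!: derivative_eq_intros d[OF z] simp: fun_eq_iff algebra_simps)
    from frechet_derivative_at[OF this, symmetric] show ?thesis by simp
  qed
  have pq: "order_at_least 1 (\<lambda>z. p z w * hv z + hu z * q z w)"
    by (rule order_add[OF order_mult'[OF op(1) o(2)] order_mult'[OF o(1) op(2)]]) simp_all
  show "order_at_least 1 (\<lambda>z. frechet_derivative la (at z) w)"
  proof -
    have a: "order_at_least 0 (\<lambda>z. 2 + hu z * hu z + hv z * hv z)"
      by (rule order_add[OF order_add[OF order_const order_mult'[OF o(1) o(1)]] order_mult'[OF o(2) o(2)]]) simp_all
    have b: "order_at_least 1 (\<lambda>z. hu z * p z w + hv z * q z w)"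
      by (rule order_add[OF order_mult'[OF o(1) op(1)] order_mult'[OF o(2) op(2)]]) simp_all
    have rt: "order_at_least 0 (\<lambda>z. r z w + t z w)" by (rule order_add[OF order_mono[OF o'(1)] o'(3)]) simp
    show ?thesis
      by (rule near[OF l order_diff[OF order_diff[OF order_add[OF order_cmult[OF order_mult'[OF b o(5)]] order_mult'[OF a o'(2)]]
            order_mult'[OF pq order_add[OF o(4) o(6)]]] order_mult'[OF order_mult[OF o(1) o(2)] rt]]]) simp_all
  qed
  have n: "frechet_derivative nu (at z) w = 2 * ((hu z * p z w - hv z * q z w) * huv z) + (hu z * hu z - hv z * hv z) * s z w
      + (p z w * hv z + hu z * q z w) * (hvv z - huu z) + (hu z * hv z) * (t z w - r z w)" if z: "norm z < e" for z
  proof -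
    have "(nu has_derivative (\<lambda>w. 2 * ((hu z * p z w - hv z * q z w) * huv z) + (hu z * hu z - hv z * hv z) * s z w
      + (p z w * hv z + hu z * q z w) * (hvv z - huu z) + (hu z * hv z) * (t z w - r z w))) (at z)"
      unfolding nu_def[abs_def] power2_eq_square
      by (auto intro!: derivative_eq_intros d[OF z] simp: fun_eq_iff algebra_simps)
    from frechet_derivative_at[OF this, symmetric] show ?thesis by simp
  qed
  show "order_at_least 2 (\<lambda>z. frechet_derivative nu (at z) w)"
  proof -
    have a: "order_at_least 2 (\<lambda>z. hu z * hu z - hv z * hv z)"
      by (rule order_diff[OF order_mult'[OF o(1) o(1)] order_mult'[OF o(2) o(2)]]) simp_all
    have b: "order_at_least 1 (\<lambda>z. hu z * p z w - hv z * q z w)"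
      by (rule order_diff[OF order_mult'[OF o(1) op(1)] order_mult'[OF o(2) op(2)]]) simp_all
    have tr: "order_at_least 0 (\<lambda>z. t z w - r z w)" by (rule order_diff[OF o'(3) order_mono[OF o'(1)]]) simp
    show ?thesis
      by (rule near[OF n order_add[OF order_add[OF order_add[OF order_cmult[OF order_mult'[OF b o(5)]] order_mult'[OF a o'(2)]]
            order_mult'[OF pq o(8)]] order_mult'[OF order_mult[OF o(1) o(2)] tr]]]) simp_all
  qed
qed

section \<open>The two principal foliations in normal form\<close>

text \<open>The inverse of \<open>x = u + j v\<close>, \<open>y = j v - u\<close>. The sign \<open>j = - 1\<close> composes the rotation with the
  reflection \<open>v \<mapsto> - v\<close>, which interchanges the roles of the two eigenlines.\<close>
definition rotated :: "real \<Rightarrow> real \<Rightarrow> real \<Rightarrow> real^2" where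
  "rotated j x y = vector [(x - y) / 2, j * ((x + y) / 2)]"

lemma rotated_nth [simp]: "rotated j x y $ 1 = (x - y) / 2" "rotated j x y $ 2 = j * ((x + y) / 2)"
  by (simp_all add: rotated_def vector_2)

lemma norm_rotated:
  assumes "\<bar>j\<bar> = 1"
  shows "norm (rotated j x y) \<le> \<bar>(x - y) / 2\<bar> + \<bar>(x + y) / 2\<bar>"
proof -
  have "norm (rotated j x y) \<le> (\<Sum>i\<in>UNIV. \<bar>rotated j x y $ i\<bar>)" by (rule norm_le_l1_cart)
  thus ?thesis using assms by (simp add: sum_2 abs_mult)
qed

lemma rotated_has_derivative:
  "((\<lambda>y. rotated j x y) has_derivative (\<lambda>t. t *\<^sub>R vector [- 1/2, j/2])) (at y)"
proof -
  have eq: "vector [a, b] = a *\<^sub>R axis 1 1 + b *\<^sub>R (axis 2 1 :: real^2)" for a b :: real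
    by (simp add: vec_eq_iff forall_2 vector_2 axis_def)
  have 1: "((\<lambda>y. (x - y) / 2) has_derivative (\<lambda>t. t * (- 1 / 2))) (at y)"
    "((\<lambda>y. j * ((x + y) / 2)) has_derivative (\<lambda>t. t * (j / 2))) (at y)"
    by (auto intro!: derivative_eq_intros)
  have "((\<lambda>y. ((x - y) / 2) *\<^sub>R axis 1 1 + (j * ((x + y) / 2)) *\<^sub>R (axis 2 1 :: real^2)) has_derivative
      (\<lambda>t. (t * (- 1 / 2)) *\<^sub>R axis 1 1 + (t * (j / 2)) *\<^sub>R axis 2 1)) (at y)"
    by (intro has_derivative_add has_derivative_scaleR_left 1)
  thus ?thesis unfolding rotated_def eq by (simp add: scaleR_diff_right)
qed

lemma rotated_continuous: "continuous_on S (\<lambda>(x, y). rotated j x y)"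
proof -
  have eq: "vector [a, b] = a *\<^sub>R axis 1 1 + b *\<^sub>R (axis 2 1 :: real^2)" for a b :: real
    by (simp add: vec_eq_iff forall_2 vector_2 axis_def)
  show ?thesis unfolding rotated_def eq by (auto intro!: continuous_intros simp: case_prod_unfold)
qed

text \<open>The partial derivative of \<open>rotated j\<close> in \<open>y\<close>.\<close>
definition direction :: "real \<Rightarrow> real^2" where "direction j = vector [- 1/2, j/2]"

text \<open>Under \<open>v \<mapsto> - v\<close> the leading term \<open>c v\<close> of \<open>mu\<close> changes its sign and the leading term \<open>B u\<^sup>2\<close> of
  \<open>la\<close> does not. Hence the same estimates, with the same positive \<open>c\<close> and \<open>B\<close>, hold for
  \<open>j mu\<close>, \<open>la\<close>, \<open>nu\<close> in the coordinates of either sign.\<close>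
theorem normal_form:
  assumes c: "c > 0" and B: "B > 0" and j: "\<bar>j\<bar> = 1" and \<delta>: "\<delta> > 0"
  shows "\<exists>K \<rho>. \<rho> \<le> \<delta> \<and> umbilic_normal_form
    (\<lambda>x y. j * mu (rotated j x y)) (\<lambda>x y. la (rotated j x y)) (\<lambda>x y. nu (rotated j x y))
    (\<lambda>x y. j * frechet_derivative mu (at (rotated j x y)) (direction j))
    (\<lambda>x y. frechet_derivative la (at (rotated j x y)) (direction j))
    (\<lambda>x y. frechet_derivative nu (at (rotated j x y)) (direction j)) c B K \<rho>"
proof -
  have jj: "j * j = 1" using j by (auto simp: abs_if split: if_splits)
  obtain A1 A2 where A: "order_at_least 1 A1" "flat 2 A2" "\<forall>z. la z - B * (z$1)\<^sup>2 = z$2 * A1 z + A2 z"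
    using order_la by (elim exE conjE) (rule that)
  define w where "w = direction j"
  have w: "c * w$2 = c * j / 2" by (simp add: w_def direction_def vector_2)
  note od = order_coefficient_derivatives[of w, unfolded w]
  obtain d0 where d0: "d0 > 0" "ball 0 d0 \<subseteq> \<phi> ` U" using ball_in_chart by blast
  obtain K1 d1 where 1: "K1 > 0" "d1 > 0" "d1 \<le> 1" "\<And>z. norm z < d1 \<Longrightarrow> \<bar>mu z - c * z$2\<bar> \<le> K1 * norm z ^ 2"
    by (rule order_at_leastE[OF order_mu]) (rule that)
  obtain K2 d2 where 2: "K2 > 0" "d2 > 0" "d2 \<le> 1" "\<And>z. norm z < d2 \<Longrightarrow> \<bar>A1 z\<bar> \<le> K2 * norm z ^ 1"
    by (rule order_at_leastE[OF A(1)]) (rule that)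
  have "B / 8 > 0" using B by simp
  then obtain d3 where 3: "d3 > 0" "\<And>z. norm z < d3 \<Longrightarrow> \<bar>A2 z\<bar> \<le> B / 8 * norm z ^ 2"
    using A(2) unfolding flat_def by blast
  obtain K4 d4 where 4: "K4 > 0" "d4 > 0" "d4 \<le> 1" "\<And>z. norm z < d4 \<Longrightarrow> \<bar>nu z\<bar> \<le> K4 * norm z ^ 3"
    by (rule order_at_leastE[OF order_nu]) (rule that)
  obtain K5 d5 where 5: "K5 > 0" "d5 > 0" "d5 \<le> 1"
    "\<And>z. norm z < d5 \<Longrightarrow> \<bar>frechet_derivative mu (at z) w - c * j / 2\<bar> \<le> K5 * norm z ^ 1"
    by (rule order_at_leastE[OF od(1)]) (rule that)
  obtain K6 d6 where 6: "K6 > 0" "d6 > 0" "d6 \<le> 1" "\<And>z. norm z < d6 \<Longrightarrow> \<bar>frechet_derivative la (at z) w\<bar> \<le> K6 * norm z ^ 1"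
    by (rule order_at_leastE[OF od(2)]) (rule that)
  obtain K7 d7 where 7: "K7 > 0" "d7 > 0" "d7 \<le> 1" "\<And>z. norm z < d7 \<Longrightarrow> \<bar>frechet_derivative nu (at z) w\<bar> \<le> K7 * norm z ^ 2"
    by (rule order_at_leastE[OF od(3)]) (rule that)
  define K where "K = K1 + K2 + K4 + K5 + K6 + K7"
  have K: "K1 \<le> K" "K2 \<le> K" "K4 \<le> K" "K5 \<le> K" "K6 \<le> K" "K7 \<le> K" "K > 0"
    using 1 2 4 5 6 7 by (simp_all add: K_def)
  define Ds where "Ds = {d0, d1, d2, d3, d4, d5, d6, d7, \<delta>}"
  define \<rho> where "\<rho> = Min Ds / 3"
  have "finite Ds" "Ds \<noteq> {}" "\<forall>d\<in>Ds. d > 0" using d0 1 2 3 4 5 6 7 \<delta> by (simp_all add: Ds_def)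
  hence \<rho>0: "\<rho> > 0" by (simp add: \<rho>_def)
  have le: "3 * \<rho> \<le> d" if "d \<in> Ds" for d
    using Min_le[OF \<open>finite Ds\<close> that] by (simp add: \<rho>_def)
  have \<rho>: "\<rho> > 0" "3 * \<rho> \<le> d0" "3 * \<rho> \<le> d1" "3 * \<rho> \<le> d2" "3 * \<rho> \<le> d3" "3 * \<rho> \<le> d4" "3 * \<rho> \<le> d5"
    "3 * \<rho> \<le> d6" "3 * \<rho> \<le> d7" "3 * \<rho> \<le> \<delta>" by (rule \<rho>0 le; simp add: Ds_def)+
  define S where "S = {- \<rho>..\<rho>} \<times> {- \<rho>..\<rho>}"
  define n where "n x y = \<bar>(x - y) / 2\<bar> + \<bar>(x + y) / 2\<bar>" for x y :: real
  have small: "norm (rotated j x y) \<le> n x y" "norm (rotated j x y) < 3 * \<rho>" "0 \<le> n x y" if "(x, y) \<in> S" for x y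
  proof -
    have "\<bar>x\<bar> \<le> \<rho>" "\<bar>y\<bar> \<le> \<rho>" using that by (auto simp: S_def)
    hence "\<bar>(x - y) / 2\<bar> \<le> \<rho>" "\<bar>(x + y) / 2\<bar> \<le> \<rho>" by (auto simp: abs_le_iff)
    thus "norm (rotated j x y) \<le> n x y" "norm (rotated j x y) < 3 * \<rho>" "0 \<le> n x y"
      using norm_rotated[OF j, of x y] \<rho>(1) by (auto simp: n_def)
  qed
  have bound: "K' * norm (rotated j x y) ^ m \<le> K * n x y ^ m" if "(x, y) \<in> S" "0 < K'" "K' \<le> K" for x y K' m
    using small[OF that(1)] that(2,3) by (intro mult_mono power_mono) auto
  have inU: "rotated j x y \<in> \<phi> ` U" if "(x, y) \<in> S" for x y
    using small(2)[OF that] \<rho> d0(2) by auto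
  have cont: "continuous_on S (\<lambda>(x, y). f (rotated j x y))" if "continuous_on (\<phi> ` U) f" for f :: "real^2 \<Rightarrow> real"
  proof -
    have "continuous_on S (f \<circ> (\<lambda>(x, y). rotated j x y))"
      using inU by (intro continuous_on_compose rotated_continuous continuous_on_subset[OF that]) auto
    thus ?thesis by (simp add: o_def case_prod_unfold)
  qed
  have cont': "continuous_on (\<phi> ` U) f" "continuous_on (\<phi> ` U) (\<lambda>z. frechet_derivative f (at z) w)"
    if "Cr_on 1 f (\<phi> ` U)" for f :: "real^2 \<Rightarrow> real"
    using that Cr_on_imp_continuous[OF that] by simp_all
  have der: "((\<lambda>y. f (rotated j x y)) has_real_derivative frechet_derivative f (at (rotated j x y)) w) (at y)"
    if "Cr_on 1 f (\<phi> ` U)" "(x, y) \<in> S" for f x y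
  proof -
    have d: "(f has_derivative frechet_derivative f (at (rotated j x y))) (at (rotated j x y))"
      by (rule Cr_on_has_derivative[OF _ inU[OF that(2)], of 0]) (use that(1) in \<open>simp only: One_nat_def\<close>)
    have "((\<lambda>y. f (rotated j x y)) has_derivative (\<lambda>t. frechet_derivative f (at (rotated j x y)) (t *\<^sub>R w))) (at y)"
      unfolding w_def direction_def by (rule has_derivative_compose[OF rotated_has_derivative d])
    moreover have "(\<lambda>t. frechet_derivative f (at (rotated j x y)) (t *\<^sub>R w)) = (*) (frechet_derivative f (at (rotated j x y)) w)"
      using linear_scale[OF has_derivative_linear[OF d]] by (simp add: fun_eq_iff mult.commute)
    ultimately show ?thesis by (simp only: has_field_derivative_def)
  qed
  have "umbilic_normal_form
    (\<lambda>x y. j * mu (rotated j x y)) (\<lambda>x y. la (rotated j x y)) (\<lambda>x y. nu (rotated j x y))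
    (\<lambda>x y. j * frechet_derivative mu (at (rotated j x y)) w)
    (\<lambda>x y. frechet_derivative la (at (rotated j x y)) w)
    (\<lambda>x y. frechet_derivative nu (at (rotated j x y)) w) c B K \<rho>"
  proof (unfold umbilic_normal_form_def, fold S_def n_def, intro conjI allI impI)
    note C = coefficients_Cr
    have mult_j: "continuous_on S (\<lambda>(x, y). j * f x y)" if "continuous_on S (\<lambda>(x, y). f x y)" for f :: "real \<Rightarrow> real \<Rightarrow> real"
      using continuous_on_mult_left[OF that, of j] by (simp add: case_prod_unfold)
    show "c > 0" "B > 0" "K > 0" "\<rho> > 0" by fact+
    show "continuous_on S (\<lambda>(x, y). j * mu (rotated j x y))"
      "continuous_on S (\<lambda>(x, y). la (rotated j x y))" "continuous_on S (\<lambda>(x, y). nu (rotated j x y))"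
      "continuous_on S (\<lambda>(x, y). j * frechet_derivative mu (at (rotated j x y)) w)"
      "continuous_on S (\<lambda>(x, y). frechet_derivative la (at (rotated j x y)) w)"
      "continuous_on S (\<lambda>(x, y). frechet_derivative nu (at (rotated j x y)) w)"
      by (intro mult_j cont cont' C)+
    fix x y assume xy: "(x, y) \<in> S"
    let ?z = "rotated j x y"
    show "((\<lambda>y. j * mu (rotated j x y)) has_real_derivative j * frechet_derivative mu (at (rotated j x y)) w) (at y)"
      by (rule DERIV_cmult[OF der[OF C(1) xy]])
    show "((\<lambda>y. la (rotated j x y)) has_real_derivative frechet_derivative la (at (rotated j x y)) w) (at y)"
      "((\<lambda>y. nu (rotated j x y)) has_real_derivative frechet_derivative nu (at (rotated j x y)) w) (at y)"
      by (rule der[OF C(2) xy], rule der[OF C(3) xy])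
    note z = small(2)[OF xy]
    have lt: "norm ?z < d" if "3 * \<rho> \<le> d" for d using z that by simp
    have jja: "j * (j * a) = a" for a using jj by (simp add: mult.assoc[symmetric])
    have abs_j: "\<bar>j * a\<bar> = \<bar>a\<bar>" for a using j by (simp add: abs_mult)
    have "j * mu ?z - c * ((x + y) / 2) = j * (mu ?z - c * ?z$2)"
      by (simp add: algebra_simps jja)
    hence "\<bar>j * mu ?z - c * ((x + y) / 2)\<bar> = \<bar>mu ?z - c * ?z$2\<bar>" by (simp only: abs_j)
    also have "\<dots> \<le> K1 * norm ?z ^ 2" by (rule 1(4)[OF lt]) (rule \<rho>)
    also have "\<dots> \<le> K * (n x y)\<^sup>2" by (rule bound[OF xy 1(1) K(1)])
    finally show "\<bar>j * mu ?z - c * ((x + y) / 2)\<bar> \<le> K * (n x y)\<^sup>2" .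
    have "la ?z - B * ((x - y) / 2)\<^sup>2 = ?z$2 * A1 ?z + A2 ?z" using A(3) rotated_nth(1)[of j x y] by metis
    hence "\<bar>la ?z - B * ((x - y) / 2)\<^sup>2\<bar> \<le> \<bar>?z$2\<bar> * \<bar>A1 ?z\<bar> + \<bar>A2 ?z\<bar>"
      using abs_triangle_ineq[of "?z$2 * A1 ?z" "A2 ?z"] by (simp only: abs_mult)
    also have "\<dots> \<le> \<bar>?z$2\<bar> * (K * n x y) + B / 8 * (n x y)\<^sup>2"
    proof (rule add_mono)
      have "\<bar>A1 ?z\<bar> \<le> K2 * norm ?z ^ 1" by (rule 2(4)[OF lt]) (rule \<rho>)
      also have "\<dots> \<le> K * n x y ^ 1" by (rule bound[OF xy 2(1) K(2)])
      finally show "\<bar>?z$2\<bar> * \<bar>A1 ?z\<bar> \<le> \<bar>?z$2\<bar> * (K * n x y)" by (intro mult_left_mono) auto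
      have "\<bar>A2 ?z\<bar> \<le> B / 8 * norm ?z ^ 2" by (rule 3(2)[OF lt]) (rule \<rho>)
      also have "\<dots> \<le> B / 8 * (n x y)\<^sup>2" using small[OF xy] B by (intro mult_left_mono power_mono) auto
      finally show "\<bar>A2 ?z\<bar> \<le> B / 8 * (n x y)\<^sup>2" .
    qed
    also have "\<bar>?z$2\<bar> = \<bar>(x + y) / 2\<bar>" unfolding rotated_nth by (rule abs_j)
    finally show "\<bar>la ?z - B * ((x - y) / 2)\<^sup>2\<bar> \<le> K * n x y * \<bar>(x + y) / 2\<bar> + B / 8 * (n x y)\<^sup>2"
      by (simp only: mult_ac)
    show "\<bar>nu ?z\<bar> \<le> K * n x y ^ 3"
      using 4(4)[OF lt[OF \<rho>(6)]] bound[OF xy 4(1) K(3), of 3] by linarith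
    have "j * frechet_derivative mu (at ?z) w - c / 2 = j * (frechet_derivative mu (at ?z) w - c * j / 2)"
      by (simp add: algebra_simps jja)
    hence "\<bar>j * frechet_derivative mu (at ?z) w - c / 2\<bar> = \<bar>frechet_derivative mu (at ?z) w - c * j / 2\<bar>" by (simp only: abs_j)
    thus "\<bar>j * frechet_derivative mu (at ?z) w - c / 2\<bar> \<le> K * n x y"
      using 5(4)[OF lt[OF \<rho>(7)]] bound[OF xy 5(1) K(4), of 1] by simp
    show "\<bar>frechet_derivative la (at ?z) w\<bar> \<le> K * n x y"
      using 6(4)[OF lt[OF \<rho>(8)]] bound[OF xy 6(1) K(5), of 1] by simp
    show "\<bar>frechet_derivative nu (at ?z) w\<bar> \<le> K * (n x y)\<^sup>2"
      using 7(4)[OF lt[OF \<rho>(9)]] bound[OF xy 7(1) K(6), of 2] by linarith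
  qed
  thus ?thesis using \<rho> by (intro exI[of _ K] exI[of _ \<rho>]) (auto simp: w_def)
qed

definition unrotated :: "real \<Rightarrow> real^2 \<Rightarrow> real \<times> real" where
  "unrotated j z = (z$1 + j * z$2, j * z$2 - z$1)"

lemma unrotated_rotated:
  assumes "\<bar>j\<bar> = 1"
  shows "unrotated j (rotated j x y) = (x, y)" "rotated j (fst (unrotated j z)) (snd (unrotated j z)) = z"
proof -
  have "j = 1 \<or> j = - 1" using assms by arith
  thus "unrotated j (rotated j x y) = (x, y)" "rotated j (fst (unrotated j z)) (snd (unrotated j z)) = z"
    by (auto simp: unrotated_def vec_eq_iff forall_2 field_simps)
qed

lemma unrotated_linear: "bounded_linear (unrotated j)"
  unfolding unrotated_def by (intro bounded_linear_Pair bounded_linear_add bounded_linear_sub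
      bounded_linear_const_mult bounded_linear_vec_nth)

lemma has_vector_derivative_rotated:
  assumes j: "\<bar>j\<bar> = 1"
  shows "((\<lambda>t. unrotated j (g t)) has_vector_derivative unrotated j w) F \<longleftrightarrow> (g has_vector_derivative w) F"
proof
  assume "(g has_vector_derivative w) F"
  thus "((\<lambda>t. unrotated j (g t)) has_vector_derivative unrotated j w) F"
    by (rule bounded_linear.has_vector_derivative[OF unrotated_linear])
next
  have j': "j = 1 \<or> j = - 1" using j by arith
  define L where "L = (\<lambda>(x, y). ((x - y) / 2) *\<^sub>R axis 1 1 + (j * ((x + y) / 2)) *\<^sub>R (axis 2 1 :: real^2))"
  have L: "L (unrotated j z) = z" for z
    using j' by (auto simp: L_def unrotated_def vec_eq_iff forall_2 axis_def field_simps)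
  have "bounded_linear L" unfolding L_def case_prod_unfold
    by (intro bounded_linear_add bounded_linear_scaleR_left[THEN bounded_linear_compose] bounded_linear_divide[THEN bounded_linear_compose]
        bounded_linear_const_mult bounded_linear_sub bounded_linear_fst bounded_linear_snd)
  moreover assume "((\<lambda>t. unrotated j (g t)) has_vector_derivative unrotated j w) F"
  ultimately show "(g has_vector_derivative w) F"
    using bounded_linear.has_vector_derivative[of L] by (fastforce simp: L)
qed

lemma on_line_rotated:
  "on_line j z w \<longleftrightarrow> snd (unrotated j w) = slope j z * fst (unrotated j w)"
  by (simp add: on_line_def unrotated_def)

lemma ex_foliation_chart:
  assumes c: "c > 0" and B: "B > 0" and j: "\<bar>j\<bar> = 1" and um: "umbilic \<A> \<alpha> x\<^sub>0"
    and W: "open W" "x\<^sub>0 \<in> W" "W \<subseteq> U"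
    and pl: "\<And>x. \<lbrakk>x \<in> W; nondeg (\<phi> x)\<rbrakk> \<Longrightarrow> \<not> umbilic \<A> \<alpha> x"
      "\<And>x c w. \<lbrakk>x \<in> W; nondeg (\<phi> x); c \<in> \<A>; x \<in> fst c\<rbrakk> \<Longrightarrow>
        principal_vector (local_param c \<alpha>) (snd c x) (principal_curvature \<A> \<alpha> i x) w
        \<longleftrightarrow> w \<noteq> 0 \<and> on_line j (\<phi> x) (D\<sigma> c x w)"
  shows "\<exists>f f' \<epsilon> m C \<psi> V. foliation_chart f f' \<epsilon> m C \<A> \<alpha> i x\<^sub>0 \<psi> (\<lambda>x. unrotated j (\<phi> x)) V \<and>
    (\<forall>(x, y)\<in>V. \<psi> (x, y) \<in> U \<and> \<phi> (\<psi> (x, y)) = rotated j x y)"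
proof -
  have inv: "inv_into U \<phi> (\<phi> x) = x" if "x \<in> U" for x using is_chart_inv[OF chart that] .
  have "open (\<phi> ` W)" by (rule is_chart_open_image[OF chart W(1,3)])
  moreover have "0 \<in> \<phi> ` W" using W(2) x\<^sub>0 by (metis imageI)
  ultimately obtain r where r: "r > 0" "ball 0 r \<subseteq> \<phi> ` W" by (rule openE)
  have "r / 3 > 0" using r by simp
  from normal_form[OF c B j this] obtain K \<rho> where \<rho>: "\<rho> \<le> r / 3" and nf: "umbilic_normal_form
    (\<lambda>x y. j * mu (rotated j x y)) (\<lambda>x y. la (rotated j x y)) (\<lambda>x y. nu (rotated j x y))
    (\<lambda>x y. j * frechet_derivative mu (at (rotated j x y)) (direction j))
    (\<lambda>x y. frechet_derivative la (at (rotated j x y)) (direction j))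
    (\<lambda>x y. frechet_derivative nu (at (rotated j x y)) (direction j)) c B K \<rho>" by (elim exE conjE) (rule that)
  interpret nf: umbilic_normal_form "\<lambda>x y. j * mu (rotated j x y)" "\<lambda>x y. la (rotated j x y)"
    "\<lambda>x y. nu (rotated j x y)" "\<lambda>x y. j * frechet_derivative mu (at (rotated j x y)) (direction j)"
    "\<lambda>x y. frechet_derivative la (at (rotated j x y)) (direction j)"
    "\<lambda>x y. frechet_derivative nu (at (rotated j x y)) (direction j)" c B K \<rho>
    "\<lambda>x y. (x - y) / 2" "\<lambda>x y. (x + y) / 2" "\<lambda>x y. \<bar>(x - y) / 2\<bar> + \<bar>(x + y) / 2\<bar>" "{-\<rho>..\<rho>} \<times> {-\<rho>..\<rho>}"
    by (intro Pure.conjunctionI nf Pure.reflexive)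
  obtain \<epsilon> m C' where \<epsilon>: "\<epsilon> > 0" "\<epsilon> \<le> \<rho>" and leaf: "one_through_leaf nf.F nf.F' \<epsilon> m C'"
    and reg: "\<And>x y. \<lbrakk>\<bar>x\<bar> \<le> \<epsilon>; \<bar>y\<bar> \<le> \<epsilon>; (x, y) \<noteq> (0, 0)\<rbrakk> \<Longrightarrow> nf.regular x y"
    using nf.ex_one_through_leaf by blast
  have jj: "(j * a)\<^sup>2 = a\<^sup>2" for a using j by (metis abs_mult mult_1 power2_abs)
  have R: "nf.R x y = sqrt (disc (rotated j x y))" for x y by (simp add: nf.R_def disc_def jj)
  have F: "nf.F x y = slope j (rotated j x y)" for x y by (simp add: nf.F_def R slope_def)
  have regular: "nf.regular x y \<longleftrightarrow> nondeg (rotated j x y)" for x y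
    unfolding nf.regular_def nondeg_def R by (simp add: disc_def jj)
  define V where "V = {-\<epsilon><..<\<epsilon>} \<times> {-\<epsilon><..<\<epsilon>}"
  define \<psi> where "\<psi> = (\<lambda>(x, y). inv_into U \<phi> (rotated j x y))"
  have inW: "rotated j x y \<in> \<phi> ` W" if "(x, y) \<in> V" for x y
  proof -
    have "\<bar>x\<bar> < r / 3" "\<bar>y\<bar> < r / 3" using that \<epsilon> \<rho> by (auto simp: V_def)
    hence "\<bar>(x - y) / 2\<bar> < r / 3" "\<bar>(x + y) / 2\<bar> < r / 3"
      using abs_triangle_ineq4[of x y] abs_triangle_ineq[of x y] by simp_all
    thus ?thesis using norm_rotated[OF j, of x y] r by auto
  qed
  have \<psi>: "\<psi> (x, y) \<in> W" "\<phi> (\<psi> (x, y)) = rotated j x y" if "(x, y) \<in> V" for x y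
  proof -
    have "\<exists>q\<in>W. \<phi> q = rotated j x y" using inW[OF that] by (metis imageE)
    then obtain q where q: "q \<in> W" "\<phi> q = rotated j x y" by blast
    hence "\<psi> (x, y) = q" using inv[of q] W(3) by (auto simp: \<psi>_def)
    thus "\<psi> (x, y) \<in> W" "\<phi> (\<psi> (x, y)) = rotated j x y" using q by auto
  qed
  have un: "unrotated j (\<phi> (\<psi> (x, y))) = (x, y)" if "(x, y) \<in> V" for x y
    using \<psi>(2)[OF that] unrotated_rotated(1)[OF j] by simp
  have "(\<lambda>x. unrotated j (\<phi> x)) (\<psi> v) = v" if "v \<in> V" for v
    using un[of "fst v" "snd v"] that by simp
  note un' = this
  have \<psi>V: "\<psi> ` V \<subseteq> W" using \<psi>(1) by auto
  have im: "\<psi> ` V = {x \<in> U. \<phi> x \<in> unrotated j -` V}"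
  proof (intro equalityI subsetI)
    fix x assume "x \<in> \<psi> ` V"
    then obtain v where "v \<in> V" "x = \<psi> v" by blast
    thus "x \<in> {x \<in> U. \<phi> x \<in> unrotated j -` V}" using un'[of v] \<psi>V W(3) by auto
  next
    fix x assume x: "x \<in> {x \<in> U. \<phi> x \<in> unrotated j -` V}"
    have "\<psi> (unrotated j (\<phi> x)) = x"
      using x inv[of x] unrotated_rotated(2)[OF j, of "\<phi> x"] by (simp add: \<psi>_def case_prod_unfold)
    thus "x \<in> \<psi> ` V" using x by (metis (mono_tags, lifting) imageI mem_Collect_eq vimage_eq)
  qed
  have rot_un: "rotated j (fst (unrotated j z)) (snd (unrotated j z)) = z" for z by (rule unrotated_rotated(2)[OF j])
  have ch: "homeomorphism U (\<phi> ` U) \<phi> (inv_into U \<phi>)" using chart by (simp add: is_chart_def)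
  have "foliation_chart nf.F nf.F' \<epsilon> m C' \<A> \<alpha> i x\<^sub>0 \<psi> (\<lambda>x. unrotated j (\<phi> x)) V"
  proof (rule foliation_chart.intro)
    show "one_through_leaf nf.F nf.F' \<epsilon> m C'" by (rule leaf)
    show "V = {-\<epsilon><..<\<epsilon>} \<times> {-\<epsilon><..<\<epsilon>}" by (rule V_def)
    show "homeomorphism V (\<psi> ` V) \<psi> (\<lambda>x. unrotated j (\<phi> x))"
    proof (rule homeomorphismI)
      have "continuous_on V (inv_into U \<phi> \<circ> (\<lambda>(x, y). rotated j x y))"
      proof (intro continuous_on_compose rotated_continuous)
        show "continuous_on ((\<lambda>(x, y). rotated j x y) ` V) (inv_into U \<phi>)"
          using homeomorphism_cont2[OF ch] by (rule continuous_on_subset) (use inW W(3) in \<open>auto dest!: subsetD[OF image_mono]\<close>)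
      qed
      thus "continuous_on V \<psi>" by (simp add: \<psi>_def o_def case_prod_unfold)
      have "continuous_on (\<psi> ` V) \<phi>"
        using homeomorphism_cont1[OF ch] by (rule continuous_on_subset) (use \<psi>V W(3) in blast)
      thus "continuous_on (\<psi> ` V) (\<lambda>x. unrotated j (\<phi> x))"
        by (rule bounded_linear.continuous_on[OF unrotated_linear])
    next
      show "(\<lambda>x. unrotated j (\<phi> x)) ` \<psi> ` V \<subseteq> V" using un' by auto
      show "\<And>x. x \<in> V \<Longrightarrow> unrotated j (\<phi> (\<psi> x)) = x" by (rule un')
      show "\<And>y. y \<in> \<psi> ` V \<Longrightarrow> \<psi> (unrotated j (\<phi> y)) = y" using un' by auto
    qed simp
    show "open (\<psi> ` V)"
    proof -
      have "open V" unfolding V_def by (intro open_Times) auto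
      hence "open (unrotated j -` V)"
        using continuous_open_vimage linear_continuous_at[OF unrotated_linear] by blast
      thus ?thesis unfolding im by (rule is_chart_open_preimage[OF chart])
    qed
    have V0: "(0, 0) \<in> V" using \<epsilon> by (simp add: V_def)
    have r0: "rotated j 0 0 = 0" by (simp add: vec_eq_iff forall_2)
    show org: "\<psi> (0, 0) = x\<^sub>0" using inv[OF x\<^sub>0(1)] x\<^sub>0(2) r0 by (simp add: \<psi>_def)
    have nd: "nondeg (\<phi> x)" if x: "x \<in> \<psi> ` V" "x \<noteq> x\<^sub>0" for x
    proof -
      obtain a b where ab: "x = \<psi> (a, b)" "(a, b) \<in> V" using x(1) by auto
      hence "(a, b) \<noteq> (0, 0)" using x(2) org by auto
      moreover have "\<bar>a\<bar> \<le> \<epsilon>" "\<bar>b\<bar> \<le> \<epsilon>" using ab(2) by (auto simp: V_def)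
      ultimately show ?thesis using reg regular \<psi>(2)[OF ab(2)] ab(1) by metis
    qed
    fix \<gamma> :: "real \<Rightarrow> 'a" and T assume \<gamma>: "\<gamma> ` T \<subseteq> \<psi> ` V"
    have lc: "line_of_curvature \<A> \<alpha> i \<gamma> T \<longleftrightarrow> continuous_on T \<gamma> \<and> (\<forall>t\<in>T. \<gamma> t \<noteq> x\<^sub>0 \<and>
        (\<exists>w. w \<noteq> 0 \<and> ((\<phi> \<circ> \<gamma>) has_vector_derivative w) (at t within T) \<and> on_line j (\<phi> (\<gamma> t)) w))"
      using \<psi>V W(3) \<gamma> um nd pl by (intro line_of_curvature_chart[where W = "\<psi> ` V"]) blast+
    have eqv: "(\<exists>w. w \<noteq> 0 \<and> ((\<phi> \<circ> \<gamma>) has_vector_derivative w) (at t within T) \<and> on_line j (\<phi> (\<gamma> t)) w) \<longleftrightarrow>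
        (\<exists>a. a \<noteq> 0 \<and> (((\<lambda>x. unrotated j (\<phi> x)) \<circ> \<gamma>) has_vector_derivative
        (a, nf.F (fst (unrotated j (\<phi> (\<gamma> t)))) (snd (unrotated j (\<phi> (\<gamma> t)))) * a)) (at t within T))"
      (is "?A t \<longleftrightarrow> ?B t") for t
    proof
      assume "?A t"
      then obtain w where w: "w \<noteq> 0" "((\<phi> \<circ> \<gamma>) has_vector_derivative w) (at t within T)" "on_line j (\<phi> (\<gamma> t)) w" by blast
      define a where "a = fst (unrotated j w)"
      have eq: "unrotated j w = (a, slope j (\<phi> (\<gamma> t)) * a)"
        using w(3) by (simp add: on_line_rotated a_def prod_eq_iff)
      have "a \<noteq> 0"
      proof
        assume "a = 0"
        hence "w = rotated j 0 0" using rot_un[of w] eq by simp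
        thus False using w(1) r0 by simp
      qed
      moreover have "((\<lambda>s. unrotated j ((\<phi> \<circ> \<gamma>) s)) has_vector_derivative (a, slope j (\<phi> (\<gamma> t)) * a)) (at t within T)"
        using w(2) has_vector_derivative_rotated[OF j, of "\<phi> \<circ> \<gamma>" w] eq by simp
      ultimately show "?B t"
        unfolding F rot_un by (auto simp: o_def)
    next
      assume "?B t"
      then obtain a where a: "a \<noteq> 0" "((\<lambda>s. unrotated j ((\<phi> \<circ> \<gamma>) s)) has_vector_derivative
        (a, slope j (\<phi> (\<gamma> t)) * a)) (at t within T)" unfolding F rot_un by (auto simp: o_def)
      define w where "w = rotated j a (slope j (\<phi> (\<gamma> t)) * a)"
      have eq: "unrotated j w = (a, slope j (\<phi> (\<gamma> t)) * a)" unfolding w_def by (rule unrotated_rotated(1)[OF j])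
      have "w \<noteq> 0" using a(1) eq by (auto simp: unrotated_def)
      moreover have "((\<phi> \<circ> \<gamma>) has_vector_derivative w) (at t within T)"
        using a(2) has_vector_derivative_rotated[OF j, of "\<phi> \<circ> \<gamma>" w] eq by simp
      moreover have "on_line j (\<phi> (\<gamma> t)) w" by (simp add: on_line_rotated eq)
      ultimately show "?A t" by blast
    qed
    show "line_of_curvature \<A> \<alpha> i \<gamma> T \<longleftrightarrow> continuous_on T \<gamma> \<and> (\<forall>t\<in>T. \<gamma> t \<noteq> x\<^sub>0 \<and> (\<exists>a. a \<noteq> 0 \<and>
        (((\<lambda>x. unrotated j (\<phi> x)) \<circ> \<gamma>) has_vector_derivative
        (a, nf.F (fst (unrotated j (\<phi> (\<gamma> t)))) (snd (unrotated j (\<phi> (\<gamma> t)))) * a)) (at t within T)))"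
      unfolding lc eqv ..
  qed
  moreover have "\<forall>(x, y)\<in>V. \<psi> (x, y) \<in> U \<and> \<phi> (\<psi> (x, y)) = rotated j x y" using \<psi> W(3) by auto
  ultimately show ?thesis by blast
qed

text \<open>The arcs stand for the germs of the two separatrices and determine the angular sectors in
  which these lie.\<close>
definition separatrix_arcs :: "principal \<Rightarrow> real \<Rightarrow> 'a set \<Rightarrow> 'a set \<Rightarrow> (real \<Rightarrow> 'a) \<Rightarrow> (real \<Rightarrow> 'a) \<Rightarrow> bool" where
  "separatrix_arcs i j s s' \<gamma> \<gamma>' \<longleftrightarrow>
    exactly_two_separatrices \<A> \<alpha> i x\<^sub>0 s s' \<and> divides_into_two_hyperbolic_sectors \<A> \<alpha> i x\<^sub>0 s s' \<and>
    arc \<gamma> \<and> pathstart \<gamma> = x\<^sub>0 \<and> same_germ x\<^sub>0 (path_image \<gamma>) s \<and>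
    arc \<gamma>' \<and> pathstart \<gamma>' = x\<^sub>0 \<and> same_germ x\<^sub>0 (path_image \<gamma>') s' \<and>
    (\<forall>t\<in>{0<..1}. \<gamma> t \<in> U \<and> \<bar>\<phi> (\<gamma> t) $ 1\<bar> < j * \<phi> (\<gamma> t) $ 2) \<and>
    (\<forall>t\<in>{0<..1}. \<gamma>' t \<in> U \<and> j * \<phi> (\<gamma>' t) $ 2 < 0 \<and> \<bar>\<phi> (\<gamma>' t) $ 2\<bar> < - (\<phi> (\<gamma>' t) $ 1))"

lemma separatrix_arcsD:
  assumes "separatrix_arcs i j s s' \<gamma> \<gamma>'"
  shows "exactly_two_separatrices \<A> \<alpha> i x\<^sub>0 s s'"
    "divides_into_two_hyperbolic_sectors \<A> \<alpha> i x\<^sub>0 s s'"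
    "arc \<gamma>"
    "pathstart \<gamma> = x\<^sub>0"
    "same_germ x\<^sub>0 (path_image \<gamma>) s"
    "arc \<gamma>'"
    "pathstart \<gamma>' = x\<^sub>0"
    "same_germ x\<^sub>0 (path_image \<gamma>') s'"
    "\<forall>t\<in>{0<..1}. \<gamma> t \<in> U \<and> \<bar>\<phi> (\<gamma> t) $ 1\<bar> < j * \<phi> (\<gamma> t) $ 2"
    "\<forall>t\<in>{0<..1}. \<gamma>' t \<in> U \<and> j * \<phi> (\<gamma>' t) $ 2 < 0 \<and> \<bar>\<phi> (\<gamma>' t) $ 2\<bar> < - (\<phi> (\<gamma>' t) $ 1)"
  using assms unfolding separatrix_arcs_def by blast+

lemma separatrices_in_sectors:
  assumes c: "c > 0" and B: "B > 0" and j: "\<bar>j\<bar> = 1" and um: "umbilic \<A> \<alpha> x\<^sub>0"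
    and W: "open W" "x\<^sub>0 \<in> W" "W \<subseteq> U"
    and pl: "\<And>x. \<lbrakk>x \<in> W; nondeg (\<phi> x)\<rbrakk> \<Longrightarrow> \<not> umbilic \<A> \<alpha> x"
      "\<And>x c w. \<lbrakk>x \<in> W; nondeg (\<phi> x); c \<in> \<A>; x \<in> fst c\<rbrakk> \<Longrightarrow>
        principal_vector (local_param c \<alpha>) (snd c x) (principal_curvature \<A> \<alpha> i x) w
        \<longleftrightarrow> w \<noteq> 0 \<and> on_line j (\<phi> x) (D\<sigma> c x w)"
  shows "\<exists>s s' \<sigma> \<sigma>'. separatrix_arcs i j s s' \<sigma> \<sigma>'"
proof -
  obtain f f' \<epsilon> m C \<psi> V where fc: "foliation_chart f f' \<epsilon> m C \<A> \<alpha> i x\<^sub>0 \<psi> (\<lambda>x. unrotated j (\<phi> x)) V"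
    and \<psi>: "\<And>x y. (x, y) \<in> V \<Longrightarrow> \<psi> (x, y) \<in> U \<and> \<phi> (\<psi> (x, y)) = rotated j x y"
    using ex_foliation_chart[OF c B j um W pl] by fast
  have jj: "j * (j * a) = a" "\<bar>j * a\<bar> = \<bar>a\<bar>" for a using j by (auto simp: abs_mult abs_if split: if_splits)
  obtain s s' \<sigma> \<sigma>' where s: "exactly_two_separatrices \<A> \<alpha> i x\<^sub>0 s s'" "divides_into_two_hyperbolic_sectors \<A> \<alpha> i x\<^sub>0 s s'"
    "arc \<sigma>" "pathstart \<sigma> = x\<^sub>0" "same_germ x\<^sub>0 (path_image \<sigma>) s"
    "arc \<sigma>'" "pathstart \<sigma>' = x\<^sub>0" "same_germ x\<^sub>0 (path_image \<sigma>') s'"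
    and r: "\<forall>t\<in>{0<..1}. \<exists>x y. (x, y) \<in> V \<and> \<sigma> t = \<psi> (x, y) \<and> 0 < x \<and> 0 < y"
    and l: "\<forall>t\<in>{0<..1}. \<exists>x y. (x, y) \<in> V \<and> \<sigma>' t = \<psi> (x, y) \<and> x < 0 \<and> 0 < y \<and> y < - x"
    using foliation_chart.two_hyperbolic_sectors[OF fc] by (elim exE conjE) (rule that)
  have "\<sigma> t \<in> U \<and> \<bar>\<phi> (\<sigma> t) $ 1\<bar> < j * \<phi> (\<sigma> t) $ 2" if t: "t \<in> {0<..1}" for t
  proof -
    obtain x y where "(x, y) \<in> V" "\<sigma> t = \<psi> (x, y)" "0 < x" "0 < y" using r t by blast
    thus ?thesis using \<psi>[of x y] by (auto simp: jj)
  qed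
  moreover have "\<sigma>' t \<in> U \<and> j * \<phi> (\<sigma>' t) $ 2 < 0 \<and> \<bar>\<phi> (\<sigma>' t) $ 2\<bar> < - (\<phi> (\<sigma>' t) $ 1)" if t: "t \<in> {0<..1}" for t
  proof -
    obtain x y where xy: "(x, y) \<in> V" "\<sigma>' t = \<psi> (x, y)" "x < 0" "0 < y" "y < - x" using l t by blast
    have "(x + y) / 2 < 0" using xy(5) by simp
    moreover from this have "\<bar>(x + y) / 2\<bar> = - ((x + y) / 2)" by (rule abs_of_neg)
    moreover have "- ((x + y) / 2) < - ((x - y) / 2)" using xy(4) by (simp add: field_simps)
    ultimately show ?thesis using \<psi>[OF xy(1)] by (simp only: xy(2) rotated_nth jj simp_thms)
  qed
  ultimately show ?thesis using s unfolding separatrix_arcs_def by blast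
qed

text \<open>The foliation with \<open>J i = 1\<close> has its separatrices in the sectors \<open>v > \<bar>u\<bar>\<close> and \<open>u < v < 0\<close>, the
  one with \<open>J i = - 1\<close> in the reflected sectors. Counting angles in the plane of \<open>(u, J Maximal * v)\<close>
  treats both values of \<open>J Maximal\<close> at once: the first separatrix of the minimal foliation points
  downwards, the first one of the maximal foliation upwards, the second ones lie on both sides
  of the negative \<open>u\<close>-axis.\<close>
theorem quartic_jet_type_D22h:
  assumes c: "c > 0" and B: "B > 0" and um: "umbilic \<A> \<alpha> x\<^sub>0"
  shows "type_D22h \<A> \<alpha> x\<^sub>0"
proof -
  obtain W J where W: "open W" "x\<^sub>0 \<in> W" "W \<subseteq> U" and J: "\<bar>J Maximal :: real\<bar> = 1" "J Minimal = - J Maximal"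
    and pl: "\<forall>x\<in>W. nondeg (\<phi> x) \<longrightarrow> \<not> umbilic \<A> \<alpha> x \<and>
      (\<forall>i. \<forall>c\<in>\<A>. x \<in> fst c \<longrightarrow> (\<forall>w. principal_vector (local_param c \<alpha>) (snd c x) (principal_curvature \<A> \<alpha> i x) w
        \<longleftrightarrow> w \<noteq> 0 \<and> on_line (J i) (\<phi> x) (D\<sigma> c x w)))"
    using ex_principal_lines by (elim exE conjE) (rule that)
  define d where "d = J Maximal"
  have d: "d = 1 \<or> d = - 1" using J(1) by (auto simp: d_def)
  have Ji: "\<bar>J i\<bar> = 1" for i using J by (cases i) auto
  have ex: "\<exists>s s' \<sigma> \<sigma>'. separatrix_arcs i (J i) s s' \<sigma> \<sigma>'" for i
    by (rule separatrices_in_sectors[OF c B Ji um W]) (use pl in blast)+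
  obtain s1 s1' \<sigma>1 \<sigma>1' where "separatrix_arcs Minimal (- d) s1 s1' \<sigma>1 \<sigma>1'"
    using ex[of Minimal, unfolded J(2), folded d_def] by blast
  note 1 = separatrix_arcsD[OF this]
  obtain s2 s2' \<sigma>2 \<sigma>2' where "separatrix_arcs Maximal d s2 s2' \<sigma>2 \<sigma>2'"
    using ex[of Maximal, folded d_def] by blast
  note 2 = separatrix_arcsD[OF this]
  define \<Phi> where "\<Phi> x = Complex (\<phi> x $ 1) (d * \<phi> x $ 2)" for x
  define \<Psi> where "\<Psi> z = inv_into U \<phi> (vector [Re z, d * Im z])" for z
  define V where "V = {z. vector [Re z, d * Im z] \<in> \<phi> ` U}"
  have ch: "homeomorphism U (\<phi> ` U) \<phi> (inv_into U \<phi>)" using chart by (simp add: is_chart_def)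
  have vec: "vector [Re (\<Phi> x), d * Im (\<Phi> x)] = \<phi> x" for x
    using d by (auto simp: \<Phi>_def vec_eq_iff forall_2)
  have cv: "continuous_on S (\<lambda>z. vector [Re z, d * Im z] :: real^2)" for S
  proof -
    have eq: "vector [a, b] = a *\<^sub>R axis 1 1 + b *\<^sub>R (axis 2 1 :: real^2)" for a b :: real
      by (simp add: vec_eq_iff forall_2 vector_2 axis_def)
    show ?thesis unfolding eq by (intro continuous_intros)
  qed
  have inv: "inv_into U \<phi> (\<phi> x) = x" if "x \<in> U" for x using is_chart_inv[OF chart that] .
  have hom: "homeomorphism U V \<Phi> \<Psi>"
  proof (rule homeomorphismI)
    have "continuous_on U \<phi>" by (rule homeomorphism_cont1[OF ch])
    thus "continuous_on U \<Phi>" unfolding \<Phi>_def Complex_eq by (intro continuous_intros)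
    show "continuous_on V \<Psi>" unfolding \<Psi>_def
      by (rule continuous_on_compose2[OF homeomorphism_cont2[OF ch] cv]) (auto simp: V_def)
    show "\<Phi> ` U \<subseteq> V" by (auto simp: V_def vec)
    show "\<Psi> ` V \<subseteq> U" using inv by (auto simp: \<Psi>_def V_def)
    show "\<Psi> (\<Phi> x) = x" if "x \<in> U" for x using that by (simp add: \<Psi>_def vec inv)
    show "\<Phi> (\<Psi> z) = z" if z: "z \<in> V" for z
    proof -
      obtain x where x: "x \<in> U" "\<phi> x = vector [Re z, d * Im z]" using z by (auto simp: V_def)
      hence "\<Psi> z = x" using inv by (metis \<Psi>_def)
      thus ?thesis using x(2) d by (auto simp: \<Phi>_def complex_eq_iff vector_2)
    qed
  qed
  have V: "open V"
  proof -
    have "V = (\<lambda>z. vector [Re z, d * Im z]) -` (\<phi> ` U)" by (auto simp: V_def)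
    thus ?thesis using continuous_on_open_vimage[OF open_UNIV, of "\<lambda>z. vector [Re z, d * Im z]"] cv[of UNIV] openU(2) by auto
  qed
  define \<sigma> where "\<sigma> = (!) [\<sigma>1, \<sigma>2, \<sigma>1', \<sigma>2']"
  \<comment> \<open>All angles but the first are shifted by a full turn, so that the order begins with the minimal foliation.\<close>
  define lo where "lo = (!) [5 * pi / 4, 9 * pi / 4, 11 * pi / 4, 3 * pi]"
  define hi where "hi = (!) [7 * pi / 4, 11 * pi / 4, 3 * pi, 13 * pi / 4]"
  have less4: "k = 0 \<or> k = 1 \<or> k = 2 \<or> k = 3" if "k < 4" for k :: nat using that by arith
  have nth: "[a, b, c, e] ! 0 = a" "[a, b, c, e] ! 1 = b" "[a, b, c, e] ! 2 = c" "[a, b, c, e] ! 3 = e" for a b c e :: 'x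
    by (simp_all add: numeral_eq_Suc)
  have cis3: "cis (3 * pi / 2) = - \<i>" "cis (5 * pi / 2) = \<i>" "cis (3 * pi) = - 1"
  proof -
    have "cis (a + 2 * pi) = cis a" for a by (simp add: complex_eq_iff)
    from this[of "- (pi / 2)"] this[of "pi / 2"] this[of pi]
    show "cis (3 * pi / 2) = - \<i>" "cis (5 * pi / 2) = \<i>" "cis (3 * pi) = - 1" by (simp_all add: complex_eq_iff)
  qed
  have angle: "\<exists>\<theta>. lo k < \<theta> \<and> \<theta> < hi k \<and> \<Phi> (\<sigma> k t) = of_real (cmod (\<Phi> (\<sigma> k t))) * cis \<theta>"
    if k: "k < 4" and t: "t \<in> {0<..1}" for k t
    using less4[OF k]
  proof (elim disjE)
    assume k: "k = 0"
    let ?z = "\<Phi> (\<sigma>1 t)"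
    have z: "?z = cis (3 * pi / 2) * Complex (- Im ?z) (Re ?z)" by (simp add: cis3 complex_eq_iff)
    have "\<bar>Re ?z\<bar> < - Im ?z" using 1(9) t by (simp add: \<Phi>_def)
    hence "0 < - Im ?z" "(- 1) * (- Im ?z) < Re ?z" "Re ?z < 1 * (- Im ?z)" by auto
    from angle_of_slope[OF this(1) z this(2,3)]
    show ?thesis by (simp add: k nth lo_def hi_def \<sigma>_def arctan_minus arctan_one field_simps)
  next
    assume k: "k = 1"
    let ?z = "\<Phi> (\<sigma>2 t)"
    have z: "?z = cis (5 * pi / 2) * Complex (Im ?z) (- Re ?z)" by (simp add: cis3 complex_eq_iff)
    have "\<bar>Re ?z\<bar> < Im ?z" using 2(9) t by (simp add: \<Phi>_def)
    hence "0 < Im ?z" "(- 1) * Im ?z < - Re ?z" "- Re ?z < 1 * Im ?z" by auto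
    from angle_of_slope[OF this(1) z this(2,3)]
    show ?thesis by (simp add: k nth[unfolded One_nat_def] lo_def hi_def \<sigma>_def arctan_minus arctan_one field_simps)
  next
    assume k: "k = 2"
    let ?z = "\<Phi> (\<sigma>1' t)"
    have z: "?z = cis (3 * pi) * Complex (- Re ?z) (- Im ?z)" by (simp add: cis3 complex_eq_iff)
    have "- Im ?z < 0" "\<bar>Im ?z\<bar> < - Re ?z" using 1(10) t d by (auto simp: \<Phi>_def)
    hence "0 < - Re ?z" "(- 1) * (- Re ?z) < - Im ?z" "- Im ?z < 0 * (- Re ?z)" by auto
    from angle_of_slope[OF this(1) z this(2,3)]
    show ?thesis by (simp add: k nth lo_def hi_def \<sigma>_def arctan_minus arctan_one field_simps)
  next
    assume k: "k = 3"
    let ?z = "\<Phi> (\<sigma>2' t)"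
    have z: "?z = cis (3 * pi) * Complex (- Re ?z) (- Im ?z)" by (simp add: cis3 complex_eq_iff)
    have "Im ?z < 0" "\<bar>Im ?z\<bar> < - Re ?z" using 2(10) t d by (auto simp: \<Phi>_def)
    hence "0 < - Re ?z" "0 * (- Re ?z) < - Im ?z" "- Im ?z < 1 * (- Re ?z)" by auto
    from angle_of_slope[OF this(1) z this(2,3)]
    show ?thesis by (simp add: k nth lo_def hi_def \<sigma>_def arctan_minus arctan_one field_simps)
  qed
  have inU: "\<sigma> k t \<in> U" if k: "k < 4" and t: "t \<in> {0<..1}" for k t
    using less4[OF k] 1(9,10) 2(9,10) t by (auto simp: \<sigma>_def nth)
  have arcs: "arc (\<sigma> k)" "pathstart (\<sigma> k) = x\<^sub>0" "same_germ x\<^sub>0 (path_image (\<sigma> k)) ([s1, s2, s1', s2'] ! k)" if k: "k < 4" for k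
    using less4[OF k] 1(3-8) 2(3-8) by (auto simp: \<sigma>_def nth)
  have "cyclically_ordered4 x\<^sub>0 ((!) [s1, s2, s1', s2'])"
  proof (rule cyclically_ordered4_sectors[OF hom openU(1) V x\<^sub>0(1), where \<sigma> = \<sigma> and lo = lo and hi = hi])
    show "\<Phi> x\<^sub>0 = 0" using x\<^sub>0(2) by (simp add: \<Phi>_def complex_eq_iff)
    show "path_image (\<sigma> k) \<subseteq> U" if k: "k < 4" for k
    proof -
      have "\<sigma> k t \<in> U" if "t \<in> {0..1}" for t
        using inU[OF k, of t] arcs(2)[OF k] x\<^sub>0(1) that by (cases "t = 0") (auto simp: pathstart_def)
      thus ?thesis by (auto simp: path_image_def)
    qed
    show "hi 0 \<le> lo 1" "hi 1 \<le> lo 2" "hi 2 \<le> lo 3" "hi 3 \<le> lo 0 + 2 * pi"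
      by (simp_all add: lo_def hi_def numeral_eq_Suc)
  qed (use arcs angle in auto)
  thus ?thesis unfolding type_D22h_def using 1(1,2) 2(1,2) by blast
qed

end

section \<open>Reduction to the normal form\<close>

lemma linear_chart:
  fixes A A' :: "real^2 \<Rightarrow> real^2"
  assumes c: "is_chart (U, \<phi>)" and A: "bounded_linear A" "bounded_linear A'" "\<And>z. A (A' z) = z" "\<And>z. A' (A z) = z"
  shows "is_chart (U, A' \<circ> \<phi>)" "\<And>x. x \<in> U \<Longrightarrow> inv_into U (A' \<circ> \<phi>) (A' (\<phi> x)) = x"
proof -
  have h: "homeomorphism U (\<phi> ` U) \<phi> (inv_into U \<phi>)" "open U" "open (\<phi> ` U)" using c by (auto simp: is_chart_def)
  have cont: "continuous_on S A" "continuous_on S A'" for S using A by (auto intro: linear_continuous_on)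
  have inj: "inj_on (A' \<circ> \<phi>) U"
  proof (rule inj_onI)
    fix x y assume "x \<in> U" "y \<in> U" "(A' \<circ> \<phi>) x = (A' \<circ> \<phi>) y"
    hence "\<phi> x = \<phi> y" using A(3) by (metis comp_apply)
    thus "x = y" using is_chart_inv[OF c] \<open>x \<in> U\<close> \<open>y \<in> U\<close> by metis
  qed
  show inv: "inv_into U (A' \<circ> \<phi>) (A' (\<phi> x)) = x" if "x \<in> U" for x
    using inv_into_f_f[OF inj that] by simp
  have im: "(A' \<circ> \<phi>) ` U = A -` (\<phi> ` U)"
  proof (intro equalityI subsetI)
    fix z assume "z \<in> A -` (\<phi> ` U)"
    then obtain x where "x \<in> U" "A z = \<phi> x" by auto
    hence "x \<in> U" "z = (A' \<circ> \<phi>) x" using A(4) by (simp, metis comp_apply)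
    thus "z \<in> (A' \<circ> \<phi>) ` U" by blast
  qed (auto simp: A(3))
  have op: "open ((A' \<circ> \<phi>) ` U)" unfolding im
    using continuous_on_open_vimage[OF open_UNIV, of A] cont(1)[of UNIV] h(3) by simp
  have "homeomorphism U ((A' \<circ> \<phi>) ` U) (A' \<circ> \<phi>) (inv_into U (A' \<circ> \<phi>))"
  proof (rule homeomorphismI)
    show "continuous_on U (A' \<circ> \<phi>)" using homeomorphism_cont1[OF h(1)] cont(2)[of "\<phi> ` U"] by (rule continuous_on_compose)
    have "continuous_on ((A' \<circ> \<phi>) ` U) (\<lambda>z. inv_into U \<phi> (A z))"
      by (rule continuous_on_compose2[OF homeomorphism_cont2[OF h(1)] cont(1)]) (auto simp: A(3))
    moreover have "inv_into U \<phi> (A z) = inv_into U (A' \<circ> \<phi>) z" if "z \<in> (A' \<circ> \<phi>) ` U" for z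
      using that inv is_chart_inv[OF c] by (auto simp: A(3))
    ultimately show "continuous_on ((A' \<circ> \<phi>) ` U) (inv_into U (A' \<circ> \<phi>))"
      by (simp cong: continuous_on_cong)
  qed (use inv in auto)
  thus "is_chart (U, A' \<circ> \<phi>)" using h(2) op by (simp add: is_chart_def)
qed

text \<open>Transition maps after linear changes of coordinates \<open>A'\<close> and \<open>B'\<close> in the two charts.\<close>
lemma linear_change_transition:
  assumes ch: "is_chart c" "is_chart c'" and fc: "fst c' = fst c" "fst d' = fst d"
    and snds: "\<And>x. x \<in> fst c \<Longrightarrow> snd c' x = A' (snd c x)" "\<And>x. x \<in> fst d \<Longrightarrow> snd d' x = B' (snd d x)"
    and A: "bounded_linear A" "\<And>z. A (A' z) = z" and B: "bounded_linear B'"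
    and o: "open (snd c ` (fst c \<inter> fst d))" "open (snd c' ` (fst c \<inter> fst d))"
    and C: "Cr_on r (transition c d) (snd c ` (fst c \<inter> fst d))"
  shows "Cr_on r (transition c' d') (snd c' ` (fst c' \<inter> fst d'))"
proof -
  have im: "A ` snd c' ` (fst c \<inter> fst d) \<subseteq> snd c ` (fst c \<inter> fst d)" using snds A(2) by auto
  have "Cr_on r (\<lambda>z. transition c d (A z)) (snd c' ` (fst c \<inter> fst d))"
    by (rule Cr_on_compose[OF o(2) o(1) im C Cr_on_bounded_linear[OF o(2) A(1)]])
  hence "Cr_on r (\<lambda>z. B' (transition c d (A z))) (snd c' ` (fst c \<inter> fst d))" by (rule Cr_on_linear[OF o(2) B])
  moreover have "B' (transition c d (A z)) = transition c' d' z" if z: "z \<in> snd c' ` (fst c \<inter> fst d)" for z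
  proof -
    obtain x where x: "x \<in> fst c" "x \<in> fst d" "z = snd c' x" using z by blast
    have "transition c d (A z) = snd d x" using x snds(1) A(2) transition_apply[OF ch(1) x(1)] by simp
    moreover have "transition c' d' z = snd d' x" using x transition_apply[OF ch(2)] fc by simp
    ultimately show ?thesis using snds(2)[OF x(2)] by simp
  qed
  ultimately show ?thesis using Cr_on_cong[OF o(2)] fc by (metis (no_types, lifting))
qed

text \<open>Near each point the Monge parametrisation is a parametrisation of the atlas composed with a
  transition map, and \<open>h\<close> is one of its components in the frame \<open>R\<close>.\<close>
lemma Monge_graph_Cr:
  assumes surface: "Cr_atlas r \<A>" and immersion: "Cr_immersion r \<A> \<alpha>"
    and Monge: "Monge_chart r \<A> \<alpha> p c\<^sub>0 R h"
  shows "Cr_on r h (snd c\<^sub>0 ` fst c\<^sub>0)"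
proof -
  have ins: "Cr_atlas r (insert c\<^sub>0 \<A>)" and R: "orthogonal_matrix R"
    and gr: "\<And>z. z \<in> snd c\<^sub>0 ` fst c\<^sub>0 \<Longrightarrow> local_param c\<^sub>0 \<alpha> z = \<alpha> p + R *v vector [z$1, z$2, h z]"
    using Monge by (auto simp: Monge_chart_def rotation_matrix_def)
  have chs: "is_chart c" if "c \<in> insert c\<^sub>0 \<A>" for c using ins that by (auto simp: Cr_atlas_def)
  have opn: "open (snd c ` W)" "open (fst c)" if "c \<in> insert c\<^sub>0 \<A>" "open W" "W \<subseteq> fst c" for c W
    using is_chart_open_image[of "fst c" "snd c" W] chs[OF that(1)] that by (auto simp: is_chart_def case_prod_unfold)
  define S where "S = snd c\<^sub>0 ` fst c\<^sub>0"
  have ofst: "open (fst c)" if "c \<in> insert c\<^sub>0 \<A>" for c using opn(2)[OF that, of "{}"] by simp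
  have S: "open S" unfolding S_def by (rule opn(1)) (auto intro: ofst)
  have "Cr_on r (local_param c\<^sub>0 \<alpha>) S"
  proof (rule Cr_on_local[OF _ S])
    fix z assume "z \<in> S"
    then obtain x where x: "x \<in> fst c\<^sub>0" "z = snd c\<^sub>0 x" by (auto simp: S_def)
    obtain c where c: "c \<in> \<A>" "x \<in> fst c" using surface unfolding Cr_atlas_def by blast
    define T where "T = snd c\<^sub>0 ` (fst c\<^sub>0 \<inter> fst c)"
    have T: "open T" unfolding T_def by (intro opn(1) open_Int ofst) (use c in auto)
    have V: "open (snd c ` fst c)" by (intro opn(1) ofst) (use c in auto)
    have ap: "transition c\<^sub>0 c (snd c\<^sub>0 y) = snd c y" if "y \<in> fst c\<^sub>0" for y
      by (rule transition_apply[OF chs that]) simp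
    have "Cr_on r (transition c\<^sub>0 c) T" using ins c by (auto simp: Cr_atlas_def T_def)
    moreover have "Cr_on r (local_param c \<alpha>) (snd c ` fst c)" using immersion c by (auto simp: Cr_immersion_def)
    moreover have "transition c\<^sub>0 c ` T \<subseteq> snd c ` fst c"
    proof (rule image_subsetI)
      fix z assume "z \<in> T"
      then obtain y where "y \<in> fst c\<^sub>0" "y \<in> fst c" "z = snd c\<^sub>0 y" unfolding T_def by blast
      thus "transition c\<^sub>0 c z \<in> snd c ` fst c" using ap[of y] by (metis imageI)
    qed
    ultimately have "Cr_on r (\<lambda>z. local_param c \<alpha> (transition c\<^sub>0 c z)) T" using Cr_on_compose[OF T V] by blast
    moreover have "local_param c \<alpha> (transition c\<^sub>0 c z) = local_param c\<^sub>0 \<alpha> z" if "z \<in> T" for z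
    proof -
      obtain y where y: "y \<in> fst c\<^sub>0" "y \<in> fst c" "z = snd c\<^sub>0 y" using \<open>z \<in> T\<close> by (auto simp: T_def)
      have "inv_into (fst c) (snd c) (snd c y) = y" "inv_into (fst c\<^sub>0) (snd c\<^sub>0) (snd c\<^sub>0 y) = y"
        using is_chart_inv[of "fst c" "snd c" y] is_chart_inv[of "fst c\<^sub>0" "snd c\<^sub>0" y] chs[of c] chs[of c\<^sub>0] c y by auto
      thus ?thesis using y ap[OF y(1)] by (simp add: local_param_def)
    qed
    ultimately have "Cr_on r (local_param c\<^sub>0 \<alpha>) T" by (rule Cr_on_cong[OF T])
    moreover have "T \<inter> S = T" by (auto simp: T_def S_def)
    moreover have "z \<in> T" using x c by (auto simp: T_def)
    ultimately show "\<exists>T. open T \<and> z \<in> T \<and> Cr_on r (local_param c\<^sub>0 \<alpha>) (T \<inter> S)" using T by metis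
  qed
  hence "Cr_on r (\<lambda>z. local_param c\<^sub>0 \<alpha> z + (- \<alpha> p)) S" by (intro Cr_on_add Cr_on_const S)
  moreover have "bounded_linear (\<lambda>y. (transpose R *v y) $ 3)"
    using bounded_linear_compose[OF bounded_linear_vec_nth matrix_vector_mul_bounded_linear] .
  ultimately have "Cr_on r (\<lambda>z. (transpose R *v (local_param c\<^sub>0 \<alpha> z + (- \<alpha> p))) $ 3) S"
    by (intro Cr_on_linear[OF S, where L = "\<lambda>y. (transpose R *v y) $ 3"])
  moreover have "(transpose R *v (local_param c\<^sub>0 \<alpha> z + (- \<alpha> p))) $ 3 = h z" if "z \<in> S" for z
  proof -
    have "transpose R *v (R *v v) = v" for v
      using R by (simp add: matrix_vector_mul_assoc orthogonal_matrix_def)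
    thus ?thesis using gr[of z] that by (simp add: S_def vector_3)
  qed
  ultimately show ?thesis unfolding S_def[symmetric] by (rule Cr_on_cong[OF S])
qed

text \<open>An isometry \<open>A\<close> of the tangent plane, extended to the matrix \<open>N\<close> by the identity on the
  normal line, replaces \<open>h\<close> by \<open>h \<circ> A\<close>. Reflections are included.\<close>
lemma quartic_jet_of_Monge_chart:
  fixes \<A> :: "'m::t2_space chart set"
  assumes r: "r \<ge> 4" and surface: "oriented_Cr_atlas r \<A>" and immersion: "Cr_immersion r \<A> \<alpha>"
    and Monge: "Monge_chart r \<A> \<alpha> p (U, \<phi>) R h"
    and A: "bounded_linear A" "bounded_linear A'" "\<And>z. A (A' z) = z" "\<And>z. A' (A z) = z"
    and N: "orthogonal_matrix N" "\<And>z t. N *v vector [z$1, z$2, t] = vector [A z $ 1, A z $ 2, t]"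
    and jet: "flat 4 (\<lambda>z. h (A z) - (k/2 * ((z$1)^2 + (z$2)^2) + c/6 * (z$2)^3
      + qA/24 * (z$1)^4 + qB/6 * (z$1)^3 * z$2 + qC/4 * (z$1)^2 * (z$2)^2 + qD/6 * z$1 * (z$2)^3 + qE/24 * (z$2)^4))"
  shows "quartic_jet \<A> \<alpha> p U (A' \<circ> \<phi>) (R ** N) (h \<circ> A) k c qA qB qC qD qE"
proof -
  have atlas: "Cr_atlas r \<A>" using surface by (simp add: oriented_Cr_atlas_def)
  have ins: "Cr_atlas r (insert (U, \<phi>) \<A>)" and R: "orthogonal_matrix R" and p: "p \<in> U" "\<phi> p = 0"
    and gr: "\<And>z. z \<in> \<phi> ` U \<Longrightarrow> local_param (U, \<phi>) \<alpha> z = \<alpha> p + R *v vector [z$1, z$2, h z]"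
    using Monge by (auto simp: Monge_chart_def rotation_matrix_def)
  have chs: "is_chart c" if "c \<in> insert (U, \<phi>) \<A>" for c using ins that by (auto simp: Cr_atlas_def)
  have ch: "is_chart (U, \<phi>)" by (rule chs) simp
  note ch' = linear_chart[OF ch A]
  have "quartic_jet_axioms (h \<circ> A) k c qA qB qC qD qE"
    unfolding quartic_jet_axioms_def using jet by simp
  moreover have "graph_chart \<A> \<alpha> p U (A' \<circ> \<phi>) (R ** N) (h \<circ> A)"
  proof (rule graph_chart.intro)
    show "is_chart c" if "c \<in> \<A>" for c using chs that by simp
    show "(\<Union>c\<in>\<A>. fst c) = UNIV" using atlas by (simp add: Cr_atlas_def)
    show "is_chart (U, A' \<circ> \<phi>)" by (rule ch'(1))
    show "p \<in> U" by (rule p)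
    show "(A' \<circ> \<phi>) p = 0" using p(2) linear_0[OF bounded_linear.linear[OF A(2)]] by simp
    show "orthogonal_matrix (R ** N)" by (rule orthogonal_matrix_mul[OF R N(1)])
    show "0 < det (matrix (frechet_derivative (transition c d) (at z)))"
      if "c \<in> \<A>" "d \<in> \<A>" "z \<in> snd c ` (fst c \<inter> fst d)" for c d z
      using surface that by (auto simp: oriented_Cr_atlas_def)
    show "local_param (U, A' \<circ> \<phi>) \<alpha> z = \<alpha> p + (R ** N) *v vector [z $ 1, z $ 2, (h \<circ> A) z]"
      if "z \<in> (A' \<circ> \<phi>) ` U" for z
    proof -
      obtain x where x: "x \<in> U" "z = A' (\<phi> x)" using \<open>z \<in> (A' \<circ> \<phi>) ` U\<close> by auto
      have "local_param (U, A' \<circ> \<phi>) \<alpha> z = \<alpha> x" using ch'(2)[OF x(1)] x(2) by (simp add: local_param_def)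
      also have "\<dots> = local_param (U, \<phi>) \<alpha> (A z)" using is_chart_inv[OF ch x(1)] x(2) A(3) by (simp add: local_param_def)
      also have "\<dots> = \<alpha> p + R *v vector [A z $ 1, A z $ 2, h (A z)]" using x A(3) by (intro gr) auto
      also have "\<dots> = \<alpha> p + (R ** N) *v vector [z $ 1, z $ 2, (h \<circ> A) z]"
        by (simp add: N(2) matrix_vector_mul_assoc[symmetric])
      finally show ?thesis .
    qed
    have op: "open (\<phi> ` U)" "open ((A' \<circ> \<phi>) ` U)" using ch ch'(1) by (simp_all add: is_chart_def)
    have "Cr_on 4 h (\<phi> ` U)" using Cr_on_mono[OF Monge_graph_Cr[OF atlas immersion Monge] r] by simp
    moreover have "A ` (A' \<circ> \<phi>) ` U \<subseteq> \<phi> ` U" by (auto simp: A(3))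
    ultimately have "Cr_on 4 (\<lambda>z. h (A z)) ((A' \<circ> \<phi>) ` U)"
      using Cr_on_compose[OF op(2) op(1)] Cr_on_bounded_linear[OF op(2) A(1)] by blast
    thus "Cr_on 4 (h \<circ> A) ((A' \<circ> \<phi>) ` U)" by (simp add: o_def)
    show "Cr_on 1 (transition c d) (snd c ` (fst c \<inter> fst d))"
      if cd: "c \<in> insert (U, A' \<circ> \<phi>) \<A>" "d \<in> insert (U, A' \<circ> \<phi>) \<A>" for c d
    proof -
      have ex: "\<exists>b L L'. b \<in> insert (U, \<phi>) \<A> \<and> fst c = fst b \<and> is_chart c \<and> bounded_linear L \<and> bounded_linear L' \<and>
          (\<forall>z. L (L' z) = z) \<and> (\<forall>x\<in>fst b. snd c x = L' (snd b x))" if "c \<in> insert (U, A' \<circ> \<phi>) \<A>" for c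
      proof (cases "c \<in> \<A>")
        case True
        thus ?thesis using chs[of c] by (intro exI[of _ c] exI[of _ "\<lambda>z. z"]) auto
      next
        case False
        hence "c = (U, A' \<circ> \<phi>)" using that by simp
        thus ?thesis using ch'(1) A by (intro exI[of _ "(U, \<phi>)"] exI[of _ A] exI[of _ A']) auto
      qed
      obtain b L L' where b: "b \<in> insert (U, \<phi>) \<A>" "fst c = fst b" "is_chart c" "bounded_linear L" "bounded_linear L'"
          "\<And>z. L (L' z) = z" "\<And>x. x \<in> fst b \<Longrightarrow> snd c x = L' (snd b x)" using ex[OF cd(1)] by blast
      obtain e M M' where e: "e \<in> insert (U, \<phi>) \<A>" "fst d = fst e" "is_chart d" "bounded_linear M'"
          "\<And>x. x \<in> fst e \<Longrightarrow> snd d x = M' (snd e x)" using ex[OF cd(2)] by blast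
      have o: "open (fst b \<inter> fst e)" using chs[OF b(1)] chs[OF e(1)] by (auto simp: is_chart_def case_prod_unfold)
      show ?thesis
      proof (rule linear_change_transition[where c = b and d = e and A = L and A' = L' and B' = M'])
        show "open (snd b ` (fst b \<inter> fst e))"
          using is_chart_open_image[of "fst b" "snd b"] chs[OF b(1)] o by simp
        show "open (snd c ` (fst b \<inter> fst e))"
          using is_chart_open_image[of "fst c" "snd c" "fst b \<inter> fst e"] b(2,3) o
          by (metis inf.cobounded1 prod.collapse)
        show "Cr_on 1 (transition b e) (snd b ` (fst b \<inter> fst e))"
          by (rule Cr_on_mono[of r]) (use ins b(1) e(1) r in \<open>auto simp: Cr_atlas_def\<close>)
      qed (use b e chs in auto)
    qed
  qed
  ultimately show ?thesis by (simp add: quartic_jet_def)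
qed

lemma order_monomial: "order_at_least (i + j) (\<lambda>z :: real^2. a * (z$1)^i * (z$2)^j)"
proof -
  have "\<bar>a * (z$1)^i * (z$2)^j\<bar> \<le> \<bar>a\<bar> * norm z ^ (i + j)" for z :: "real^2"
  proof -
    have "\<bar>z$1\<bar> ^ i * \<bar>z$2\<bar> ^ j \<le> norm z ^ i * norm z ^ j"
      by (intro mult_mono power_mono component_le_norm_cart) auto
    hence "\<bar>a\<bar> * (\<bar>z$1\<bar> ^ i * \<bar>z$2\<bar> ^ j) \<le> \<bar>a\<bar> * norm z ^ (i + j)"
      by (simp only: power_add mult_left_mono abs_ge_zero)
    thus ?thesis by (simp add: abs_mult power_abs mult.assoc)
  qed
  thus ?thesis unfolding order_at_least_def by (intro exI[of _ "\<bar>a\<bar>"] exI[of _ 1]) auto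
qed

text \<open>The terms of degree five only contribute to the remainder. The hypothesis says nothing about
  the value at the origin; that \<open>h\<close> vanishes there comes from the position of the frame.\<close>
lemma Monge_chart_quartic_jet:
  assumes Monge: "Monge_chart r \<A> \<alpha> p (U, \<phi>) R h"
    and normalized:
      "(\<lambda>z. h z - (let u = z$1; v = z$2 in
           k/2 * (u^2 + v^2) + a/6 * u^3 + b/2 * u * v^2 + c/6 * v^3
           + A/24 * u^4 + B/6 * u^3 * v + C/4 * u^2 * v^2 + D/6 * u * v^3 + E/24 * v^4
           + a\<^sub>5\<^sub>0/120 * u^5 + a\<^sub>4\<^sub>1/24 * u^4 * v + a\<^sub>3\<^sub>2/12 * u^3 * v^2
           + a\<^sub>2\<^sub>3/12 * u^2 * v^3 + a\<^sub>1\<^sub>4/24 * u * v^4 + a\<^sub>0\<^sub>5/120 * v^5))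
         \<in> o[at 0](\<lambda>z. norm z ^ 5)"
  shows "flat 4 (\<lambda>z. h z - (k/2 * ((z$1)^2 + (z$2)^2) + a/6 * (z$1)^3 + b/2 * z$1 * (z$2)^2 + c/6 * (z$2)^3
           + A/24 * (z$1)^4 + B/6 * (z$1)^3 * z$2 + C/4 * (z$1)^2 * (z$2)^2 + D/6 * z$1 * (z$2)^3 + E/24 * (z$2)^4))"
    (is "flat 4 (\<lambda>z. h z - ?Q z)")
proof -
  define q where "q z = a\<^sub>5\<^sub>0/120 * (z$1)^5 * (z$2)^0 + a\<^sub>4\<^sub>1/24 * (z$1)^4 * (z$2)^1 + a\<^sub>3\<^sub>2/12 * (z$1)^3 * (z$2)^2
           + a\<^sub>2\<^sub>3/12 * (z$1)^2 * (z$2)^3 + a\<^sub>1\<^sub>4/24 * (z$1)^1 * (z$2)^4 + a\<^sub>0\<^sub>5/120 * (z$1)^0 * (z$2)^5" for z :: "real^2"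
  have h0: "h 0 = 0"
  proof -
    have p: "p \<in> U" "\<phi> p = 0" and R: "orthogonal_matrix R" and ch: "is_chart (U, \<phi>)"
      and gr: "\<And>z. z \<in> \<phi> ` U \<Longrightarrow> local_param (U, \<phi>) \<alpha> z = \<alpha> p + R *v vector [z$1, z$2, h z]"
      using Monge by (auto simp: Monge_chart_def rotation_matrix_def Cr_atlas_def)
    have "0 \<in> \<phi> ` U" using p by (metis imageI)
    from gr[OF this] have "R *v vector [0, 0, h 0] = 0"
      using is_chart_inv[OF ch p(1)] p(2) by (simp add: local_param_def)
    hence "transpose R *v (R *v vector [0, 0, h 0]) = 0" by simp
    hence "vector [0, 0, h 0] = (0 :: real^3)" using R by (simp add: matrix_vector_mul_assoc orthogonal_matrix_def)
    hence "(vector [0, 0, h 0] :: real^3) $ 3 = 0" by simp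
    thus ?thesis by (simp add: vector_3)
  qed
  have "\<forall>\<^sub>F z in at 0. norm (h z - (?Q z + q z)) \<le> 1 * norm (norm z ^ 5)"
    by (rule landau_o.smallD) (use normalized in \<open>simp_all add: Let_def q_def add_ac\<close>)
  then obtain d where d: "d > 0" "\<And>z. \<lbrakk>z \<noteq> 0; dist z 0 < d\<rbrakk> \<Longrightarrow> \<bar>h z - (?Q z + q z)\<bar> \<le> norm z ^ 5"
    unfolding eventually_at by auto
  have "order_at_least 5 (\<lambda>z. h z - (?Q z + q z))"
    unfolding order_at_least_def
  proof (intro exI conjI allI impI)
    show "d > 0" by (rule d)
    fix z :: "real^2" assume "norm z < d"
    thus "\<bar>h z - (?Q z + q z)\<bar> \<le> 1 * norm z ^ 5"
      using d(2)[of z] h0 by (cases "z = 0") (simp_all add: q_def)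
  qed
  moreover have "order_at_least 5 q" unfolding q_def
    by (intro order_add order_mono[OF order_monomial]) simp_all
  ultimately have "order_at_least 5 (\<lambda>z. h z - (?Q z + q z) + q z)" by (rule order_add)
  moreover have "h z - (?Q z + q z) + q z = h z - ?Q z" for z by simp
  ultimately have "order_at_least 5 (\<lambda>z. h z - ?Q z)" by (simp only:)
  thus ?thesis by (rule order_imp_flat) simp
qed

lemma flat_isometry:
  assumes "flat n g" "\<And>z. norm (A z) = norm z"
  shows "flat n (\<lambda>z. g (A z))"
  using assms unfolding flat_def by metis

text \<open>Reflections of the axes make \<open>c\<close> and \<open>B\<close> positive if \<open>a = b = 0\<close>. If \<open>b = c = 0\<close>, exchanging
  \<open>u\<close> and \<open>v\<close> turns \<open>a\<close> into the coefficient of \<open>v\<^sup>3\<close> and \<open>D\<close> into that of \<open>u\<^sup>3 v\<close>.\<close>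
theorem proposition3:
  fixes \<A> :: "('m::{t2_space,second_countable_topology}) chart set"
    and \<alpha> :: "'m \<Rightarrow> real^3" and p\<^sub>0 :: 'm and r :: nat
    and c\<^sub>0 :: "'m chart" and R :: "real^3^3" and h :: "real^2 \<Rightarrow> real"
    and k a b c A B C D E a\<^sub>5\<^sub>0 a\<^sub>4\<^sub>1 a\<^sub>3\<^sub>2 a\<^sub>2\<^sub>3 a\<^sub>1\<^sub>4 a\<^sub>0\<^sub>5 :: real
  assumes r: "r \<ge> 6"
    and surface: "oriented_Cr_atlas r \<A>"
    and immersion: "Cr_immersion r \<A> \<alpha>"
    and umbilic: "umbilic \<A> \<alpha> p\<^sub>0"
    and Monge: "Monge_chart r \<A> \<alpha> p\<^sub>0 c\<^sub>0 R h"
    and normalized: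
      "(\<lambda>z. h z - (let u = z$1; v = z$2 in
           k/2 * (u^2 + v^2) + a/6 * u^3 + b/2 * u * v^2 + c/6 * v^3
           + A/24 * u^4 + B/6 * u^3 * v + C/4 * u^2 * v^2 + D/6 * u * v^3 + E/24 * v^4
           + a\<^sub>5\<^sub>0/120 * u^5 + a\<^sub>4\<^sub>1/24 * u^4 * v + a\<^sub>3\<^sub>2/12 * u^3 * v^2
           + a\<^sub>2\<^sub>3/12 * u^2 * v^3 + a\<^sub>1\<^sub>4/24 * u * v^4 + a\<^sub>0\<^sub>5/120 * v^5))
         \<in> o[at 0](\<lambda>z. norm z ^ 5)"
    and cases: "(a = 0 \<and> b = 0 \<and> c * B \<noteq> 0) \<or> (b = 0 \<and> c = 0 \<and> a * D \<noteq> 0)"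
  shows "type_D22h \<A> \<alpha> p\<^sub>0"
proof -
  obtain U \<phi> where c0: "c\<^sub>0 = (U, \<phi>)" by (cases c\<^sub>0)
  note M = Monge[unfolded c0]
  note jet = Monge_chart_quartic_jet[OF M normalized]
  have r4: "r \<ge> 4" using r by simp
  have norm2: "norm z = sqrt ((z$1)\<^sup>2 + (z$2)\<^sup>2)" for z :: "real^2" by (simp add: norm_vec_def L2_set_def sum_2)
  have bl: "bounded_linear f" if "\<And>x y. f (x + y) = f x + f y" "\<And>t x. f (t *\<^sub>R x) = t *\<^sub>R f x" for f :: "real^2 \<Rightarrow> real^2"
    using that by (auto simp: linear_conv_bounded_linear[symmetric] intro: linearI)
  note v = vec_eq_iff forall_2 vector_2
  note v3 = vec_eq_iff forall_3 vector_3
  from cases show ?thesis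
  proof
    assume ab: "a = 0 \<and> b = 0 \<and> c * B \<noteq> 0"
    define e1 e2 where "e1 = sgn B * sgn c" and "e2 = sgn c"
    have e: "e1 = 1 \<or> e1 = - 1" "e2 = 1 \<or> e2 = - 1" and pos: "e2 * c > 0" "e1 * e2 * B > 0"
      using ab by (auto simp: e1_def e2_def sgn_if)
    define A1 :: "real^2 \<Rightarrow> real^2" where "A1 z = vector [e1 * z$1, e2 * z$2]" for z
    define N :: "real^3^3" where "N = vector [vector [e1, 0, 0], vector [0, e2, 0], vector [0, 0, 1]]"
    have "quartic_jet \<A> \<alpha> p\<^sub>0 U (A1 \<circ> \<phi>) (R ** N) (h \<circ> A1) k (e2 * c) A (e1 * e2 * B) C (e1 * e2 * D) E"
    proof (rule quartic_jet_of_Monge_chart[OF r4 surface immersion M])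
      show "bounded_linear A1" "bounded_linear A1" by (rule bl; simp add: A1_def v algebra_simps)+
      show "A1 (A1 z) = z" "A1 (A1 z) = z" for z using e by (auto simp: A1_def v)
      show "orthogonal_matrix N" using e
        by (auto simp: orthogonal_matrix_def N_def v3 matrix_matrix_mult_def sum_3 transpose_def mat_def)
      show "N *v vector [z $ 1, z $ 2, t] = vector [A1 z $ 1, A1 z $ 2, t]" for z t
        by (simp add: N_def A1_def v3 vector_2 matrix_vector_mult_def sum_3)
      have "norm (A1 z) = norm z" for z using e by (auto simp: norm2 A1_def vector_2)
      from flat_isometry[OF jet this]
      show "flat 4 (\<lambda>z. h (A1 z) - (k/2 * ((z$1)^2 + (z$2)^2) + (e2 * c)/6 * (z$2)^3
        + A/24 * (z$1)^4 + (e1 * e2 * B)/6 * (z$1)^3 * z$2 + C/4 * (z$1)^2 * (z$2)^2 + (e1 * e2 * D)/6 * z$1 * (z$2)^3 + E/24 * (z$2)^4))"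
        using e ab by (auto simp: A1_def vector_2)
    qed
    from quartic_jet.quartic_jet_type_D22h[OF this pos umbilic] show ?thesis .
  next
    assume bc: "b = 0 \<and> c = 0 \<and> a * D \<noteq> 0"
    define e1 e2 where "e1 = sgn D * sgn a" and "e2 = sgn a"
    have e: "e1 = 1 \<or> e1 = - 1" "e2 = 1 \<or> e2 = - 1" and pos: "e2 * a > 0" "e1 * e2 * D > 0"
      using bc by (auto simp: e1_def e2_def sgn_if)
    define A1 A2 :: "real^2 \<Rightarrow> real^2" where "A1 z = vector [e2 * z$2, e1 * z$1]" and "A2 z = vector [e1 * z$2, e2 * z$1]" for z
    define N :: "real^3^3" where "N = vector [vector [0, e2, 0], vector [e1, 0, 0], vector [0, 0, 1]]"
    have "quartic_jet \<A> \<alpha> p\<^sub>0 U (A2 \<circ> \<phi>) (R ** N) (h \<circ> A1) k (e2 * a) E (e1 * e2 * D) C (e1 * e2 * B) A"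
    proof (rule quartic_jet_of_Monge_chart[OF r4 surface immersion M])
      show "bounded_linear A1" "bounded_linear A2" by (rule bl; simp add: A1_def A2_def v algebra_simps)+
      show "A1 (A2 z) = z" "A2 (A1 z) = z" for z using e by (auto simp: A1_def A2_def v)
      show "orthogonal_matrix N" using e
        by (auto simp: orthogonal_matrix_def N_def v3 matrix_matrix_mult_def sum_3 transpose_def mat_def)
      show "N *v vector [z $ 1, z $ 2, t] = vector [A1 z $ 1, A1 z $ 2, t]" for z t
        by (simp add: N_def A1_def v3 vector_2 matrix_vector_mult_def sum_3)
      have "norm (A1 z) = norm z" for z using e by (auto simp: norm2 A1_def vector_2 add.commute)
      note fl = flat_isometry[OF jet this]
      have eq: "(k/2 * ((A1 z$1)^2 + (A1 z$2)^2) + a/6 * (A1 z$1)^3 + b/2 * A1 z$1 * (A1 z$2)^2 + c/6 * (A1 z$2)^3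
           + A/24 * (A1 z$1)^4 + B/6 * (A1 z$1)^3 * A1 z$2 + C/4 * (A1 z$1)^2 * (A1 z$2)^2 + D/6 * A1 z$1 * (A1 z$2)^3 + E/24 * (A1 z$2)^4)
         = (k/2 * ((z$1)^2 + (z$2)^2) + (e2 * a)/6 * (z$2)^3
        + E/24 * (z$1)^4 + (e1 * e2 * D)/6 * (z$1)^3 * z$2 + C/4 * (z$1)^2 * (z$2)^2 + (e1 * e2 * B)/6 * z$1 * (z$2)^3 + A/24 * (z$2)^4)" for z
        using e bc by (auto simp: A1_def vector_2 algebra_simps)
      show "flat 4 (\<lambda>z. h (A1 z) - (k/2 * ((z$1)^2 + (z$2)^2) + (e2 * a)/6 * (z$2)^3
        + E/24 * (z$1)^4 + (e1 * e2 * D)/6 * (z$1)^3 * z$2 + C/4 * (z$1)^2 * (z$2)^2 + (e1 * e2 * B)/6 * z$1 * (z$2)^3 + A/24 * (z$2)^4))"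
        using fl unfolding eq .
    qed
    from quartic_jet.quartic_jet_type_D22h[OF this pos umbilic] show ?thesis .
  qed
qed

end
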